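(* Let $\mathcal{S}=(\mathcal{S}_n)$ be a constraint set and let $\mathcal{X}$ be a normalized spike prior such that if $\bm x\sim\mathcal{X}_n$ then $\bm x\in\mathcal{S}_n$ with high probability. Suppose there exist $\varepsilon>0$ and a randomized polynomial-time algorithm that certifies the value $2-\varepsilon$ on $\mathsf{PCA}(\mathcal{S})$. Then there exist $\gamma>1$ and $\beta\in(-1,0)$ such that there is a randomized polynomial-time algorithm for strong detection in $\mathsf{Wishart}(\gamma,\beta,\mathcal{X})$.
   Context: "With high probability" means with probability tending to $1$ as $n\to\infty$. A constraint set is a sequence $\mathcal{S}=(\mathcal{S}_n)_{n\in\mathbb{N}}$ with $\mathcal{S}_n\subseteq\mathbb{R}^n$. $\mathsf{GOE}(n)$ is the law of a symmetric $n\times n$ matrix $\bm W$ with independent entries $W_{ij}\sim\mathcal{N}(0,1/n)$ for $i<j$ and $W_{ii}\sim\mathcal{N}(0,2/n)$. $\mathsf{PCA}(\mathcal{S})$ is the problem of maximizing $\bm x^\top\bm W\bm x$ over $\bm x\in\mathcal{S}_n$ with $\bm W\sim\mathsf{GOE}(n)$. A (possibly randomized) algorithm $f$ mapping square matrices to real numbers certifies the value $B$ on $\mathsf{PCA}(\mathcal{S})$ if (1) for every symmetric $\bm W\in\mathbb{R}^{n\times n}$, $\max_{\bm x\in\mathcal{S}_n}\bm x^\top\bm W\bm x\le f(\bm W)$ (almost surely over the algorithm's randomness), and (2) if $\bm W_n\sim\mathsf{GOE}(n)$ then $f(\bm W_n)\le B+o(1)$ with high probability. A normalized spike prior is a sequence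 $\mathcal{X}=(\mathcal{X}_n)$ of distributions on $\mathbb{R}^n$ with $\|\bm x\|\to1$ in probability for $\bm x\sim\mathcal{X}_n$. Spiked Wishart model $\mathsf{Wishart}(\gamma,\beta,\mathcal{X})$, with $N=\lceil n/\gamma\rceil$: under the null $\mathbb{Q}_n$, $\bm y_1,\dots,\bm y_N\sim\mathcal{N}(\bm 0,\bm I_n)$ i.i.d.; under the planted $\mathbb{P}_n$, draw $\bm x\sim\mathcal{X}_n$, and if $\beta\|\bm x\|^2\ge-1$ draw $\bm y_i\sim\mathcal{N}(\bm 0,\bm I_n+\beta\bm x\bm x^\top)$ i.i.d., otherwise $\bm y_i\sim\mathcal{N}(\bm 0,\bm I_n)$ i.i.d. An algorithm $f_n:(\mathbb{R}^n)^N\to\{0,1\}$ achieves strong detection if $\mathbb{Q}_n[f_n=0]=1-o(1)$ and $\mathbb{P}_n[f_n=1]=1-o(1)$. *)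

theory Defs
  imports "HOL-Probability.Probability" "HOL-Computational_Algebra.Polynomial"
begin

section \<open>A randomized real random-access machine\<close>

text \<open>
  The model of computation is a real RAM in the style of Blum, Shub and Smale: real numbers are
  stored exactly and arithmetic, square roots and comparisons on them cost one step. Programs are
  uniform (one program serves all dimensions) and contain rational constants only. Counters and
  memory addresses are natural numbers, kept apart from the reals: there is no rounding and no
  multiplication of counters, so unit cost does not hide a superpolynomial amount of discrete
  computation. Randomness comes from a tape of independent standard Gaussians (an exact fair bit is
  a sign, an exact uniform variate on the unit interval is
  $(g_1^2+g_2^2)/(g_1^2+g_2^2+g_3^2+g_4^2)$).

  The numbers in the instructions are names of counters, of real registers and of two-dimensional
  real arrays; array subscripts are always read from counters.
\<close>

datatype bexp =
    NLess nat nat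
  | RLess nat nat
  | Neg bexp

datatype rop = RAdd | RSub | RMul | RDiv

datatype com =
    SKIP
  | NConst nat nat
  | NAdd nat nat nat
  | NSub nat nat nat
  | RConst nat rat
  | ROp rop nat nat nat
  | RSqrt nat nat
  | Load nat nat nat nat
  | Store nat nat nat nat
  | Gauss nat
  | Seq com com
  | Cond bexp com com
  | While bexp com

record state =
  nreg :: "nat \<Rightarrow> nat"
  rreg :: "nat \<Rightarrow> real"
  mem :: "nat \<Rightarrow> nat \<Rightarrow> nat \<Rightarrow> real"
  tape_pos :: nat

fun bval :: "bexp \<Rightarrow> state \<Rightarrow> bool" where
  "bval (NLess i j) s \<longleftrightarrow> nreg s i < nreg s j"
| "bval (RLess x y) s \<longleftrightarrow> rreg s x < rreg s y"
| "bval (Neg b) s \<longleftrightarrow> \<not> bval b s"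

text \<open>Division by zero returns zero, and the root of a negative number \<open>a\<close> is \<open>- sqrt (- a)\<close>.\<close>

fun rop_val :: "rop \<Rightarrow> real \<Rightarrow> real \<Rightarrow> real" where
  "rop_val RAdd a b = a + b"
| "rop_val RSub a b = a - b"
| "rop_val RMul a b = a * b"
| "rop_val RDiv a b = a / b"

text \<open>
  \<open>exec \<omega> c s t s'\<close>: on random tape \<open>\<omega>\<close>, program \<open>c\<close> started in \<open>s\<close> halts in \<open>s'\<close> after \<open>t\<close> steps.
\<close>

inductive exec :: "(nat \<Rightarrow> real) \<Rightarrow> com \<Rightarrow> state \<Rightarrow> nat \<Rightarrow> state \<Rightarrow> bool" for \<omega> where
  Skip: "exec \<omega> SKIP s 1 s"
| NConst: "exec \<omega> (NConst i k) s 1 (s\<lparr>nreg := (nreg s)(i := k)\<rparr>)"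
| NAdd: "exec \<omega> (NAdd i j k) s 1 (s\<lparr>nreg := (nreg s)(i := nreg s j + nreg s k)\<rparr>)"
| NSub: "exec \<omega> (NSub i j k) s 1 (s\<lparr>nreg := (nreg s)(i := nreg s j - nreg s k)\<rparr>)"
| RConst: "exec \<omega> (RConst x q) s 1 (s\<lparr>rreg := (rreg s)(x := of_rat q)\<rparr>)"
| ROp: "exec \<omega> (ROp f x y z) s 1 (s\<lparr>rreg := (rreg s)(x := rop_val f (rreg s y) (rreg s z))\<rparr>)"
| RSqrt: "exec \<omega> (RSqrt x y) s 1 (s\<lparr>rreg := (rreg s)(x := sqrt (rreg s y))\<rparr>)"
| Load: "exec \<omega> (Load x a i j) s 1
    (s\<lparr>rreg := (rreg s)(x := mem s a (nreg s i) (nreg s j))\<rparr>)"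
| Store: "exec \<omega> (Store a i j x) s 1
    (s\<lparr>mem := (mem s)(a := (mem s a)(nreg s i := (mem s a (nreg s i))(nreg s j := rreg s x)))\<rparr>)"
| Gauss: "exec \<omega> (Gauss x) s 1
    (s\<lparr>rreg := (rreg s)(x := \<omega> (tape_pos s)), tape_pos := Suc (tape_pos s)\<rparr>)"
| Seq: "exec \<omega> c s t s' \<Longrightarrow> exec \<omega> c' s' t' s'' \<Longrightarrow> exec \<omega> (Seq c c') s (t + t') s''"
| CondTrue: "bval b s \<Longrightarrow> exec \<omega> c s t s' \<Longrightarrow> exec \<omega> (Cond b c c') s (Suc t) s'"
| CondFalse: "\<not> bval b s \<Longrightarrow> exec \<omega> c' s t s' \<Longrightarrow> exec \<omega> (Cond b c c') s (Suc t) s'"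
| WhileFalse: "\<not> bval b s \<Longrightarrow> exec \<omega> (While b c) s 1 s"
| WhileTrue: "bval b s \<Longrightarrow> exec \<omega> c s t s' \<Longrightarrow> exec \<omega> (While b c) s' t' s'' \<Longrightarrow>
    exec \<omega> (While b c) s (Suc (t + t')) s''"

text \<open>
  Counters 0 and 1 hold the sizes of the input, array 0 its real data; everything else is zero.
\<close>

definition init_state :: "nat \<Rightarrow> nat \<Rightarrow> (nat \<Rightarrow> nat \<Rightarrow> real) \<Rightarrow> state" where
  "init_state n m a =
     \<lparr>nreg = (\<lambda>_. 0)(0 := n, 1 := m), rreg = (\<lambda>_. 0), mem = (\<lambda>_ _ _. 0)(0 := a), tape_pos = 0\<rparr>"

definition normal_law :: "real \<Rightarrow> real measure" where
  "normal_law \<sigma> = density lborel (normal_density 0 \<sigma>)"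

definition coins :: "(nat \<Rightarrow> real) measure" where
  "coins = (\<Pi>\<^sub>M i\<in>UNIV. normal_law 1)"

section \<open>Vectors, matrices and limits in probability\<close>

text \<open>
  A vector in $\mathbb{R}^n$ is a function on \<open>{..<n}\<close>, extended by \<open>undefined\<close> outside, as
  in the finite product measures; likewise for matrices.
\<close>

definition vec_space :: "nat \<Rightarrow> (nat \<Rightarrow> real) measure" where
  "vec_space n = (\<Pi>\<^sub>M i\<in>{..<n}. borel)"

definition mat_space :: "nat \<Rightarrow> (nat \<times> nat \<Rightarrow> real) measure" where
  "mat_space n = (\<Pi>\<^sub>M p\<in>{..<n} \<times> {..<n}. borel)"

definition sym_mat :: "nat \<Rightarrow> (nat \<times> nat \<Rightarrow> real) \<Rightarrow> bool" where
  "sym_mat n W \<longleftrightarrow> (\<forall>i<n. \<forall>j<n. W (i, j) = W (j, i))"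

definition qform :: "nat \<Rightarrow> (nat \<times> nat \<Rightarrow> real) \<Rightarrow> (nat \<Rightarrow> real) \<Rightarrow> real" where
  "qform n W x = (\<Sum>i<n. \<Sum>j<n. x i * W (i, j) * x j)"

text \<open>
  A property holds with high probability if it contains measurable events of probability tending
  to one. Where the property is itself measurable this just says that its probability tends to
  one; in general no measurability of it (for instance of a constraint set) is presupposed.
\<close>

definition whp :: "(nat \<Rightarrow> 'a measure) \<Rightarrow> (nat \<Rightarrow> 'a \<Rightarrow> bool) \<Rightarrow> bool" where
  "whp M P \<longleftrightarrow> (\<exists>A. (\<forall>n. A n \<in> sets (M n) \<and> (\<forall>z\<in>A n. P n z)) \<and>
     (\<lambda>n. measure (M n) (A n)) \<longlonglongrightarrow> 1)"

section \<open>Certification for constrained PCA\<close>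

definition constraint_set :: "(nat \<Rightarrow> (nat \<Rightarrow> real) set) \<Rightarrow> bool" where
  "constraint_set S \<longleftrightarrow> (\<forall>n. S n \<subseteq> space (vec_space n))"

definition GOE :: "nat \<Rightarrow> (nat \<times> nat \<Rightarrow> real) measure" where
  "GOE n = distr
     (\<Pi>\<^sub>M p\<in>{(i, j). i \<le> j \<and> j < n}. normal_law (sqrt ((if fst p = snd p then 2 else 1) / real n)))
     (mat_space n)
     (\<lambda>w. \<lambda>(i, j)\<in>{..<n} \<times> {..<n}. w (min i j, max i j))"

text \<open>
  A randomized polynomial-time algorithm from square real matrices to reals, as the function
  \<open>f n W \<omega>\<close> of the dimension, the matrix and the random tape. The bound on the running time holds
  for every input and every tape.
\<close>

definition polytime_matrix_alg ::
    "(nat \<Rightarrow> (nat \<times> nat \<Rightarrow> real) \<Rightarrow> (nat \<Rightarrow> real) \<Rightarrow> real) \<Rightarrow> bool" where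
  "polytime_matrix_alg f \<longleftrightarrow> (\<exists>c (p :: nat poly). \<forall>n. \<forall>W\<in>space (mat_space n). \<forall>\<omega>. \<exists>t s.
     exec \<omega> c (init_state n 0 (\<lambda>i j. if i < n \<and> j < n then W (i, j) else 0)) t s \<and>
     t \<le> poly p n \<and> f n W \<omega> = rreg s 0)"

definition certifies ::
    "(nat \<Rightarrow> (nat \<Rightarrow> real) set) \<Rightarrow> (nat \<Rightarrow> (nat \<times> nat \<Rightarrow> real) \<Rightarrow> (nat \<Rightarrow> real) \<Rightarrow> real) \<Rightarrow>
     real \<Rightarrow> bool" where
  "certifies S f B \<longleftrightarrow>
     (\<forall>n. \<forall>W\<in>space (mat_space n). sym_mat n W \<longrightarrow>
        (AE \<omega> in coins. \<forall>x\<in>S n. qform n W x \<le> f n W \<omega>)) \<and>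
     (\<exists>e. e \<longlonglongrightarrow> 0 \<and> whp (\<lambda>n. GOE n \<Otimes>\<^sub>M coins) (\<lambda>n (W, \<omega>). f n W \<omega> \<le> B + e n))"

section \<open>Strong detection in the spiked Wishart model\<close>

definition normalized_spike_prior :: "(nat \<Rightarrow> (nat \<Rightarrow> real) measure) \<Rightarrow> bool" where
  "normalized_spike_prior X \<longleftrightarrow>
     (\<forall>n. prob_space (X n) \<and> sets (X n) = sets (vec_space n)) \<and>
     (\<forall>\<delta>>0. (\<lambda>n. measure (X n) {x \<in> space (X n). \<bar>L2_set x {..<n} - 1\<bar> > \<delta>}) \<longlonglongrightarrow> 0)"

text \<open>
  \<open>psd_sqrt n C\<close> is the positive semidefinite square root of the positive semidefinite \<open>n \<times> n\<close>
  matrix \<open>C\<close>. It is unique up to the irrelevant entries with an index outside \<open>{..<n}\<close>.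
\<close>

definition psd_sqrt :: "nat \<Rightarrow> (nat \<Rightarrow> nat \<Rightarrow> real) \<Rightarrow> nat \<Rightarrow> nat \<Rightarrow> real" where
  "psd_sqrt n C = (SOME A.
     (\<forall>i<n. \<forall>j<n. A i j = A j i) \<and>
     (\<forall>v. (\<Sum>i<n. \<Sum>j<n. v i * A i j * v j) \<ge> 0) \<and>
     (\<forall>i<n. \<forall>j<n. (\<Sum>k<n. A i k * A k j) = C i j))"

text \<open>The law $\mathcal{N}(0, C)$ of $C^{1/2} g$ with $g$ standard Gaussian; \<open>C\<close> may be singular.\<close>

definition gaussian_vec :: "nat \<Rightarrow> (nat \<Rightarrow> nat \<Rightarrow> real) \<Rightarrow> (nat \<Rightarrow> real) measure" where
  "gaussian_vec n C = distr (\<Pi>\<^sub>M i\<in>{..<n}. normal_law 1) (vec_space n)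
     (\<lambda>g. \<lambda>i\<in>{..<n}. \<Sum>j<n. psd_sqrt n C i j * g j)"

definition id_mat :: "nat \<Rightarrow> nat \<Rightarrow> real" where
  "id_mat i j = (if i = j then 1 else 0)"

definition num_samples :: "real \<Rightarrow> nat \<Rightarrow> nat" where
  "num_samples \<gamma> n = nat \<lceil>real n / \<gamma>\<rceil>"

definition wishart_null :: "real \<Rightarrow> nat \<Rightarrow> (nat \<Rightarrow> nat \<Rightarrow> real) measure" where
  "wishart_null \<gamma> n = (\<Pi>\<^sub>M k\<in>{..<num_samples \<gamma> n}. gaussian_vec n id_mat)"

definition planted_cov :: "nat \<Rightarrow> real \<Rightarrow> (nat \<Rightarrow> real) \<Rightarrow> nat \<Rightarrow> nat \<Rightarrow> real" where
  "planted_cov n \<beta> x =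
     (if \<beta> * (L2_set x {..<n})\<^sup>2 \<ge> -1 then (\<lambda>i j. id_mat i j + \<beta> * x i * x j) else id_mat)"

definition wishart_planted ::
    "real \<Rightarrow> real \<Rightarrow> (nat \<Rightarrow> (nat \<Rightarrow> real) measure) \<Rightarrow> nat \<Rightarrow> (nat \<Rightarrow> nat \<Rightarrow> real) measure" where
  "wishart_planted \<gamma> \<beta> X n =
     X n \<bind> (\<lambda>x. \<Pi>\<^sub>M k\<in>{..<num_samples \<gamma> n}. gaussian_vec n (planted_cov n \<beta> x))"

text \<open>
  A randomized polynomial-time algorithm with output in \<open>{0, 1}\<close> that reads \<open>N\<close> samples in
  $\mathbb{R}^n$; sample \<open>k\<close> is row \<open>k\<close> of the input array.
\<close>

definition polytime_sample_alg ::
    "real \<Rightarrow> (nat \<Rightarrow> (nat \<Rightarrow> nat \<Rightarrow> real) \<Rightarrow> (nat \<Rightarrow> real) \<Rightarrow> nat) \<Rightarrow> bool" where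
  "polytime_sample_alg \<gamma> f \<longleftrightarrow> (\<exists>c (p :: nat poly). \<forall>n.
     let N = num_samples \<gamma> n in
     \<forall>Y\<in>space (\<Pi>\<^sub>M k\<in>{..<N}. vec_space n). \<forall>\<omega>. \<exists>t s.
     exec \<omega> c (init_state n N (\<lambda>k i. if k < N \<and> i < n then Y k i else 0)) t s \<and>
     t \<le> poly p n \<and> f n Y \<omega> = nreg s 0 \<and> f n Y \<omega> \<in> {0, 1})"

definition strong_detection ::
    "real \<Rightarrow> real \<Rightarrow> (nat \<Rightarrow> (nat \<Rightarrow> real) measure) \<Rightarrow>
     (nat \<Rightarrow> (nat \<Rightarrow> nat \<Rightarrow> real) \<Rightarrow> (nat \<Rightarrow> real) \<Rightarrow> nat) \<Rightarrow> bool" where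
  "strong_detection \<gamma> \<beta> X f \<longleftrightarrow>
     whp (\<lambda>n. wishart_null \<gamma> n \<Otimes>\<^sub>M coins) (\<lambda>n (Y, \<omega>). f n Y \<omega> = 0) \<and>
     whp (\<lambda>n. wishart_planted \<gamma> \<beta> X n \<Otimes>\<^sub>M coins) (\<lambda>n (Y, \<omega>). f n Y \<omega> = 1)"

end

theory Submission
  imports Defs
begin

text \<open>
  Choose \<open>\<gamma> = M / (M - 1)\<close> for a large integer \<open>M\<close>, so that the \<open>N\<close> samples miss only
  \<open>d = n div M\<close> dimensions, and \<open>\<beta>\<close> close to \<open>- 1\<close>, so that all samples are nearly orthogonal to the
  spike \<open>x\<close>. Complete the samples by \<open>d\<close> Gaussian vectors and orthonormalise: under the null the
  resulting frame is Haar distributed, while under the planted law \<open>x\<close> lies almost in the span of its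
  last \<open>d\<close> vectors. Conjugating an independent tridiagonal matrix by a Haar frame, after any fixed
  rotation of the coordinates, gives exactly the GOE. The off-diagonal entries of the tridiagonal model
  concentrate at \<open>sqrt ((n - 1 - k) / n)\<close>, which is close to \<open>1\<close> for small \<open>k\<close>, so its quadratic form is
  nearly \<open>2\<close> at unit vectors that are flat on long windows of early coordinates. Hence the fixed
  rotation is taken to exchange each of the last \<open>d\<close> basis vectors with such a flat vector: now the
  matrix is still GOE under the null, but its quadratic form at \<open>x\<close> is nearly \<open>2\<close> under the planted law,
  and comparing the certificate with a threshold between \<open>2 - \<epsilon>\<close> and \<open>2\<close> tells the two apart.
\<close>

section \<open>Programs with bounded loops\<close>

text \<open>The value \<open>2 - \<epsilon>\<close> is promised only under the exact GOE law, so
  every transformation has to preserve the null law exactly and not just in the limit. The natural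
  plan would plant top eigenvectors of a GOE matrix along the directions missed by the samples, but
  exact eigenvectors are out of reach of arithmetic and square roots. The tridiagonal model replaces
  them: where its off-diagonal is close to 1, a flat vector on a long window nearly attains the
  value 2, and disjoint windows give explicit orthonormal vectors. Windows of square length
  \<open>m = r * r\<close> have the rational height \<open>1 / r\<close>. The constants are fixed in
  the order \<open>\<kappa>\<close>, \<open>r\<close>, \<open>M\<close>, \<open>\<beta>\<close>:
  long windows make boundary losses small, a large \<open>M\<close> keeps all windows where the
  off-diagonal is near 1, and \<open>\<beta>\<close> near -1 must beat the factor
  \<open>n / d\<close> lost when the mass of the spike in the span of the samples is estimated. None
  depends on \<open>n\<close>, so one program serves all dimensions. That its acceptance is an event
  at all follows from the measurability of programs with bounded running time.\<close>

notation Seq (infixr ";;" 60)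

text \<open>Total correctness with a time budget. The state comes last, so that
  \<open>ok \<omega> c T Q\<close> is itself a postcondition and sequential programs are handled by
  nesting.\<close>

definition ok :: "(nat \<Rightarrow> real) \<Rightarrow> com \<Rightarrow> nat \<Rightarrow> (state \<Rightarrow> bool) \<Rightarrow> state \<Rightarrow> bool" where
  "ok \<omega> c T Q s \<longleftrightarrow> (\<exists>t s'. exec \<omega> c s t s' \<and> t \<le> T \<and> Q s')"

lemma ok_conseq: "ok \<omega> c T Q s \<Longrightarrow> T \<le> T' \<Longrightarrow> (\<And>s'. Q s' \<Longrightarrow> Q' s') \<Longrightarrow> ok \<omega> c T' Q' s"
  unfolding ok_def by (meson le_trans)

lemma ok_Seq:
  assumes "ok \<omega> c T (\<lambda>s'. ok \<omega> c' T' Q s') s"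
  shows "ok \<omega> (c ;; c') (T + T') Q s"
proof -
  from assms obtain t s' t' s'' where "exec \<omega> c s t s'" "t \<le> T" "exec \<omega> c' s' t' s''" "t' \<le> T'" "Q s''"
    unfolding ok_def by blast
  then show ?thesis unfolding ok_def
    by (intro exI[of _ "t + t'"] exI[of _ s'']) (auto intro: exec.Seq)
qed

inductive_cases exec_SKIP: "exec \<omega> SKIP s t s'"
inductive_cases exec_NConst: "exec \<omega> (NConst i k) s t s'"
inductive_cases exec_NAdd: "exec \<omega> (NAdd i j k) s t s'"
inductive_cases exec_NSub: "exec \<omega> (NSub i j k) s t s'"
inductive_cases exec_RConst: "exec \<omega> (RConst i k) s t s'"
inductive_cases exec_ROp: "exec \<omega> (ROp f i j k) s t s'"
inductive_cases exec_RSqrt: "exec \<omega> (RSqrt i j) s t s'"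
inductive_cases exec_Load: "exec \<omega> (Load x a i j) s t s'"
inductive_cases exec_Store: "exec \<omega> (Store a i j x) s t s'"
inductive_cases exec_Gauss: "exec \<omega> (Gauss x) s t s'"
inductive_cases exec_Seq: "exec \<omega> (c ;; c') s t s'"
inductive_cases exec_Cond: "exec \<omega> (Cond b c c') s t s'"
inductive_cases exec_While: "exec \<omega> (While b c) s t s'"

lemma exec_basic:
  "exec \<omega> SKIP s t s' \<longleftrightarrow> t = 1 \<and> s' = s"
  "exec \<omega> (NConst i k) s t s' \<longleftrightarrow> t = 1 \<and> s' = s\<lparr>nreg := (nreg s)(i := k)\<rparr>"
  "exec \<omega> (NAdd i j l) s t s' \<longleftrightarrow> t = 1 \<and> s' = s\<lparr>nreg := (nreg s)(i := nreg s j + nreg s l)\<rparr>"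
  "exec \<omega> (NSub i j l) s t s' \<longleftrightarrow> t = 1 \<and> s' = s\<lparr>nreg := (nreg s)(i := nreg s j - nreg s l)\<rparr>"
  "exec \<omega> (RConst x q) s t s' \<longleftrightarrow> t = 1 \<and> s' = s\<lparr>rreg := (rreg s)(x := of_rat q)\<rparr>"
  "exec \<omega> (ROp f x y z) s t s' \<longleftrightarrow> t = 1 \<and> s' = s\<lparr>rreg := (rreg s)(x := rop_val f (rreg s y) (rreg s z))\<rparr>"
  "exec \<omega> (RSqrt x y) s t s' \<longleftrightarrow> t = 1 \<and> s' = s\<lparr>rreg := (rreg s)(x := sqrt (rreg s y))\<rparr>"
  "exec \<omega> (Load x a i j) s t s' \<longleftrightarrow> t = 1 \<and> s' = s\<lparr>rreg := (rreg s)(x := mem s a (nreg s i) (nreg s j))\<rparr>"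
  "exec \<omega> (Store a i j x) s t s' \<longleftrightarrow> t = 1 \<and>
     s' = s\<lparr>mem := (mem s)(a := (mem s a)(nreg s i := (mem s a (nreg s i))(nreg s j := rreg s x)))\<rparr>"
  "exec \<omega> (Gauss x) s t s' \<longleftrightarrow> t = 1 \<and>
     s' = s\<lparr>rreg := (rreg s)(x := \<omega> (tape_pos s)), tape_pos := Suc (tape_pos s)\<rparr>"
  by (auto elim: exec_SKIP exec_NConst exec_NAdd exec_NSub exec_RConst exec_ROp exec_RSqrt
      exec_Load exec_Store exec_Gauss intro: exec.intros simp del: One_nat_def)

text \<open>Being equivalences, these rules execute straight-line code symbolically by rewriting,
  with one unit of the budget paid per instruction. The second form peels the first instruction off
  a right-nested sequence.\<close>

lemma ok_step:
  assumes "\<And>t s'. exec \<omega> c s t s' \<longleftrightarrow> t = 1 \<and> s' = u"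
  shows "ok \<omega> c T Q s \<longleftrightarrow> 1 \<le> T \<and> Q u" "ok \<omega> (c ;; c') T Q s \<longleftrightarrow> 1 \<le> T \<and> ok \<omega> c' (T - 1) Q u"
proof -
  show "ok \<omega> c T Q s \<longleftrightarrow> 1 \<le> T \<and> Q u" by (auto simp: ok_def assms)
  show "ok \<omega> (c ;; c') T Q s \<longleftrightarrow> 1 \<le> T \<and> ok \<omega> c' (T - 1) Q u"
  proof
    assume "ok \<omega> (c ;; c') T Q s"
    then obtain t s' t' s'' where "exec \<omega> c s t s'" "exec \<omega> c' s' t' s''" "t + t' \<le> T" "Q s''"
      unfolding ok_def by (blast elim: exec_Seq)
    then show "1 \<le> T \<and> ok \<omega> c' (T - 1) Q u"
      unfolding ok_def assms by (intro conjI exI[of _ t'] exI[of _ s'']) auto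
  next
    assume *: "1 \<le> T \<and> ok \<omega> c' (T - 1) Q u"
    then have "ok \<omega> (c ;; c') (1 + (T - 1)) Q s"
      by (intro ok_Seq) (auto simp: ok_def assms)
    with * show "ok \<omega> (c ;; c') T Q s" by simp
  qed
qed

lemmas ok_steps = exec_basic[THEN ok_step(1)] exec_basic[THEN ok_step(2)]

lemma ok_Cond:
  "ok \<omega> (Cond b c c') T Q s \<longleftrightarrow> 1 \<le> T \<and> ok \<omega> (if bval b s then c else c') (T - 1) Q s"
proof
  assume "ok \<omega> (Cond b c c') T Q s"
  then show "1 \<le> T \<and> ok \<omega> (if bval b s then c else c') (T - 1) Q s"
    unfolding ok_def by (force elim!: exec_Cond)
next
  assume "1 \<le> T \<and> ok \<omega> (if bval b s then c else c') (T - 1) Q s"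
  then show "ok \<omega> (Cond b c c') T Q s"
    unfolding ok_def by (cases "bval b s") (fastforce intro: exec.intros)+
qed

lemma ok_Seq_le:
  assumes "ok \<omega> c T (\<lambda>s'. ok \<omega> c' T' Q s') s" "T + T' \<le> T''"
  shows "ok \<omega> (c ;; c') T'' Q s"
  using ok_conseq[OF ok_Seq[OF assms(1)] assms(2)] .

text \<open>The syntactic write sets of a program (counters here, then real registers and arrays)
  yield its frame condition \<open>agree\<close>, so that loop invariants mention only what
  changes.\<close>

fun nw :: "com \<Rightarrow> nat set" where
  "nw (NConst i _) = {i}" | "nw (NAdd i _ _) = {i}" | "nw (NSub i _ _) = {i}"
| "nw (Seq c c') = nw c \<union> nw c'" | "nw (Cond _ c c') = nw c \<union> nw c'" | "nw (While _ c) = nw c"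
| "nw _ = {}"

fun rw :: "com \<Rightarrow> nat set" where
  "rw (RConst x _) = {x}" | "rw (ROp _ x _ _) = {x}" | "rw (RSqrt x _) = {x}"
| "rw (Load x _ _ _) = {x}" | "rw (Gauss x) = {x}"
| "rw (Seq c c') = rw c \<union> rw c'" | "rw (Cond _ c c') = rw c \<union> rw c'" | "rw (While _ c) = rw c"
| "rw _ = {}"

fun mw :: "com \<Rightarrow> nat set" where
  "mw (Store a _ _ _) = {a}"
| "mw (Seq c c') = mw c \<union> mw c'" | "mw (Cond _ c c') = mw c \<union> mw c'" | "mw (While _ c) = mw c"
| "mw _ = {}"

fun reads_tape :: "com \<Rightarrow> bool" where
  "reads_tape (Gauss _) \<longleftrightarrow> True"
| "reads_tape (Seq c c') \<longleftrightarrow> reads_tape c \<or> reads_tape c'"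
| "reads_tape (Cond _ c c') \<longleftrightarrow> reads_tape c \<or> reads_tape c'"
| "reads_tape (While _ c) \<longleftrightarrow> reads_tape c"
| "reads_tape _ \<longleftrightarrow> False"

definition agree :: "com \<Rightarrow> state \<Rightarrow> state \<Rightarrow> bool" where
  "agree c s s' \<longleftrightarrow> (\<forall>i. i \<notin> nw c \<longrightarrow> nreg s' i = nreg s i) \<and> (\<forall>x. x \<notin> rw c \<longrightarrow> rreg s' x = rreg s x) \<and>
     (\<forall>a. a \<notin> mw c \<longrightarrow> mem s' a = mem s a) \<and> (\<not> reads_tape c \<longrightarrow> tape_pos s' = tape_pos s)"

lemma exec_agree: "exec \<omega> c s t s' \<Longrightarrow> agree c s s'"
  by (induction rule: exec.induct) (auto simp: agree_def)

lemma ok_agree: "ok \<omega> c T Q s \<Longrightarrow> ok \<omega> c T (\<lambda>s'. agree c s s' \<and> Q s') s"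
  unfolding ok_def using exec_agree by blast

lemma ok_then:
  assumes "ok \<omega> c T P s" "\<And>s'. agree c s s' \<Longrightarrow> P s' \<Longrightarrow> ok \<omega> c' T' Q s'" "T + T' \<le> T''"
  shows "ok \<omega> (c ;; c') T'' Q s"
  by (rule ok_Seq_le[OF ok_conseq[OF ok_agree[OF assms(1)] order_refl] assms(3)]) (use assms(2) in auto)

definition For :: "nat \<Rightarrow> nat \<Rightarrow> com \<Rightarrow> com" where
  "For i l c = NConst i 0 ;; While (NLess i l) (c ;; NAdd i i 2)"

lemma For_writes [simp]:
  "nw (For i l c) = insert i (nw c)" "rw (For i l c) = rw c" "mw (For i l c) = mw c"
  "reads_tape (For i l c) = reads_tape c"
  by (auto simp: For_def)

text \<open>Counter 2 is reserved for the constant one.\<close>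

lemma ok_For:
  assumes s: "nreg s 2 = 1" "nreg s l = L" and w: "i \<notin> nw c" "l \<notin> nw c" "2 \<notin> nw c" "i \<noteq> l" "i \<noteq> 2"
    and init: "Inv 0 (s\<lparr>nreg := (nreg s)(i := 0)\<rparr>)"
    and step: "\<And>k s'. k < L \<Longrightarrow> nreg s' i = k \<Longrightarrow> agree (For i l c) s s' \<Longrightarrow> Inv k s' \<Longrightarrow>
      ok \<omega> c T (\<lambda>s''. Inv (Suc k) (s''\<lparr>nreg := (nreg s'')(i := Suc k)\<rparr>)) s'"
    and final: "\<And>s'. agree (For i l c) s s' \<Longrightarrow> Inv L s' \<Longrightarrow> Q s'"
    and le: "L * (T + 2) + 2 \<le> T'"
  shows "ok \<omega> (For i l c) T' Q s"
proof -
  \<comment> \<open>Generalised to a start at iteration \<open>k\<close>, for induction on the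
    iterations left. Each costs \<open>T + 2\<close>: the body, the increment and the test.\<close>
  have *: "\<exists>t s'. exec \<omega> (While (NLess i l) (c ;; NAdd i i 2)) s1 t s' \<and>
      t \<le> (L - k) * (T + 2) + 1 \<and> Inv L s'"
    if "k \<le> L" "nreg s1 i = k" "agree (For i l c) s s1" "Inv k s1" for k s1
    using that
  proof (induction "L - k" arbitrary: k s1)
    case 0
    then have "k = L" by simp
    have "nreg s1 l = L" using 0 s w by (auto simp: agree_def)
    then have "exec \<omega> (While (NLess i l) (c ;; NAdd i i 2)) s1 1 s1"
      using 0 by (intro exec.WhileFalse) auto
    then show ?case using 0 \<open>k = L\<close> by (intro exI[of _ 1] exI[of _ s1]) auto
  next
    case (Suc d)
    then have k: "k < L" by simp
    obtain t2 s2 where s2: "exec \<omega> c s1 t2 s2" "t2 \<le> T" "Inv (Suc k) (s2\<lparr>nreg := (nreg s2)(i := Suc k)\<rparr>)"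
      using step[OF k Suc.prems(2-4)] unfolding ok_def by blast
    have a2: "agree c s1 s2" using s2(1) by (rule exec_agree)
    define s3 where "s3 = s2\<lparr>nreg := (nreg s2)(i := Suc k)\<rparr>"
    have n2: "nreg s2 i = k" "nreg s2 2 = 1"
      using a2 Suc.prems w s by (auto simp: agree_def)
    have "exec \<omega> (NAdd i i 2) s2 1 s3"
      using exec.NAdd[of \<omega> i i 2 s2] n2 by (simp add: s3_def)
    from exec.Seq[OF s2(1) this] have b: "exec \<omega> (c ;; NAdd i i 2) s1 (t2 + 1) s3" .
    have a3: "agree (For i l c) s s3"
      using a2 Suc.prems(3) by (auto simp: agree_def s3_def)
    have d: "d = L - Suc k" using Suc.hyps(2) by simp
    have "\<exists>t s'. exec \<omega> (While (NLess i l) (c ;; NAdd i i 2)) s3 t s' \<and>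
        t \<le> (L - Suc k) * (T + 2) + 1 \<and> Inv L s'"
      by (rule Suc.hyps(1)[OF d]) (use k a3 s2(3) in \<open>auto simp: s3_def\<close>)
    then obtain t4 s4 where s4: "exec \<omega> (While (NLess i l) (c ;; NAdd i i 2)) s3 t4 s4"
      "t4 \<le> (L - Suc k) * (T + 2) + 1" "Inv L s4" by blast
    have "bval (NLess i l) s1" using k Suc.prems s w by (auto simp: agree_def)
    from exec.WhileTrue[OF this b s4(1)]
    have "exec \<omega> (While (NLess i l) (c ;; NAdd i i 2)) s1 (Suc (t2 + 1 + t4)) s4" .
    moreover have "L - k = Suc (L - Suc k)" using k by simp
    then have "Suc (t2 + 1 + t4) \<le> (L - k) * (T + 2) + 1" using s2(2) s4(2) by simp
    ultimately show ?case using s4(3) by blast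
  qed
  have "agree (For i l c) s (s\<lparr>nreg := (nreg s)(i := 0)\<rparr>)" by (auto simp: agree_def)
  from *[of 0, OF _ _ this init] obtain t s'
    where t: "exec \<omega> (While (NLess i l) (c ;; NAdd i i 2)) (s\<lparr>nreg := (nreg s)(i := 0)\<rparr>) t s'"
      "t \<le> L * (T + 2) + 1" "Inv L s'" by auto
  from exec.Seq[OF exec.NConst t(1)] have e: "exec \<omega> (For i l c) s (1 + t) s'"
    by (simp add: For_def)
  moreover have "Q s'" using final exec_agree[OF e] t(3) by blast
  ultimately show ?thesis unfolding ok_def using t(2) le by (intro exI[of _ "1 + t"] exI[of _ s']) auto
qed

lemma exec_cong: "exec \<omega> c s t s' \<Longrightarrow> s' = s'' \<Longrightarrow> exec \<omega> c s t s''"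
  by simp

text \<open>The tape is read only through \<open>tape_pos\<close>, so a run that starts at position
  \<open>p\<close> is a run from the beginning of the tape shifted by \<open>p\<close>. This lets
  the given certificate run unchanged after the preprocessing has used up cells.\<close>

lemma exec_shift:
  assumes "exec (\<lambda>i. \<omega> (i + p)) c s t s'"
  shows "exec \<omega> c (s\<lparr>tape_pos := tape_pos s + p\<rparr>) t (s'\<lparr>tape_pos := tape_pos s' + p\<rparr>)"
  using assms
proof (induction rule: exec.induct)
  case (Gauss x s)
  then show ?case by (intro exec_cong[OF exec.Gauss]) simp
next
  case (NConst i k s) then show ?case by (intro exec_cong[OF exec.NConst]) simp
next
  case (NAdd i j k s) then show ?case by (intro exec_cong[OF exec.NAdd]) simp
next
  case (NSub i j k s) then show ?case by (intro exec_cong[OF exec.NSub]) simp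
next
  case (RConst i k s) then show ?case by (intro exec_cong[OF exec.RConst]) simp
next
  case (ROp f x y z s) then show ?case by (intro exec_cong[OF exec.ROp]) simp
next
  case (RSqrt x y s) then show ?case by (intro exec_cong[OF exec.RSqrt]) simp
next
  case (Load x a i j s) then show ?case by (intro exec_cong[OF exec.Load]) simp
next
  case (Store a i j x s) then show ?case by (intro exec_cong[OF exec.Store]) simp
next
  case (CondTrue b s c t s' c')
  have "bval b (s\<lparr>tape_pos := q\<rparr>) = bval b s" for q by (induction b) auto
  with CondTrue show ?case by (intro exec.CondTrue) auto
next
  case (CondFalse b s c t s' c')
  have "bval b (s\<lparr>tape_pos := q\<rparr>) = bval b s" for q by (induction b) auto
  with CondFalse show ?case by (intro exec.CondFalse) auto
next
  case (WhileFalse b s c)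
  have "bval b (s\<lparr>tape_pos := q\<rparr>) = bval b s" for q by (induction b) auto
  with WhileFalse show ?case by (intro exec.WhileFalse) auto
next
  case (WhileTrue b s c t s' t' s'')
  have "bval b (s\<lparr>tape_pos := q\<rparr>) = bval b s" for q by (induction b) auto
  with WhileTrue show ?case by (intro exec.WhileTrue) auto
qed (auto intro: exec.intros simp del: One_nat_def)

section \<open>Running a program on measurable inputs\<close>

text \<open>Stated component by component, since the record type carries no sigma-algebra.\<close>

definition meas_state :: "'a measure \<Rightarrow> ('a \<Rightarrow> state) \<Rightarrow> bool" where
  "meas_state M s \<longleftrightarrow>
     (\<forall>i. (\<lambda>z. nreg (s z) i) \<in> measurable M (count_space UNIV)) \<and>
     (\<forall>x. (\<lambda>z. rreg (s z) x) \<in> borel_measurable M) \<and>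
     (\<forall>a i j. (\<lambda>z. mem (s z) a i j) \<in> borel_measurable M) \<and>
     (\<lambda>z. tape_pos (s z)) \<in> measurable M (count_space UNIV)"

lemma meas_state_cong:
  assumes "\<And>z. z \<in> space M \<Longrightarrow> s z = s' z"
  shows "meas_state M s \<longleftrightarrow> meas_state M s'"
  unfolding meas_state_def using assms
  by (intro arg_cong2[where f=conj] all_cong1 measurable_cong) auto

lemma meas_state_restrict: "meas_state M s \<Longrightarrow> meas_state (restrict_space M B) s"
  unfolding meas_state_def by (auto intro: measurable_restrict_space1)

lemma meas_state_glue:
  assumes B: "B \<in> sets M" and "meas_state (restrict_space M B) s"
    "meas_state (restrict_space M (space M - B)) s"
  shows "meas_state M s"
proof -
  have *: "f \<in> measurable M N"
    if "f \<in> measurable (restrict_space M B) N" "f \<in> measurable (restrict_space M (space M - B)) N"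
    for f and N :: "'c measure"
    by (rule measurable_piecewise_restrict[where C="{B, space M - B}"]) (use that B in auto)
  show ?thesis using assms(2,3) unfolding meas_state_def by (auto intro!: *)
qed

lemma meas_state_bval: "meas_state M s \<Longrightarrow> {z \<in> space M. bval b (s z)} \<in> sets M"
proof (induction b)
  case (NLess i j)
  then have [measurable]: "(\<lambda>z. nreg (s z) i) \<in> measurable M (count_space UNIV)"
    "(\<lambda>z. nreg (s z) j) \<in> measurable M (count_space UNIV)" by (auto simp: meas_state_def)
  have "{z \<in> space M. bval (NLess i j) (s z)} =
      (\<Union>k. ((\<lambda>z. nreg (s z) i) -` {k} \<inter> space M) \<inter> ((\<lambda>z. nreg (s z) j) -` {k<..} \<inter> space M))" by auto
  also have "\<dots> \<in> sets M"
  proof -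
    have "((\<lambda>z. nreg (s z) i) -` {k} \<inter> space M) \<inter> ((\<lambda>z. nreg (s z) j) -` {k<..} \<inter> space M) \<in> sets M" for k
      by (rule sets.Int[OF measurable_sets measurable_sets]) measurable
    then show ?thesis by blast
  qed
  finally show ?case .
next
  case (RLess x y)
  then have [measurable]: "(\<lambda>z. rreg (s z) x) \<in> borel_measurable M"
    "(\<lambda>z. rreg (s z) y) \<in> borel_measurable M" by (auto simp: meas_state_def)
  show ?case by simp
next
  case (Neg b)
  then have "space M - {z \<in> space M. bval b (s z)} \<in> sets M" by auto
  also have "space M - {z \<in> space M. bval b (s z)} = {z \<in> space M. bval (Neg b) (s z)}" by auto
  finally show ?case .
qed

lemma exec_time_pos: "exec \<omega> c s t s' \<Longrightarrow> 0 < t"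
  by (induction rule: exec.induct) auto

text \<open>Time bounds hold for all inputs, so induction on the bound reaches every branch; the inputs following
  one branch of a test form a measurable set, and the two restrictions are glued.\<close>

lemma meas_state_exec:
  fixes M :: "'a measure"
  assumes "\<And>i. (\<lambda>z. \<omega> z i) \<in> borel_measurable M" "meas_state M s"
    and "\<And>z. z \<in> space M \<Longrightarrow> exec (\<omega> z) c (s z) (t z) (s' z) \<and> t z \<le> T"
  shows "meas_state M s'"
  using assms
proof (induction T arbitrary: M c s t s' rule: less_induct)
  case (less T)
  note ex = less.prems(3)
  show ?case
  \<comment> \<open>On an empty space the time bound is vacuous and \<open>T\<close> might be 0.
    Otherwise some run takes at least one step, so \<open>T - 1 < T\<close> and the induction
    hypothesis applies.\<close>
  proof (cases "space M = {}")
    case True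
    then show ?thesis by (auto simp: meas_state_def measurable_def)
  next
    case False
    then obtain z0 where z0: "z0 \<in> space M" by auto
    have T: "T - 1 < T" using ex[OF z0] exec_time_pos by fastforce
    have n [measurable]: "(\<lambda>z. nreg (s z) i) \<in> measurable M (count_space UNIV)" for i
      using less.prems(2) by (simp add: meas_state_def)
    have r [measurable]: "(\<lambda>z. rreg (s z) i) \<in> borel_measurable M" for i
      using less.prems(2) by (simp add: meas_state_def)
    have m [measurable]: "(\<lambda>z. mem (s z) a i j) \<in> borel_measurable M" for a i j
      using less.prems(2) by (simp add: meas_state_def)
    have tp [measurable]: "(\<lambda>z. tape_pos (s z)) \<in> measurable M (count_space UNIV)"
      using less.prems(2) by (simp add: meas_state_def)
    have om [measurable]: "(\<lambda>z. \<omega> z i) \<in> borel_measurable M" for i by (rule less.prems)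
    have upd: "meas_state M s'" if "\<And>z. z \<in> space M \<Longrightarrow> s' z = g (\<omega> z) (s z)"
      "meas_state M (\<lambda>z. g (\<omega> z) (s z))" for g
      using meas_state_cong[of M s' "\<lambda>z. g (\<omega> z) (s z)"] that by blast
    have split: "meas_state M s'" if
      "meas_state (restrict_space M {z \<in> space M. bval b (s z)}) s'"
      "meas_state (restrict_space M (space M - {z \<in> space M. bval b (s z)})) s'" for b
      by (rule meas_state_glue[OF meas_state_bval[OF less.prems(2)]]) (use that in auto)
    have om': "(\<lambda>z. \<omega> z i) \<in> borel_measurable (restrict_space M B)" for i B
      by (rule measurable_restrict_space1) (rule om)
    show ?thesis
    proof (cases c)
      case SKIP
      show ?thesis
        by (rule upd[of "\<lambda>\<omega> s. s"]) (use ex less.prems(2) in \<open>auto simp: SKIP elim: exec_SKIP\<close>)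
    next
      case (NConst i k)
      show ?thesis
        by (rule upd[of "\<lambda>\<omega> s. s\<lparr>nreg := (nreg s)(i := k)\<rparr>"])
          (use ex in \<open>auto simp: NConst meas_state_def elim: exec_NConst\<close>)
    next
      case (NAdd i j k)
      show ?thesis
        by (rule upd[of "\<lambda>\<omega> s. s\<lparr>nreg := (nreg s)(i := nreg s j + nreg s k)\<rparr>"])
          (use ex in \<open>auto simp: NAdd meas_state_def elim: exec_NAdd\<close>)
    next
      case (NSub i j k)
      show ?thesis
        by (rule upd[of "\<lambda>\<omega> s. s\<lparr>nreg := (nreg s)(i := nreg s j - nreg s k)\<rparr>"])
          (use ex in \<open>auto simp: NSub meas_state_def elim: exec_NSub\<close>)
    next
      case (RConst x q)
      show ?thesis
        by (rule upd[of "\<lambda>\<omega> s. s\<lparr>rreg := (rreg s)(x := of_rat q)\<rparr>"])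
          (use ex in \<open>auto simp: RConst meas_state_def elim: exec_RConst\<close>)
    next
      case (ROp f x y z)
      have "(\<lambda>u. rop_val f (rreg (s u) y) (rreg (s u) z)) \<in> borel_measurable M"
        by (cases f) auto
      then show ?thesis
        by (intro upd[of "\<lambda>\<omega> s. s\<lparr>rreg := (rreg s)(x := rop_val f (rreg s y) (rreg s z))\<rparr>"])
          (use ex in \<open>auto simp: ROp meas_state_def elim: exec_ROp\<close>)
    next
      case (RSqrt x y)
      show ?thesis
        by (rule upd[of "\<lambda>\<omega> s. s\<lparr>rreg := (rreg s)(x := sqrt (rreg s y))\<rparr>"])
          (use ex in \<open>auto simp: RSqrt meas_state_def elim: exec_RSqrt\<close>)
    next
      case (Load x a i j)
      \<comment> \<open>The address depends on the input, but it takes countably many values, and on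
        each of the resulting pieces the cell read is fixed.\<close>
      have "(\<lambda>z. mem (s z) a (nreg (s z) i) (nreg (s z) j)) \<in> borel_measurable M"
        by (rule measurable_compose_countable[OF measurable_compose_countable[OF m n] n])
      then show ?thesis
        by (intro upd[of "\<lambda>\<omega> s. s\<lparr>rreg := (rreg s)(x := mem s a (nreg s i) (nreg s j))\<rparr>"])
          (use ex in \<open>auto simp: Load meas_state_def elim: exec_Load\<close>)
    next
      case (Store a i j x)
      let ?g = "\<lambda>s. s\<lparr>mem := (mem s)(a := (mem s a)(nreg s i := (mem s a (nreg s i))(nreg s j := rreg s x)))\<rparr>"
      have "mem (?g (s z)) b k l = (if b = a \<and> k = nreg (s z) i \<and> l = nreg (s z) j
          then rreg (s z) x else mem (s z) b k l)" for b k l z by auto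
      then have "(\<lambda>z. mem (?g (s z)) b k l) \<in> borel_measurable M" for b k l
        by (subst measurable_cong) (assumption, measurable)
      then have "meas_state M (\<lambda>z. ?g (s z))"
        unfolding meas_state_def using n r tp by (intro conjI allI) simp_all
      then show ?thesis
        by (intro upd[of "\<lambda>\<omega> s. ?g s"]) (use ex in \<open>auto simp: Store elim: exec_Store\<close>)
    next
      case (Gauss x)
      have "(\<lambda>z. \<omega> z (tape_pos (s z))) \<in> borel_measurable M"
        by (rule measurable_compose_countable[OF om tp])
      then show ?thesis
        by (intro upd[of "\<lambda>\<omega> s. s\<lparr>rreg := (rreg s)(x := \<omega> (tape_pos s)), tape_pos := Suc (tape_pos s)\<rparr>"])
          (use ex in \<open>auto simp: Gauss meas_state_def elim!: exec_Gauss\<close>)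
    next
      case (Seq c1 c2)
      have "\<forall>z\<in>space M. \<exists>t1 s1 t2. exec (\<omega> z) c1 (s z) t1 s1 \<and> exec (\<omega> z) c2 s1 t2 (s' z) \<and> t1 + t2 \<le> T"
        using ex unfolding Seq by (metis exec_Seq)
      then obtain t1 s1 t2 where *: "\<And>z. z \<in> space M \<Longrightarrow> exec (\<omega> z) c1 (s z) (t1 z) (s1 z)"
        "\<And>z. z \<in> space M \<Longrightarrow> exec (\<omega> z) c2 (s1 z) (t2 z) (s' z)"
        "\<And>z. z \<in> space M \<Longrightarrow> t1 z + t2 z \<le> T" by metis
      have le: "t1 z \<le> T - 1" "t2 z \<le> T - 1" if "z \<in> space M" for z
        using *[OF that] exec_time_pos[OF *(1)[OF that]] exec_time_pos[OF *(2)[OF that]] by auto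
      have "meas_state M s1"
        by (rule less.IH[OF T om less.prems(2)]) (use * le in blast)
      then show ?thesis
        by (rule less.IH[OF T om]) (use * le in blast)
    next
      case (Cond b c1 c2)
      show ?thesis
      proof (rule split[of b])
        have 1: "\<forall>z\<in>space (restrict_space M {z \<in> space M. bval b (s z)}).
            \<exists>t. exec (\<omega> z) c1 (s z) t (s' z) \<and> t \<le> T - 1"
        proof
          fix z assume "z \<in> space (restrict_space M {z \<in> space M. bval b (s z)})"
          then have "z \<in> space M" "bval b (s z)" by (auto simp: space_restrict_space)
          with ex[of z] show "\<exists>t. exec (\<omega> z) c1 (s z) t (s' z) \<and> t \<le> T - 1"
            unfolding Cond by (auto elim!: exec_Cond)
        qed
        from bchoice[OF this] obtain t1 where "\<forall>z\<in>space (restrict_space M {z \<in> space M. bval b (s z)}).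
            exec (\<omega> z) c1 (s z) (t1 z) (s' z) \<and> t1 z \<le> T - 1" by blast
        then show "meas_state (restrict_space M {z \<in> space M. bval b (s z)}) s'"
          by (intro less.IH[OF T om' meas_state_restrict[OF less.prems(2)]]) auto
      next
        have 1: "\<forall>z\<in>space (restrict_space M (space M - {z \<in> space M. bval b (s z)})).
            \<exists>t. exec (\<omega> z) c2 (s z) t (s' z) \<and> t \<le> T - 1"
        proof
          fix z assume "z \<in> space (restrict_space M (space M - {z \<in> space M. bval b (s z)}))"
          then have "z \<in> space M" "\<not> bval b (s z)" by (auto simp: space_restrict_space)
          with ex[of z] show "\<exists>t. exec (\<omega> z) c2 (s z) t (s' z) \<and> t \<le> T - 1"
            unfolding Cond by (auto elim!: exec_Cond)
        qed
        from bchoice[OF this] obtain t1 where "\<forall>z\<in>space (restrict_space M (space M - {z \<in> space M. bval b (s z)})).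
            exec (\<omega> z) c2 (s z) (t1 z) (s' z) \<and> t1 z \<le> T - 1" by blast
        then show "meas_state (restrict_space M (space M - {z \<in> space M. bval b (s z)})) s'"
          by (intro less.IH[OF T om' meas_state_restrict[OF less.prems(2)]]) auto
      qed
    next
      case (While b c1)
      show ?thesis
      proof (rule split[of b])
        let ?M = "restrict_space M {z \<in> space M. bval b (s z)}"
        \<comment> \<open>The same loop reappears as its own continuation, only with a smaller time
          bound: an induction over programs would not reach it.\<close>
        let ?P = "\<lambda>z t1 s1 t2. exec (\<omega> z) c1 (s z) t1 s1 \<and>
          exec (\<omega> z) (While b c1) s1 t2 (s' z) \<and> t1 \<le> T - 1 \<and> t2 \<le> T - 1"
        have "\<forall>z\<in>space ?M. \<exists>u. ?P z (fst u) (fst (snd u)) (snd (snd u))"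
        proof
          fix z assume "z \<in> space ?M"
          then have "z \<in> space M" "bval b (s z)" by (auto simp: space_restrict_space)
          with ex[of z] have "exec (\<omega> z) (While b c1) (s z) (t z) (s' z)" "t z \<le> T"
            by (auto simp: While)
          then obtain t1 s1 t2 where "exec (\<omega> z) c1 (s z) t1 s1"
            "exec (\<omega> z) (While b c1) s1 t2 (s' z)" "Suc (t1 + t2) \<le> T"
            using \<open>bval b (s z)\<close> by (cases rule: exec_While) auto
          then show "\<exists>u. ?P z (fst u) (fst (snd u)) (snd (snd u))"
            by (intro exI[of _ "(t1, s1, t2)"]) auto
        qed
        from bchoice[OF this] obtain u where
          u: "\<forall>z\<in>space ?M. ?P z (fst (u z)) (fst (snd (u z))) (snd (snd (u z)))" by blast
        define t1 s1 t2 where "t1 z = fst (u z)" and "s1 z = fst (snd (u z))" and "t2 z = snd (snd (u z))" for z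
        have *: "\<And>z. z \<in> space ?M \<Longrightarrow> exec (\<omega> z) c1 (s z) (t1 z) (s1 z) \<and> t1 z \<le> T - 1"
          "\<And>z. z \<in> space ?M \<Longrightarrow> exec (\<omega> z) (While b c1) (s1 z) (t2 z) (s' z) \<and> t2 z \<le> T - 1"
          using u by (auto simp: t1_def s1_def t2_def)
        have "meas_state ?M s1"
          by (rule less.IH[OF T om' meas_state_restrict[OF less.prems(2)] *(1)])
        then show "meas_state ?M s'"
          by (rule less.IH[OF T om' _ *(2)])
      next
        let ?M = "restrict_space M (space M - {z \<in> space M. bval b (s z)})"
        have "s' z = s z" if "z \<in> space ?M" for z
        proof -
          from that have "z \<in> space M" "\<not> bval b (s z)" by (auto simp: space_restrict_space)
          with ex[of z] have "exec (\<omega> z) (While b c1) (s z) (t z) (s' z)" by (auto simp: While)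
          then show ?thesis using \<open>\<not> bval b (s z)\<close> by (cases rule: exec_While) auto
        qed
        then show "meas_state ?M s'"
          using meas_state_cong[of ?M s' s] meas_state_restrict[OF less.prems(2)] by blast
      qed
    qed
  qed
qed

text \<open>The certificate is known only as the output of a program. Joint measurability in matrix
  and tape is extracted from the uniform time bound; it makes the set where the output lies below
  the threshold an event.\<close>

lemma measurable_polytime_matrix_alg:
  assumes "polytime_matrix_alg f"
  shows "(\<lambda>(W, \<omega>). f n W \<omega>) \<in> borel_measurable (mat_space n \<Otimes>\<^sub>M coins)"
proof -
  from assms obtain c p where c: "\<forall>n. \<forall>W\<in>space (mat_space n). \<forall>\<omega>. \<exists>t s.
     exec \<omega> c (init_state n 0 (\<lambda>i j. if i < n \<and> j < n then W (i, j) else 0)) t s \<and>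
     t \<le> poly p n \<and> f n W \<omega> = rreg s 0" unfolding polytime_matrix_alg_def by blast
  let ?M = "mat_space n \<Otimes>\<^sub>M coins"
  define init where "init z = init_state n 0 (\<lambda>i j. if i < n \<and> j < n then fst z (i, j) else 0)"
    for z :: "(nat \<times> nat \<Rightarrow> real) \<times> (nat \<Rightarrow> real)"
  have "\<forall>z\<in>space ?M. \<exists>t s. exec (snd z) c (init z) t s \<and> t \<le> poly p n \<and> f n (fst z) (snd z) = rreg s 0"
  proof
    fix z assume "z \<in> space ?M"
    then have "fst z \<in> space (mat_space n)" by (auto simp: space_pair_measure)
    with c show "\<exists>t s. exec (snd z) c (init z) t s \<and> t \<le> poly p n \<and> f n (fst z) (snd z) = rreg s 0"
      unfolding init_def by blast
  qed
  then obtain t s where ts: "\<And>z. z \<in> space ?M \<Longrightarrow> exec (snd z) c (init z) (t z) (s z) \<and> t z \<le> poly p n"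
    and fs: "\<And>z. z \<in> space ?M \<Longrightarrow> f n (fst z) (snd z) = rreg (s z) 0"
    by metis
  have W: "(\<lambda>z. fst z (i, j)) \<in> borel_measurable ?M" if "i < n" "j < n" for i j
  proof -
    have "(\<lambda>W. W (i, j)) \<in> borel_measurable (mat_space n)"
      using that unfolding mat_space_def by (intro measurable_component_singleton) auto
    from measurable_compose[OF measurable_fst this] show ?thesis .
  qed
  have "meas_state ?M init"
    unfolding meas_state_def
  proof (intro conjI allI)
    fix a i j
    show "(\<lambda>z. mem (init z) a i j) \<in> borel_measurable ?M"
      using W[of i j] by (cases "a = 0"; cases "i < n \<and> j < n") (auto simp: init_def init_state_def)
  qed (auto simp: init_def init_state_def)
  moreover have "(\<lambda>z. snd z i) \<in> borel_measurable ?M" for i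
  proof -
    have "(\<lambda>\<omega>. \<omega> i) \<in> measurable coins (normal_law 1)"
      unfolding coins_def by (intro measurable_component_singleton) auto
    then have "(\<lambda>\<omega>. \<omega> i) \<in> borel_measurable coins"
      by (simp add: normal_law_def cong: measurable_cong_sets)
    from measurable_compose[OF measurable_snd this] show ?thesis .
  qed
  ultimately have "meas_state ?M s" using ts meas_state_exec by blast
  then have "(\<lambda>z. rreg (s z) 0) \<in> borel_measurable ?M" by (simp add: meas_state_def)
  then have "(\<lambda>z. f n (fst z) (snd z)) \<in> borel_measurable ?M"
    using fs by (subst measurable_cong) auto
  then show ?thesis by (simp add: case_prod_beta)
qed

section \<open>The reduction as a program\<close>

definition dotp :: "nat \<Rightarrow> (nat \<Rightarrow> real) \<Rightarrow> (nat \<Rightarrow> real) \<Rightarrow> real" where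
  "dotp n u v = (\<Sum>l<n. u l * v l)"

text \<open>A tape cell is consumed for every pair \<open>(k, i)\<close>, even where a sample is
  kept, so that the cell belonging to \<open>(k, i)\<close> always has position
  \<open>k * n + i\<close>.\<close>

definition fill_prog :: com where
  "fill_prog = For 3 0 (For 4 0 (Gauss 0 ;; Cond (NLess 3 1) SKIP (Store 0 3 4 0)))"

definition filled :: "nat \<Rightarrow> nat \<Rightarrow> (nat \<Rightarrow> nat \<Rightarrow> real) \<Rightarrow> (nat \<Rightarrow> real) \<Rightarrow> nat \<Rightarrow> nat \<Rightarrow> real" where
  "filled n N a \<omega> = (\<lambda>k i. if k < n \<and> i < n then if N \<le> k then \<omega> (k * n + i) else a k i else 0)"

text \<open>The bound is a plain step count: a loop adds two steps per iteration (test and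
  increment) and two more for its initialisation and last test. All later bounds are composed in
  this way.\<close>

lemma ok_fill:
  assumes "nreg s 0 = n" "nreg s 1 = N" "nreg s 2 = 1" "tape_pos s = 0"
  shows "ok \<omega> fill_prog (n * (n * 5 + 4) + 2)
    (\<lambda>s'. mem s' 0 = (\<lambda>k i. if N \<le> k \<and> k < n \<and> i < n then \<omega> (k * n + i) else mem s 0 k i) \<and>
      tape_pos s' = n * n) s"
  unfolding fill_prog_def
proof (rule ok_For[where L=n and
      Inv="\<lambda>k s'. mem s' 0 = (\<lambda>k' i. if N \<le> k' \<and> k' < k \<and> i < n then \<omega> (k' * n + i) else mem s 0 k' i) \<and>
        tape_pos s' = k * n" and T = "n * 5 + 2"], goal_cases)
  case (9 k s1)
  note k = this
  show ?case
  proof (rule ok_For[where L=n and T=3 and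
      Inv="\<lambda>j s'. mem s' 0 = (\<lambda>k' i. if N \<le> k' \<and> (k' < k \<and> i < n \<or> k' = k \<and> i < j) then \<omega> (k' * n + i) else mem s 0 k' i) \<and>
        tape_pos s' = k * n + j"], goal_cases)
    case (9 j s2)
    then show ?case
      using assms k by (auto simp: agree_def fun_eq_iff less_Suc_eq ok_steps ok_Cond)
  qed (use assms k in \<open>auto simp: agree_def fun_eq_iff less_Suc_eq\<close>)
qed (use assms in \<open>auto simp: agree_def fun_eq_iff algebra_simps\<close>)

section \<open>Gram-Schmidt orthonormalisation in place\<close>

primrec gs_elim :: "nat \<Rightarrow> nat \<Rightarrow> (nat \<Rightarrow> nat \<Rightarrow> real) \<Rightarrow> nat \<Rightarrow> nat \<Rightarrow> nat \<Rightarrow> real" where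
  "gs_elim n k M 0 = M"
| "gs_elim n k M (Suc j) = (gs_elim n k M j)(k := \<lambda>l. if l < n
     then gs_elim n k M j k l - dotp n (gs_elim n k M j k) (gs_elim n k M j j) * gs_elim n k M j j l
     else gs_elim n k M j k l)"

text \<open>Division by zero returns zero, so a row that depends on earlier ones becomes the zero
  row. Entries from \<open>n\<close> on are kept, because the program does not touch them.\<close>

definition gs_norm :: "nat \<Rightarrow> nat \<Rightarrow> (nat \<Rightarrow> nat \<Rightarrow> real) \<Rightarrow> nat \<Rightarrow> nat \<Rightarrow> real" where
  "gs_norm n k M = M(k := \<lambda>l. if l < n then M k l / sqrt (dotp n (M k) (M k)) else M k l)"

primrec gs :: "nat \<Rightarrow> (nat \<Rightarrow> nat \<Rightarrow> real) \<Rightarrow> nat \<Rightarrow> nat \<Rightarrow> nat \<Rightarrow> real" where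
  "gs n M 0 = M"
| "gs n M (Suc k) = gs_norm n k (gs_elim n k (gs n M k) k)"

definition dot_prog :: com where
  "dot_prog = RConst 0 0 ;; For 5 0 (Load 1 0 3 5 ;; Load 2 0 4 5 ;; ROp RMul 1 1 2 ;; ROp RAdd 0 0 1)"

lemma ok_dot:
  assumes "nreg s 0 = n" "nreg s 2 = 1"
  shows "ok \<omega> dot_prog (n * 6 + 3)
    (\<lambda>s'. rreg s' 0 = dotp n (mem s 0 (nreg s 3)) (mem s 0 (nreg s 4))) s"
  unfolding dot_prog_def ok_steps
proof (intro conjI, goal_cases)
  case 2
  show ?case
    by (rule ok_For[where L=n and T=4 and
      Inv="\<lambda>j s'. rreg s' 0 = dotp j (mem s 0 (nreg s 3)) (mem s 0 (nreg s 4))"])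
      (use assms in \<open>auto simp: agree_def dotp_def ok_steps\<close>)
qed simp

definition sub_prog :: com where
  "sub_prog = For 5 0 (Load 1 0 4 5 ;; ROp RMul 1 0 1 ;; Load 2 0 3 5 ;; ROp RSub 1 2 1 ;; Store 0 3 5 1)"

lemma ok_sub:
  assumes "nreg s 0 = n" "nreg s 2 = 1" "nreg s 3 = k" "nreg s 4 = j" "j \<noteq> k"
  shows "ok \<omega> sub_prog (n * 7 + 2)
    (\<lambda>s'. mem s' 0 = (mem s 0)(k := \<lambda>l. if l < n then mem s 0 k l - rreg s 0 * mem s 0 j l else mem s 0 k l)) s"
  unfolding sub_prog_def
  by (rule ok_For[where L=n and T=5 and
      Inv="\<lambda>i s'. mem s' 0 = (mem s 0)(k := \<lambda>l. if l < i then mem s 0 k l - rreg s 0 * mem s 0 j l else mem s 0 k l)"])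
    (use assms in \<open>auto simp: agree_def fun_eq_iff less_Suc_eq ok_steps\<close>)

definition norm_prog :: com where
  "norm_prog = RConst 0 0 ;; For 5 0 (Load 1 0 3 5 ;; ROp RMul 1 1 1 ;; ROp RAdd 0 0 1) ;;
     RSqrt 0 0 ;; For 5 0 (Load 1 0 3 5 ;; ROp RDiv 1 1 0 ;; Store 0 3 5 1)"

lemma ok_norm:
  assumes "nreg s 0 = n" "nreg s 2 = 1" "nreg s 3 = k"
  shows "ok \<omega> norm_prog (n * 10 + 6) (\<lambda>s'. mem s' 0 = gs_norm n k (mem s 0)) s"
proof -
  let ?c1 = "For 5 0 (Load 1 0 3 5 ;; ROp RMul 1 1 1 ;; ROp RAdd 0 0 1)"
  let ?c2 = "For 5 0 (Load 1 0 3 5 ;; ROp RDiv 1 1 0 ;; Store 0 3 5 1)"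
  have L1: "ok \<omega> ?c1 (n * 5 + 2) (\<lambda>s'. rreg s' 0 = dotp n (mem s 0 k) (mem s 0 k)) s1"
    if "nreg s1 0 = n" "nreg s1 2 = 1" "nreg s1 3 = k" "rreg s1 0 = 0" "mem s1 = mem s" for s1
    by (rule ok_For[where L=n and T=3 and
      Inv="\<lambda>j s'. rreg s' 0 = dotp j (mem s 0 k) (mem s 0 k)"])
      (use that in \<open>auto simp: agree_def dotp_def ok_steps\<close>)
  have L2: "ok \<omega> ?c2 (n * 5 + 2) (\<lambda>s'. mem s' 0 = gs_norm n k (mem s 0)) s1"
    if "nreg s1 0 = n" "nreg s1 2 = 1" "nreg s1 3 = k" "mem s1 0 = mem s 0"
      "rreg s1 0 = sqrt (dotp n (mem s 0 k) (mem s 0 k))" for s1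
    by (rule ok_For[where L=n and T=3 and
      Inv="\<lambda>i s'. mem s' 0 = (mem s 0)(k := \<lambda>l. if l < i then mem s 0 k l / rreg s1 0 else mem s 0 k l)"])
      (use that in \<open>auto simp: agree_def gs_norm_def fun_eq_iff less_Suc_eq ok_steps\<close>)
  show ?thesis
    unfolding norm_prog_def ok_steps
  proof ((rule conjI, simp)+, rule ok_then[where T="n * 5 + 2" and T'="n * 5 + 3" and
        P="\<lambda>s'. rreg s' 0 = dotp n (mem s 0 k) (mem s 0 k)"], goal_cases)
    case 1
    show ?case by (rule L1) (use assms in auto)
  next
    case (2 s')
    show ?case unfolding ok_steps
      by (intro conjI, simp, rule L2[THEN ok_conseq]) (use 2 assms in \<open>auto simp: agree_def\<close>)
  qed auto
qed

definition gs_prog :: com where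
  "gs_prog = For 3 0 (For 4 3 (dot_prog ;; sub_prog) ;; norm_prog)"

lemma sub_dot_norm_writes [simp]:
  "nw dot_prog = {5}" "nw sub_prog = {5}" "nw norm_prog = {5}"
  "rw dot_prog = {0, 1, 2}" "rw sub_prog = {1, 2}" "rw norm_prog = {0, 1}"
  "mw dot_prog = {}" "mw sub_prog = {0}" "mw norm_prog = {0}"
  "\<not> reads_tape dot_prog" "\<not> reads_tape sub_prog" "\<not> reads_tape norm_prog"
  by (auto simp: dot_prog_def sub_prog_def norm_prog_def)

lemma ok_gs:
  assumes "nreg s 0 = n" "nreg s 2 = 1"
  shows "ok \<omega> gs_prog (n * (n * (n * 13 + 7) + n * 10 + 10) + 2) (\<lambda>s'. mem s' 0 = gs n (mem s 0) n) s"
  unfolding gs_prog_def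
proof (rule ok_For[where L=n and T="n * (n * 13 + 7) + n * 10 + 8" and
      Inv="\<lambda>k s'. mem s' 0 = gs n (mem s 0) k"], goal_cases)
  case (9 k s1)
  show ?case
  proof (rule ok_then[where T="n * (n * 13 + 7) + 2" and T'="n * 10 + 6"
        and P="\<lambda>s'. mem s' 0 = gs_elim n k (gs n (mem s 0) k) k"], goal_cases)
    case 1
    show ?case
    proof (rule ok_For[where L=k and T="n * 13 + 5" and
        Inv="\<lambda>j s'. mem s' 0 = gs_elim n k (gs n (mem s 0) k) j"], goal_cases)
      case (9 j s2)
      show ?case
      proof (rule ok_then[OF ok_dot[where n=n], where T'="n * 7 + 2"], goal_cases)
        case (3 s3)
        have st: "nreg s3 0 = n" "nreg s3 2 = 1" "nreg s3 3 = k" "nreg s3 4 = j"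
            "mem s3 0 = gs_elim n k (gs n (mem s 0) k) j"
          using 3(1) 9 \<open>nreg s1 3 = k\<close> assms \<open>agree _ s s1\<close> by (auto simp: agree_def)
        have "nreg s2 3 = k" "nreg s2 4 = j" "mem s2 0 = gs_elim n k (gs n (mem s 0) k) j"
          using 9 \<open>nreg s1 3 = k\<close> by (auto simp: agree_def)
        with 3(2) have r: "rreg s3 0 = dotp n (gs_elim n k (gs n (mem s 0) k) j k) (gs_elim n k (gs n (mem s 0) k) j j)"
          by simp
        show ?case
          by (rule ok_sub[OF st(1-4), THEN ok_conseq], use 9 in simp, simp, simp add: fun_eq_iff st(5) r)
      qed (use 9 assms \<open>agree _ s s1\<close> in \<open>auto simp: agree_def\<close>)
    next
      case 11
      show ?case using mult_le_mono1[of k n "n * 13 + 7"] \<open>k < n\<close> by (simp add: algebra_simps)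
    qed (use 9 assms in \<open>auto simp: agree_def\<close>)
  next
    case (2 s2)
    show ?case
      by (rule ok_norm[where k=k and n=n, THEN ok_conseq]) (use 2 9 assms in \<open>auto simp: agree_def\<close>)
  qed simp
qed (use assms in \<open>auto simp: agree_def\<close>)

text \<open>This is the inner product of \<open>v\<close> with \<open>u\<close>, the basis vector
  \<open>N + j\<close> minus the flat unit vector of window \<open>j\<close>. For
  \<open>m = r * r\<close> the squared norm of \<open>u\<close> is 2, so the reflection along
  \<open>u\<close> simply subtracts this multiple of \<open>u\<close>.\<close>

definition refl_amount :: "nat \<Rightarrow> nat \<Rightarrow> nat \<Rightarrow> nat \<Rightarrow> (nat \<Rightarrow> real) \<Rightarrow> real" where
  "refl_amount N m r j v = v (N + j) - (\<Sum>i<m. v (j * m + i)) / real r"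

text \<open>The reflection exchanging the basis vector \<open>N + j\<close> with the unit vector that is \<open>1 / r\<close> on the \<open>j\<close>-th
  window of \<open>m = r\<^sup>2\<close> coordinates.\<close>

definition refl_step :: "nat \<Rightarrow> nat \<Rightarrow> nat \<Rightarrow> nat \<Rightarrow> (nat \<Rightarrow> real) \<Rightarrow> nat \<Rightarrow> real" where
  "refl_step N m r j v = (\<lambda>k. if k = N + j then v k - refl_amount N m r j v
     else if j * m \<le> k \<and> k < j * m + m then v k + refl_amount N m r j v / real r else v k)"

primrec reflect :: "nat \<Rightarrow> nat \<Rightarrow> nat \<Rightarrow> nat \<Rightarrow> (nat \<Rightarrow> real) \<Rightarrow> nat \<Rightarrow> real" where
  "reflect N m r 0 v = v"
| "reflect N m r (Suc j) v = refl_step N m r j (reflect N m r j v)"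

definition cell_prog :: com where
  "cell_prog = RConst 0 0 ;; For 5 8 (NAdd 10 7 5 ;; Load 1 0 10 4 ;; ROp RAdd 0 0 1) ;;
     ROp RDiv 0 0 3 ;; Load 1 0 9 4 ;; ROp RSub 0 1 0 ;; ROp RSub 1 1 0 ;; Store 0 9 4 1 ;; ROp RDiv 0 0 3 ;;
     For 5 8 (NAdd 10 7 5 ;; Load 1 0 10 4 ;; ROp RAdd 1 1 0 ;; Store 0 10 4 1)"

lemma cell_writes [simp]:
  "nw cell_prog = {5, 10}" "rw cell_prog = {0, 1}" "mw cell_prog = {0}" "\<not> reads_tape cell_prog"
  by (auto simp: cell_prog_def)

text \<open>The window ends at or before \<open>N\<close>, hence misses the index
  \<open>N + j\<close>. Overwriting that entry first therefore does not disturb the window, which is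
  updated afterwards.\<close>

lemma ok_cell:
  assumes "nreg s 2 = 1" "nreg s 4 = c" "nreg s 7 = j * m" "nreg s 8 = m" "nreg s 9 = N + j"
    "rreg s 3 = real r" "j * m + m \<le> N"
  shows "ok \<omega> cell_prog (m * 11 + 11)
    (\<lambda>s'. mem s' 0 = (\<lambda>k c'. if c' = c then refl_step N m r j (\<lambda>k. mem s 0 k c) k else mem s 0 k c')) s"
proof -
  let ?c1 = "For 5 8 (NAdd 10 7 5 ;; Load 1 0 10 4 ;; ROp RAdd 0 0 1)"
  let ?c2 = "For 5 8 (NAdd 10 7 5 ;; Load 1 0 10 4 ;; ROp RAdd 1 1 0 ;; Store 0 10 4 1)"
  let ?v = "\<lambda>k. mem s 0 k c" and ?a = "refl_amount N m r j (\<lambda>k. mem s 0 k c)"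
  have L1: "ok \<omega> ?c1 (m * 5 + 2) (\<lambda>s'. rreg s' 0 = (\<Sum>i<m. ?v (j * m + i))) s1"
    if "agree cell_prog s s1" "rreg s1 0 = 0" "mem s1 = mem s" for s1
    by (rule ok_For[where L=m and T=3 and
      Inv="\<lambda>i s'. rreg s' 0 = (\<Sum>i<i. ?v (j * m + i))"])
      (use that assms in \<open>auto simp: agree_def ok_steps\<close>)
  have L2: "ok \<omega> ?c2 (m * 6 + 2)
      (\<lambda>s'. mem s' 0 = (\<lambda>k c'. if c' = c then refl_step N m r j (\<lambda>k. mem s 0 k c) k else mem s 0 k c')) s1"
    if "agree cell_prog s s1" "rreg s1 0 = ?a / real r"
      "mem s1 0 = (mem s 0)(N + j := (mem s 0 (N + j))(c := ?v (N + j) - ?a))" for s1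
    by (rule ok_For[where L=m and T=4 and
      Inv="\<lambda>i s'. mem s' 0 = (\<lambda>k c'. if c' = c \<and> k = N + j then ?v k - ?a
         else if c' = c \<and> j * m \<le> k \<and> k < j * m + i then ?v k + ?a / real r else mem s 0 k c')"])
      (use that assms in \<open>auto simp: agree_def ok_steps fun_eq_iff refl_step_def\<close>)
  show ?thesis
    unfolding cell_prog_def ok_steps
  proof ((rule conjI, simp)+, rule ok_then[where T="m * 5 + 2" and T'="m * 6 + 8" and
        P="\<lambda>s'. rreg s' 0 = (\<Sum>i<m. ?v (j * m + i))"], goal_cases)
    case 1
    show ?case by (rule L1) (auto simp: agree_def)
  next
    case (2 s')
    show ?case
      by (simp add: ok_steps del: One_nat_def, rule L2[THEN ok_conseq]) (use 2 assms in \<open>auto simp: agree_def refl_amount_def\<close>)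
  qed auto
qed

text \<open>Counters cannot be multiplied, so the window start \<open>j * m\<close> is kept in
  counter 7 and advanced by adding \<open>m\<close>. The numbers \<open>m\<close> and
  \<open>r\<close> are constants of the program and independent of the dimension.\<close>

definition refl_prog :: "nat \<Rightarrow> nat \<Rightarrow> com" where
  "refl_prog m r = NSub 6 0 1 ;; NConst 8 m ;; NConst 7 0 ;; RConst 3 (of_nat r) ;;
     For 3 6 (NAdd 9 1 3 ;; For 4 0 cell_prog ;; NAdd 7 7 8)"

lemma ok_refl:
  assumes "nreg s 0 = n" "nreg s 1 = N" "nreg s 2 = 1" "(n - N) * m \<le> N"
  shows "ok \<omega> (refl_prog m r) (n * (n * (m * 11 + 13) + 6) + 6)
    (\<lambda>s'. mem s' 0 = (\<lambda>k c. if c < n then reflect N m r (n - N) (\<lambda>k. mem s 0 k c) k else mem s 0 k c)) s"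
  unfolding refl_prog_def ok_steps
proof (intro conjI, goal_cases)
  case 5
  show ?case
  proof (rule ok_For[where L="n - N" and T="n * (m * 11 + 13) + 4" and
      Inv="\<lambda>j s'. nreg s' 7 = j * m \<and>
        mem s' 0 = (\<lambda>k c. if c < n then reflect N m r j (\<lambda>k. mem s 0 k c) k else mem s 0 k c)"], goal_cases)
    case (9 j s1)
    note j = 9
    have jm: "j * m + m \<le> N"
    proof -
      have "Suc j * m \<le> (n - N) * m" using 9 by (intro mult_le_mono1) auto
      with assms(4) show ?thesis by simp
    qed
    show ?case unfolding ok_steps
    proof ((rule conjI, simp)+, rule ok_then[where T="n * (m * 11 + 13) + 2" and T'=1 and
          P="\<lambda>s'. mem s' 0 = (\<lambda>k c. if c < n then reflect N m r (Suc j) (\<lambda>k. mem s 0 k c) k else mem s 0 k c)"], goal_cases)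
      case 1
      show ?case
      proof (rule ok_For[where L=n and T="m * 11 + 11" and
           Inv="\<lambda>c s'. mem s' 0 = (\<lambda>k c'. if c' < n then reflect N m r (if c' < c then Suc j else j) (\<lambda>k. mem s 0 k c') k else mem s 0 k c')"],
           goal_cases)
        case (9 c s2)
        show ?case
          by (rule ok_cell[where c=c and j=j and N=N and m=m and r=r, THEN ok_conseq])
            (use 9 j assms jm
              in \<open>auto simp: agree_def fun_eq_iff less_Suc_eq\<close>)
      qed (use 9 assms in \<open>auto simp: agree_def fun_eq_iff\<close>)
    next
      case (2 s2)
      then show ?case unfolding ok_steps using 9 assms by (auto simp: agree_def)
    qed auto
  next
    case 11
    have "(n - N) * (n * (m * 11 + 13) + 6) \<le> n * (n * (m * 11 + 13) + 6)"
      by (rule mult_le_mono1) simp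
    moreover have "n * (m * 11 + 13) + 4 + 2 = n * (m * 11 + 13) + 6"
      "n * (n * (m * 11 + 13) + 6) + 6 - 1 - 1 - 1 - 1 = n * (n * (m * 11 + 13) + 6) + 2" by simp_all
    ultimately show ?case by (metis add_le_mono1)
  qed (use assms in \<open>auto simp: agree_def fun_eq_iff\<close>)
qed auto

text \<open>No instruction converts a counter into a real, so the real number \<open>n\<close> is
  built by adding 1 repeatedly.\<close>

definition root_prog :: com where
  "root_prog = RConst 6 1 ;; RConst 4 0 ;; For 3 0 (ROp RAdd 4 4 6) ;; RSqrt 4 4 ;; RConst 5 2 ;; RSqrt 5 5"

lemma ok_root:
  assumes "nreg s 0 = n" "nreg s 2 = 1"
  shows "ok \<omega> root_prog (n * 3 + 7) (\<lambda>s'. rreg s' 4 = sqrt (real n) \<and> rreg s' 5 = sqrt 2) s"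
  unfolding root_prog_def ok_steps
proof ((rule conjI, simp)+, rule ok_then[where T="n * 3 + 2" and T'=3 and P="\<lambda>s'. rreg s' 4 = real n"], goal_cases)
  case 1
  show ?case
    by (rule ok_For[where L=n and T=1 and Inv="\<lambda>k s'. rreg s' 4 = real k"])
      (use assms in \<open>auto simp: agree_def ok_steps\<close>)
next
  case (2 s')
  then show ?case by (auto simp: agree_def ok_steps)
qed auto

text \<open>With \<open>wig_b\<close>, the entries that Householder tridiagonalisation produces from
  the GOE: normal with variance \<open>2 / n\<close> on the diagonal, and beside it a chi variable
  with \<open>n - 1 - k\<close> degrees of freedom over \<open>sqrt n\<close>. The chi variable is
  formed as the norm of a Gaussian row, so that the same cells can also be read as the entries of a
  GOE matrix.\<close>

definition wig_a :: "nat \<Rightarrow> (nat \<Rightarrow> real) \<Rightarrow> nat \<Rightarrow> real" where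
  "wig_a n \<xi> k = \<xi> (k * n + k) * sqrt 2 / sqrt (real n)"

definition wig_b :: "nat \<Rightarrow> (nat \<Rightarrow> real) \<Rightarrow> nat \<Rightarrow> real" where
  "wig_b n \<xi> k = sqrt (\<Sum>l\<in>{Suc k..<n}. (\<xi> (k * n + l))\<^sup>2) / sqrt (real n)"

text \<open>The contribution of index \<open>k\<close> to the conjugate of the tridiagonal matrix by
  the frame \<open>q\<close>. For \<open>k = n - 1\<close> the sum in \<open>wig_b\<close> is empty,
  so the nonexistent vector \<open>q n\<close> gets coefficient 0.\<close>

definition wig_term :: "nat \<Rightarrow> (nat \<Rightarrow> real) \<Rightarrow> (nat \<Rightarrow> nat \<Rightarrow> real) \<Rightarrow> nat \<Rightarrow> nat \<Rightarrow> nat \<Rightarrow> real" where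
  "wig_term n \<xi> q k i j = wig_a n \<xi> k * (q k i * q k j) +
     wig_b n \<xi> k * (q (Suc k) i * q k j + q k i * q (Suc k) j)"

text \<open>A full row of \<open>n\<close> cells is read for every \<open>k\<close>, again to keep
  positions regular. Register 2 is overwritten for each column up to \<open>k\<close>, so the value
  that survives is the diagonal one.\<close>

definition sample_prog :: com where
  "sample_prog = RConst 0 0 ;; RConst 2 0 ;; For 4 0 (Gauss 1 ;;
     Cond (NLess 3 4) (ROp RMul 1 1 1 ;; ROp RAdd 0 0 1) (ROp RMul 2 1 5)) ;;
     RSqrt 0 0 ;; ROp RDiv 0 0 4 ;; ROp RDiv 2 2 4"

lemma sample_writes [simp]:
  "nw sample_prog = {4}" "rw sample_prog = {0, 1, 2}" "mw sample_prog = {}"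
  by (auto simp: sample_prog_def)

lemma ok_sample:
  assumes "nreg s 0 = n" "nreg s 2 = 1" "nreg s 3 = k" "k < n" "tape_pos s = p + k * n"
    "rreg s 4 = sqrt (real n)" "rreg s 5 = sqrt 2"
  shows "ok \<omega> sample_prog (n * 6 + 7)
    (\<lambda>s'. rreg s' 2 = wig_a n (\<lambda>i. \<omega> (p + i)) k \<and> rreg s' 0 = wig_b n (\<lambda>i. \<omega> (p + i)) k \<and>
      tape_pos s' = p + Suc k * n) s"
  unfolding sample_prog_def ok_steps
proof ((rule conjI, simp)+, rule ok_then[where T="n * 6 + 2" and T'=3 and
    P="\<lambda>s'. rreg s' 2 = \<omega> (p + k * n + k) * sqrt 2 \<and>
       rreg s' 0 = (\<Sum>l\<in>{Suc k..<n}. (\<omega> (p + k * n + l))\<^sup>2) \<and> tape_pos s' = p + k * n + n"], goal_cases)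
  case 1
  show ?case
  proof (rule ok_For[where L=n and T=4 and
     Inv="\<lambda>j s'. (k < j \<longrightarrow> rreg s' 2 = \<omega> (p + k * n + k) * sqrt 2) \<and>
       rreg s' 0 = (\<Sum>l\<in>{Suc k..<j}. (\<omega> (p + k * n + l))\<^sup>2) \<and> tape_pos s' = p + k * n + j"], goal_cases)
    case (9 j s1)
    show ?case
    proof (cases "k < j")
      case True
      then show ?thesis using 9 assms by (auto simp: agree_def ok_steps ok_Cond power2_eq_square)
    next
      case False
      then have e: "{Suc k..<Suc j} = {}" "{Suc k..<j} = {}" and "j = k \<or> j < k" by auto
      from this(3) show ?thesis
      proof
        assume [simp]: "j = k"
        show ?thesis using e 9 assms by (auto simp: agree_def ok_steps ok_Cond)
      next
        assume "j < k"
        then show ?thesis using e 9 assms by (auto simp: agree_def ok_steps ok_Cond)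
      qed
    qed
  qed (use assms in \<open>auto simp: agree_def\<close>)
next
  case (2 s')
  then show ?case using assms by (auto simp: agree_def ok_steps wig_a_def wig_b_def add.assoc)
qed auto

definition acc_prog :: com where
  "acc_prog = For 4 0 (For 5 0 (
      Load 6 0 3 4 ;; Load 7 0 3 5 ;; Load 8 0 6 4 ;; Load 9 0 6 5 ;;
      ROp RMul 9 6 9 ;; ROp RMul 8 8 7 ;; ROp RAdd 8 8 9 ;; ROp RMul 8 0 8 ;;
      ROp RMul 6 6 7 ;; ROp RMul 6 2 6 ;; ROp RAdd 6 6 8 ;;
      Load 7 1 4 5 ;; ROp RAdd 6 6 7 ;; Store 1 4 5 6))"

lemma acc_writes [simp]:
  "nw acc_prog = {4, 5}" "rw acc_prog = {6, 7, 8, 9}" "mw acc_prog = {1}" "\<not> reads_tape acc_prog"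
  by (auto simp: acc_prog_def)

lemma ok_acc:
  assumes "nreg s 0 = n" "nreg s 2 = 1" "nreg s 3 = k" "nreg s 6 = Suc k"
    "rreg s 2 = wig_a n \<xi> k" "rreg s 0 = wig_b n \<xi> k"
  shows "ok \<omega> acc_prog (n * (n * 16 + 4) + 2)
    (\<lambda>s'. mem s' 1 = (\<lambda>i j. if i < n \<and> j < n then wig_term n \<xi> (mem s 0) k i j + mem s 1 i j else mem s 1 i j)) s"
  unfolding acc_prog_def
proof (rule ok_For[where L=n and T="n * 16 + 2" and
     Inv="\<lambda>i' s'. mem s' 1 = (\<lambda>i j. if i < i' \<and> j < n then wig_term n \<xi> (mem s 0) k i j + mem s 1 i j else mem s 1 i j)"],
    goal_cases)
  case (9 i' s1)
  show ?case
  proof (rule ok_For[where L=n and T=14 and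
     Inv="\<lambda>j' s'. mem s' 1 = (\<lambda>i j. if i < i' \<and> j < n \<or> i = i' \<and> j < j'
        then wig_term n \<xi> (mem s 0) k i j + mem s 1 i j else mem s 1 i j)"], goal_cases)
    case (9 j' s2)
    then show ?case
      using \<open>nreg s1 4 = i'\<close> \<open>agree _ s s1\<close> \<open>i' < n\<close> assms
      by (auto simp: agree_def ok_steps fun_eq_iff less_Suc_eq wig_term_def)
  qed (use 9 assms in \<open>auto simp: agree_def fun_eq_iff less_Suc_eq\<close>)
qed (use assms in \<open>auto simp: agree_def fun_eq_iff algebra_simps\<close>)

definition wig_prog :: com where
  "wig_prog = For 3 0 (NAdd 6 3 2 ;; sample_prog ;; acc_prog)"

lemma ok_wig:
  assumes "nreg s 0 = n" "nreg s 2 = 1" "rreg s 4 = sqrt (real n)" "rreg s 5 = sqrt 2" "tape_pos s = p"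
    "mem s 1 = (\<lambda>_ _. 0)"
  shows "ok \<omega> wig_prog (n * (n * (n * 16 + 4) + n * 6 + 12) + 2)
    (\<lambda>s'. mem s' 1 = (\<lambda>i j. if i < n \<and> j < n then (\<Sum>k<n. wig_term n (\<lambda>i. \<omega> (p + i)) (mem s 0) k i j) else 0) \<and>
       tape_pos s' = p + n * n) s"
  unfolding wig_prog_def
proof (rule ok_For[where L=n and T="n * (n * 16 + 4) + n * 6 + 10" and
     Inv="\<lambda>m s'. mem s' 1 = (\<lambda>i j. if i < n \<and> j < n then (\<Sum>k<m. wig_term n (\<lambda>i. \<omega> (p + i)) (mem s 0) k i j) else 0)
       \<and> tape_pos s' = p + m * n"],
    goal_cases)
  case (9 k s1)
  show ?case unfolding ok_steps
  proof ((rule conjI, simp)+, rule ok_then[OF ok_sample[where n=n and k=k and p=p],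
        where T'="n * (n * 16 + 4) + 2"], goal_cases)
    case (8 s2)
    have st: "nreg s2 0 = n" "nreg s2 2 = 1" "nreg s2 3 = k" "nreg s2 6 = Suc k" "mem s2 0 = mem s 0" "mem s2 1 = mem s1 1"
      using 8(1) \<open>agree _ s s1\<close> \<open>nreg s1 3 = k\<close> assms by (auto simp: agree_def)
    show ?case
      by (rule ok_acc[OF st(1-4), where \<xi>="\<lambda>i. \<omega> (p + i)", THEN ok_agree, THEN ok_conseq])
        (use 8(2) \<open>mem s1 1 = _ \<and> _\<close> in \<open>auto simp: agree_def fun_eq_iff st(5) st(6)[unfolded One_nat_def] st(6)\<close>)
  qed (use 9 assms in \<open>auto simp: agree_def\<close>)
qed (use assms in \<open>auto simp: agree_def fun_eq_iff\<close>)

definition copy_prog :: com where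
  "copy_prog = For 3 0 (For 4 0 (Load 0 1 3 4 ;; Store 0 3 4 0 ;; RConst 0 0 ;; Store 1 3 4 0))"

lemma ok_copy:
  assumes "nreg s 0 = n" "nreg s 2 = 1"
  shows "ok \<omega> copy_prog (n * (n * 6 + 4) + 2)
    (\<lambda>s'. mem s' 0 = (\<lambda>i j. if i < n \<and> j < n then mem s 1 i j else mem s 0 i j) \<and>
      mem s' 1 = (\<lambda>i j. if i < n \<and> j < n then 0 else mem s 1 i j)) s"
  unfolding copy_prog_def
proof (rule ok_For[where L=n and T="n * 6 + 2" and
     Inv="\<lambda>i' s'. mem s' 0 = (\<lambda>i j. if i < i' \<and> j < n then mem s 1 i j else mem s 0 i j) \<and>
      mem s' 1 = (\<lambda>i j. if i < i' \<and> j < n then 0 else mem s 1 i j)"],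
    goal_cases)
  case (9 i' s1)
  show ?case
  proof (rule ok_For[where L=n and T=4 and
     Inv="\<lambda>j' s'. mem s' 0 = (\<lambda>i j. if i < i' \<and> j < n \<or> i = i' \<and> j < j' then mem s 1 i j else mem s 0 i j) \<and>
      mem s' 1 = (\<lambda>i j. if i < i' \<and> j < n \<or> i = i' \<and> j < j' then 0 else mem s 1 i j)"], goal_cases)
    case (9 j' s2)
    then show ?case
      using \<open>nreg s1 3 = i'\<close> \<open>agree _ s s1\<close> \<open>i' < n\<close> assms
      by (auto simp: agree_def ok_steps fun_eq_iff less_Suc_eq)
  qed (use 9 assms in \<open>auto simp: agree_def fun_eq_iff less_Suc_eq\<close>)
qed (use assms in \<open>auto simp: agree_def fun_eq_iff algebra_simps\<close>)

text \<open>The certificate is specified only from its initial state, so every counter and register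
  written by the preprocessing must return to zero, except counter 0, which still holds
  \<open>n\<close>.\<close>

definition clear_prog :: com where
  "clear_prog = NConst 1 0 ;; NConst 2 0 ;; NConst 3 0 ;; NConst 4 0 ;; NConst 5 0 ;; NConst 6 0 ;;
     NConst 7 0 ;; NConst 8 0 ;; NConst 9 0 ;; NConst 10 0 ;;
     RConst 0 0 ;; RConst 1 0 ;; RConst 2 0 ;; RConst 3 0 ;; RConst 4 0 ;; RConst 5 0 ;; RConst 6 0 ;;
     RConst 7 0 ;; RConst 8 0 ;; RConst 9 0"

text \<open>With the Gram-Schmidt vectors as the columns of a matrix, the reflections act on the
  column index \<open>l\<close> and not on the coordinate \<open>i\<close>: the frame consists of
  the columns of a product with the fixed rotation on the right.\<close>

definition frame :: "nat \<Rightarrow> nat \<Rightarrow> nat \<Rightarrow> nat \<Rightarrow> (nat \<Rightarrow> nat \<Rightarrow> real) \<Rightarrow> nat \<Rightarrow> nat \<Rightarrow> real" where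
  "frame n N m r G k i = reflect N m r (n - N) (\<lambda>l. gs n G n l i) k"

definition reduction :: "nat \<Rightarrow> nat \<Rightarrow> nat \<Rightarrow> nat \<Rightarrow> (nat \<Rightarrow> nat \<Rightarrow> real) \<Rightarrow> (nat \<Rightarrow> real) \<Rightarrow> nat \<times> nat \<Rightarrow> real" where
  "reduction n N m r Y \<omega> = (\<lambda>(i, j)\<in>{..<n} \<times> {..<n}.
     \<Sum>k<n. wig_term n (\<lambda>l. \<omega> (n * n + l)) (frame n N m r (filled n N Y \<omega>)) k i j)"

definition pre_prog :: "nat \<Rightarrow> nat \<Rightarrow> com" where
  "pre_prog m r = NConst 2 1 ;; fill_prog ;; gs_prog ;; refl_prog m r ;; root_prog ;; wig_prog ;; copy_prog ;; clear_prog"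

definition pre_time :: "nat \<Rightarrow> nat \<Rightarrow> nat" where
  "pre_time m n = n * (n * 5 + 4) + n * (n * (n * 13 + 7) + n * 10 + 10) + n * (n * (m * 11 + 13) + 6) +
     n * 3 + n * (n * (n * 16 + 4) + n * 6 + 12) + n * (n * 6 + 4) + 42"

lemma prog_writes [simp]:
  "nw fill_prog = {3, 4}" "rw fill_prog = {0}" "mw fill_prog = {0}"
  "nw gs_prog = {3, 4, 5}" "rw gs_prog = {0, 1, 2}" "mw gs_prog = {0}" "\<not> reads_tape gs_prog"
  "nw (refl_prog m r) = {3, 4, 5, 6, 7, 8, 9, 10}" "rw (refl_prog m r) = {0, 1, 3}" "mw (refl_prog m r) = {0}"
    "\<not> reads_tape (refl_prog m r)"
  "nw root_prog = {3}" "rw root_prog = {4, 5, 6}" "mw root_prog = {}" "\<not> reads_tape root_prog"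
  "nw wig_prog = {3, 4, 5, 6}" "rw wig_prog = {0, 1, 2, 6, 7, 8, 9}" "mw wig_prog = {1}"
  "nw copy_prog = {3, 4}" "rw copy_prog = {0}" "mw copy_prog = {0, 1}" "\<not> reads_tape copy_prog"
  by (auto simp: fill_prog_def gs_prog_def refl_prog_def root_prog_def wig_prog_def copy_prog_def)

lemma gs_outside: "n \<le> l \<Longrightarrow> gs n M K k l = M k l"
proof (induction K arbitrary: k)
  case (Suc K)
  have "gs_elim n K M' j k l = M' k l" for M' j k
    using \<open>n \<le> l\<close> by (induction j) auto
  then show ?case using Suc by (simp add: gs_norm_def)
qed simp

lemma gs_later: "K \<le> k \<Longrightarrow> gs n M K k = M k"
proof (induction K)
  case (Suc K)
  have "gs_elim n K M' j k = M' k" for M' j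
    using Suc.prems by (induction j) auto
  then show ?case using Suc by (simp add: gs_norm_def)
qed simp

lemma reflect_outside:
  assumes "j * m \<le> N" "N + j \<le> k"
  shows "reflect N m r j v k = v k"
  using assms
proof (induction j)
  case (Suc j)
  then show ?case by (auto simp: refl_step_def)
qed simp

text \<open>The final state is determined completely, because it has to match the initial state
  assumed by the certificate. Only the tape position differs: \<open>n * n\<close> cells went into
  completing the samples and \<open>n * n\<close> into the tridiagonal matrix.\<close>

lemma ok_pre:
  assumes "N \<le> n" "(n - N) * m \<le> N"
  shows "ok \<omega> (pre_prog m r) (pre_time m n)
    (\<lambda>s'. s' = (init_state n 0 (\<lambda>i j. if i < n \<and> j < n then reduction n N m r Y \<omega> (i, j) else 0))\<lparr>tape_pos := 2 * (n * n)\<rparr>)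
    (init_state n N (\<lambda>k i. if k < N \<and> i < n then Y k i else 0))"
proof -
  define Y0 where "Y0 = (\<lambda>k i. if k < N \<and> i < n then Y k i else 0 :: real)"
  define G where "G = filled n N Y \<omega>"
  have fill: "(\<lambda>k i. if N \<le> k \<and> k < n \<and> i < n then \<omega> (k * n + i) else Y0 k i) = G"
    using assms by (auto simp: fun_eq_iff G_def filled_def Y0_def)
  define F where "F = (\<lambda>k c. if c < n then reflect N m r (n - N) (\<lambda>k. gs n G n k c) k else gs n G n k c)"
  \<comment> \<open>The result is copied over the square of side \<open>n\<close> only, so array 0
    must already vanish outside it.\<close>
  have F0: "F k c = 0" if "n \<le> k \<or> n \<le> c" for k c
  proof -
    have "G k c = 0" using that by (auto simp: G_def filled_def)
    moreover have "reflect N m r (n - N) (\<lambda>l. gs n G n l c) k = gs n G n k c" if "n \<le> k"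
      using that assms by (intro reflect_outside) auto
    moreover have "gs n G n k c = G k c"
      using that gs_outside[of n c G n k] gs_later[of n k n G] by auto
    ultimately show ?thesis using that by (auto simp: F_def)
  qed
  have F1: "F k c = frame n N m r G k c" if "c < n" for k c
    using that by (simp add: F_def frame_def)
  define W where "W = (\<lambda>i j. if i < n \<and> j < n then (\<Sum>k<n. wig_term n (\<lambda>l. \<omega> (n * n + l)) F k i j) else 0)"
  have W: "W = (\<lambda>i j. if i < n \<and> j < n then reduction n N m r Y \<omega> (i, j) else 0)"
    by (auto simp: fun_eq_iff W_def reduction_def G_def[symmetric] wig_term_def F1)
  let ?Q = "\<lambda>s'. s' = (init_state n 0 W)\<lparr>tape_pos := 2 * (n * n)\<rparr>"
  define s0 where "s0 = (init_state n N Y0)\<lparr>nreg := (nreg (init_state n N Y0))(2 := 1)\<rparr>"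
  note fr = agree_def s0_def init_state_def
  have "ok \<omega> (fill_prog ;; gs_prog ;; refl_prog m r ;; root_prog ;; wig_prog ;; copy_prog ;; clear_prog)
      (pre_time m n - 1) ?Q s0"
  proof (rule ok_then[OF ok_fill[where n=n and N=N], where
        T'="n * (n * (n * 13 + 7) + n * 10 + 10) + n * (n * (m * 11 + 13) + 6) +
     n * 3 + n * (n * (n * 16 + 4) + n * 6 + 12) + n * (n * 6 + 4) + 39"], goal_cases)
    case (5 s1)
    have m0: "mem s0 0 = Y0" by (simp add: s0_def init_state_def)
    have r1: "nreg s1 0 = n" "nreg s1 1 = N" "nreg s1 2 = 1" "mem s1 0 = G" "tape_pos s1 = n * n"
        "mem s1 1 = (\<lambda>_ _. 0)"
      using 5(1) 5(2)[unfolded m0 fill] by (auto simp: fr)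
    have s1: "\<forall>i>10. nreg s1 i = 0" "\<forall>x>9. rreg s1 x = 0" "\<forall>a>1. mem s1 a = (\<lambda>_ _. 0)"
      using 5(1) by (auto simp: fr)
    show ?case
    proof (rule ok_then[OF ok_gs[where n=n], where
        T'="n * (n * (m * 11 + 13) + 6) +
     n * 3 + n * (n * (n * 16 + 4) + n * 6 + 12) + n * (n * 6 + 4) + 37"], goal_cases)
      case (3 s2)
      have r2: "nreg s2 0 = n" "nreg s2 1 = N" "nreg s2 2 = 1" "mem s2 0 = gs n G n" "tape_pos s2 = n * n"
          "mem s2 1 = (\<lambda>_ _. 0)"
        using 3 r1 by (auto simp: agree_def)
      have s2: "\<forall>i>10. nreg s2 i = 0" "\<forall>x>9. rreg s2 x = 0" "\<forall>a>1. mem s2 a = (\<lambda>_ _. 0)"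
        using 3(1) s1 by (auto simp: agree_def)
      show ?case
      proof (rule ok_then[OF ok_refl[where n=n and N=N], where
        T'="n * 3 + n * (n * (n * 16 + 4) + n * 6 + 12) + n * (n * 6 + 4) + 31"], goal_cases)
        case (5 s3)
        have F3: "mem s3 0 = F" using 5(2) unfolding r2(4) F_def .
        then have r3: "nreg s3 0 = n" "nreg s3 2 = 1" "mem s3 0 = F" "tape_pos s3 = n * n"
            "mem s3 1 = (\<lambda>_ _. 0)"
          using 5(1) r2 by (auto simp: agree_def)
        have s3: "\<forall>i>10. nreg s3 i = 0" "\<forall>x>9. rreg s3 x = 0" "\<forall>a>1. mem s3 a = (\<lambda>_ _. 0)"
          using 5(1) s2 by (auto simp: agree_def)
        show ?case
        proof (rule ok_then[OF ok_root[where n=n], where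
            T'="n * (n * (n * 16 + 4) + n * 6 + 12) + n * (n * 6 + 4) + 24"], goal_cases)
          case (3 s4)
          have r4: "nreg s4 0 = n" "nreg s4 2 = 1" "mem s4 0 = F" "tape_pos s4 = n * n"
              "mem s4 1 = (\<lambda>_ _. 0)" "rreg s4 4 = sqrt (real n)" "rreg s4 5 = sqrt 2"
            using 3 r3 by (auto simp: agree_def)
          have s4: "\<forall>i>10. nreg s4 i = 0" "\<forall>x>9. rreg s4 x = 0" "\<forall>a>1. mem s4 a = (\<lambda>_ _. 0)"
            using 3(1) s3 by (auto simp: agree_def)
          show ?case
          proof (rule ok_then[OF ok_wig[where n=n and p="n * n"], where T'="n * (n * 6 + 4) + 22"], goal_cases)
            case (7 s5)
            have r5: "nreg s5 0 = n" "nreg s5 2 = 1" "mem s5 0 = F" "tape_pos s5 = 2 * (n * n)" "mem s5 1 = W"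
              using 7(1) 7(2)[unfolded r4(3)] r4 by (auto simp: agree_def W_def)
            have s5: "\<forall>i>10. nreg s5 i = 0" "\<forall>x>9. rreg s5 x = 0" "\<forall>a>1. mem s5 a = (\<lambda>_ _. 0)"
              using 7(1) s4 by (auto simp: agree_def)
            show ?case
            proof (rule ok_then[OF ok_copy[where n=n], where T'=20], goal_cases)
              case (3 s6)
              have r6: "nreg s6 0 = n" "tape_pos s6 = 2 * (n * n)" "mem s6 0 = W" "mem s6 1 = (\<lambda>_ _. 0)"
                using 3 r5 F0 by (auto simp: agree_def W_def fun_eq_iff)
              have s6: "\<forall>i>10. nreg s6 i = 0" "\<forall>x>9. rreg s6 x = 0" "\<forall>a>1. mem s6 a = (\<lambda>_ _. 0)"
                using 3(1) s5 by (auto simp: agree_def)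
              have n: "i \<in> {0,1,2,3,4,5,6,7,8,9,10}" if "\<not> i > 10" for i :: nat using that by simp presburger
              have x: "x \<in> {0,1,2,3,4,5,6,7,8,9}" if "\<not> x > 9" for x :: nat using that by simp presburger
              have n': "nreg s6 i = 0" if "i \<notin> {0,1,2,3,4,5,6,7,8,9,10}" for i using n s6 that by blast
              have x': "rreg s6 i = 0" if "i \<notin> {0,1,2,3,4,5,6,7,8,9}" for i using x s6 that by blast
              have m': "mem s6 a = (\<lambda>_ _. 0)" if "a \<noteq> 0" for a
                using s6 r6(4) that by (cases "a = 1") auto
              show ?case unfolding clear_prog_def
              proof (simp add: ok_steps, rule state.equality, goal_cases)
                case 1
                show ?case using r6 n' by (auto simp: init_state_def fun_eq_iff)
              next
                case 2
                show ?case using x' by (auto simp: init_state_def fun_eq_iff)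
              next
                case 3
                show ?case using r6 m' by (auto simp: init_state_def fun_eq_iff)
              qed (use r6 in \<open>auto simp: init_state_def\<close>)
            qed (use r5 in auto)
          qed (use r4 in auto)
        qed (use r3 in auto)
      qed (use r2 assms in auto)
    qed (use r1 in auto)
  qed (auto simp: s0_def init_state_def pre_time_def)
  then show ?thesis
    unfolding pre_prog_def ok_steps W s0_def Y0_def by (auto simp: pre_time_def)
qed

lemma pre_time_poly: "\<exists>p::nat poly. \<forall>n. pre_time m n \<le> poly p n"
proof -
  let ?n = "[:0, 1:] :: nat poly"
  have "\<forall>n. pre_time m n = poly (?n * (?n * 5 + 4) + ?n * (?n * (?n * 13 + 7) + ?n * 10 + 10) + ?n * (?n * (of_nat m * 11 + 13) + 6) +
     ?n * 3 + ?n * (?n * (?n * 16 + 4) + ?n * 6 + 12) + ?n * (?n * 6 + 4) + 42) n"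
    by (simp add: pre_time_def algebra_simps)
  then show ?thesis by (metis order_refl)
qed

definition main_prog :: "nat \<Rightarrow> nat \<Rightarrow> rat \<Rightarrow> com \<Rightarrow> com" where
  "main_prog m r q c = pre_prog m r ;; c ;; RConst 1 q ;; Cond (RLess 0 1) (NConst 0 0) (NConst 0 1)"

text \<open>The time bound of the certificate holds for every input and every tape, hence for the
  computed matrix and the shifted tape. The three extra steps load the threshold, compare and write
  the answer.\<close>

lemma polytime_reduction:
  assumes f: "polytime_matrix_alg f" and N: "\<And>n. num_samples \<gamma> n \<le> n"
    "\<And>n. (n - num_samples \<gamma> n) * m \<le> num_samples \<gamma> n"
  shows "polytime_sample_alg \<gamma> (\<lambda>n Y \<omega>.
    if f n (reduction n (num_samples \<gamma> n) m r Y \<omega>) (\<lambda>i. \<omega> (i + 2 * (n * n))) < of_rat q then 0 else 1)"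
proof -
  from f obtain c p where c: "\<forall>n. \<forall>W\<in>space (mat_space n). \<forall>\<omega>. \<exists>t s.
     exec \<omega> c (init_state n 0 (\<lambda>i j. if i < n \<and> j < n then W (i, j) else 0)) t s \<and>
     t \<le> poly p n \<and> f n W \<omega> = rreg s 0" unfolding polytime_matrix_alg_def by blast
  obtain p' :: "nat poly" where p': "\<And>n. pre_time m n \<le> poly p' n" using pre_time_poly by blast
  show ?thesis
    unfolding polytime_sample_alg_def Let_def
  proof (rule exI[of _ "main_prog m r q c"], rule exI[of _ "p' + p + 3"], intro allI ballI)
    fix n Y \<omega>
    assume Y: "Y \<in> space (\<Pi>\<^sub>M k\<in>{..<num_samples \<gamma> n}. vec_space n)"
    define W where "W = reduction n (num_samples \<gamma> n) m r Y \<omega>"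
    let ?out = "if f n W (\<lambda>i. \<omega> (i + 2 * (n * n))) < of_rat q then 0 else 1 :: nat"
    let ?s = "init_state n (num_samples \<gamma> n) (\<lambda>k i. if k < num_samples \<gamma> n \<and> i < n then Y k i else 0)"
    have "W \<in> space (mat_space n)"
      by (auto simp: W_def reduction_def mat_space_def space_PiM PiE_iff)
    with c obtain t s where ts: "exec (\<lambda>i. \<omega> (i + 2 * (n * n))) c
        (init_state n 0 (\<lambda>i j. if i < n \<and> j < n then W (i, j) else 0)) t s"
      "t \<le> poly p n" "f n W (\<lambda>i. \<omega> (i + 2 * (n * n))) = rreg s 0" by meson
    from exec_shift[OF ts(1)] have e: "exec \<omega> c ((init_state n 0 (\<lambda>i j. if i < n \<and> j < n then W (i, j) else 0))
        \<lparr>tape_pos := 2 * (n * n)\<rparr>) t (s\<lparr>tape_pos := tape_pos s + 2 * (n * n)\<rparr>)"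
      by (simp add: init_state_def)
    have "ok \<omega> (main_prog m r q c) (pre_time m n + (t + 3)) (\<lambda>s'. nreg s' 0 = ?out) ?s"
      unfolding main_prog_def
    proof (rule ok_then[OF ok_pre[OF N(1)[of n] N(2)[of n], where \<omega>=\<omega> and r=r and Y=Y], where T'="t + 3"], goal_cases)
      case (1 s')
      have "ok \<omega> c t (\<lambda>s''. s'' = s\<lparr>tape_pos := tape_pos s + 2 * (n * n)\<rparr>) s'"
        using e unfolding ok_def W_def 1(2) by blast
      then show ?case
        by (rule ok_then[where T'=3]) (auto simp: ok_steps ok_Cond ts(3))
    qed simp
    then obtain t' s' where "exec \<omega> (main_prog m r q c) ?s t' s'" "t' \<le> pre_time m n + (t + 3)" "nreg s' 0 = ?out"
      unfolding ok_def by blast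
    moreover have "pre_time m n + (t + 3) \<le> poly (p' + p + 3) n" using p'[of n] ts(2) by simp
    ultimately show "\<exists>t s. exec \<omega> (main_prog m r q c) ?s t s \<and> t \<le> poly (p' + p + 3) n \<and>
      (if f n (reduction n (num_samples \<gamma> n) m r Y \<omega>) (\<lambda>i. \<omega> (i + 2 * (n * n))) < of_rat q then 0 else 1) = nreg s 0 \<and>
      (if f n (reduction n (num_samples \<gamma> n) m r Y \<omega>) (\<lambda>i. \<omega> (i + 2 * (n * n))) < of_rat q then 0 else 1 :: nat) \<in> {0, 1}"
      unfolding W_def by (intro exI[of _ t'] exI[of _ s']) auto
  qed
qed

section \<open>Orthogonal invariance of Gaussian vectors\<close>

lemma prob_space_normal_law: "0 < \<sigma> \<Longrightarrow> prob_space (normal_law \<sigma>)"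
  by (simp add: normal_law_def prob_space_normal_density)

lemma sets_normal_law [simp, measurable_cong]: "sets (normal_law \<sigma>) = sets borel"
  by (simp add: normal_law_def)

lemma space_normal_law [simp]: "space (normal_law \<sigma>) = UNIV"
  by (simp add: normal_law_def)

definition gauss :: "'i set \<Rightarrow> ('i \<Rightarrow> real) measure" where
  "gauss I = (\<Pi>\<^sub>M i\<in>I. normal_law 1)"

interpretation gauss_pf: product_prob_space "\<lambda>_. normal_law 1" I for I
  by (simp add: product_prob_space_def product_prob_space_axioms_def product_sigma_finite_def
      prob_space_normal_law prob_space_imp_sigma_finite)

lemma prob_space_gauss: "prob_space (gauss I)"
  unfolding gauss_def by (rule prob_space_PiM) (simp add: prob_space_normal_law)

lemma sets_gauss [measurable_cong]: "sets (gauss I) = sets (\<Pi>\<^sub>M i\<in>I. borel)"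
  unfolding gauss_def by (rule sets_PiM_cong) auto

lemma space_gauss: "space (gauss I) = I \<rightarrow>\<^sub>E UNIV"
  by (simp add: gauss_def space_PiM)

lemma measurable_gaussI:
  assumes "\<And>i. i \<in> I \<Longrightarrow> (\<lambda>x. f x i) \<in> borel_measurable M"
    and "\<And>x. x \<in> space M \<Longrightarrow> f x \<in> extensional I"
  shows "f \<in> measurable M (gauss I)"
  unfolding gauss_def
  by (rule measurable_PiM_single') (use assms in \<open>auto simp: PiE_iff\<close>)

lemma measurable_gauss_component [measurable]:
  "i \<in> I \<Longrightarrow> (\<lambda>x. x i) \<in> borel_measurable (gauss I)"
  unfolding gauss_def by measurable

lemma nn_integral_normal_law:
  "f \<in> borel_measurable borel \<Longrightarrow>
    (\<integral>\<^sup>+x. f x \<partial>normal_law 1) = (\<integral>\<^sup>+x. ennreal (std_normal_density x) * f x \<partial>lborel)"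
  unfolding normal_law_def by (subst nn_integral_density) auto

lemma nn_integral_normal_uminus:
  assumes [measurable]: "f \<in> borel_measurable borel"
  shows "(\<integral>\<^sup>+x. f (- x) \<partial>normal_law 1) = (\<integral>\<^sup>+x. f x \<partial>normal_law 1)"
  using nn_integral_real_affine[of "\<lambda>x. ennreal (std_normal_density x) * f x" "-1" 0]
  by (simp add: nn_integral_normal_law std_normal_density_def)

text \<open>A plane reflection preserves the product of two normal densities. The change of
  variables is done one coordinate at a time with Fubini in between, which requires dividing by
  \<open>d\<close>; for \<open>d = 0\<close> only sign changes remain.\<close>

lemma nn_integral_normal_reflect:
  assumes [measurable]: "(\<lambda>(x, y). f x y) \<in> borel_measurable (borel \<Otimes>\<^sub>M borel)"
    and cd: "c\<^sup>2 + d\<^sup>2 = (1::real)"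
  shows "(\<integral>\<^sup>+x. \<integral>\<^sup>+y. f (c * x + d * y) (d * x - c * y) \<partial>normal_law 1 \<partial>normal_law 1) =
    (\<integral>\<^sup>+x. \<integral>\<^sup>+y. f x y \<partial>normal_law 1 \<partial>normal_law 1)"
proof (cases "d = 0")
  case True
  with cd have "c = 1 \<or> c = -1" by (simp add: power2_eq_1_iff)
  note um = nn_integral_normal_uminus
  have 1: "(\<integral>\<^sup>+x. \<integral>\<^sup>+y. f x (- y) \<partial>normal_law 1 \<partial>normal_law 1) =
      (\<integral>\<^sup>+x. \<integral>\<^sup>+y. f x y \<partial>normal_law 1 \<partial>normal_law 1)"
    by (intro nn_integral_cong um) measurable
  interpret prob_space "normal_law 1" by (rule prob_space_normal_law) simp
  have 2: "(\<integral>\<^sup>+x. \<integral>\<^sup>+y. f (- x) y \<partial>normal_law 1 \<partial>normal_law 1) =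
      (\<integral>\<^sup>+x. \<integral>\<^sup>+y. f x y \<partial>normal_law 1 \<partial>normal_law 1)"
    by (intro um[of "\<lambda>x. \<integral>\<^sup>+y. f x y \<partial>normal_law 1"]) measurable
  from \<open>c = 1 \<or> c = -1\<close> True 1 2 show ?thesis by auto
next
  case d: False
  let ?p = "std_normal_density"
  have key: "?p x * ?p y = ?p u * ?p v"
    if "u = c * x + d * y" "v = d * x - c * y" for x y u v
  proof -
    have "u\<^sup>2 + v\<^sup>2 = (c\<^sup>2 + d\<^sup>2) * (x\<^sup>2 + y\<^sup>2)" unfolding that by algebra
    then have "u\<^sup>2 + v\<^sup>2 = x\<^sup>2 + y\<^sup>2" by (simp add: cd)
    then have "exp (- x\<^sup>2 / 2) * exp (- y\<^sup>2 / 2) = exp (- u\<^sup>2 / 2) * exp (- v\<^sup>2 / 2)"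
      by (simp add: mult_exp_exp field_simps)
    then show ?thesis by (simp add: std_normal_density_def)
  qed
  have "(\<integral>\<^sup>+x. \<integral>\<^sup>+y. f (c * x + d * y) (d * x - c * y) \<partial>normal_law 1 \<partial>normal_law 1)
    = (\<integral>\<^sup>+x. \<integral>\<^sup>+y. ennreal (?p x * ?p y) * f (c * x + d * y) (d * x - c * y) \<partial>lborel \<partial>lborel)"
    by (subst nn_integral_normal_law, measurable, subst nn_integral_normal_law, measurable)
      (simp add: nn_integral_cmult[symmetric] ennreal_mult mult.assoc)
  \<comment> \<open>For fixed \<open>x\<close>, substitute \<open>u = c * x + d * y\<close> for
    \<open>y\<close>.\<close>
  also have "\<dots> = (\<integral>\<^sup>+x. \<integral>\<^sup>+u. ennreal (1 / \<bar>d\<bar>) *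
       (ennreal (?p x * ?p ((u - c * x) / d)) * f u ((x - c * u) / d)) \<partial>lborel \<partial>lborel)"
  proof (rule nn_integral_cong)
    fix x :: real
    have e: "d * x - c * (u - c * x) / d = (x - c * u) / d" for u
      using d cd by (simp add: field_simps) algebra
    have e2: "c * x + d * (- (c * x / d) + 1 / d * u) = u"
      and e3: "- (c * x / d) + 1 / d * u = (u - c * x) / d" for u
      using d by (auto simp: field_simps)
    have "(\<integral>\<^sup>+y. ennreal (?p x * ?p y) * f (c * x + d * y) (d * x - c * y) \<partial>lborel) =
      ennreal \<bar>1 / d\<bar> * (\<integral>\<^sup>+u. ennreal (?p x * ?p (- (c * x / d) + 1 / d * u)) *
         f (c * x + d * (- (c * x / d) + 1 / d * u)) (d * x - c * (- (c * x / d) + 1 / d * u)) \<partial>lborel)"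
      by (subst nn_integral_real_affine[where c="1 / d" and t="- (c * x / d)"]) (use d in auto)
    also have "\<dots> = (\<integral>\<^sup>+u. ennreal (1 / \<bar>d\<bar>) *
       (ennreal (?p x * ?p ((u - c * x) / d)) * f u ((x - c * u) / d)) \<partial>lborel)"
      unfolding e2 e3 using d by (subst nn_integral_cmult) (auto simp: e)
    finally show "(\<integral>\<^sup>+y. ennreal (?p x * ?p y) * f (c * x + d * y) (d * x - c * y) \<partial>lborel) = \<dots>" .
  qed
  also have "\<dots> = (\<integral>\<^sup>+u. \<integral>\<^sup>+x. ennreal (1 / \<bar>d\<bar>) *
       (ennreal (?p x * ?p ((u - c * x) / d)) * f u ((x - c * u) / d)) \<partial>lborel \<partial>lborel)"
    by (rule lborel_pair.Fubini') measurable
  \<comment> \<open>For fixed \<open>u\<close>, substitute \<open>x = c * u + d * v\<close>. The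
    reflection is an involution, so the same formulas invert it and the two Jacobian factors
    cancel.\<close>
  also have "\<dots> = (\<integral>\<^sup>+u. \<integral>\<^sup>+v. ennreal (?p u * ?p v) * f u v \<partial>lborel \<partial>lborel)"
  proof (rule nn_integral_cong)
    fix u :: real
    have e: "(u - c * (c * u + d * v)) / d = d * u - c * v" for v
      using d cd by (simp add: field_simps) algebra
    have fu [measurable]: "f u \<in> borel_measurable borel"
      using measurable_compose[OF measurable_Pair1'[of u borel borel] assms(1)] by simp
    have dd: "ennreal \<bar>d\<bar> * ennreal (1 / \<bar>d\<bar>) = 1"
      using d by (simp flip: ennreal_mult)
    have k: "?p (c * u + d * v) * ?p (d * u - c * v) = ?p u * ?p v" for v
      by (rule key[symmetric]) auto
    have "(\<integral>\<^sup>+x. ennreal (1 / \<bar>d\<bar>) * (ennreal (?p x * ?p ((u - c * x) / d)) * f u ((x - c * u) / d)) \<partial>lborel)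
      = ennreal \<bar>d\<bar> * (\<integral>\<^sup>+v. ennreal (1 / \<bar>d\<bar>) * (ennreal (?p (c * u + d * v) *
          ?p ((u - c * (c * u + d * v)) / d)) * f u ((c * u + d * v - c * u) / d)) \<partial>lborel)"
      by (subst nn_integral_real_affine[where c="d" and t="c * u"]) (use d in auto)
    also have "\<dots> = ennreal \<bar>d\<bar> * (\<integral>\<^sup>+v. ennreal (1 / \<bar>d\<bar>) * (ennreal (?p u * ?p v) * f u v) \<partial>lborel)"
      unfolding e k using d by simp
    also have "\<dots> = (\<integral>\<^sup>+v. ennreal (?p u * ?p v) * f u v \<partial>lborel)"
    proof -
      have "(\<integral>\<^sup>+v. ennreal (1 / \<bar>d\<bar>) * (ennreal (?p u * ?p v) * f u v) \<partial>lborel) =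
          ennreal (1 / \<bar>d\<bar>) * (\<integral>\<^sup>+v. ennreal (?p u * ?p v) * f u v \<partial>lborel)"
        by (rule nn_integral_cmult) simp
      then have "ennreal \<bar>d\<bar> * (\<integral>\<^sup>+v. ennreal (1 / \<bar>d\<bar>) * (ennreal (?p u * ?p v) * f u v) \<partial>lborel) =
          (ennreal \<bar>d\<bar> * ennreal (1 / \<bar>d\<bar>)) * (\<integral>\<^sup>+v. ennreal (?p u * ?p v) * f u v \<partial>lborel)"
        by (simp only: mult.assoc)
      then show ?thesis unfolding dd by (simp only: mult_1)
    qed
    finally show "(\<integral>\<^sup>+x. ennreal (1 / \<bar>d\<bar>) * (ennreal (?p x * ?p ((u - c * x) / d)) * f u ((x - c * u) / d)) \<partial>lborel) = \<dots>" .
  qed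
  also have "\<dots> = (\<integral>\<^sup>+x. \<integral>\<^sup>+y. f x y \<partial>normal_law 1 \<partial>normal_law 1)"
    by (subst (2) nn_integral_normal_law, measurable, subst nn_integral_normal_law, measurable)
      (simp add: nn_integral_cmult[symmetric] ennreal_mult mult.assoc)
  finally show ?thesis .
qed

lemma gauss_reflect2:
  fixes I :: "'i set"
  assumes I: "finite I" "s \<in> I" "t \<in> I" "s \<noteq> t" and cd: "c\<^sup>2 + d\<^sup>2 = (1::real)"
  shows "distr (gauss I) (gauss I) (\<lambda>x. x(s := c * x s + d * x t, t := d * x s - c * x t)) = gauss I"
    (is "distr _ _ ?G = _")
proof -
  define J where "J = I - {s, t}"
  have J: "finite J" "s \<notin> insert t J" "t \<notin> J" "I = insert s (insert t J)" "finite (insert t J)"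
    using I by (auto simp: J_def)
  have G [measurable]: "?G \<in> measurable (gauss I) (gauss I)"
  proof (rule measurable_gaussI)
    show "(\<lambda>x. (?G x) i) \<in> borel_measurable (gauss I)" if "i \<in> I" for i
      using I that by (cases "i = t"; cases "i = s") auto
  qed (use I in \<open>auto simp: space_gauss PiE_iff extensional_def\<close>)
  have ins: "(\<integral>\<^sup>+x. f x \<partial>gauss I) =
      (\<integral>\<^sup>+z. \<integral>\<^sup>+y. \<integral>\<^sup>+x. f (z(t := y, s := x)) \<partial>normal_law 1 \<partial>normal_law 1 \<partial>gauss J)"
    if f: "f \<in> borel_measurable (gauss I)" for f :: "('i \<Rightarrow> real) \<Rightarrow> ennreal"
    unfolding gauss_def J(4)
  proof (subst gauss_pf.product_nn_integral_insert[OF J(5) J(2)], goal_cases)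
    case 1 then show ?case using f by (simp add: gauss_def J(4))
  next
    case 2
    have "(\<lambda>z. \<integral>\<^sup>+x. f (z(s := x)) \<partial>normal_law 1) \<in> borel_measurable (Pi\<^sub>M (insert t J) (\<lambda>_. normal_law 1))"
      using f by (simp add: gauss_def J(4)) 
    then show ?case by (subst gauss_pf.product_nn_integral_insert[OF J(1) J(3)]) auto
  qed
  show ?thesis
  proof (rule measure_eqI)
    fix A assume A: "A \<in> sets (distr (gauss I) (gauss I) ?G)"
    let ?f = "indicator A :: _ \<Rightarrow> ennreal"
    have f [measurable]: "?f \<in> borel_measurable (gauss I)" using A by auto
    have "emeasure (distr (gauss I) (gauss I) ?G) A = (\<integral>\<^sup>+x. ?f (?G x) \<partial>gauss I)"
      using A by (simp add: nn_integral_distr flip: nn_integral_indicator)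
    also have "\<dots> = (\<integral>\<^sup>+z. \<integral>\<^sup>+y. \<integral>\<^sup>+x. ?f (?G (z(t := y, s := x))) \<partial>normal_law 1 \<partial>normal_law 1 \<partial>gauss J)"
      by (rule ins) measurable
    also have "\<dots> = (\<integral>\<^sup>+z. \<integral>\<^sup>+y. \<integral>\<^sup>+x. ?f (z(t := y, s := x)) \<partial>normal_law 1 \<partial>normal_law 1 \<partial>gauss J)"
    proof (rule nn_integral_cong)
      fix z assume z: "z \<in> space (gauss J)"
      have m: "(\<lambda>(y, x). z(t := y, s := x)) \<in> measurable (borel \<Otimes>\<^sub>M borel) (gauss I)"
      proof (rule measurable_gaussI)
        show "(\<lambda>x. (case x of (y, x) \<Rightarrow> z(t := y, s := x)) i) \<in> borel_measurable (borel \<Otimes>\<^sub>M borel)"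
          if "i \<in> I" for i
          by (cases "i = t"; cases "i = s") (auto simp: case_prod_beta)
      qed (use I z in \<open>auto simp: space_gauss J_def PiE_iff extensional_def\<close>)
      \<comment> \<open>The coordinates \<open>t\<close> and \<open>s\<close> are integrated in the
        opposite order to that of the reflection, and exchanging them turns \<open>c\<close> into
        \<open>- c\<close>.\<close>
      have *: "?G (z(t := y, s := x)) = z(t := (- c) * y + d * x, s := d * y - (- c) * x)" for x y
        using I by (auto simp: fun_eq_iff)
      show "(\<integral>\<^sup>+y. \<integral>\<^sup>+x. ?f (?G (z(t := y, s := x))) \<partial>normal_law 1 \<partial>normal_law 1) =
        (\<integral>\<^sup>+y. \<integral>\<^sup>+x. ?f (z(t := y, s := x)) \<partial>normal_law 1 \<partial>normal_law 1)"
        unfolding * by (rule nn_integral_normal_reflect)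
          (use measurable_compose[OF m f] cd in \<open>auto simp: case_prod_beta\<close>)
    qed
    also have "\<dots> = (\<integral>\<^sup>+x. ?f x \<partial>gauss I)"
      by (rule ins[symmetric]) measurable
    also have "\<dots> = emeasure (gauss I) A" using A by simp
    finally show "emeasure (distr (gauss I) (gauss I) ?G) A = emeasure (gauss I) A" .
  qed simp
qed

lemma gauss_flip:
  fixes I :: "'i set"
  assumes I: "finite I" "s \<in> I"
  shows "distr (gauss I) (gauss I) (\<lambda>x. x(s := - x s)) = gauss I"
    (is "distr _ _ ?G = _")
proof -
  define J where "J = I - {s}"
  have J: "finite J" "s \<notin> J" "I = insert s J"
    using I by (auto simp: J_def)
  have G [measurable]: "?G \<in> measurable (gauss I) (gauss I)"
  proof (rule measurable_gaussI)
    show "(\<lambda>x. (?G x) i) \<in> borel_measurable (gauss I)" if "i \<in> I" for i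
      using I that by (cases "i = s") auto
  qed (use I in \<open>auto simp: space_gauss PiE_iff extensional_def\<close>)
  have ins: "(\<integral>\<^sup>+x. f x \<partial>gauss I) = (\<integral>\<^sup>+z. \<integral>\<^sup>+x. f (z(s := x)) \<partial>normal_law 1 \<partial>gauss J)"
    if f: "f \<in> borel_measurable (gauss I)" for f :: "('i \<Rightarrow> real) \<Rightarrow> ennreal"
    using f unfolding gauss_def J(3)
    by (rule gauss_pf.product_nn_integral_insert[OF J(1) J(2)])
  show ?thesis
  proof (rule measure_eqI)
    fix A assume A: "A \<in> sets (distr (gauss I) (gauss I) ?G)"
    let ?f = "indicator A :: _ \<Rightarrow> ennreal"
    have f [measurable]: "?f \<in> borel_measurable (gauss I)" using A by auto
    have "emeasure (distr (gauss I) (gauss I) ?G) A = (\<integral>\<^sup>+x. ?f (?G x) \<partial>gauss I)"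
      using A by (simp add: nn_integral_distr flip: nn_integral_indicator)
    also have "\<dots> = (\<integral>\<^sup>+z. \<integral>\<^sup>+x. ?f (?G (z(s := x))) \<partial>normal_law 1 \<partial>gauss J)"
      by (rule ins) measurable
    also have "\<dots> = (\<integral>\<^sup>+z. \<integral>\<^sup>+x. ?f (z(s := x)) \<partial>normal_law 1 \<partial>gauss J)"
    proof (rule nn_integral_cong)
      fix z assume z: "z \<in> space (gauss J)"
      have m: "(\<lambda>x. z(s := x)) \<in> measurable borel (gauss I)"
        by (rule measurable_gaussI)
          (use I z in \<open>auto simp: space_gauss J_def PiE_iff extensional_def\<close>)
      show "(\<integral>\<^sup>+x. ?f (?G (z(s := x))) \<partial>normal_law 1) = (\<integral>\<^sup>+x. ?f (z(s := x)) \<partial>normal_law 1)"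
        using nn_integral_normal_uminus[OF measurable_compose[OF m f]] by simp
    qed
    also have "\<dots> = (\<integral>\<^sup>+x. ?f x \<partial>gauss I)"
      by (rule ins[symmetric]) measurable
    also have "\<dots> = emeasure (gauss I) A" using A by simp
    finally show "emeasure (distr (gauss I) (gauss I) ?G) A = emeasure (gauss I) A" .
  qed simp
qed

definition lin_map :: "'i set \<Rightarrow> ('i \<Rightarrow> 'i \<Rightarrow> real) \<Rightarrow> ('i \<Rightarrow> real) \<Rightarrow> 'i \<Rightarrow> real" where
  "lin_map I a x = (\<lambda>i\<in>I. \<Sum>j\<in>I. a i j * x j)"

lemma measurable_lin_map [measurable]: "lin_map I a \<in> measurable (gauss I) (gauss I)"
  unfolding lin_map_def by (rule measurable_gaussI) auto

definition ortho :: "'i set \<Rightarrow> ('i \<Rightarrow> 'i \<Rightarrow> real) \<Rightarrow> bool" where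
  "ortho I a \<longleftrightarrow> (\<forall>j\<in>I. \<forall>k\<in>I. (\<Sum>i\<in>I. a i j * a i k) = (if j = k then 1 else 0))"

text \<open>Pairing the unit column \<open>j\<close> with column \<open>k\<close> reads off the
  entry \<open>a j k\<close>.\<close>

lemma ortho_fixed_row:
  assumes o: "ortho I a" "finite I" and j: "j \<in> I" "k \<in> I" "\<And>i. i \<in> I \<Longrightarrow> a i j = (if i = j then 1 else 0)"
  shows "a j k = (if j = k then 1 else 0)"
proof -
  have "(\<Sum>i\<in>I. a i j * a i k) = (\<Sum>i\<in>I. if i = j then a i k else 0)"
    by (intro sum.cong) (auto simp: j)
  also have "\<dots> = a j k" using o(2) j by simp
  finally have "(\<Sum>i\<in>I. a i j * a i k) = a j k" .
  with o(1) j(1,2) show ?thesis unfolding ortho_def by metis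
qed

text \<open>The matrix is factored into plane reflections and sign changes, each of which preserves
  the Gaussian law. \<open>S\<close> contains the columns that need not yet be unit vectors.\<close>

lemma gauss_ortho_aux:
  fixes I :: "'i set"
  assumes "finite I" "S \<subseteq> I" "ortho I a"
    "\<And>i j. i \<in> I \<Longrightarrow> j \<in> I - S \<Longrightarrow> a i j = (if i = j then 1 else 0)"
  shows "distr (gauss I) (gauss I) (lin_map I a) = gauss I"
proof -
  have "finite S" using assms finite_subset by blast
  from this assms show ?thesis
  proof (induction S arbitrary: a rule: finite_induct)
    case empty
    have "distr (gauss I) (gauss I) (lin_map I a) = distr (gauss I) (gauss I) (\<lambda>x. x)"
    proof (rule distr_cong)
      fix x assume x: "x \<in> space (gauss I)"
      have "lin_map I a x = (\<lambda>i\<in>I. \<Sum>j\<in>I. if i = j then x j else 0)"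
        unfolding lin_map_def by (intro restrict_ext sum.cong) (auto simp: empty)
      also have "\<dots> = x" using x empty(1) by (auto simp: space_gauss PiE_iff extensional_def fun_eq_iff)
      finally show "lin_map I a x = x" .
    qed auto
    then show ?case by (simp add: distr_id)
  next
    case (insert s S)
    then have s: "s \<in> I" "s \<notin> S" "S \<subseteq> I" by auto
    note hyp = insert.prems
    \<comment> \<open>Inner induction on the number of entries still to be cleared in column
      \<open>s\<close>; each plane reflection clears one.\<close>
    define supp where "supp a = card {t\<in>S. a t s \<noteq> (0::real)}" for a :: "'i \<Rightarrow> 'i \<Rightarrow> real"
    from hyp(3,4) show ?case
    proof (induction "supp a" arbitrary: a rule: less_induct)
      case (less a)
      have row: "a j k = (if j = k then 1 else 0)" if "j \<in> I - insert s S" "k \<in> I" for j k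
        by (rule ortho_fixed_row[OF less.prems(1) hyp(1)]) (use that less.prems(2) in auto)
      show ?case
      proof (cases "\<exists>t\<in>S. a t s \<noteq> 0")
        case True
        then obtain t where t: "t \<in> S" "a t s \<noteq> 0" by auto
        have ts: "t \<noteq> s" "t \<in> I" using t s by auto
        define r where "r = sqrt ((a s s)\<^sup>2 + (a t s)\<^sup>2)"
        have "0 < (a t s)\<^sup>2" using t by simp
        then have pos: "0 < (a s s)\<^sup>2 + (a t s)\<^sup>2" by (smt (verit) zero_le_power2)
        have r: "r > 0" "r\<^sup>2 = (a s s)\<^sup>2 + (a t s)\<^sup>2"
          unfolding r_def using pos by (simp_all only: real_sqrt_gt_zero real_sqrt_pow2 less_imp_le)
        \<comment> \<open>The reflection with these coefficients sends the pair
          \<open>(a s s, a t s)\<close> to \<open>(r, 0)\<close>.\<close>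
        define c d where "c = a s s / r" and "d = a t s / r"
        have cd: "c\<^sup>2 + d\<^sup>2 = 1"
          unfolding c_def d_def power_divide r(2)
          using pos by (metis add_divide_distrib divide_self less_irrefl)
        define b where "b = (\<lambda>i j. if i = t then d * a s j - c * a t j
          else if i = s then c * a s j + d * a t j else a i j)"
        let ?G = "\<lambda>x::'i \<Rightarrow> real. x(s := c * x s + d * x t, t := d * x s - c * x t)"
        have bt: "b t s = 0" using r by (simp add: b_def c_def d_def)
        have "{u\<in>S. b u s \<noteq> 0} \<subset> {u\<in>S. a u s \<noteq> 0}"
          using t bt s by (auto simp: b_def split: if_splits)
        then have less': "supp b < supp a" unfolding supp_def
          using insert.hyps(1) by (intro psubset_card_mono) auto
        have ob: "ortho I b" unfolding ortho_def
        proof (intro ballI)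
          fix j k assume jk: "j \<in> I" "k \<in> I"
          have spl: "(\<Sum>i\<in>I. g i) = g s + g t + (\<Sum>i\<in>I-{s,t}. g i)" for g :: "'i \<Rightarrow> real"
          proof -
            have "(\<Sum>i\<in>I. g i) = g s + (\<Sum>i\<in>I-{s}. g i)"
              using hyp(1) s by (simp add: sum.remove)
            also have "(\<Sum>i\<in>I-{s}. g i) = g t + (\<Sum>i\<in>I-{s}-{t}. g i)"
              using hyp(1) ts by (simp add: sum.remove)
            also have "I-{s}-{t} = I-{s,t}" by auto
            finally show ?thesis by (simp add: add.assoc)
          qed
          have "(\<Sum>i\<in>I-{s,t}. b i j * b i k) = (\<Sum>i\<in>I-{s,t}. a i j * a i k)"
            by (intro sum.cong) (auto simp: b_def)
          moreover have "b s j * b s k + b t j * b t k = (c\<^sup>2 + d\<^sup>2) * (a s j * a s k + a t j * a t k)"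
            using ts by (simp add: b_def power2_eq_square algebra_simps)
          ultimately have "(\<Sum>i\<in>I. b i j * b i k) = (\<Sum>i\<in>I. a i j * a i k)"
            unfolding spl by (simp add: cd)
          then show "(\<Sum>i\<in>I. b i j * b i k) = (if j = k then 1 else 0)"
            using less.prems(1) jk by (simp add: ortho_def)
        qed
        have fb: "b i j = (if i = j then 1 else 0)" if "i \<in> I" "j \<in> I - insert s S" for i j
          using less.prems(2)[of i j] less.prems(2)[of s j] less.prems(2)[of t j] that t s ts
          by (auto simp: b_def)
        have IH: "distr (gauss I) (gauss I) (lin_map I b) = gauss I"
          by (rule less.hyps[OF less' ob fb])
        \<comment> \<open>\<open>b\<close> is the reflection applied to \<open>a\<close>; since
          reflecting twice does nothing, \<open>a\<close> is the reflection applied to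
          \<open>b\<close>.\<close>
        have eq: "lin_map I a x = ?G (lin_map I b x)" for x
        proof -
          define u v where "u = (\<Sum>j\<in>I. a s j * x j)" and "v = (\<Sum>j\<in>I. a t j * x j)"
          have 1: "lin_map I b x s = c * u + d * v" "lin_map I b x t = d * u - c * v"
            using s ts by (simp_all add: lin_map_def b_def u_def v_def sum_distrib_left
                sum.distrib sum_subtractf distrib_right left_diff_distrib mult.assoc)
          have "c * (c * u + d * v) + d * (d * u - c * v) = (c\<^sup>2 + d\<^sup>2) * u"
            "d * (c * u + d * v) - c * (d * u - c * v) = (c\<^sup>2 + d\<^sup>2) * v" by algebra+
          then have 2: "c * (c * u + d * v) + d * (d * u - c * v) = u"
            "d * (c * u + d * v) - c * (d * u - c * v) = v" by (simp_all add: cd)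
          show ?thesis unfolding 1 2
            using s ts by (auto simp: fun_eq_iff lin_map_def b_def u_def v_def)
        qed
        have mG: "?G \<in> measurable (gauss I) (gauss I)"
        proof (rule measurable_gaussI)
          show "(\<lambda>x. (?G x) i) \<in> borel_measurable (gauss I)" if "i \<in> I" for i
            using s ts that by (cases "i = t"; cases "i = s") auto
        qed (use s ts in \<open>auto simp: space_gauss PiE_iff extensional_def\<close>)
        have "distr (gauss I) (gauss I) (lin_map I a) =
            distr (distr (gauss I) (gauss I) (lin_map I b)) (gauss I) ?G"
          by (subst distr_distr[OF mG]) (auto simp: eq[abs_def] comp_def)
        also have "\<dots> = gauss I"
          unfolding IH by (rule gauss_reflect2) (use hyp(1) s ts cd in auto)
        finally show ?thesis .
      next
        case False
        \<comment> \<open>Column \<open>s\<close> is now supported on the diagonal, so by its norm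
          it is a unit vector up to sign. A negative sign is removed by one coordinate flip.\<close>
        have z: "a i s = 0" if "i \<in> I" "i \<noteq> s" for i
          using False that row[of i s] s by (cases "i \<in> S") auto
        have "(\<Sum>i\<in>I. a i s * a i s) = (\<Sum>i\<in>I. if i = s then a s s * a s s else 0)"
          using z by (intro sum.cong) auto
        then have "(a s s)\<^sup>2 = 1"
          using less.prems(1) s hyp(1) by (simp add: ortho_def power2_eq_square)
        then consider "a s s = 1" | "a s s = -1" by (auto simp: power2_eq_1_iff)
        then show ?thesis
        proof cases
          case 1
          show ?thesis
          proof (rule insert.IH[OF hyp(1) s(3) less.prems(1)])
            show "a i j = (if i = j then 1 else 0)" if "i \<in> I" "j \<in> I - S" for i j
              using that z[of i] 1 less.prems(2)[of i j] by (cases "j = s") auto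
          qed
        next
          case 2
          define b where "b = (\<lambda>i j. if i = s then - a i j else a i j)"
          have "distr (gauss I) (gauss I) (lin_map I b) = gauss I"
          proof (rule insert.IH[OF hyp(1) s(3)])
            have "b i j * b i k = a i j * a i k" for i j k by (simp add: b_def)
            then show "ortho I b" using less.prems(1) by (simp add: ortho_def)
            show "b i j = (if i = j then 1 else 0)" if "i \<in> I" "j \<in> I - S" for i j
              using that z[of i] 2 less.prems(2)[of i j] by (cases "j = s") (auto simp: b_def)
          qed
          moreover have mG: "(\<lambda>x. x(s := - x s)) \<in> measurable (gauss I) (gauss I)"
          proof (rule measurable_gaussI)
            show "(\<lambda>x::'i \<Rightarrow> real. (x(s := - x s)) i) \<in> borel_measurable (gauss I)" if "i \<in> I" for i
              using s that by (cases "i = s") auto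
          qed (use s in \<open>auto simp: space_gauss PiE_iff extensional_def\<close>)
          moreover have "lin_map I a x = (lin_map I b x)(s := - lin_map I b x s)" for x
            using s by (auto simp: fun_eq_iff lin_map_def b_def sum_negf)
          then have "lin_map I a = (\<lambda>x. (lin_map I b x)(s := - lin_map I b x s))"
            by (rule ext)
          then have "distr (gauss I) (gauss I) (lin_map I a) =
            distr (distr (gauss I) (gauss I) (lin_map I b)) (gauss I) (\<lambda>x. x(s := - x s))"
            by (subst distr_distr[OF mG]) (auto simp: comp_def)
          ultimately show ?thesis using gauss_flip[OF hyp(1) s(1)] by simp
        qed
      qed
    qed
  qed
qed

lemma gauss_ortho:
  assumes "finite I" "ortho I a"
  shows "distr (gauss I) (gauss I) (lin_map I a) = gauss I"
  using assms by (intro gauss_ortho_aux[of I I]) auto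

text \<open>For maps given by a formula instead of a matrix, such as conjugation in the coordinates
  of a triangle. Polarisation turns preservation of the norm into orthogonality of the matrix that
  represents the map.\<close>

lemma gauss_isometry:
  fixes I :: "'i set"
  assumes I: "finite I"
    and ext: "\<And>x. L x \<in> extensional I"
    and cong: "\<And>x y. (\<And>i. i \<in> I \<Longrightarrow> x i = y i) \<Longrightarrow> L x = L y"
    and add: "\<And>x y i. i \<in> I \<Longrightarrow> L (\<lambda>i. x i + y i) i = L x i + L y i"
    and scale: "\<And>c x i. i \<in> I \<Longrightarrow> L (\<lambda>i. c * x i) i = c * L x i"
    and norm: "\<And>x. (\<Sum>i\<in>I. (L x i)\<^sup>2) = (\<Sum>i\<in>I. (x i)\<^sup>2)"
  shows "L \<in> measurable (gauss I) (gauss I)" "distr (gauss I) (gauss I) L = gauss I"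
proof -
  define e where "e j = (\<lambda>i. if i = j then 1 else 0 :: real)" for j :: 'i
  define a where "a i j = L (e j) i" for i j
  have sum: "L (\<lambda>i. \<Sum>j\<in>F. x j * e j i) i = (\<Sum>j\<in>F. a i j * x j)" if "finite F" "i \<in> I" for F x i
    using that
  proof (induction F rule: finite_induct)
    case empty
    then show ?case using scale[of i 0 "\<lambda>_. 0"] by simp
  next
    case (insert t F)
    then have "(\<lambda>i. \<Sum>j\<in>insert t F. x j * e j i) = (\<lambda>i. x t * e t i + (\<Sum>j\<in>F. x j * e j i))"
      by auto
    then have "L (\<lambda>i. \<Sum>j\<in>insert t F. x j * e j i) i = L (\<lambda>i. x t * e t i + (\<Sum>j\<in>F. x j * e j i)) i"
      by simp
    also have "\<dots> = x t * a i t + (\<Sum>j\<in>F. a i j * x j)"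
      using insert by (subst add) (auto simp: scale a_def)
    finally show ?case using insert by (simp add: mult.commute)
  qed
  have L: "L x = lin_map I a x" for x
  proof -
    have "L x = L (\<lambda>i. \<Sum>j\<in>I. x j * e j i)"
      using I by (intro cong) (simp add: e_def if_distrib cong: if_cong)
    then show ?thesis
      using sum[OF I] ext[of x] unfolding lin_map_def
      by (auto simp: fun_eq_iff extensional_def)
  qed
  have "ortho I a" unfolding ortho_def
  proof (intro ballI)
    fix j k assume jk: "j \<in> I" "k \<in> I"
    have 1: "(\<Sum>i\<in>I. (a i j)\<^sup>2) = 1" if "j \<in> I" for j
    proof -
      have "(\<Sum>i\<in>I. (a i j)\<^sup>2) = (\<Sum>i\<in>I. (e j i)\<^sup>2)" unfolding a_def by (rule norm)
      also have "\<dots> = (\<Sum>i\<in>I. if i = j then 1 else 0)" by (intro sum.cong) (auto simp: e_def)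
      finally show ?thesis using that I by simp
    qed
    have "(\<Sum>i\<in>I. (a i j + a i k)\<^sup>2) = (\<Sum>i\<in>I. (L (\<lambda>i. e j i + e k i) i)\<^sup>2)"
      by (intro sum.cong) (auto simp: add a_def)
    also have "\<dots> = (\<Sum>i\<in>I. (e j i + e k i)\<^sup>2)" by (rule norm)
    also have "\<dots> = (\<Sum>i\<in>I. (if i = j then 1 else 0) + (if i = k then 1 else 0) + (if i = j \<and> j = k then 2 else 0))"
      by (intro sum.cong) (auto simp: e_def)
    also have "\<dots> = 2 + (if j = k then 2 else 0)"
      using jk I by (auto simp: sum.distrib)
    finally have *: "(\<Sum>i\<in>I. (a i j + a i k)\<^sup>2) = 2 + (if j = k then 2 else 0)" .
    have "(\<Sum>i\<in>I. (a i j)\<^sup>2) + 2 * (\<Sum>i\<in>I. a i j * a i k) + (\<Sum>i\<in>I. (a i k)\<^sup>2) =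
        2 + (if j = k then 2 else 0)"
    proof -
      have "(\<Sum>i\<in>I. (a i j + a i k)\<^sup>2) =
          (\<Sum>i\<in>I. (a i j)\<^sup>2 + 2 * (a i j * a i k) + (a i k)\<^sup>2)"
        by (intro sum.cong refl) (simp add: power2_eq_square algebra_simps)
      then show ?thesis using * by (simp add: sum.distrib sum_distrib_left[symmetric])
    qed
    then show "(\<Sum>i\<in>I. a i j * a i k) = (if j = k then 1 else 0)"
      using 1 jk by (simp split: if_splits)
  qed
  moreover have "L = lin_map I a" using L by auto
  ultimately show "L \<in> measurable (gauss I) (gauss I)" "distr (gauss I) (gauss I) L = gauss I"
    using gauss_ortho[OF I] by auto
qed

section \<open>Orthonormal frames\<close>

lemma dotp_simps:
  "dotp n (\<lambda>l. u l + v l) w = dotp n u w + dotp n v w" "dotp n (\<lambda>l. u l - v l) w = dotp n u w - dotp n v w"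
  "dotp n (\<lambda>l. c * u l) w = c * dotp n u w" "dotp n (\<lambda>l. u l / c) w = dotp n u w / c"
  "dotp n w (\<lambda>l. u l + v l) = dotp n w u + dotp n w v" "dotp n w (\<lambda>l. u l - v l) = dotp n w u - dotp n w v"
  "dotp n w (\<lambda>l. c * u l) = c * dotp n w u" "dotp n w (\<lambda>l. u l / c) = dotp n w u / c"
  by (auto simp: dotp_def algebra_simps sum.distrib sum_subtractf sum_distrib_left sum_divide_distrib)

lemma dotp_sum:
  "dotp n (\<lambda>l. \<Sum>i\<in>I. f i l) w = (\<Sum>i\<in>I. dotp n (f i) w)"
  "dotp n w (\<lambda>l. \<Sum>i\<in>I. f i l) = (\<Sum>i\<in>I. dotp n w (f i))"
  unfolding dotp_def sum_distrib_left sum_distrib_right by (rule sum.swap)+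

lemma dotp_commute: "dotp n u v = dotp n v u"
  by (simp add: dotp_def mult.commute)

lemma dotp_cong: "(\<And>l. l < n \<Longrightarrow> u l = u' l) \<Longrightarrow> (\<And>l. l < n \<Longrightarrow> v l = v' l) \<Longrightarrow> dotp n u v = dotp n u' v'"
  by (simp add: dotp_def)

lemma dotp_self: "dotp n u u = (\<Sum>l<n. (u l)\<^sup>2)"
  by (simp add: dotp_def power2_eq_square)

lemma dotp_self_nonneg: "0 \<le> dotp n u u"
  by (simp add: dotp_self sum_nonneg)

lemma dotp_self_eq_0: "dotp n u u = 0 \<longleftrightarrow> (\<forall>l<n. u l = 0)"
  by (auto simp: dotp_self sum_nonneg_eq_0_iff)

lemma dotp_Cauchy_Schwarz: "(dotp n u v)\<^sup>2 \<le> dotp n u u * dotp n v v"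
  unfolding dotp_self unfolding dotp_def by (rule Cauchy_Schwarz_ineq_sum)

definition in_span :: "nat \<Rightarrow> nat \<Rightarrow> (nat \<Rightarrow> nat \<Rightarrow> real) \<Rightarrow> (nat \<Rightarrow> real) \<Rightarrow> bool" where
  "in_span n K V v \<longleftrightarrow> (\<exists>c. \<forall>l<n. v l = (\<Sum>k<K. c k * V k l))"

lemma in_span_base: "k < K \<Longrightarrow> in_span n K V (V k)"
  unfolding in_span_def
  by (rule exI[of _ "\<lambda>i. if i = k then 1 else 0"]) (simp add: if_distribR if_distrib cong: if_cong)

lemma in_span_zero: "(\<And>l. l < n \<Longrightarrow> v l = 0) \<Longrightarrow> in_span n K V v"
  unfolding in_span_def by (rule exI[of _ "\<lambda>_. 0"]) simp

lemma in_span_lin: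
  assumes "in_span n K V u" "in_span n K V v" "\<And>l. l < n \<Longrightarrow> w l = a * u l + b * v l"
  shows "in_span n K V w"
proof -
  from assms(1,2) obtain c d where "\<forall>l<n. u l = (\<Sum>k<K. c k * V k l)" "\<forall>l<n. v l = (\<Sum>k<K. d k * V k l)"
    unfolding in_span_def by blast
  then have "\<forall>l<n. w l = (\<Sum>k<K. (a * c k + b * d k) * V k l)"
    using assms(3) by (simp add: algebra_simps sum.distrib sum_distrib_left)
  then show ?thesis unfolding in_span_def by (intro exI[of _ "\<lambda>k. a * c k + b * d k"])
qed

lemma in_span_trans:
  assumes "in_span n J W v" "\<And>j. j < J \<Longrightarrow> in_span n K V (W j)"
  shows "in_span n K V v"
proof -
  obtain c where c: "\<forall>l<n. v l = (\<Sum>k<J. c k * W k l)" using assms(1) unfolding in_span_def by blast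
  have "in_span n K V (\<lambda>l. \<Sum>k<J'. c k * W k l)" if "J' \<le> J" for J'
    using that
  proof (induction J')
    case 0
    show ?case by (rule in_span_zero) simp
  next
    case (Suc J')
    then have "in_span n K V (\<lambda>l. \<Sum>k<J'. c k * W k l)" "in_span n K V (W J')"
      using assms(2)[of J'] by simp_all
    then show ?case by (rule in_span_lin[where a=1 and b="c J'"]) simp
  qed
  from in_span_lin[OF this[of J] this[of J], of v 1 0] c show ?thesis by simp
qed

lemma in_span_mono: "in_span n J V v \<Longrightarrow> J \<le> K \<Longrightarrow> in_span n K V v"
  by (erule in_span_trans) (auto intro: in_span_base)

lemma gs_elim_other: "i \<noteq> k \<Longrightarrow> gs_elim n k M J i = M i"
  by (induction J) auto

lemma gs_elim_span:
  assumes "J \<le> k"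
  shows "\<exists>c. \<forall>l<n. gs_elim n k M J k l = M k l - (\<Sum>j<J. c j * M j l)"
  using assms
proof (induction J)
  case (Suc J)
  then obtain c where c: "\<forall>l<n. gs_elim n k M J k l = M k l - (\<Sum>j<J. c j * M j l)" by auto
  let ?a = "dotp n (gs_elim n k M J k) (gs_elim n k M J J)"
  have "gs_elim n k M J J = M J" using Suc by (intro gs_elim_other) auto
  then have "\<forall>l<n. gs_elim n k M (Suc J) k l = M k l - (\<Sum>j<Suc J. (c(J := ?a)) j * M j l)"
    using c by simp
  then show ?case by (intro exI[of _ "c(J := ?a)"])
qed simp

lemma gs_elim_ortho:
  assumes "J \<le> k" "\<And>i j. i < k \<Longrightarrow> j < k \<Longrightarrow> i \<noteq> j \<Longrightarrow> dotp n (M i) (M j) = 0"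
    "\<And>i. i < k \<Longrightarrow> dotp n (M i) (M i) \<in> {0, 1}" "i < J"
  shows "dotp n (gs_elim n k M J k) (M i) = 0"
  using assms(1,4)
proof (induction J)
  case (Suc J)
  have MJ: "gs_elim n k M J J = M J" using Suc by (intro gs_elim_other) auto
  let ?r = "gs_elim n k M J k" and ?a = "dotp n (gs_elim n k M J k) (M J)"
  have "dotp n (gs_elim n k M (Suc J) k) (M i) = dotp n (\<lambda>l. ?r l - ?a * M J l) (M i)"
    by (rule dotp_cong) (auto simp: MJ)
  also have "\<dots> = dotp n ?r (M i) - ?a * dotp n (M J) (M i)" by (simp add: dotp_simps)
  also have "\<dots> = 0"
  proof (cases "i = J")
    case True
    have "dotp n (M J) (M J) = 0 \<Longrightarrow> ?a = 0"
      by (simp add: dotp_self_eq_0) (simp add: dotp_def)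
    then show ?thesis using True Suc.prems assms(3)[of J] by auto
  next
    case False
    then show ?thesis using Suc assms(2)[of J i] by auto
  qed
  finally show ?case .
qed simp

lemma dotp_normalize: "dotp n (\<lambda>l. u l / sqrt (dotp n u u)) (\<lambda>l. u l / sqrt (dotp n u u)) =
    (if dotp n u u = 0 then 0 else 1)"
  using dotp_self_nonneg[of n u] by (simp add: dotp_simps)

lemma gs_ortho:
  assumes "K \<le> n"
  shows "(\<forall>i<K. \<forall>j<K. i \<noteq> j \<longrightarrow> dotp n (gs n M K i) (gs n M K j) = 0) \<and>
    (\<forall>i<K. dotp n (gs n M K i) (gs n M K i) \<in> {0, 1})"
  using assms
proof (induction K)
  case (Suc K)
  let ?G = "gs n M K" and ?r = "gs_elim n K (gs n M K) K K"
  have new: "dotp n (gs n M (Suc K) K) v = dotp n (\<lambda>l. ?r l / sqrt (dotp n ?r ?r)) v" for v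
    by (rule dotp_cong) (auto simp: gs_norm_def)
  have new': "dotp n v (gs n M (Suc K) K) = dotp n v (\<lambda>l. ?r l / sqrt (dotp n ?r ?r))" for v
    by (rule dotp_cong) (auto simp: gs_norm_def)
  have old: "gs n M (Suc K) i = ?G i" if "i < K" for i
    using that by (simp add: gs_norm_def gs_elim_other)
  have o: "dotp n ?r (?G i) = 0" if "i < K" for i
    by (rule gs_elim_ortho) (use Suc that in auto)
  show ?case
  proof (intro conjI allI impI)
    fix i j assume ij: "i < Suc K" "j < Suc K" "i \<noteq> j"
    then consider "i < K" "j < K" | "i = K" "j < K" | "j = K" "i < K" by linarith
    then show "dotp n (gs n M (Suc K) i) (gs n M (Suc K) j) = 0"
    proof cases
      case 1
      then show ?thesis using Suc ij by (simp only: old) auto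
    next
      case 2
      then show ?thesis using o[of j] by (simp only: new old) (simp add: dotp_simps)
    next
      case 3
      then show ?thesis using o[of i] by (simp only: new' old) (simp add: dotp_simps dotp_commute)
    qed
  next
    fix i assume i: "i < Suc K"
    show "dotp n (gs n M (Suc K) i) (gs n M (Suc K) i) \<in> {0, 1}"
    proof (cases "i = K")
      case True
      then show ?thesis by (simp only: new new' dotp_normalize) simp
    next
      case False
      then show ?thesis using i Suc by (metis (no_types, lifting) less_SucE old Suc_leD)
    qed
  qed
qed simp

lemma gs_stable: "k < K \<Longrightarrow> K \<le> K' \<Longrightarrow> gs n M K' k = gs n M K k"
proof (induction K')
  case (Suc K')
  then show ?case by (cases "K = Suc K'") (auto simp: gs_norm_def gs_elim_other)
qed simp

text \<open>The two span relations move a combination of samples to the orthonormal frame and back.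
  The last conclusion confines degeneracy to the event that a row depends on its predecessors, which
  has probability zero for Gaussian rows.\<close>

lemma gs_span:
  assumes "k < K"
  shows "in_span n K (gs n M K) (M k)" "in_span n K M (gs n M K k)"
    and "dotp n (gs n M K k) (gs n M K k) = 0 \<Longrightarrow> in_span n k M (M k)"
proof -
  have main: "(\<forall>k<K. in_span n K (gs n M K) (M k) \<and> in_span n K M (gs n M K k)) \<and>
    (\<forall>k<K. dotp n (gs n M K k) (gs n M K k) = 0 \<longrightarrow> in_span n k M (M k))"
  proof (induction K)
    case (Suc K)
    let ?G = "gs n M K" and ?r = "gs_elim n K (gs n M K) K K"
    let ?s = "sqrt (dotp n ?r ?r)"
    have old: "gs n M (Suc K) i = ?G i" if "i < K" for i
      using that by (simp add: gs_norm_def gs_elim_other)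
    have new: "gs n M (Suc K) K l = ?r l / ?s" if "l < n" for l
      using that by (simp add: gs_norm_def)
    obtain c where c: "\<forall>l<n. ?r l = M K l - (\<Sum>j<K. c j * ?G j l)"
      using gs_elim_span[of K K n ?G] gs_later[of K K n M] by auto
    have sum: "in_span n K ?G (\<lambda>l. \<Sum>j<K. c j * ?G j l)" unfolding in_span_def by blast
    have lift: "in_span n (Suc K) (gs n M (Suc K)) v" if "in_span n K ?G v" for v
      by (rule in_span_trans[OF that]) (metis old in_span_base less_SucI)
    have GM: "in_span n K M v" if "in_span n K ?G v" for v
      by (rule in_span_trans[OF that]) (use Suc in auto)
    \<comment> \<open>The normalisation can be undone even when the norm vanishes, since then the
      residual itself is zero.\<close>
    have rs: "?r l = ?s * gs n M (Suc K) K l" if "l < n" for l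
      using that new[OF that] dotp_self_eq_0[of n ?r] by auto
    have 1: "in_span n (Suc K) (gs n M (Suc K)) (M K)"
      by (rule in_span_lin[OF in_span_base[of K "Suc K"] lift[OF sum], of _ ?s 1])
        (use c rs in \<open>auto simp: algebra_simps\<close>)
    have 2: "in_span n (Suc K) M (gs n M (Suc K) K)"
      by (rule in_span_lin[OF in_span_base[of K "Suc K"] in_span_mono[OF GM[OF sum]], of _ "1 / ?s" "- 1 / ?s"])
        (use c new in \<open>auto simp: diff_divide_distrib\<close>)
    have 3: "in_span n K M (M K)" if "dotp n (gs n M (Suc K) K) (gs n M (Suc K) K) = 0"
    proof -
      have "\<forall>l<n. ?r l = 0" using that rs by (simp add: dotp_self_eq_0 del: gs.simps)
      then have "\<And>l. l < n \<Longrightarrow> M K l = (\<Sum>j<K. c j * ?G j l)" using c by auto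
      then have "in_span n K ?G (M K)" unfolding in_span_def by blast
      then show ?thesis by (rule GM)
    qed
    show ?case
    proof (intro conjI allI impI)
      fix k assume k: "k < Suc K"
      show "in_span n (Suc K) (gs n M (Suc K)) (M k)"
        using k 1 Suc lift[of "M k"] by (cases "k = K") (auto simp del: gs.simps)
      show "in_span n (Suc K) M (gs n M (Suc K) k)"
      proof (cases "k = K")
        case False
        then have "in_span n K M (?G k)" using k Suc by auto
        then show ?thesis using False k old[of k] in_span_mono[of n K M _ "Suc K"] by (simp del: gs.simps)
      qed (use 2 in auto)
      assume "dotp n (gs n M (Suc K) k) (gs n M (Suc K) k) = 0"
      then show "in_span n k M (M k)"
        using 3 k Suc old[of k] by (cases "k = K") (auto simp del: gs.simps)
    qed
  qed simp
  from main assms show "in_span n K (gs n M K) (M k)" "in_span n K M (gs n M K k)"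
    "dotp n (gs n M K k) (gs n M K k) = 0 \<Longrightarrow> in_span n k M (M k)" by auto
qed

text \<open>Gram-Schmidt uses only inner products and linear combinations of rows, so it commutes
  with a linear isometry applied to all of them.\<close>

lemma gs_equivariant:
  assumes T: "\<And>u v w a. (\<And>l. l < n \<Longrightarrow> w l = u l - a * v l) \<Longrightarrow> \<forall>l<n. T w l = T u l - a * T v l"
    and scale: "\<And>u w a. (\<And>l. l < n \<Longrightarrow> w l = u l / a) \<Longrightarrow> \<forall>l<n. T w l = T u l / a"
    and iso: "\<And>u v. dotp n (T u) (T v) = dotp n u v"
    and M: "\<And>k l. k < n \<Longrightarrow> l < n \<Longrightarrow> M' k l = T (M k) l"
    and kl: "k < n" "l < n" "K \<le> n"
  shows "gs n M' K k l = T (gs n M K k) l"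
proof -
  have el: "\<forall>k<n. \<forall>l<n. gs_elim n K B' j k l = T (gs_elim n K B j k) l"
    if B: "\<And>k l. k < n \<Longrightarrow> l < n \<Longrightarrow> B' k l = T (B k) l" and K: "K < n" "j \<le> n" for B B' j K
    using K(2)
  proof (induction j)
    case (Suc j)
    have "dotp n (gs_elim n K B' j K) (gs_elim n K B' j j) = dotp n (T (gs_elim n K B j K)) (T (gs_elim n K B j j))"
      using Suc K by (intro dotp_cong) auto
    then have d: "dotp n (gs_elim n K B' j K) (gs_elim n K B' j j) = dotp n (gs_elim n K B j K) (gs_elim n K B j j)"
      by (simp add: iso)
    have "\<forall>l<n. T (gs_elim n K B (Suc j) K) l = T (gs_elim n K B j K) l -
      dotp n (gs_elim n K B j K) (gs_elim n K B j j) * T (gs_elim n K B j j) l"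
      by (rule T) simp
    then show ?case using Suc K d by auto
  qed (simp add: B)
  have "\<forall>k<n. \<forall>l<n. gs n M' K k l = T (gs n M K k) l"
    using kl(3)
  proof (induction K)
    case (Suc K)
    let ?B' = "gs_elim n K (gs n M' K) K" and ?B = "gs_elim n K (gs n M K) K"
    have B: "\<forall>k<n. \<forall>l<n. ?B' k l = T (?B k) l"
      using Suc by (intro el) auto
    then have "dotp n (?B' K) (?B' K) = dotp n (T (?B K)) (T (?B K))"
      using Suc by (intro dotp_cong) auto
    then have d: "dotp n (?B' K) (?B' K) = dotp n (?B K) (?B K)" by (simp add: iso)
    have "\<forall>l<n. T (gs_norm n K ?B K) l = T (?B K) l / sqrt (dotp n (?B K) (?B K))"
      by (rule scale) (simp add: gs_norm_def)
    then show ?case using B d by (auto simp: gs_norm_def)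
  qed (simp add: M)
  with kl show ?thesis by auto
qed

text \<open>With orthonormal columns, \<open>P\<close>, the product of the matrix and its transpose,
  is a symmetric projection of trace \<open>n\<close>. Hence the squared Frobenius norm of the
  identity minus \<open>P\<close> equals the trace of that difference, which is 0.\<close>

lemma ortho_transpose:
  fixes n :: nat
  assumes "ortho {..<n} a"
  shows "ortho {..<n} (\<lambda>i j. a j i)"
proof -
  define P where "P i j = (\<Sum>k<n. a i k * a j k)" for i j
  have col: "(\<Sum>i<n. a i j * a i k) = (if j = k then 1 else 0)" if "j < n" "k < n" for j k
    using assms that by (auto simp: ortho_def)
  have PP: "(\<Sum>j<n. P i j * P k j) = P i k" if "i < n" "k < n" for i k
  proof -
    have "(\<Sum>j<n. P i j * P k j) = (\<Sum>j<n. \<Sum>p<n. \<Sum>q<n. a i p * a j p * (a k q * a j q))"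
      by (simp add: P_def sum_product)
    also have "\<dots> = (\<Sum>p<n. \<Sum>q<n. \<Sum>j<n. a i p * a j p * (a k q * a j q))"
      by (subst sum.swap) (intro sum.cong refl sum.swap)
    also have "\<dots> = (\<Sum>p<n. \<Sum>q<n. a i p * a k q * (\<Sum>j<n. a j p * a j q))"
      by (simp add: sum_distrib_left mult_ac)
    also have "\<dots> = (\<Sum>p<n. \<Sum>q<n. if p = q then a i p * a k q else 0)"
      by (intro sum.cong refl) (auto simp: col)
    also have "\<dots> = P i k" unfolding P_def by (intro sum.cong refl) (subst sum.delta', auto)
    finally show ?thesis .
  qed
  have tr: "(\<Sum>i<n. P i i) = real n"
  proof -
    have "(\<Sum>i<n. P i i) = (\<Sum>k<n. \<Sum>i<n. a i k * a i k)"
      unfolding P_def by (rule sum.swap)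
    also have "\<dots> = (\<Sum>k<n. 1)" by (intro sum.cong refl) (simp add: col)
    finally show ?thesis by simp
  qed
  define e where "e i j = (if i = j then 1 else 0 :: real)" for i j :: nat
  have es: "(\<Sum>j<n. e i j * f j) = f i" if "i < n" for i f
  proof -
    have "(\<Sum>j<n. e i j * f j) = (\<Sum>j<n. if i = j then f j else 0)"
      by (intro sum.cong) (auto simp: e_def)
    also have "\<dots> = f i" using that by (subst sum.delta') auto
    finally show ?thesis .
  qed
  have "(\<Sum>i<n. \<Sum>j<n. (e i j - P i j)\<^sup>2) = (\<Sum>i<n. 1 - P i i)"
  proof (intro sum.cong refl)
    fix i assume i: "i \<in> {..<n}"
    have "(\<Sum>j<n. (e i j - P i j)\<^sup>2) = (\<Sum>j<n. e i j * e i j) - 2 * (\<Sum>j<n. e i j * P i j) + (\<Sum>j<n. P i j * P i j)"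
      by (simp add: power2_eq_square algebra_simps sum.distrib sum_subtractf sum_distrib_left)
    also have "\<dots> = 1 - P i i" using i by (simp only: es PP lessThan_iff) (simp add: e_def)
    finally show "(\<Sum>j<n. (e i j - P i j)\<^sup>2) = 1 - P i i" .
  qed
  also have "\<dots> = 0" by (simp add: sum_subtractf tr)
  finally have "\<forall>i<n. \<forall>j<n. e i j = P i j"
    by (auto simp: sum_nonneg_eq_0_iff sum_nonneg)
  then show ?thesis by (auto simp: ortho_def P_def e_def)
qed

lemma ortho_norm:
  fixes n :: nat
  assumes "ortho {..<n} a"
  shows "(\<Sum>i<n. (\<Sum>j<n. a i j * x j)\<^sup>2) = (\<Sum>j<n. (x j)\<^sup>2)"
proof -
  have "(\<Sum>i<n. (\<Sum>j<n. a i j * x j)\<^sup>2) = (\<Sum>i<n. \<Sum>j<n. \<Sum>k<n. (a i j * x j) * (a i k * x k))"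
    by (simp add: power2_eq_square sum_product)
  also have "\<dots> = (\<Sum>j<n. \<Sum>k<n. \<Sum>i<n. (a i j * x j) * (a i k * x k))"
    by (subst sum.swap) (intro sum.cong refl sum.swap)
  also have "\<dots> = (\<Sum>j<n. \<Sum>k<n. x j * x k * (\<Sum>i<n. a i j * a i k))"
    by (simp add: sum_distrib_left mult_ac)
  also have "\<dots> = (\<Sum>j<n. \<Sum>k<n. if j = k then x j * x k else 0)"
    using assms by (intro sum.cong refl) (auto simp: ortho_def)
  also have "\<dots> = (\<Sum>j<n. (x j)\<^sup>2)" by (intro sum.cong refl) (subst sum.delta', auto simp: power2_eq_square)
  finally show ?thesis .
qed

lemma gs_orthonormal:
  assumes "\<And>k. k < n \<Longrightarrow> dotp n (gs n M n k) (gs n M n k) \<noteq> 0"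
  shows "ortho {..<n} (\<lambda>i k. gs n M n k i)"
  unfolding ortho_def
proof (intro ballI)
  fix j k assume jk: "j \<in> {..<n}" "k \<in> {..<n}"
  have "dotp n (gs n M n j) (gs n M n k) = (if j = k then 1 else 0)"
    using gs_ortho[of n n M] assms[of j] jk by auto
  then show "(\<Sum>i<n. gs n M n j i * gs n M n k i) = (if j = k then 1 else 0)" by (simp add: dotp_def)
qed

text \<open>Fewer than \<open>n\<close> vectors have a common normal: average the squared distances of the unit vectors
  from their span.\<close>

lemma ex_normal:
  assumes "k < n"
  shows "\<exists>u. dotp n u u \<noteq> 0 \<and> (\<forall>v. in_span n k M v \<longrightarrow> dotp n u v = 0)"
proof -
  define q where "q = gs n M k"
  have qo: "dotp n (q i) (q j) = 0" if "i < k" "j < k" "i \<noteq> j" for i j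
    using gs_ortho[of k n M] that assms by (auto simp: q_def)
  have qn: "dotp n (q i) (q i) \<in> {0, 1}" if "i < k" for i
    using gs_ortho[of k n M] that assms by (auto simp: q_def)
  have "(\<Sum>i<n. 1 - (\<Sum>j<k. (q j i)\<^sup>2)) = real n - (\<Sum>j<k. dotp n (q j) (q j))"
    by (simp add: sum_subtractf dotp_self) (rule sum.swap)
  also have "(\<Sum>j<k. dotp n (q j) (q j)) \<le> (\<Sum>j<k. 1)"
    by (intro sum_mono) (use qn in fastforce)
  then have "real n - (\<Sum>j<k. dotp n (q j) (q j)) > 0" using assms by simp
  finally obtain i where i: "i < n" "1 - (\<Sum>j<k. (q j i)\<^sup>2) \<noteq> 0"
    by (metis (no_types, lifting) lessThan_iff less_irrefl sum.neutral)
  define u where "u l = (if l = i then 1 else 0) - (\<Sum>j<k. q j i * q j l)" for l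
  have e: "dotp n (\<lambda>l. if l = i then 1 else 0) v = v i" for v
  proof -
    have "dotp n (\<lambda>l. if l = i then 1 else 0) v = (\<Sum>l<n. if l = i then v l else 0)"
      unfolding dotp_def by (intro sum.cong) auto
    then show ?thesis using i by simp
  qed
  have uv: "dotp n u v = v i - (\<Sum>j<k. q j i * dotp n (q j) v)" for v
    unfolding u_def by (simp add: dotp_simps dotp_sum e)
  have uq: "dotp n u (q j) = 0" if "j < k" for j
  proof -
    have "(\<Sum>j'<k. q j' i * dotp n (q j') (q j)) = (\<Sum>j'<k. if j' = j then q j i * dotp n (q j) (q j) else 0)"
      using that qo by (intro sum.cong) auto
    also have "\<dots> = q j i * dotp n (q j) (q j)" using that by simp
    also have "\<dots> = q j i"
      using qn[OF that] dotp_self_eq_0[of n "q j"] i by auto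
    finally show ?thesis by (simp add: uv)
  qed
  have "dotp n u u = u i - (\<Sum>j<k. q j i * dotp n (q j) u)" by (rule uv)
  also have "\<dots> = 1 - (\<Sum>j<k. (q j i)\<^sup>2)"
    using uq by (simp add: dotp_commute[of n _ u] u_def power2_eq_square)
  finally have "dotp n u u \<noteq> 0" using i by simp
  moreover have "dotp n u v = 0" if "in_span n k M v" for v
  proof -
    have "in_span n k q v"
      by (rule in_span_trans[OF that]) (simp add: q_def gs_span(1))
    then obtain c where "\<forall>l<n. v l = (\<Sum>j<k. c j * q j l)" unfolding in_span_def by blast
    then have "dotp n u v = dotp n u (\<lambda>l. \<Sum>j<k. c j * q j l)" by (intro dotp_cong) auto
    also have "\<dots> = 0" using uq by (simp add: dotp_sum dotp_simps)
    finally show ?thesis .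
  qed
  ultimately show ?thesis by blast
qed

section \<open>The window reflections\<close>

text \<open>\<open>m = r * r\<close> gives the vector of height \<open>1 / r\<close> on a window
  unit length. By \<open>fit\<close> the \<open>n - N\<close> windows are disjoint and lie among the
  first \<open>N\<close> coordinates, away from the basis vectors they are exchanged with.\<close>

locale windows =
  fixes n N m r :: nat
  assumes m: "m = r * r" and r: "0 < r" and N: "N \<le> n" and fit: "(n - N) * m \<le> N"
begin

lemma m_pos: "0 < m" using m r by simp

lemma window_le: "j < n - N \<Longrightarrow> j * m + m \<le> N"
proof -
  assume "j < n - N"
  then have "Suc j * m \<le> (n - N) * m" by (intro mult_le_mono1) auto
  with fit show ?thesis by simp
qed

lemma sum_split_window:
  fixes f :: "nat \<Rightarrow> real"
  assumes "j < n - N"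
  shows "(\<Sum>k<n. f k) = f (N + j) + (\<Sum>i<m. f (j * m + i)) + (\<Sum>k\<in>{..<n} - insert (N + j) {j * m..<j * m + m}. f k)"
proof -
  have w: "j * m + m \<le> N" using assms by (rule window_le)
  have sub: "insert (N + j) {j * m..<j * m + m} \<subseteq> {..<n}" using w assms by auto
  have "(\<Sum>k<n. f k) = (\<Sum>k\<in>insert (N + j) {j * m..<j * m + m}. f k) +
      (\<Sum>k\<in>{..<n} - insert (N + j) {j * m..<j * m + m}. f k)"
    by (subst add.commute, rule sum.subset_diff[OF sub]) simp
  also have "(\<Sum>k\<in>insert (N + j) {j * m..<j * m + m}. f k) = f (N + j) + (\<Sum>k\<in>{j * m..<j * m + m}. f k)"
    using w by (subst sum.insert) auto
  also have "(\<Sum>k\<in>{j * m..<j * m + m}. f k) = (\<Sum>i<m. f (j * m + i))"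
    by (rule sum.reindex_bij_witness[of _ "\<lambda>i. j * m + i" "\<lambda>k. k - j * m"]) auto
  finally show ?thesis .
qed

text \<open>The window gains \<open>2 * (s / r) * S + s\<^sup>2\<close>, which is what the entry
  \<open>N + j\<close> loses, because \<open>s\<close> is that entry minus
  \<open>S / r\<close>.\<close>

lemma refl_step_norm:
  assumes "j < n - N"
  shows "(\<Sum>k<n. (refl_step N m r j v k)\<^sup>2) = (\<Sum>k<n. (v k)\<^sup>2)"
proof -
  have w: "j * m + m \<le> N" using assms by (rule window_le)
  define S where "S = (\<Sum>i<m. v (j * m + i))"
  define s where "s = v (N + j) - S / real r"
  have s: "refl_amount N m r j v = s" by (simp add: refl_amount_def s_def S_def)
  have "(\<Sum>i<m. (refl_step N m r j v (j * m + i))\<^sup>2) = (\<Sum>i<m. (v (j * m + i) + s / r)\<^sup>2)"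
    using w by (intro sum.cong refl) (auto simp: refl_step_def s)
  also have "\<dots> = (\<Sum>i<m. (v (j * m + i))\<^sup>2) + 2 * (s / r) * S + real m * (s / r)\<^sup>2"
    by (simp add: power2_sum sum.distrib S_def sum_distrib_left mult_ac)
  also have "real m * (s / r)\<^sup>2 = s\<^sup>2" using r by (simp add: m power2_eq_square)
  finally have 1: "(\<Sum>i<m. (refl_step N m r j v (j * m + i))\<^sup>2) =
      (\<Sum>i<m. (v (j * m + i))\<^sup>2) + 2 * (s / r) * S + s\<^sup>2" .
  have 2: "(refl_step N m r j v (N + j))\<^sup>2 = (v (N + j) - s)\<^sup>2" by (simp add: refl_step_def s)
  have 3: "(\<Sum>k\<in>{..<n} - insert (N + j) {j * m..<j * m + m}. (refl_step N m r j v k)\<^sup>2) =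
    (\<Sum>k\<in>{..<n} - insert (N + j) {j * m..<j * m + m}. (v k)\<^sup>2)"
    by (intro sum.cong refl) (auto simp: refl_step_def)
  have "(v (N + j) - s)\<^sup>2 + 2 * (s / r) * S + s\<^sup>2 = (v (N + j))\<^sup>2 - 2 * s * (v (N + j) - S / r) + 2 * s\<^sup>2"
    by (simp add: power2_eq_square algebra_simps)
  also have "\<dots> = (v (N + j))\<^sup>2" unfolding s_def[symmetric] by (simp add: power2_eq_square)
  finally show ?thesis
    unfolding sum_split_window[OF assms] 1 2 3 by simp
qed

lemma reflect_norm:
  "j \<le> n - N \<Longrightarrow> (\<Sum>k<n. (reflect N m r j v k)\<^sup>2) = (\<Sum>k<n. (v k)\<^sup>2)"
  by (induction j) (auto simp: refl_step_norm)

lemma refl_step_linear: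
  "refl_step N m r j (\<lambda>k. a * u k + b * v k) = (\<lambda>k. a * refl_step N m r j u k + b * refl_step N m r j v k)"
proof -
  have "refl_amount N m r j (\<lambda>k. a * u k + b * v k) = a * refl_amount N m r j u + b * refl_amount N m r j v"
    by (simp add: refl_amount_def sum.distrib sum_distrib_left[symmetric] add_divide_distrib algebra_simps)
  then show ?thesis by (auto simp: refl_step_def fun_eq_iff add_divide_distrib algebra_simps)
qed

lemma reflect_linear:
  "reflect N m r j (\<lambda>k. a * u k + b * v k) = (\<lambda>k. a * reflect N m r j u k + b * reflect N m r j v k)"
  by (induction j) (auto simp: refl_step_linear)

lemma reflect_sum:
  assumes "finite I"
  shows "reflect N m r j (\<lambda>k. \<Sum>i\<in>I. c i * f i k) = (\<lambda>k. \<Sum>i\<in>I. c i * reflect N m r j (f i) k)"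
  using assms
proof (induction I rule: finite_induct)
  case empty
  show ?case using reflect_linear[of j 0 _ 0] by simp
next
  case (insert x F)
  then show ?case using reflect_linear[of j "c x" "f x" 1 "\<lambda>k. \<Sum>i\<in>F. c i * f i k"] by simp
qed

lemma reflect_cong:
  assumes "j \<le> n - N" "\<And>k. k < n \<Longrightarrow> u k = v k"
  shows "k < n \<Longrightarrow> reflect N m r j u k = reflect N m r j v k"
  using assms(1)
proof (induction j arbitrary: k)
  case (Suc j)
  have w: "j * m + m \<le> N" using Suc.prems by (intro window_le) simp
  have "(\<Sum>i<m. reflect N m r j u (j * m + i)) = (\<Sum>i<m. reflect N m r j v (j * m + i))"
    using w Suc N by (intro sum.cong refl) auto
  moreover have "reflect N m r j u (N + j) = reflect N m r j v (N + j)" using Suc by auto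
  ultimately have "refl_amount N m r j (reflect N m r j u) = refl_amount N m r j (reflect N m r j v)"
    by (simp add: refl_amount_def)
  then show ?case using Suc by (auto simp: refl_step_def)
qed (use assms in auto)

text \<open>For a vector supported beyond \<open>N\<close> the sum over an untouched window is 0, so
  each reflection moves one tail entry entirely into its window, spread evenly. The window
  containing \<open>k\<close> is \<open>k div m\<close>. This flatness is the source of the large
  quadratic form.\<close>

lemma reflect_tail:
  assumes "\<And>k. k < N \<Longrightarrow> v k = 0" "J \<le> n - N"
  shows "reflect N m r J v k = (if k < J * m then v (N + k div m) / r
    else if k < N then 0 else if k < N + J then 0 else v k)"
  using assms(2)
proof (induction J arbitrary: k)
  case (Suc J)
  have w: "J * m + m \<le> N" using Suc.prems by (intro window_le) simp
  have s: "refl_amount N m r J (reflect N m r J v) = v (N + J)"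
    using Suc w by (simp add: refl_amount_def)
  show ?case
  proof (cases "J * m \<le> k \<and> k < J * m + m")
    case True
    then have "k div m = J" using m_pos by (metis add.commute div_nat_eqI mult.commute mult_Suc)
    then show ?thesis using True Suc w by (auto simp: refl_step_def s)
  next
    case False
    then show ?thesis using Suc w by (auto simp: refl_step_def s)
  qed
qed (use assms in auto)

end

section \<open>Haar measure on the orthogonal group\<close>

lemma emeasure_normal_singleton: "emeasure (normal_law 1) {x} = 0"
  unfolding normal_law_def by (subst emeasure_density) (auto simp: nn_integral_cmult_indicator)

lemma nn_integral_gauss_fold:
  assumes "I \<inter> J = {}" "finite I" "finite J" and f: "f \<in> borel_measurable (gauss (I \<union> J))"
  shows "(\<integral>\<^sup>+x. f x \<partial>gauss (I \<union> J)) = (\<integral>\<^sup>+x. \<integral>\<^sup>+y. f (merge I J (x, y)) \<partial>gauss J \<partial>gauss I)"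
  using assms unfolding gauss_def by (rule gauss_pf.product_nn_integral_fold)

lemma nn_integral_gauss_insert:
  assumes "finite I" "i \<notin> I" and f: "f \<in> borel_measurable (gauss (insert i I))"
  shows "(\<integral>\<^sup>+x. f x \<partial>gauss (insert i I)) = (\<integral>\<^sup>+x. \<integral>\<^sup>+y. f (x(i := y)) \<partial>normal_law 1 \<partial>gauss I)"
  using assms unfolding gauss_def by (rule gauss_pf.product_nn_integral_insert)

lemma measurable_merge_gauss:
  "I \<inter> J = {} \<Longrightarrow> (\<lambda>(x, y). merge I J (x, y)) \<in> measurable (gauss I \<Otimes>\<^sub>M gauss J) (gauss (I \<union> J))"
  unfolding gauss_def using measurable_merge[of I J "\<lambda>_. normal_law 1"] by (simp add: case_prod_beta)

text \<open>With all coordinates but \<open>i\<close> fixed, the hyperplane leaves a single value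
  for the remaining one.\<close>

lemma gauss_hyperplane_null:
  assumes J: "finite J" and w: "i \<in> J" "w i \<noteq> 0"
  shows "AE g in gauss J. (\<Sum>j\<in>J. w j * g j) \<noteq> 0"
proof -
  define J' where "J' = J - {i}"
  have J': "J = insert i J'" "finite J'" "i \<notin> J'" using assms by (auto simp: J'_def)
  define B where "B = {g \<in> space (gauss J). (\<Sum>j\<in>J. w j * g j) = 0}"
  have B [measurable]: "B \<in> sets (gauss J)" unfolding B_def by measurable
  have "emeasure (gauss J) B = (\<integral>\<^sup>+g. indicator B g \<partial>gauss J)" by simp
  also have "\<dots> = (\<integral>\<^sup>+z. \<integral>\<^sup>+x. indicator B (z(i := x)) \<partial>normal_law 1 \<partial>gauss J')"
    using B unfolding J'(1) by (intro nn_integral_gauss_insert J') auto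
  also have "\<dots> = (\<integral>\<^sup>+z. 0 \<partial>gauss J')"
  proof (rule nn_integral_cong)
    fix z assume z: "z \<in> space (gauss J')"
    define c where "c = (\<Sum>j\<in>J'. w j * z j)"
    have "(\<integral>\<^sup>+x. indicator B (z(i := x)) \<partial>normal_law 1) \<le> (\<integral>\<^sup>+x. indicator {- c / w i} x \<partial>normal_law 1)"
    proof (rule nn_integral_mono)
      fix x :: real
      have "(\<Sum>j\<in>J. w j * (z(i := x)) j) = w i * x + c"
        unfolding J'(1) c_def using J' by (auto intro!: sum.cong)
      then show "indicator B (z(i := x)) \<le> (indicator {- c / w i} x :: ennreal)"
        using w by (auto simp: B_def indicator_def field_simps)
    qed
    also have "\<dots> = 0" by (simp add: emeasure_normal_singleton)
    finally show "(\<integral>\<^sup>+x. indicator B (z(i := x)) \<partial>normal_law 1) = 0" by simp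
  qed
  finally have "B \<in> null_sets (gauss J)" by (auto simp: B)
  then show ?thesis by (rule AE_I') (auto simp: B_def)
qed

lemma measurable_gs:
  assumes "\<And>k l. (\<lambda>z. f z k l) \<in> borel_measurable M"
  shows "(\<lambda>z. gs n (f z) K k l) \<in> borel_measurable M"
proof -
  have el: "(\<lambda>z. gs_elim n K (g z) j k l) \<in> borel_measurable M"
    if "\<And>k l. (\<lambda>z. g z k l) \<in> borel_measurable M" for g K j k l
  proof (induction j arbitrary: k l)
    case (Suc j)
    show ?case
      by (cases "k = K"; cases "l < n")
        (simp_all add: dotp_def Suc borel_measurable_diff borel_measurable_times borel_measurable_sum)
  qed (simp add: that)
  show ?thesis
  proof (induction K arbitrary: k l)
    case (Suc K)
    have m: "(\<lambda>z. gs_elim n K (gs n (f z) K) K k l) \<in> borel_measurable M" for k l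
      by (rule el) (rule Suc)
    show ?case
      by (cases "k = K"; cases "l < n")
        (simp_all add: dotp_def gs_norm_def m borel_measurable_divide borel_measurable_times borel_measurable_sum
          measurable_compose[OF _ borel_measurable_sqrt])
  qed (simp add: assms)
qed

abbreviation sq :: "nat \<Rightarrow> (nat \<times> nat) set" where
  "sq n \<equiv> {..<n} \<times> {..<n}"

text \<open>Each row has its own linear map, so that one nondegeneracy statement serves both the
  null frame and the planted one, in which only the first \<open>N\<close> rows are
  transformed.\<close>

definition row_map :: "nat \<Rightarrow> (nat \<Rightarrow> nat \<Rightarrow> nat \<Rightarrow> real) \<Rightarrow> (nat \<times> nat \<Rightarrow> real) \<Rightarrow> nat \<Rightarrow> nat \<Rightarrow> real" where
  "row_map n B G k l = (if k < n \<and> l < n then \<Sum>i<n. B k l i * G (k, i) else 0)"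

lemma measurable_row_map [measurable]: "(\<lambda>G. row_map n B G k l) \<in> borel_measurable (gauss (sq n))"
proof (cases "k < n \<and> l < n")
  case True
  then have "(\<lambda>G. \<Sum>i<n. B k l i * G (k, i)) \<in> borel_measurable (gauss (sq n))"
    by (intro borel_measurable_sum borel_measurable_times borel_measurable_const measurable_gauss_component) auto
  moreover have "(\<lambda>G. row_map n B G k l) = (\<lambda>G. \<Sum>i<n. B k l i * G (k, i))"
    using True by (simp add: row_map_def)
  ultimately show ?thesis by (simp only:)
next
  case False
  then have "(\<lambda>G. row_map n B G k l) = (\<lambda>G. 0)" by (auto simp: row_map_def)
  then show ?thesis by (simp only: borel_measurable_const)
qed

text \<open>Independent Gaussian rows are almost surely linearly independent: given the earlier rows, the next
  one avoids the hyperplane orthogonal to a common normal of them.\<close>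

lemma AE_gs_nonzero:
  assumes B: "\<And>k u. k < n \<Longrightarrow> dotp n u u \<noteq> 0 \<Longrightarrow> \<exists>i<n. (\<Sum>l<n. u l * B k l i) \<noteq> 0"
  shows "AE G in gauss (sq n). \<forall>k<n. dotp n (gs n (row_map n B G) n k) (gs n (row_map n B G) n k) \<noteq> 0"
proof -
  have "AE G in gauss (sq n). dotp n (gs n (row_map n B G) n k) (gs n (row_map n B G) n k) \<noteq> 0" if k: "k < n" for k
  proof -
    define J where "J = {k} \<times> {..<n}"
    define I where "I = sq n - J"
    have IJ: "I \<inter> J = {}" "finite I" "finite J" "sq n = I \<union> J" using k by (auto simp: I_def J_def)
    define E where "E = {G \<in> space (gauss (sq n)). dotp n (gs n (row_map n B G) n k) (gs n (row_map n B G) n k) = 0}"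
    have E [measurable]: "E \<in> sets (gauss (sq n))" 
    proof -
      have "(\<lambda>G. gs n (row_map n B G) n k l) \<in> borel_measurable (gauss (sq n))" for l
        by (rule measurable_gs) (rule measurable_row_map)
      then show ?thesis unfolding E_def dotp_def by measurable
    qed
    have "emeasure (gauss (sq n)) E = (\<integral>\<^sup>+G. indicator E G \<partial>gauss (sq n))" by simp
    also have "\<dots> = (\<integral>\<^sup>+x. \<integral>\<^sup>+y. indicator E (merge I J (x, y)) \<partial>gauss J \<partial>gauss I)"
      using E unfolding IJ(4) by (intro nn_integral_gauss_fold IJ) auto
    also have "\<dots> = (\<integral>\<^sup>+x. 0 \<partial>gauss I)"
    proof (rule nn_integral_cong)
      fix x assume x: "x \<in> space (gauss I)"
      \<comment> \<open>Rows before \<open>k\<close> do not involve the block \<open>y\<close>, so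
        they may be computed with this filler; their common normal \<open>u\<close> is thus
        independent of row \<open>k\<close>.\<close>
      define y0 where "y0 = (\<lambda>_ :: nat \<times> nat. 0 :: real)"
      define V where "V = row_map n B (merge I J (x, y0))"
      obtain u where u: "dotp n u u \<noteq> 0" "\<And>v. in_span n k V v \<Longrightarrow> dotp n u v = 0"
        using ex_normal[OF k, of V] by blast
      define w where "w p = (\<Sum>l<n. u l * B k l (snd p))" for p :: "nat \<times> nat"
      obtain i where i: "i < n" "w (k, i) \<noteq> 0" using B[OF k u(1)] by (auto simp: w_def)
      have ae: "AE y in gauss J. (\<Sum>p\<in>J. w p * y p) \<noteq> 0"
        by (rule gauss_hyperplane_null[of J "(k, i)"]) (use i IJ in \<open>auto simp: J_def\<close>)
      have "AE y in gauss J. indicator E (merge I J (x, y)) = (0 :: ennreal)"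
        using ae
      proof eventually_elim
        case (elim y)
        let ?G = "merge I J (x, y)"
        let ?R = "row_map n B ?G"
        have "dotp n (gs n ?R n k) (gs n ?R n k) \<noteq> 0"
        proof
          assume "dotp n (gs n ?R n k) (gs n ?R n k) = 0"
          then have "in_span n k ?R (?R k)" using gs_span(3)[OF k] by blast
          moreover have "?R j = V j" if "j < k" for j
            using that k by (auto simp: V_def row_map_def fun_eq_iff merge_def I_def J_def intro!: sum.cong)
          ultimately have "in_span n k V (?R k)" by (simp add: in_span_def)
          then have "dotp n u (?R k) = 0" by (rule u)
          also have "dotp n u (?R k) = (\<Sum>l<n. \<Sum>i<n. u l * B k l i * y (k, i))"
            using k by (simp add: dotp_def row_map_def sum_distrib_left mult.assoc merge_def I_def J_def)
          also have "\<dots> = (\<Sum>i<n. w (k, i) * y (k, i))"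
            by (subst sum.swap) (simp add: w_def sum_distrib_right)
          also have "\<dots> = (\<Sum>p\<in>J. w p * y p)"
            unfolding J_def by (rule sum.reindex_bij_witness[of _ snd "\<lambda>i. (k, i)"]) auto
          finally show False using elim by simp
        qed
        then show ?case by (simp add: E_def)
      qed
      then have "(\<integral>\<^sup>+y. indicator E (merge I J (x, y)) \<partial>gauss J) = (\<integral>\<^sup>+y. 0 \<partial>gauss J)"
        by (rule nn_integral_cong_AE)
      then show "(\<integral>\<^sup>+y. indicator E (merge I J (x, y)) \<partial>gauss J) = 0" by simp
    qed
    finally have "E \<in> null_sets (gauss (sq n))" by (auto simp: E)
    then show ?thesis by (rule AE_I') (auto simp: E_def)
  qed
  then show ?thesis by (simp add: AE_all_countable)
qed

definition mm :: "nat \<Rightarrow> (nat \<times> nat \<Rightarrow> real) \<Rightarrow> (nat \<times> nat \<Rightarrow> real) \<Rightarrow> nat \<times> nat \<Rightarrow> real" where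
  "mm n A B = (\<lambda>(i, j)\<in>sq n. \<Sum>k<n. A (i, k) * B (k, j))"

definition transp :: "nat \<Rightarrow> (nat \<times> nat \<Rightarrow> real) \<Rightarrow> nat \<times> nat \<Rightarrow> real" where
  "transp n A = (\<lambda>(i, j)\<in>sq n. A (j, i))"

definition conj_by :: "nat \<Rightarrow> (nat \<times> nat \<Rightarrow> real) \<Rightarrow> (nat \<times> nat \<Rightarrow> real) \<Rightarrow> nat \<times> nat \<Rightarrow> real" where
  "conj_by n B M = (\<lambda>(i, j)\<in>sq n. \<Sum>k<n. \<Sum>l<n. B (i, k) * M (k, l) * B (j, l))"

definition orthm :: "nat \<Rightarrow> (nat \<times> nat \<Rightarrow> real) \<Rightarrow> bool" where
  "orthm n A \<longleftrightarrow> ortho {..<n} (\<lambda>i j. A (i, j))"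

lemma orthm_transp: "orthm n A \<Longrightarrow> orthm n (transp n A)"
  using ortho_transpose[of n "\<lambda>i j. A (i, j)"] by (simp add: orthm_def transp_def ortho_def)

lemma conj_by_mm: "conj_by n (mm n A B) M = conj_by n A (conj_by n B M)"
proof (rule ext)
  fix p :: "nat \<times> nat"
  obtain i j where p: "p = (i, j)" by (cases p)
  show "conj_by n (mm n A B) M p = conj_by n A (conj_by n B M) p"
  proof (cases "i < n \<and> j < n")
    case True
    have "conj_by n A (conj_by n B M) (i, j) =
      (\<Sum>a<n. \<Sum>b<n. A (i, a) * (\<Sum>k<n. \<Sum>l<n. B (a, k) * M (k, l) * B (b, l)) * A (j, b))"
      using True by (simp add: conj_by_def)
    also have "\<dots> = (\<Sum>a<n. \<Sum>b<n. \<Sum>k<n. \<Sum>l<n. A (i, a) * B (a, k) * M (k, l) * (A (j, b) * B (b, l)))"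
      by (simp add: sum_distrib_left sum_distrib_right mult_ac)
    also have "\<dots> = (\<Sum>a<n. \<Sum>k<n. \<Sum>b<n. \<Sum>l<n. A (i, a) * B (a, k) * M (k, l) * (A (j, b) * B (b, l)))"
      by (intro sum.cong refl sum.swap)
    also have "\<dots> = (\<Sum>k<n. \<Sum>a<n. \<Sum>b<n. \<Sum>l<n. A (i, a) * B (a, k) * M (k, l) * (A (j, b) * B (b, l)))"
      by (rule sum.swap)
    also have "\<dots> = (\<Sum>k<n. \<Sum>a<n. \<Sum>l<n. \<Sum>b<n. A (i, a) * B (a, k) * M (k, l) * (A (j, b) * B (b, l)))"
      by (intro sum.cong refl sum.swap)
    also have "\<dots> = (\<Sum>k<n. \<Sum>l<n. \<Sum>a<n. \<Sum>b<n. A (i, a) * B (a, k) * M (k, l) * (A (j, b) * B (b, l)))"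
      by (intro sum.cong refl sum.swap)
    also have "\<dots> = (\<Sum>k<n. \<Sum>l<n. (\<Sum>a<n. A (i, a) * B (a, k)) * M (k, l) * (\<Sum>b<n. A (j, b) * B (b, l)))"
      by (simp add: sum_distrib_left sum_distrib_right mult_ac)
    also have "\<dots> = conj_by n (mm n A B) M (i, j)" using True by (simp add: conj_by_def mm_def)
    finally show ?thesis by (simp add: p)
  qed (auto simp: p conj_by_def)
qed

lemma sets_mat_space_gauss: "sets (mat_space n) = sets (gauss (sq n))"
  by (simp add: mat_space_def sets_gauss)

lemma measurable_matI:
  assumes "\<And>i j. i < n \<Longrightarrow> j < n \<Longrightarrow> (\<lambda>z. f z (i, j)) \<in> borel_measurable M"
    and "\<And>z. z \<in> space M \<Longrightarrow> f z \<in> extensional (sq n)"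
  shows "f \<in> measurable M (mat_space n)"
  unfolding measurable_cong_sets[OF refl sets_mat_space_gauss]
  by (rule measurable_gaussI) (use assms in auto)

lemma measurable_mat_component [measurable]:
  "i < n \<Longrightarrow> j < n \<Longrightarrow> (\<lambda>W. W (i, j)) \<in> borel_measurable (mat_space n)"
  unfolding mat_space_def by (rule measurable_component_singleton) auto

lemma measurable_mat_entry:
  "f \<in> measurable M (mat_space n) \<Longrightarrow> i < n \<Longrightarrow> j < n \<Longrightarrow> (\<lambda>z. f z (i, j)) \<in> borel_measurable M"
  by (rule measurable_compose[OF _ measurable_mat_component])

lemma space_mat_space: "space (mat_space n) = extensional (sq n)"
  by (simp add: mat_space_def space_PiM PiE_def)

lemma measurable_mm [measurable (raw)]:
  assumes [measurable]: "f \<in> measurable M (mat_space n)" "g \<in> measurable M (mat_space n)"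
  shows "(\<lambda>z. mm n (f z) (g z)) \<in> measurable M (mat_space n)"
proof (rule measurable_matI)
  fix i j assume ij: "i < n" "j < n"
  have "(\<lambda>z. mm n (f z) (g z) (i, j)) = (\<lambda>z. \<Sum>k<n. f z (i, k) * g z (k, j))" using ij by (simp add: mm_def)
  moreover have "(\<lambda>z. \<Sum>k<n. f z (i, k) * g z (k, j)) \<in> borel_measurable M"
    by (intro borel_measurable_sum borel_measurable_times measurable_mat_entry) (use assms ij in auto)
  ultimately show "(\<lambda>z. mm n (f z) (g z) (i, j)) \<in> borel_measurable M" by (simp only:)
qed (auto simp: mm_def)

lemma measurable_transp [measurable (raw)]:
  assumes [measurable]: "f \<in> measurable M (mat_space n)"
  shows "(\<lambda>z. transp n (f z)) \<in> measurable M (mat_space n)"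
proof (rule measurable_matI)
  fix i j assume ij: "i < n" "j < n"
  have "(\<lambda>z. transp n (f z) (i, j)) = (\<lambda>z. f z (j, i))" using ij by (simp add: transp_def)
  moreover have "(\<lambda>z. f z (j, i)) \<in> borel_measurable M"
    by (intro borel_measurable_sum borel_measurable_times measurable_mat_entry) (use assms ij in auto)
  ultimately show "(\<lambda>z. transp n (f z) (i, j)) \<in> borel_measurable M" by (simp only:)
qed (auto simp: transp_def)

lemma measurable_conj_by [measurable (raw)]:
  assumes [measurable]: "f \<in> measurable M (mat_space n)" "g \<in> measurable M (mat_space n)"
  shows "(\<lambda>z. conj_by n (f z) (g z)) \<in> measurable M (mat_space n)"
proof (rule measurable_matI)
  fix i j assume ij: "i < n" "j < n"
  have "(\<lambda>z. conj_by n (f z) (g z) (i, j)) = (\<lambda>z. \<Sum>k<n. \<Sum>l<n. f z (i, k) * g z (k, l) * f z (j, l))" using ij by (simp add: conj_by_def)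
  moreover have "(\<lambda>z. \<Sum>k<n. \<Sum>l<n. f z (i, k) * g z (k, l) * f z (j, l)) \<in> borel_measurable M"
    by (intro borel_measurable_sum borel_measurable_times measurable_mat_entry) (use assms ij in auto)
  ultimately show "(\<lambda>z. conj_by n (f z) (g z) (i, j)) \<in> borel_measurable M" by (simp only:)
qed (auto simp: conj_by_def)

text \<open>Transposed on purpose: the Gram-Schmidt rows become columns, so that rotating all
  Gaussian rows multiplies the result from the left.\<close>

definition gs_mat :: "nat \<Rightarrow> (nat \<times> nat \<Rightarrow> real) \<Rightarrow> nat \<times> nat \<Rightarrow> real" where
  "gs_mat n G = (\<lambda>(i, k)\<in>sq n. gs n (\<lambda>k i. if k < n \<and> i < n then G (k, i) else 0) n k i)"

lemma measurable_gs_mat [measurable]: "gs_mat n \<in> measurable (gauss (sq n)) (mat_space n)"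
proof (rule measurable_matI)
  fix i k assume ik: "i < n" "k < n"
  have "(\<lambda>G. if k < n \<and> i < n then G (k, i) else 0) \<in> borel_measurable (gauss (sq n))" for k i
  proof (cases "k < n \<and> i < n")
    case True
    then have "(\<lambda>G. if k < n \<and> i < n then G (k, i) else 0) = (\<lambda>G. G (k, i) :: real)" by simp
    moreover have "(\<lambda>G. G (k, i)) \<in> borel_measurable (gauss (sq n))"
      by (rule measurable_gauss_component) (use True in simp)
    ultimately show ?thesis by (simp only:)
  next
    case False
    then have "(\<lambda>G. if k < n \<and> i < n then G (k, i) else 0) = (\<lambda>G. 0 :: real)" by auto
    then show ?thesis by (simp only: borel_measurable_const)
  qed
  then have gm: "(\<lambda>G. gs n (\<lambda>k i. if k < n \<and> i < n then G (k, i) else 0) n k i) \<in> borel_measurable (gauss (sq n))"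
    by (rule measurable_gs)
  have "(\<lambda>G. gs_mat n G (i, k)) = (\<lambda>G. gs n (\<lambda>k i. if k < n \<and> i < n then G (k, i) else 0) n k i)"
    using ik by (simp add: gs_mat_def)
  with gm show "(\<lambda>G. gs_mat n G (i, k)) \<in> borel_measurable (gauss (sq n))"
    by (simp only:)
qed (auto simp: gs_mat_def)

text \<open>The Haar measure is taken in its concrete form, as the law of an orthonormalised
  Gaussian matrix; the invariances are then proved.\<close>

definition haar :: "nat \<Rightarrow> (nat \<times> nat \<Rightarrow> real) measure" where
  "haar n = distr (gauss (sq n)) (mat_space n) (gs_mat n)"

lemma prob_space_haar: "prob_space (haar n)"
  unfolding haar_def by (rule prob_space.prob_space_distr[OF prob_space_gauss]) measurable

lemma sets_haar [simp, measurable_cong]: "sets (haar n) = sets (mat_space n)"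
  by (simp add: haar_def)

lemma space_haar [simp]: "space (haar n) = space (mat_space n)"
  by (simp add: haar_def)

lemma AE_haar_orthm: "AE Q in haar n. orthm n Q"
proof -
  define B where "B = (\<lambda>(k :: nat) (l :: nat) (i :: nat). if l = i then 1 else 0 :: real)"
  have Bs: "(\<Sum>l<n. u l * B k l i) = u i" if "i < n" for u k i
  proof -
    have "(\<Sum>l<n. u l * B k l i) = (\<Sum>l<n. if l = i then u l else 0)"
      by (intro sum.cong) (auto simp: B_def)
    then show ?thesis using that by simp
  qed
  have "AE G in gauss (sq n). \<forall>k<n. dotp n (gs n (row_map n B G) n k) (gs n (row_map n B G) n k) \<noteq> 0"
  proof (rule AE_gs_nonzero)
    fix k u assume "dotp n u u \<noteq> 0"
    then obtain i where "i < n" "u i \<noteq> 0" by (auto simp: dotp_self_eq_0)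
    then show "\<exists>i<n. (\<Sum>l<n. u l * B k l i) \<noteq> 0" using Bs by auto
  qed
  then have "AE G in gauss (sq n). orthm n (gs_mat n G)"
  proof eventually_elim
    case (elim G)
    have "row_map n B G = (\<lambda>k i. if k < n \<and> i < n then G (k, i) else 0)"
    proof (intro ext)
      fix k l
      have "(\<Sum>i<n. B k l i * G (k, i)) = (\<Sum>i<n. if l = i then G (k, i) else 0)"
        by (intro sum.cong) (auto simp: B_def)
      then show "row_map n B G k l = (if k < n \<and> l < n then G (k, l) else 0)"
        by (auto simp: row_map_def)
    qed
    with elim have "ortho {..<n} (\<lambda>i k. gs n (\<lambda>k i. if k < n \<and> i < n then G (k, i) else 0) n k i)"
      by (intro gs_orthonormal) auto
    then show ?case by (simp add: orthm_def gs_mat_def ortho_def)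
  qed
  moreover have "{Q \<in> space (mat_space n). orthm n Q} \<in> sets (mat_space n)"
    unfolding orthm_def ortho_def
  proof (intro sets.sets_Collect_finite_All)
    fix j k assume jk: "j \<in> {..<n}" "k \<in> {..<n}"
    have "(\<lambda>Q. \<Sum>i<n. Q (i, j) * Q (i, k)) \<in> borel_measurable (mat_space n)"
    proof (rule borel_measurable_sum)
      fix i assume i: "i \<in> {..<n}"
      show "(\<lambda>Q. Q (i, j) * Q (i, k)) \<in> borel_measurable (mat_space n)"
        by (rule borel_measurable_times; rule measurable_mat_component; use i jk in simp)
    qed
    then have m1: "(\<lambda>Q. \<Sum>i<n. Q (i, j) * Q (i, k)) -` {if j = k then 1 else 0} \<inter> space (mat_space n) \<in> sets (mat_space n)"
      by (rule measurable_sets) simp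
    have e1: "(\<lambda>Q. \<Sum>i<n. Q (i, j) * Q (i, k)) -` {if j = k then 1 else 0} \<inter> space (mat_space n) =
        {Q \<in> space (mat_space n). (\<Sum>i<n. Q (i, j) * Q (i, k)) = (if j = k then 1 else 0)}" by auto
    show "{Q \<in> space (mat_space n). (\<Sum>i<n. Q (i, j) * Q (i, k)) = (if j = k then 1 else 0)} \<in> sets (mat_space n)"
      using m1 unfolding e1 .
  qed auto
  ultimately show ?thesis
    unfolding haar_def by (subst AE_distr_iff[OF measurable_gs_mat]) simp_all
qed

text \<open>Multiplying every Gaussian row by \<open>A\<close> preserves the joint law, and by
  equivariance of Gram-Schmidt it multiplies the frame by \<open>A\<close>.\<close>

lemma nn_integral_haar_left:
  assumes f [measurable]: "f \<in> borel_measurable (mat_space n)" and A: "orthm n A"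
  shows "(\<integral>\<^sup>+Q. f (mm n A Q) \<partial>haar n) = (\<integral>\<^sup>+Q. f Q \<partial>haar n)"
proof -
  define L where "L G = (\<lambda>(k, l)\<in>sq n. \<Sum>i<n. A (l, i) * G (k, i))" for G :: "nat \<times> nat \<Rightarrow> real"
  have iso: "(\<Sum>p\<in>sq n. (L G p)\<^sup>2) = (\<Sum>p\<in>sq n. (G p)\<^sup>2)" for G
  proof -
    have "(\<Sum>p\<in>sq n. (L G p)\<^sup>2) = (\<Sum>k<n. \<Sum>l<n. (\<Sum>i<n. A (l, i) * G (k, i))\<^sup>2)"
      by (simp add: sum.cartesian_product L_def split_beta)
    also have "\<dots> = (\<Sum>k<n. \<Sum>i<n. (G (k, i))\<^sup>2)"
      using A by (intro sum.cong refl ortho_norm) (simp add: orthm_def)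
    finally show ?thesis by (simp add: sum.cartesian_product split_beta)
  qed
  have L: "L \<in> measurable (gauss (sq n)) (gauss (sq n))" "distr (gauss (sq n)) (gauss (sq n)) L = gauss (sq n)"
    by (rule gauss_isometry; use iso in \<open>auto simp: L_def sum.distrib algebra_simps sum_distrib_left intro!: restrict_ext sum.cong\<close>)+
  define T where "T v l = (\<Sum>i<n. A (l, i) * v i)" for v :: "nat \<Rightarrow> real" and l
  have Tn: "dotp n (T u) (T u) = dotp n u u" for u
    unfolding dotp_self T_def using A by (intro ortho_norm) (simp add: orthm_def)
  have Td: "dotp n (T u) (T v) = dotp n u v" for u v
  proof -
    have "T (\<lambda>l. u l + v l) = (\<lambda>l. T u l + T v l)" by (auto simp: T_def algebra_simps sum.distrib)
    then have "dotp n (\<lambda>l. T u l + T v l) (\<lambda>l. T u l + T v l) = dotp n (\<lambda>l. u l + v l) (\<lambda>l. u l + v l)"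
      using Tn[of "\<lambda>l. u l + v l"] by simp
    moreover have "dotp n (\<lambda>l. x l + y l) (\<lambda>l. x l + y l) = dotp n x x + 2 * dotp n x y + dotp n y y" for x y
      by (simp add: dotp_simps dotp_commute[of n y x])
    ultimately show ?thesis using Tn[of u] Tn[of v] by simp
  qed
  have eq: "gs_mat n (L G) = mm n A (gs_mat n G)" for G
  proof (rule ext)
    fix p :: "nat \<times> nat"
    obtain l k where p: "p = (l, k)" by (cases p)
    show "gs_mat n (L G) p = mm n A (gs_mat n G) p"
    proof (cases "l < n \<and> k < n")
      case True
      have "gs n (\<lambda>k i. if k < n \<and> i < n then L G (k, i) else 0) n k l =
        T (gs n (\<lambda>k i. if k < n \<and> i < n then G (k, i) else 0) n k) l"
      proof (rule gs_equivariant[where T=T])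
        fix u v w :: "nat \<Rightarrow> real" and a :: real
        assume w: "\<And>l. l < n \<Longrightarrow> w l = u l - a * v l"
        have "T w l = (\<Sum>i<n. A (l, i) * (u i - a * v i))" for l
          unfolding T_def using w by (intro sum.cong) auto
        then show "\<forall>l<n. T w l = T u l - a * T v l"
          by (simp add: T_def right_diff_distrib sum_subtractf sum_distrib_left mult_ac)
      next
        fix u w :: "nat \<Rightarrow> real" and a :: real
        assume "\<And>l. l < n \<Longrightarrow> w l = u l / a"
        then show "\<forall>l<n. T w l = T u l / a" by (simp add: T_def sum_divide_distrib)
      qed (use True Td in \<open>auto simp: L_def T_def\<close>)
      then show ?thesis using True by (simp add: p gs_mat_def mm_def T_def)
    qed (auto simp: p gs_mat_def mm_def)
  qed
  have [measurable]: "A' \<in> space (mat_space n) \<Longrightarrow> (\<lambda>Q. mm n A' Q) \<in> measurable (mat_space n) (mat_space n)" for A'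
    by measurable
  \<comment> \<open>\<open>orthm\<close> does not constrain entries outside the square, so
    \<open>A\<close> need not be a point of the matrix space. Its restriction is, and it acts in the
    same way.\<close>
  define A' where "A' = (\<lambda>p\<in>sq n. A p)"
  have A': "mm n A Q = mm n A' Q" for Q by (auto simp: mm_def A'_def fun_eq_iff)
  have "A' \<in> space (mat_space n)" by (simp add: A'_def space_mat_space)
  then have mA: "(\<lambda>Q. mm n A Q) \<in> measurable (mat_space n) (mat_space n)"
    unfolding A' by measurable
  have "(\<integral>\<^sup>+Q. f (mm n A Q) \<partial>haar n) = (\<integral>\<^sup>+G. f (mm n A (gs_mat n G)) \<partial>gauss (sq n))"
    unfolding haar_def using mA by (subst nn_integral_distr) auto
  also have "\<dots> = (\<integral>\<^sup>+G. f (gs_mat n (L G)) \<partial>gauss (sq n))" by (simp add: eq)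
  also have "\<dots> = (\<integral>\<^sup>+G. f (gs_mat n G) \<partial>distr (gauss (sq n)) (gauss (sq n)) L)"
    using L(1) by (subst nn_integral_distr) auto
  also have "\<dots> = (\<integral>\<^sup>+Q. f Q \<partial>haar n)"
    unfolding L(2) haar_def by (subst nn_integral_distr) auto
  finally show ?thesis .
qed

text \<open>A left-invariant probability measure on a group is invariant under inversion: apply left
  invariance in either variable of the product of an inverse and an independent copy.\<close>

lemma nn_integral_haar_transp:
  assumes f [measurable]: "f \<in> borel_measurable (mat_space n)"
  shows "(\<integral>\<^sup>+Q. f (transp n Q) \<partial>haar n) = (\<integral>\<^sup>+Q. f Q \<partial>haar n)"
proof -
  interpret h: prob_space "haar n" by (rule prob_space_haar)
  interpret hh: pair_sigma_finite "haar n" "haar n" ..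
  have "(\<integral>\<^sup>+Q. f Q \<partial>haar n) = (\<integral>\<^sup>+Z. \<integral>\<^sup>+Q. f Q \<partial>haar n \<partial>haar n)"
    by (simp add: h.emeasure_space_1[unfolded space_haar])
  also have "\<dots> = (\<integral>\<^sup>+Z. \<integral>\<^sup>+Q. f (mm n (transp n Z) Q) \<partial>haar n \<partial>haar n)"
  proof (rule nn_integral_cong_AE)
    show "AE Z in haar n. (\<integral>\<^sup>+Q. f Q \<partial>haar n) = (\<integral>\<^sup>+Q. f (mm n (transp n Z) Q) \<partial>haar n)"
      using AE_haar_orthm
      by eventually_elim (rule nn_integral_haar_left[symmetric, OF f orthm_transp])
  qed
  also have "\<dots> = (\<integral>\<^sup>+Q. \<integral>\<^sup>+Z. f (mm n (transp n Z) Q) \<partial>haar n \<partial>haar n)"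
    by (rule hh.Fubini') measurable
  also have "\<dots> = (\<integral>\<^sup>+Q. \<integral>\<^sup>+Z. f (transp n Z) \<partial>haar n \<partial>haar n)"
  proof (rule nn_integral_cong_AE)
    show "AE Q in haar n. (\<integral>\<^sup>+Z. f (mm n (transp n Z) Q) \<partial>haar n) = (\<integral>\<^sup>+Z. f (transp n Z) \<partial>haar n)"
      using AE_haar_orthm AE_space
    proof eventually_elim
      case (elim Q)
      have "mm n (transp n Z) Q = transp n (mm n (transp n Q) Z)" for Z
        by (auto simp: mm_def transp_def fun_eq_iff mult.commute)
      then show ?case
        using nn_integral_haar_left[of "\<lambda>Z. f (transp n Z)" n "transp n Q"] elim by (simp add: orthm_transp)
    qed
  qed
  also have "\<dots> = (\<integral>\<^sup>+Q. f (transp n Q) \<partial>haar n)" by (simp add: h.emeasure_space_1[unfolded space_haar])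
  finally show ?thesis ..
qed

text \<open>Right multiplication is left multiplication between two transpositions.\<close>

lemma nn_integral_haar_right:
  assumes f [measurable]: "f \<in> borel_measurable (mat_space n)" and C: "orthm n C"
  shows "(\<integral>\<^sup>+Q. f (mm n Q C) \<partial>haar n) = (\<integral>\<^sup>+Q. f Q \<partial>haar n)"
proof -
  define C' where "C' = (\<lambda>p\<in>sq n. C p)"
  have C': "mm n Q C = mm n Q C'" for Q by (auto simp: mm_def C'_def fun_eq_iff)
  have "C' \<in> space (mat_space n)" by (simp add: C'_def space_mat_space)
  then have m: "(\<lambda>Q. mm n Q C) \<in> measurable (mat_space n) (mat_space n)"
    unfolding C' by measurable
  then have "(\<integral>\<^sup>+Q. f (mm n Q C) \<partial>haar n) = (\<integral>\<^sup>+Q. f (mm n (transp n Q) C) \<partial>haar n)"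
    using nn_integral_haar_transp[of "\<lambda>Q. f (mm n Q C)" n] by simp
  also have "\<dots> = (\<integral>\<^sup>+Q. f (transp n (mm n (transp n C) Q)) \<partial>haar n)"
  proof -
    have "mm n (transp n Q) C = transp n (mm n (transp n C) Q)" for Q
      by (auto simp: mm_def transp_def fun_eq_iff mult.commute)
    then show ?thesis by simp
  qed
  also have "\<dots> = (\<integral>\<^sup>+Q. f (transp n Q) \<partial>haar n)"
    using nn_integral_haar_left[of "\<lambda>Q. f (transp n Q)" n "transp n C"] C by (simp add: orthm_transp)
  also have "\<dots> = (\<integral>\<^sup>+Q. f Q \<partial>haar n)" by (rule nn_integral_haar_transp) simp
  finally show ?thesis .
qed

section \<open>Tridiagonalising the GOE\<close>

definition ut :: "nat \<Rightarrow> (nat \<times> nat) set" where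
  "ut n = {(i, j). i \<le> j \<and> j < n}"

lemma finite_ut [simp]: "finite (ut n)"
  by (rule finite_subset[of _ "sq n"]) (auto simp: ut_def)

definition wt :: "nat \<Rightarrow> nat \<Rightarrow> real" where
  "wt i j = (if i = j then sqrt 2 else 1)"

text \<open>The symmetric matrix whose first \<open>K\<close> rows are already tridiagonal, while the remaining block is a
  GOE block; \<open>K = 0\<close> is the GOE itself and \<open>K = n\<close> the tridiagonal model.\<close>

definition part :: "nat \<Rightarrow> nat \<Rightarrow> (nat \<times> nat \<Rightarrow> real) \<Rightarrow> nat \<times> nat \<Rightarrow> real" where
  "part n K \<xi> = (\<lambda>(i, j)\<in>sq n. (if min i j < K
     then if i = j then sqrt 2 * \<xi> (i, i)
       else if max i j = Suc (min i j) then sqrt (\<Sum>l\<in>{Suc (min i j)..<n}. (\<xi> (min i j, l))\<^sup>2) else 0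
     else wt i j * \<xi> (min i j, max i j)) / sqrt (real n))"

definition block :: "nat \<Rightarrow> (nat \<times> nat \<Rightarrow> real) \<Rightarrow> nat \<times> nat \<Rightarrow> real" where
  "block b y = (\<lambda>(i, j). if b \<le> min i j then wt i j * y (min i j, max i j) else 0)"

definition block_ix :: "nat \<Rightarrow> nat \<Rightarrow> (nat \<times> nat) set" where
  "block_ix n b = {(i, j). b \<le> i \<and> i \<le> j \<and> j < n}"

lemma finite_block_ix [simp]: "finite (block_ix n b)"
  by (rule finite_subset[of _ "sq n"]) (auto simp: block_ix_def)

lemma distr_PiM_components:
  assumes I: "finite I" and M: "\<And>i. prob_space (M i)" and M': "\<And>i. i \<in> I \<Longrightarrow> f i \<in> measurable (M i) (M' i)"
  shows "distr (PiM I M) (PiM I M') (\<lambda>\<omega>. \<lambda>i\<in>I. f i (\<omega> i)) = PiM I (\<lambda>i. distr (M i) (M' i) (f i))"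
proof -
  \<comment> \<open>The product construction asks for a probability measure at every index; outside
    \<open>I\<close> a point mass fills in, where \<open>f\<close> is not known to be
    measurable.\<close>
  define D where "D i = (if i \<in> I then distr (M i) (M' i) (f i) else return (count_space UNIV) undefined)" for i
  have D: "prob_space (D i)" for i
    using M M' by (auto simp: D_def intro: prob_space.prob_space_distr prob_space_return)
  interpret D: product_sigma_finite D
    by (simp add: product_sigma_finite_def D prob_space_imp_sigma_finite)
  interpret M: product_prob_space M I
    by (rule product_prob_spaceI) (rule M)
  have m: "(\<lambda>\<omega>. \<lambda>i\<in>I. f i (\<omega> i)) \<in> measurable (PiM I M) (PiM I M')"
    by (rule measurable_restrict, rule measurable_compose[OF measurable_component_singleton]) (auto intro: M')
  have "distr (PiM I M) (PiM I M') (\<lambda>\<omega>. \<lambda>i\<in>I. f i (\<omega> i)) = PiM I D"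
  proof (rule D.PiM_eqI[OF I])
    show "sets (distr (PiM I M) (PiM I M') (\<lambda>\<omega>. \<lambda>i\<in>I. f i (\<omega> i))) = sets (PiM I D)"
      by (simp, rule sets_PiM_cong) (auto simp: D_def)
    fix A assume A: "\<And>i. i \<in> I \<Longrightarrow> A i \<in> sets (D i)"
    then have A': "A i \<in> sets (M' i)" if "i \<in> I" for i using that by (auto simp: D_def)
    have "emeasure (distr (PiM I M) (PiM I M') (\<lambda>\<omega>. \<lambda>i\<in>I. f i (\<omega> i))) (Pi\<^sub>E I A) =
        emeasure (PiM I M) ((\<lambda>\<omega>. \<lambda>i\<in>I. f i (\<omega> i)) -` Pi\<^sub>E I A \<inter> space (PiM I M))"
      using A' I by (intro emeasure_distr m sets_PiM_I_finite)
    also have "(\<lambda>\<omega>. \<lambda>i\<in>I. f i (\<omega> i)) -` Pi\<^sub>E I A \<inter> space (PiM I M) = Pi\<^sub>E I (\<lambda>i. f i -` A i \<inter> space (M i))"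
      by (auto simp: space_PiM PiE_iff extensional_def)
    also have "emeasure (PiM I M) \<dots> = (\<Prod>i\<in>I. emeasure (M i) (f i -` A i \<inter> space (M i)))"
      using A' M' I by (intro M.emeasure_PiM measurable_sets) auto
    also have "\<dots> = (\<Prod>i\<in>I. emeasure (D i) (A i))"
      using A' M' by (intro prod.cong) (auto simp: D_def emeasure_distr)
    finally show "emeasure (distr (PiM I M) (PiM I M') (\<lambda>\<omega>. \<lambda>i\<in>I. f i (\<omega> i))) (Pi\<^sub>E I A) =
      (\<Prod>i\<in>I. emeasure (D i) (A i))" .
  qed
  also have "PiM I D = PiM I (\<lambda>i. distr (M i) (M' i) (f i))"
    by (intro PiM_cong) (auto simp: D_def)
  finally show ?thesis .
qed

lemma normal_law_scale:
  assumes "0 < \<sigma>"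
  shows "distr (normal_law 1) borel (\<lambda>x. \<sigma> * x) = normal_law \<sigma>"
proof -
  have "distributed (normal_law 1) lborel (\<lambda>x. x) (normal_density 0 1)"
    unfolding distributed_def by (auto simp: normal_law_def distr_id2)
  from prob_space.normal_density_affine[OF prob_space_normal_law[OF zero_less_one] this, of \<sigma> 0] assms
  have "distributed (normal_law 1) lborel (\<lambda>x. \<sigma> * x) (normal_density 0 \<sigma>)" by simp
  then have "distr (normal_law 1) lborel (\<lambda>x. \<sigma> * x) = density lborel (normal_density 0 \<sigma>)"
    by (rule distributed_distr_eq_density)
  moreover have "distr (normal_law 1) lborel (\<lambda>x. \<sigma> * x) = distr (normal_law 1) borel (\<lambda>x. \<sigma> * x)"
    by (intro distr_cong) auto
  ultimately show ?thesis by (simp add: normal_law_def)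
qed

lemma measurable_part [measurable]: "part n K \<in> measurable (gauss (ut n)) (mat_space n)"
proof (rule measurable_matI)
  fix i j assume ij: "i < n" "j < n"
  have c: "(\<lambda>\<xi>. \<xi> (a, b)) \<in> borel_measurable (gauss (ut n))" if "a \<le> b" "b < n" for a b
    using that by (intro measurable_gauss_component) (auto simp: ut_def)
  have "(\<lambda>\<xi>. (\<Sum>l\<in>{Suc (min i j)..<n}. (\<xi> (min i j, l))\<^sup>2)) \<in> borel_measurable (gauss (ut n))"
    by (intro borel_measurable_sum borel_measurable_power c) auto
  then have s: "(\<lambda>\<xi>. sqrt (\<Sum>l\<in>{Suc (min i j)..<n}. (\<xi> (min i j, l))\<^sup>2)) \<in> borel_measurable (gauss (ut n))"
    by (rule measurable_compose[OF _ borel_measurable_sqrt])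
  have 1: "(\<lambda>\<xi>. sqrt 2 * \<xi> (i, i) / sqrt (real n)) \<in> borel_measurable (gauss (ut n))"
    "(\<lambda>\<xi>. wt i j * \<xi> (min i j, max i j) / sqrt (real n)) \<in> borel_measurable (gauss (ut n))"
    "(\<lambda>\<xi>. sqrt (\<Sum>l\<in>{Suc (min i j)..<n}. (\<xi> (min i j, l))\<^sup>2) / sqrt (real n)) \<in> borel_measurable (gauss (ut n))"
    by (intro borel_measurable_divide borel_measurable_times borel_measurable_const s c; use ij in simp)+
  consider "(\<lambda>\<xi>. part n K \<xi> (i, j)) = (\<lambda>\<xi>. sqrt 2 * \<xi> (i, i) / sqrt (real n))"
    | "(\<lambda>\<xi>. part n K \<xi> (i, j)) = (\<lambda>\<xi>. wt i j * \<xi> (min i j, max i j) / sqrt (real n))"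
    | "(\<lambda>\<xi>. part n K \<xi> (i, j)) = (\<lambda>\<xi>. sqrt (\<Sum>l\<in>{Suc (min i j)..<n}. (\<xi> (min i j, l))\<^sup>2) / sqrt (real n))"
    | "(\<lambda>\<xi>. part n K \<xi> (i, j)) = (\<lambda>\<xi>. 0)"
    using ij by (cases "min i j < K"; cases "i = j"; cases "max i j = Suc (min i j)")
      (simp_all add: part_def)
  then show "(\<lambda>\<xi>. part n K \<xi> (i, j)) \<in> borel_measurable (gauss (ut n))"
    using 1 by cases (simp_all only: borel_measurable_const)
qed (auto simp: part_def)

lemma GOE_eq:
  assumes n: "0 < n"
  shows "GOE n = distr (gauss (ut n)) (mat_space n) (part n 0)"
proof -
  define \<sigma> where "\<sigma> p = sqrt ((if fst p = snd p then 2 else 1) / real n)" for p :: "nat \<times> nat"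
  have \<sigma>: "0 < \<sigma> p" for p using n by (simp add: \<sigma>_def)
  let ?g = "\<lambda>w. \<lambda>(i, j)\<in>sq n. w (min i j, max i j) :: real"
  have ut: "{(i, j). i \<le> j \<and> j < n} = ut n" by (simp add: ut_def)
  have "PiM (ut n) (\<lambda>p. normal_law (\<sigma> p)) = PiM (ut n) (\<lambda>p. distr (normal_law 1) borel (\<lambda>x. \<sigma> p * x))"
    by (simp add: normal_law_scale \<sigma>)
  also have "\<dots> = distr (gauss (ut n)) (PiM (ut n) (\<lambda>_. borel)) (\<lambda>\<omega>. \<lambda>p\<in>ut n. \<sigma> p * \<omega> p)"
    unfolding gauss_def
    by (rule distr_PiM_components[symmetric]) (simp_all add: prob_space_normal_law measurable_cong_sets[OF sets_normal_law refl])
  finally have P: "PiM (ut n) (\<lambda>p. normal_law (\<sigma> p)) =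
      distr (gauss (ut n)) (PiM (ut n) (\<lambda>_. borel)) (\<lambda>\<omega>. \<lambda>p\<in>ut n. \<sigma> p * \<omega> p)" .
  have m1: "?g \<in> measurable (PiM (ut n) (\<lambda>_. borel)) (mat_space n)"
  proof (rule measurable_matI)
    fix i j assume ij: "i < n" "j < n"
    have "(\<lambda>z. ?g z (i, j)) = (\<lambda>w. w (min i j, max i j))" using ij by simp
    moreover have "(\<lambda>w. w (min i j, max i j)) \<in> borel_measurable (PiM (ut n) (\<lambda>_. borel))"
      by (rule measurable_component_singleton) (use ij in \<open>auto simp: ut_def\<close>)
    ultimately show "(\<lambda>z. ?g z (i, j)) \<in> borel_measurable (PiM (ut n) (\<lambda>_. borel))" by (simp only:)
  qed auto
  have m2: "(\<lambda>\<omega>. \<lambda>p\<in>ut n. \<sigma> p * \<omega> p) \<in> measurable (gauss (ut n)) (PiM (ut n) (\<lambda>_. borel))"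
    by (intro measurable_restrict borel_measurable_times borel_measurable_const measurable_gauss_component)
  have "GOE n = distr (PiM (ut n) (\<lambda>p. normal_law (\<sigma> p))) (mat_space n) ?g"
    unfolding GOE_def ut \<sigma>_def ..
  also have "\<dots> = distr (gauss (ut n)) (mat_space n) (?g \<circ> (\<lambda>\<omega>. \<lambda>p\<in>ut n. \<sigma> p * \<omega> p))"
    unfolding P by (rule distr_distr[OF m1 m2])
  also have "?g \<circ> (\<lambda>\<omega>. \<lambda>p\<in>ut n. \<sigma> p * \<omega> p) = part n 0"
    by (auto simp: fun_eq_iff part_def ut_def \<sigma>_def wt_def real_sqrt_divide min_def max_def)
  finally show ?thesis .
qed

lemma prob_space_GOE: "0 < n \<Longrightarrow> prob_space (GOE n)"
  unfolding GOE_eq by (rule prob_space.prob_space_distr[OF prob_space_gauss]) measurable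

lemma sets_GOE: "sets (GOE n) = sets (mat_space n)"
  by (simp add: GOE_def)

lemma symmetric_sum:
  fixes f :: "nat \<times> nat \<Rightarrow> real"
  assumes "\<And>i j. f (i, j) = f (j, i)"
  shows "(\<Sum>i<n. \<Sum>j<n. f (i, j)) = (\<Sum>p\<in>ut n. (if fst p = snd p then 1 else 2) * f p)"
proof -
  have U: "sq n = ut n \<union> {p \<in> sq n. snd p < fst p}" "ut n \<inter> {p \<in> sq n. snd p < fst p} = {}"
    by (auto simp: ut_def)
  have "(\<Sum>i<n. \<Sum>j<n. f (i, j)) = (\<Sum>p\<in>sq n. f p)"
    by (simp add: sum.cartesian_product)
  also have "\<dots> = (\<Sum>p\<in>ut n. f p) + (\<Sum>p\<in>{p \<in> sq n. snd p < fst p}. f p)"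
    by (subst U(1), subst sum.union_disjoint) (use U(2) in auto)
  also have "(\<Sum>p\<in>{p \<in> sq n. snd p < fst p}. f p) = (\<Sum>p\<in>{p \<in> ut n. fst p < snd p}. f p)"
    by (rule sum.reindex_bij_witness[of _ prod.swap prod.swap]) (auto simp: ut_def assms)
  also have "\<dots> = (\<Sum>p\<in>ut n. if fst p < snd p then f p else 0)"
    by (rule sum.inter_filter) simp
  also have "(\<Sum>p\<in>ut n. f p) + \<dots> = (\<Sum>p\<in>ut n. (if fst p = snd p then 1 else 2) * f p)"
    unfolding sum.distrib[symmetric] by (intro sum.cong) (auto simp: ut_def)
  finally show ?thesis .
qed

text \<open>An off-diagonal entry occurs twice in the matrix and a diagonal one once, with weight
  \<open>sqrt 2\<close>: this is why the GOE doubles the variance on its diagonal. Maps that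
  preserve the Frobenius norm are thereby isometries of the independent Gaussian
  coordinates.\<close>

lemma block_norm: "(\<Sum>i<n. \<Sum>j<n. (block b y (i, j))\<^sup>2) = 2 * (\<Sum>p\<in>block_ix n b. (y p)\<^sup>2)"
proof -
  have "(\<Sum>i<n. \<Sum>j<n. (block b y (i, j))\<^sup>2) = (\<Sum>p\<in>ut n. (if fst p = snd p then 1 else 2) * (block b y p)\<^sup>2)"
    by (rule symmetric_sum) (simp add: block_def wt_def min.commute max.commute)
  also have "\<dots> = (\<Sum>p\<in>ut n. if b \<le> fst p then 2 * (y p)\<^sup>2 else 0)"
    by (intro sum.cong) (auto simp: ut_def block_def wt_def power_mult_distrib min_def max_def)
  also have "\<dots> = (\<Sum>p\<in>{p \<in> ut n. b \<le> fst p}. 2 * (y p)\<^sup>2)"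
    by (rule sum.inter_filter[symmetric]) simp
  also have "{p \<in> ut n. b \<le> fst p} = block_ix n b" by (auto simp: ut_def block_ix_def)
  finally show ?thesis by (simp add: sum_distrib_left)
qed

definition fixes_below :: "nat \<Rightarrow> nat \<Rightarrow> (nat \<times> nat \<Rightarrow> real) \<Rightarrow> bool" where
  "fixes_below n b A \<longleftrightarrow> (\<forall>i<n. \<forall>j<n. i < b \<or> j < b \<longrightarrow> A (i, j) = (if i = j then 1 else 0))"

definition block_conj :: "nat \<Rightarrow> nat \<Rightarrow> (nat \<times> nat \<Rightarrow> real) \<Rightarrow> (nat \<times> nat \<Rightarrow> real) \<Rightarrow> nat \<times> nat \<Rightarrow> real" where
  "block_conj n b A y = (\<lambda>(i, j)\<in>block_ix n b. conj_by n A (block b y) (i, j) / wt i j)"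

lemma conj_by_symmetric:
  assumes "\<And>i j. i < n \<Longrightarrow> j < n \<Longrightarrow> M (i, j) = M (j, i)"
  shows "conj_by n A M (i, j) = conj_by n A M (j, i)"
proof (cases "i < n \<and> j < n")
  case True
  have "conj_by n A M (i, j) = (\<Sum>k<n. \<Sum>l<n. A (i, k) * M (k, l) * A (j, l))"
    using True by (simp add: conj_by_def)
  also have "\<dots> = (\<Sum>l<n. \<Sum>k<n. A (i, k) * M (k, l) * A (j, l))" by (rule sum.swap)
  also have "\<dots> = (\<Sum>l<n. \<Sum>k<n. A (j, l) * M (l, k) * A (i, k))"
    using assms by (intro sum.cong refl) (simp add: mult_ac)
  finally show ?thesis using True by (simp add: conj_by_def)
qed (auto simp: conj_by_def)

lemma conj_by_norm:
  assumes A: "orthm n A"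
  shows "(\<Sum>i<n. \<Sum>j<n. (conj_by n A M (i, j))\<^sup>2) = (\<Sum>i<n. \<Sum>j<n. (M (i, j))\<^sup>2)"
proof -
  have o: "(\<Sum>i<n. (\<Sum>j<n. A (i, j) * x j)\<^sup>2) = (\<Sum>j<n. (x j)\<^sup>2)" for x
    using A by (intro ortho_norm) (simp add: orthm_def)
  have "(\<Sum>i<n. \<Sum>j<n. (conj_by n A M (i, j))\<^sup>2) =
      (\<Sum>j<n. \<Sum>i<n. (\<Sum>k<n. A (i, k) * (\<Sum>l<n. A (j, l) * M (k, l)))\<^sup>2)"
    by (subst sum.swap) (simp add: conj_by_def sum_distrib_left mult_ac)
  also have "\<dots> = (\<Sum>k<n. \<Sum>l<n. (M (k, l))\<^sup>2)"
    unfolding o by (subst sum.swap) (simp only: o)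
  finally show ?thesis .
qed

lemma conj_by_fixed:
  assumes f: "fixes_below n b A" and ij: "i < n" "j < n"
  shows "i < b \<Longrightarrow> conj_by n A M (i, j) = (\<Sum>l<n. M (i, l) * A (j, l))"
    and "i < b \<Longrightarrow> j < b \<Longrightarrow> conj_by n A M (i, j) = M (i, j)"
proof -
  assume i: "i < b"
  have Ai: "A (i, k) = (if k = i then 1 else 0)" if "k < n" for k
    using f ij i that by (auto simp: fixes_below_def)
  have "(\<Sum>k<n. \<Sum>l<n. A (i, k) * M (k, l) * A (j, l)) = (\<Sum>k<n. if k = i then \<Sum>l<n. M (k, l) * A (j, l) else 0)"
    by (rule sum.cong) (auto simp: Ai)
  then have "conj_by n A M (i, j) = (\<Sum>k<n. if k = i then \<Sum>l<n. M (k, l) * A (j, l) else 0)"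
    using ij by (simp add: conj_by_def)
  then show 1: "conj_by n A M (i, j) = (\<Sum>l<n. M (i, l) * A (j, l))" using ij by simp
  assume j: "j < b"
  have "(\<Sum>l<n. M (i, l) * A (j, l)) = (\<Sum>l<n. if l = j then M (i, l) else 0)"
    using f ij j by (intro sum.cong) (auto simp: fixes_below_def)
  then show "conj_by n A M (i, j) = M (i, j)" using 1 ij by simp
qed

lemma conj_by_block_eq:
  assumes f: "fixes_below n b A" and ij: "i < n" "j < n"
  shows "conj_by n A (block b y) (i, j) = block b (block_conj n b A y) (i, j)"
proof -
  have sym: "conj_by n A (block b y) (i, j) = conj_by n A (block b y) (j, i)" for i j
    by (rule conj_by_symmetric) (simp add: block_def wt_def min.commute max.commute)
  have z: "conj_by n A (block b y) (i, j) = 0" if "i < b" "i < n" "j < n" for i j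
    using conj_by_fixed(1)[OF f that(2,3,1)] that by (simp add: block_def)
  show ?thesis
  proof (cases "b \<le> min i j")
    case True
    have "conj_by n A (block b y) (i, j) = conj_by n A (block b y) (min i j, max i j)"
      using sym by (simp add: min_def max_def)
    also have "\<dots> = wt i j * block_conj n b A y (min i j, max i j)"
      using True ij by (auto simp: block_conj_def block_ix_def wt_def min_def max_def)
    finally show ?thesis using True by (simp add: block_def)
  next
    case False
    then have "conj_by n A (block b y) (i, j) = 0" using z[of i j] z[of j i] sym[of i j] ij by auto
    then show ?thesis using False by (auto simp: block_def)
  qed
qed

text \<open>Orthogonal conjugation preserves the Frobenius norm, so by \<open>block_norm\<close> it
  is an isometry in the coordinates of the triangle.\<close>

lemma gauss_block_conj:
  assumes A: "orthm n A" and f: "fixes_below n b A"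
  shows "block_conj n b A \<in> measurable (gauss (block_ix n b)) (gauss (block_ix n b))"
    "distr (gauss (block_ix n b)) (gauss (block_ix n b)) (block_conj n b A) = gauss (block_ix n b)"
proof -
  have lin: "conj_by n A (block b (\<lambda>i. x i + y i)) (i, j) = conj_by n A (block b x) (i, j) + conj_by n A (block b y) (i, j)"
    "conj_by n A (block b (\<lambda>i. c * x i)) (i, j) = c * conj_by n A (block b x) (i, j)"
    if "i < n" "j < n" for x y c i j
  proof -
    have "block b (\<lambda>i. x i + y i) p = block b x p + block b y p" "block b (\<lambda>i. c * x i) p = c * block b x p" for p
      by (cases p; simp add: block_def algebra_simps)+
    then show "conj_by n A (block b (\<lambda>i. x i + y i)) (i, j) = conj_by n A (block b x) (i, j) + conj_by n A (block b y) (i, j)"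
      "conj_by n A (block b (\<lambda>i. c * x i)) (i, j) = c * conj_by n A (block b x) (i, j)"
      using that by (simp_all add: conj_by_def algebra_simps sum.distrib sum_distrib_left)
  qed
  have norm: "(\<Sum>p\<in>block_ix n b. (block_conj n b A x p)\<^sup>2) = (\<Sum>p\<in>block_ix n b. (x p)\<^sup>2)" for x
  proof -
    have "2 * (\<Sum>p\<in>block_ix n b. (block_conj n b A x p)\<^sup>2) =
        (\<Sum>i<n. \<Sum>j<n. (block b (block_conj n b A x) (i, j))\<^sup>2)" by (rule block_norm[symmetric])
    also have "\<dots> = (\<Sum>i<n. \<Sum>j<n. (conj_by n A (block b x) (i, j))\<^sup>2)"
      by (intro sum.cong refl) (simp add: conj_by_block_eq[OF f])
    also have "\<dots> = 2 * (\<Sum>p\<in>block_ix n b. (x p)\<^sup>2)" by (simp only: conj_by_norm[OF A] block_norm)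
    finally show ?thesis by simp
  qed
  have cong: "block_conj n b A x = block_conj n b A y" if "\<And>i. i \<in> block_ix n b \<Longrightarrow> x i = y i" for x y
  proof -
    have "block b x (k, l) = block b y (k, l)" if "k < n" "l < n" for k l
      using that \<open>\<And>i. i \<in> block_ix n b \<Longrightarrow> x i = y i\<close>[of "(min k l, max k l)"]
      by (auto simp: block_def block_ix_def)
    then have "conj_by n A (block b x) = conj_by n A (block b y)"
      by (auto simp: conj_by_def fun_eq_iff intro!: sum.cong)
    then show ?thesis by (simp add: block_conj_def)
  qed
  have ext: "block_conj n b A x \<in> extensional (block_ix n b)" for x by (simp add: block_conj_def)
  have add: "block_conj n b A (\<lambda>i. x i + y i) p = block_conj n b A x p + block_conj n b A y p"
    and sc: "block_conj n b A (\<lambda>i. c * x i) p = c * block_conj n b A x p" if "p \<in> block_ix n b" for x y c p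
    using that by (cases p; simp add: block_conj_def lin block_ix_def add_divide_distrib)+
  show "block_conj n b A \<in> measurable (gauss (block_ix n b)) (gauss (block_ix n b))"
    "distr (gauss (block_ix n b)) (gauss (block_ix n b)) (block_conj n b A) = gauss (block_ix n b)"
    using gauss_isometry[of "block_ix n b" "block_conj n b A", OF finite_block_ix ext cong add sc norm] by blast+
qed

text \<open>Reflection along \<open>h\<close>, the part of \<open>g\<close> from \<open>b\<close> on
  minus its own norm times the basis vector \<open>b\<close>. The image has a nonnegative entry, as
  a chi variable must. With \<open>b = 0\<close> the same statement later rotates the spike to the
  first axis.\<close>

lemma householder:
  assumes K: "b < n"
  shows "\<exists>A. orthm n A \<and> fixes_below n (b) A \<and>
    (\<forall>i\<in>{b..<n}. (\<Sum>l\<in>{b..<n}. g l * A (i, l)) =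
      (if i = b then sqrt (\<Sum>l\<in>{b..<n}. (g l)\<^sup>2) else 0))"
proof -
  let ?S = "{b..<n}"
  define \<rho> where "\<rho> = sqrt (\<Sum>l\<in>?S. (g l)\<^sup>2)"
  have \<rho>: "\<rho>\<^sup>2 = (\<Sum>l\<in>?S. (g l)\<^sup>2)" unfolding \<rho>_def by (simp add: sum_nonneg)
  define h where "h j = (if j \<in> ?S then g j - (if j = b then \<rho> else 0) else 0)" for j
  define H where "H = (\<Sum>j<n. (h j)\<^sup>2)"
  \<comment> \<open>If \<open>g\<close> already equals its target on these coordinates, then
    \<open>H = 0\<close>; division by zero gives \<open>c = 0\<close> and \<open>A\<close> is the
    identity.\<close>
  define c where "c = 2 / H"
  define A where "A = (\<lambda>(i, j). (if i = j then 1 else 0) - c * h i * h j)"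
  have cH: "c * c * H = 2 * c" by (simp add: c_def)
  have sub: "(\<Sum>j<n. if j \<in> ?S then f j else 0) = (\<Sum>j\<in>?S. f j)" for f :: "nat \<Rightarrow> real"
  proof -
    have "{..<n} \<inter> ?S = ?S" by auto
    then show ?thesis using sum.inter_restrict[of "{..<n}" f ?S] by simp
  qed
  have 1: "(\<Sum>j\<in>?S. if j = b then f j else 0) = f (b)" for f :: "nat \<Rightarrow> real"
    using K by simp
  have "H = (\<Sum>j<n. if j \<in> ?S then (h j)\<^sup>2 else 0)"
    unfolding H_def by (intro sum.cong) (auto simp: h_def)
  also have "\<dots> = (\<Sum>j\<in>?S. (h j)\<^sup>2)" by (rule sub)
  also have "\<dots> = (\<Sum>j\<in>?S. (g j)\<^sup>2 + (if j = b then \<rho>\<^sup>2 - 2 * \<rho> * g j else 0))"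
    by (intro sum.cong) (auto simp: h_def power2_diff)
  also have "\<dots> = 2 * (\<rho>\<^sup>2 - \<rho> * g (b))" unfolding sum.distrib 1 \<rho>[symmetric] by simp
  finally have H: "H = 2 * (\<rho>\<^sup>2 - \<rho> * g (b))" .
  have "(\<Sum>l\<in>?S. g l * h l) = (\<Sum>l\<in>?S. (g l)\<^sup>2 + (if l = b then - \<rho> * g l else 0))"
    by (intro sum.cong) (auto simp: h_def power2_eq_square algebra_simps)
  also have "\<dots> = H / 2" unfolding sum.distrib 1 \<rho>[symmetric] H by simp
  finally have gh: "(\<Sum>l\<in>?S. g l * h l) = H / 2" .
  have "orthm n A" unfolding orthm_def ortho_def
  proof (intro ballI)
    fix j k assume jk: "j \<in> {..<n}" "k \<in> {..<n}"
    have "(\<Sum>i<n. A (i, j) * A (i, k)) =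
      (\<Sum>i<n. (if i = j then if j = k then 1 else 0 else 0) - c * h k * (if i = j then h i else 0)
         - c * h j * (if i = k then h i else 0) + c * c * h j * h k * (h i)\<^sup>2)"
      by (intro sum.cong) (auto simp: A_def power2_eq_square algebra_simps)
    also have "\<dots> = (if j = k then 1 else 0) - c * h k * h j - c * h j * h k + c * c * h j * h k * H"
      using jk by (simp add: sum.distrib sum_subtractf sum_distrib_left[symmetric] H_def)
    also have "c * c * h j * h k * H = (c * c * H) * h j * h k" by simp
    finally show "(\<Sum>i<n. A (i, j) * A (i, k)) = (if j = k then 1 else 0)"
      unfolding cH by simp
  qed
  moreover have "fixes_below n (b) A" by (auto simp: fixes_below_def A_def h_def)
  moreover have "(\<Sum>l\<in>?S. g l * A (i, l)) = (if i = b then \<rho> else 0)" if i: "i \<in> ?S" for i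
  proof -
    have "(\<Sum>l\<in>?S. g l * A (i, l)) = (\<Sum>l\<in>?S. (if i = l then g l else 0) - c * h i * (g l * h l))"
      by (intro sum.cong) (auto simp: A_def algebra_simps)
    also have "\<dots> = g i - c * h i * (H / 2)"
      using i by (simp add: sum_subtractf sum_distrib_left[symmetric] gh)
    also have "\<dots> = g i - h i"
    proof (cases "H = 0")
      case True
      have "\<forall>j\<in>{..<n}. (h j)\<^sup>2 = 0"
        using True unfolding H_def by (subst (asm) sum_nonneg_eq_0_iff) auto
      then show ?thesis using i True by auto
    qed (simp add: c_def)
    also have "\<dots> = (if i = b then \<rho> else 0)" using i by (auto simp: h_def)
    finally show ?thesis .
  qed
  ultimately show ?thesis unfolding \<rho>_def by blast
qed

lemma part_symmetric: "i < n \<Longrightarrow> j < n \<Longrightarrow> part n K \<xi> (i, j) = part n K \<xi> (j, i)"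
  by (simp add: part_def wt_def min.commute max.commute)

text \<open>Finished rows are untouched, row \<open>K\<close> is rotated to its norm next to the
  diagonal, and the trailing block is conjugated. The new coordinates \<open>\<xi>'\<close> keep row
  \<open>K\<close> of \<open>\<xi>\<close> unchanged, since from then on it enters only through its
  norm.\<close>

lemma conj_part:
  assumes K: "K < n" and \<xi>: "\<And>i j. Suc K \<le> i \<Longrightarrow> i \<le> j \<Longrightarrow> j < n \<Longrightarrow> \<xi>' (i, j) = block_conj n (Suc K) A \<xi> (i, j)"
    "\<And>i j. i \<le> K \<Longrightarrow> \<xi>' (i, j) = \<xi> (i, j)"
    and f: "fixes_below n (Suc K) A"
    and h: "\<And>i. i \<in> {Suc K..<n} \<Longrightarrow> (\<Sum>l\<in>{Suc K..<n}. \<xi> (K, l) * A (i, l)) =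
      (if i = Suc K then sqrt (\<Sum>l\<in>{Suc K..<n}. (\<xi> (K, l))\<^sup>2) else 0)"
  shows "conj_by n A (part n K \<xi>) = part n (Suc K) \<xi>'"
proof -
  let ?M = "part n K \<xi>"
  have up: "conj_by n A ?M (i, j) = part n (Suc K) \<xi>' (i, j)" if ij: "i \<le> j" "j < n" for i j
  proof -
    have i: "i < n" using ij by simp
    consider "j \<le> K" | "i < K" "K < j" | "i = K" "K < j" | "K < i" using ij by linarith
    then show ?thesis
    proof cases
      case 1
      then have "conj_by n A ?M (i, j) = ?M (i, j)" using ij i by (intro conj_by_fixed(2)[OF f]) auto
      then show ?thesis using 1 ij i K by (auto simp: part_def \<xi>(2) wt_def min_def max_def)
    next
      case 2
      have "conj_by n A ?M (i, j) = (\<Sum>l<n. ?M (i, l) * A (j, l))"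
        using 2 ij i by (intro conj_by_fixed(1)[OF f]) auto
      also have "\<dots> = (\<Sum>l<n. 0)"
      proof (intro sum.cong refl)
        fix l assume l: "l \<in> {..<n}"
        show "?M (i, l) * A (j, l) = 0"
          using 2 l ij i f by (cases "l \<le> K") (auto simp: part_def fixes_below_def min_def max_def)
      qed
      finally show ?thesis using 2 ij i by (auto simp: part_def)
    next
      case 3
      have "conj_by n A ?M (i, j) = (\<Sum>l<n. ?M (i, l) * A (j, l))"
        using 3 ij i by (intro conj_by_fixed(1)[OF f]) auto
      also have "\<dots> = (\<Sum>l<n. if l \<in> {Suc K..<n} then \<xi> (K, l) * A (j, l) / sqrt (real n) else 0)"
      proof (intro sum.cong refl)
        fix l assume l: "l \<in> {..<n}"
        show "?M (i, l) * A (j, l) = (if l \<in> {Suc K..<n} then \<xi> (K, l) * A (j, l) / sqrt (real n) else 0)"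
          using 3 l ij i f by (cases "l \<le> K") (auto simp: part_def fixes_below_def min_def max_def wt_def)
      qed
      also have "\<dots> = (\<Sum>l\<in>{Suc K..<n}. \<xi> (K, l) * A (j, l) / sqrt (real n))"
      proof -
        have "{..<n} \<inter> {Suc K..<n} = {Suc K..<n}" by auto
        then show ?thesis
          using sum.inter_restrict[of "{..<n}" "\<lambda>l. \<xi> (K, l) * A (j, l) / sqrt (real n)" "{Suc K..<n}"] by simp
      qed
      also have "\<dots> = (if j = Suc K then sqrt (\<Sum>l\<in>{Suc K..<n}. (\<xi> (K, l))\<^sup>2) else 0) / sqrt (real n)"
        using 3 ij by (subst h[symmetric]) (auto simp: sum_divide_distrib)
      finally show ?thesis using 3 ij i by (auto simp: part_def \<xi>(2) min_def max_def)
    next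
      case 4
      have "conj_by n A ?M (i, j) = (\<Sum>k<n. \<Sum>l<n. A (i, k) * (block (Suc K) \<xi> (k, l) / sqrt (real n)) * A (j, l))"
      proof -
        have "A (i, k) * ?M (k, l) * A (j, l) = A (i, k) * (block (Suc K) \<xi> (k, l) / sqrt (real n)) * A (j, l)"
          if kl: "k < n" "l < n" for k l
        proof -
          consider "k \<le> K" | "l \<le> K" | "Suc K \<le> k" "Suc K \<le> l" by linarith
          then show ?thesis
          proof cases
            case 1
            then have "A (i, k) = 0" using f 4 i kl by (simp add: fixes_below_def)
            then show ?thesis by simp
          next
            case 2
            then have "A (j, l) = 0" using f 4 ij kl by (simp add: fixes_below_def)
            then show ?thesis by simp
          next
            case 3
            then have "?M (k, l) = block (Suc K) \<xi> (k, l) / sqrt (real n)"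
              using kl by (auto simp: part_def block_def min_def)
            then show ?thesis by simp
          qed
        qed
        moreover have "conj_by n A ?M (i, j) = (\<Sum>k<n. \<Sum>l<n. A (i, k) * ?M (k, l) * A (j, l))"
          using ij i by (simp add: conj_by_def)
        ultimately show ?thesis by simp
      qed
      also have "\<dots> = conj_by n A (block (Suc K) \<xi>) (i, j) / sqrt (real n)"
        using ij i by (simp add: conj_by_def sum_divide_distrib)
      also have "\<dots> = wt i j * \<xi>' (i, j) / sqrt (real n)"
        using 4 ij i \<xi>(1)[of i j] conj_by_block_eq[OF f i ij(2)] by (simp add: block_def)
      finally show ?thesis using 4 ij i by (simp add: part_def)
    qed
  qed
  show ?thesis
  proof (rule ext)
    fix p :: "nat \<times> nat"
    obtain i j where p: "p = (i, j)" by (cases p)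
    show "conj_by n A ?M p = part n (Suc K) \<xi>' p"
    proof (cases "i < n \<and> j < n")
      case True
      have "conj_by n A ?M (i, j) = conj_by n A ?M (j, i)"
        by (rule conj_by_symmetric) (rule part_symmetric)
      then show ?thesis using up[of i j] up[of j i] True part_symmetric[of i n j] unfolding p
        by (cases "i \<le> j") auto
    qed (auto simp: p conj_by_def part_def)
  qed
qed

definition conj_invariant :: "nat \<Rightarrow> ((nat \<times> nat \<Rightarrow> real) \<Rightarrow> ennreal) \<Rightarrow> bool" where
  "conj_invariant n f \<longleftrightarrow> (\<forall>A M. orthm n A \<longrightarrow> f (conj_by n A M) = f M)"

text \<open>Once the rows up to \<open>K\<close> are fixed, the rotation for row \<open>K\<close> is
  fixed as well, while the trailing block is an independent GOE block whose law it preserves. As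
  \<open>f\<close> is conjugation invariant, the rotation can be inserted separately for each value
  of the fixed rows.\<close>

lemma part_step:
  assumes K: "K < n" and f [measurable]: "f \<in> borel_measurable (mat_space n)" and inv: "conj_invariant n f"
  shows "(\<integral>\<^sup>+\<xi>. f (part n K \<xi>) \<partial>gauss (ut n)) = (\<integral>\<^sup>+\<xi>. f (part n (Suc K) \<xi>) \<partial>gauss (ut n))"
proof -
  define L where "L = block_ix n (Suc K)"
  define J where "J = ut n - L"
  have "L \<subseteq> ut n" by (auto simp: L_def ut_def block_ix_def)
  then have JL: "J \<inter> L = {}" "finite J" "finite L" "ut n = J \<union> L"
    by (auto simp: J_def L_def)
  have mp: "(\<lambda>\<xi>. f (part n K \<xi>)) \<in> borel_measurable (gauss (J \<union> L))" for K
    unfolding JL(4)[symmetric] by (rule measurable_compose[OF measurable_part f])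
  have fold: "(\<integral>\<^sup>+\<xi>. f (part n K \<xi>) \<partial>gauss (ut n)) =
      (\<integral>\<^sup>+x. \<integral>\<^sup>+y. f (part n K (merge J L (x, y))) \<partial>gauss L \<partial>gauss J)" for K
    unfolding JL(4) by (rule nn_integral_gauss_fold[OF JL(1-3) mp])
  show ?thesis
    unfolding fold
  proof (rule nn_integral_cong)
    fix x assume x: "x \<in> space (gauss J)"
    obtain A where A: "orthm n A" "fixes_below n (Suc K) A"
      "\<And>i. i \<in> {Suc K..<n} \<Longrightarrow> (\<Sum>l\<in>{Suc K..<n}. x (K, l) * A (i, l)) =
        (if i = Suc K then sqrt (\<Sum>l\<in>{Suc K..<n}. (x (K, l))\<^sup>2) else 0)"
    proof (cases "Suc K < n")
      case True
      from householder[OF this, of "\<lambda>l. x (K, l)"] that show ?thesis by blast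
    next
      case False
      \<comment> \<open>Here \<open>K\<close> is the last row: no block is left, the set
        \<open>{Suc K..<n}\<close> is empty, and the identity will do.\<close>
      define E where "E = (\<lambda>(i :: nat, j :: nat). if i = j then 1 else 0 :: real)" 
      have "(\<Sum>i<n. E (i, j) * E (i, k)) = (if j = k then 1 else 0)" if "j < n" "k < n" for j k
      proof -
        have "(\<Sum>i<n. E (i, j) * E (i, k)) = (\<Sum>i<n. if i = j then (if j = k then 1 else 0) else 0)"
          by (intro sum.cong) (auto simp: E_def)
        then show ?thesis using that by simp
      qed
      then have "orthm n E" by (simp add: orthm_def ortho_def)
      moreover have "fixes_below n (Suc K) E" by (simp add: fixes_below_def E_def)
      ultimately show ?thesis using False that by auto
    qed
    have mK: "x' (K, l) = x (K, l)" if "x' = merge J L (x, y)" "l \<in> {K..<n}" for x' y l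
      using that K by (auto simp: merge_def J_def L_def ut_def block_ix_def)
    have eq: "conj_by n A (part n K (merge J L (x, y))) = part n (Suc K) (merge J L (x, block_conj n (Suc K) A y))" for y
    proof (rule conj_part[OF K _ _ A(2)], goal_cases)
      case (1 i j)
      have "block_conj n (Suc K) A (merge J L (x, y)) = block_conj n (Suc K) A y"
      proof -
        have "block (Suc K) (merge J L (x, y)) (k, l) = block (Suc K) y (k, l)" if "k < n" "l < n" for k l
          using that by (auto simp: block_def merge_def J_def L_def block_ix_def)
        then have "conj_by n A (block (Suc K) (merge J L (x, y))) = conj_by n A (block (Suc K) y)"
          by (auto simp: conj_by_def fun_eq_iff intro!: sum.cong)
        then show ?thesis by (simp add: block_conj_def)
      qed
      then show ?case using 1 by (simp add: merge_def J_def L_def block_ix_def)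
    next
      case (2 i j)
      then show ?case by (simp add: merge_def J_def L_def block_ix_def)
    next
      case (3 i)
      then show ?case using A(3)[of i] mK[OF refl] by simp
    qed
    have mm: "(\<lambda>y. f (part n (Suc K) (merge J L (x, y)))) \<in> borel_measurable (gauss L)"
      using measurable_compose[OF measurable_compose[OF measurable_Pair1'[OF x] measurable_merge_gauss[OF JL(1)]] mp] by simp
    have "(\<integral>\<^sup>+y. f (part n K (merge J L (x, y))) \<partial>gauss L) =
        (\<integral>\<^sup>+y. f (conj_by n A (part n K (merge J L (x, y)))) \<partial>gauss L)"
      using inv A(1) by (simp add: conj_invariant_def)
    also have "\<dots> = (\<integral>\<^sup>+y. f (part n (Suc K) (merge J L (x, block_conj n (Suc K) A y))) \<partial>gauss L)"
      by (simp only: eq)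
    also have "\<dots> = (\<integral>\<^sup>+y. f (part n (Suc K) (merge J L (x, y))) \<partial>distr (gauss L) (gauss L) (block_conj n (Suc K) A))"
      unfolding L_def using gauss_block_conj(1)[OF A(1,2)] mm[unfolded L_def]
      by (intro nn_integral_distr[symmetric]) auto
    also have "\<dots> = (\<integral>\<^sup>+y. f (part n (Suc K) (merge J L (x, y))) \<partial>gauss L)"
      unfolding L_def gauss_block_conj(2)[OF A(1,2)] ..
    finally show "(\<integral>\<^sup>+y. f (part n K (merge J L (x, y))) \<partial>gauss L) =
      (\<integral>\<^sup>+y. f (part n (Suc K) (merge J L (x, y))) \<partial>gauss L)" .
  qed
qed

lemma part_all:
  assumes f: "f \<in> borel_measurable (mat_space n)" and inv: "conj_invariant n f"
  shows "(\<integral>\<^sup>+\<xi>. f (part n n \<xi>) \<partial>gauss (ut n)) = (\<integral>\<^sup>+\<xi>. f (part n 0 \<xi>) \<partial>gauss (ut n))"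
proof -
  have "(\<integral>\<^sup>+\<xi>. f (part n K \<xi>) \<partial>gauss (ut n)) = (\<integral>\<^sup>+\<xi>. f (part n 0 \<xi>) \<partial>gauss (ut n))" if "K \<le> n" for K
    using that
  proof (induction K)
    case (Suc K)
    then show ?case using part_step[OF _ f inv, of K] by (simp only: Suc_le_eq less_imp_le)
  qed simp
  from this[OF order_refl] show ?thesis .
qed

text \<open>For \<open>b = 0\<close> the block is the whole matrix, so this is
  \<open>gauss_block_conj\<close> without any fixed coordinates.\<close>

lemma nn_integral_GOE_conj:
  assumes n: "0 < n" and f [measurable]: "f \<in> borel_measurable (mat_space n)" and A: "orthm n A"
  shows "(\<integral>\<^sup>+W. f (conj_by n A W) \<partial>GOE n) = (\<integral>\<^sup>+W. f W \<partial>GOE n)"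
proof -
  have fx: "fixes_below n 0 A" by (simp add: fixes_below_def)
  have ix: "block_ix n 0 = ut n" by (simp add: block_ix_def ut_def)
  have blk: "part n 0 \<xi> (i, j) = block 0 \<xi> (i, j) / sqrt (real n)" if "i < n" "j < n" for \<xi> i j
    using that by (simp add: part_def block_def)
  have eq: "conj_by n A (part n 0 \<xi>) = part n 0 (block_conj n 0 A \<xi>)" for \<xi>
  proof (rule ext)
    fix p :: "nat \<times> nat"
    obtain i j where p: "p = (i, j)" by (cases p)
    show "conj_by n A (part n 0 \<xi>) p = part n 0 (block_conj n 0 A \<xi>) p"
    proof (cases "i < n \<and> j < n")
      case True
      then have "conj_by n A (part n 0 \<xi>) (i, j) = conj_by n A (block 0 \<xi>) (i, j) / sqrt (real n)"
        by (simp add: conj_by_def blk sum_divide_distrib)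
      also have "\<dots> = part n 0 (block_conj n 0 A \<xi>) (i, j)"
        using True conj_by_block_eq[OF fx] by (simp add: blk)
      finally show ?thesis by (simp add: p)
    qed (auto simp: p conj_by_def part_def)
  qed
  define A' where "A' = (\<lambda>p\<in>sq n. A p)"
  have A': "conj_by n A M = conj_by n A' M" for M by (auto simp: conj_by_def A'_def fun_eq_iff)
  have "(\<lambda>_. A') \<in> measurable (mat_space n) (mat_space n)"
    by (rule measurable_const) (simp add: A'_def space_mat_space)
  then have "(\<lambda>W. conj_by n A' W) \<in> measurable (mat_space n) (mat_space n)"
    by (rule measurable_conj_by) simp
  then have m: "(\<lambda>W. f (conj_by n A W)) \<in> borel_measurable (mat_space n)"
    unfolding A' by (rule measurable_compose[OF _ f])
  have "(\<integral>\<^sup>+W. f (conj_by n A W) \<partial>GOE n) = (\<integral>\<^sup>+\<xi>. f (conj_by n A (part n 0 \<xi>)) \<partial>gauss (ut n))"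
    unfolding GOE_eq[OF n] by (rule nn_integral_distr[OF measurable_part]) (simp only: measurable_distr_eq1 m)
  also have "\<dots> = (\<integral>\<^sup>+\<xi>. f (part n 0 (block_conj n 0 A \<xi>)) \<partial>gauss (ut n))" by (simp only: eq)
  also have "\<dots> = (\<integral>\<^sup>+\<xi>. f (part n 0 \<xi>) \<partial>distr (gauss (ut n)) (gauss (ut n)) (block_conj n 0 A))"
    using gauss_block_conj(1)[OF A fx] measurable_compose[OF measurable_part f, of 0] unfolding ix
    by (intro nn_integral_distr[symmetric]) auto
  also have "\<dots> = (\<integral>\<^sup>+\<xi>. f (part n 0 \<xi>) \<partial>gauss (ut n))"
    using gauss_block_conj(2)[OF A fx] unfolding ix by simp
  also have "\<dots> = (\<integral>\<^sup>+W. f W \<partial>GOE n)"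
    unfolding GOE_eq[OF n] by (rule nn_integral_distr[symmetric, OF measurable_part]) (simp only: measurable_distr_eq1 f)
  finally show ?thesis .
qed

text \<open>Averaging over the Haar measure makes any test function conjugation invariant, so the reflection \<open>R\<close> can
  be dropped and the tridiagonal model replaced by the GOE.\<close>

theorem nn_integral_haar_tridiagonal:
  assumes n: "0 < n" and f [measurable]: "f \<in> borel_measurable (mat_space n)" and R: "orthm n R"
  shows "(\<integral>\<^sup>+Q. \<integral>\<^sup>+\<xi>. f (conj_by n (mm n Q R) (part n n \<xi>)) \<partial>gauss (ut n) \<partial>haar n) = (\<integral>\<^sup>+W. f W \<partial>GOE n)"
proof -
  interpret h: prob_space "haar n" by (rule prob_space_haar)
  interpret g: prob_space "gauss (ut n)" by (rule prob_space_gauss)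
  interpret W: prob_space "GOE n" by (rule prob_space_GOE[OF n])
  interpret hg: pair_sigma_finite "haar n" "gauss (ut n)" ..
  define F where "F M = (\<integral>\<^sup>+Q. f (conj_by n Q M) \<partial>haar n)" for M
  have F: "F \<in> borel_measurable (mat_space n)"
    unfolding F_def by measurable
  have inv: "F (conj_by n A M) = F M" if A: "orthm n A" for A M
  proof -
    define M' where "M' = (\<lambda>p\<in>sq n. M p)"
    have M': "conj_by n Q M = conj_by n Q M'" for Q by (auto simp: conj_by_def M'_def fun_eq_iff)
    have "(\<lambda>_. M') \<in> measurable (mat_space n) (mat_space n)"
      by (rule measurable_const) (simp add: M'_def space_mat_space)
    then have "(\<lambda>Q. f (conj_by n Q M')) \<in> borel_measurable (mat_space n)"
      by (intro measurable_compose[OF measurable_conj_by f] measurable_ident_sets refl)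
    then have "(\<integral>\<^sup>+Q. f (conj_by n (mm n Q A) M) \<partial>haar n) = (\<integral>\<^sup>+Q. f (conj_by n Q M) \<partial>haar n)"
      unfolding M' using nn_integral_haar_right[of "\<lambda>Q. f (conj_by n Q M')" n A] A by simp
    then show ?thesis by (simp add: F_def conj_by_mm)
  qed
  then have cinv: "conj_invariant n F" by (simp add: conj_invariant_def)
  define R' where "R' = (\<lambda>p\<in>sq n. R p)"
  have R': "mm n Q R = mm n Q R'" for Q by (auto simp: mm_def R'_def fun_eq_iff)
  have [measurable]: "R' \<in> space (mat_space n)" by (simp add: R'_def space_mat_space)
  have "(\<integral>\<^sup>+Q. \<integral>\<^sup>+\<xi>. f (conj_by n (mm n Q R) (part n n \<xi>)) \<partial>gauss (ut n) \<partial>haar n) =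
    (\<integral>\<^sup>+\<xi>. \<integral>\<^sup>+Q. f (conj_by n (mm n Q R') (part n n \<xi>)) \<partial>haar n \<partial>gauss (ut n))"
    unfolding R' by (rule hg.Fubini'[symmetric]) measurable
  also have "\<dots> = (\<integral>\<^sup>+\<xi>. F (conj_by n R (part n n \<xi>)) \<partial>gauss (ut n))"
    unfolding R'[symmetric] by (simp add: F_def conj_by_mm)
  also have "\<dots> = (\<integral>\<^sup>+\<xi>. F (part n n \<xi>) \<partial>gauss (ut n))" by (simp add: inv[OF R])
  also have "\<dots> = (\<integral>\<^sup>+\<xi>. F (part n 0 \<xi>) \<partial>gauss (ut n))" by (rule part_all[OF F cinv])
  also have "\<dots> = (\<integral>\<^sup>+Q. \<integral>\<^sup>+\<xi>. f (conj_by n Q (part n 0 \<xi>)) \<partial>gauss (ut n) \<partial>haar n)"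
    unfolding F_def by (rule hg.Fubini') measurable
  \<comment> \<open>A fixed orthogonal \<open>Q\<close> preserves the GOE law, so the average over
    the Haar measure, introduced to gain invariance, disappears again.\<close>
  also have "\<dots> = (\<integral>\<^sup>+Q. \<integral>\<^sup>+W. f W \<partial>GOE n \<partial>haar n)"
  proof (rule nn_integral_cong_AE)
    show "AE Q in haar n. (\<integral>\<^sup>+\<xi>. f (conj_by n Q (part n 0 \<xi>)) \<partial>gauss (ut n)) = (\<integral>\<^sup>+W. f W \<partial>GOE n)"
      using AE_haar_orthm AE_space
    proof eventually_elim
      case (elim Q)
      have "(\<lambda>_. Q) \<in> measurable (mat_space n) (mat_space n)"
        by (rule measurable_const) (use elim in simp)
      then have "(\<lambda>W. f (conj_by n Q W)) \<in> borel_measurable (mat_space n)"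
        by (intro measurable_compose[OF measurable_conj_by f] measurable_ident_sets refl)
      then have "(\<integral>\<^sup>+\<xi>. f (conj_by n Q (part n 0 \<xi>)) \<partial>gauss (ut n)) = (\<integral>\<^sup>+W. f (conj_by n Q W) \<partial>GOE n)"
        unfolding GOE_eq[OF n] by (subst nn_integral_distr[OF measurable_part]) auto
      also have "\<dots> = (\<integral>\<^sup>+W. f W \<partial>GOE n)" by (rule nn_integral_GOE_conj[OF n f]) (use elim in simp)
      finally show ?case .
    qed
  qed
  also have "\<dots> = (\<integral>\<^sup>+W. f W \<partial>GOE n)" by (simp add: h.emeasure_space_1[unfolded space_haar])
  finally show ?thesis .
qed

section \<open>The matrix produced by the reduction\<close>

context windows
begin

text \<open>Row \<open>l\<close> is the image of the basis vector \<open>l\<close>: the reflections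
  act on row vectors by multiplication from the right, which fits the column index of the
  frame.\<close>

definition refl_mat :: "nat \<times> nat \<Rightarrow> real" where
  "refl_mat = (\<lambda>(l, k). reflect N m r (n - N) (\<lambda>i. if i = l then 1 else 0) k)"

lemma reflect_expand:
  assumes k: "k < n"
  shows "reflect N m r (n - N) v k = (\<Sum>l<n. v l * refl_mat (l, k))"
proof -
  have "reflect N m r (n - N) v k = reflect N m r (n - N) (\<lambda>i. \<Sum>l<n. v l * (if i = l then 1 else 0)) k"
  proof (rule reflect_cong[OF order_refl _ k])
    fix i assume i: "i < n"
    have "(\<Sum>l<n. v l * (if i = l then 1 else 0)) = (\<Sum>l<n. if l = i then v l else 0)"
      by (intro sum.cong) auto
    then show "v i = (\<Sum>l<n. v l * (if i = l then 1 else 0))" using i by simp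
  qed
  also have "\<dots> = (\<Sum>l<n. v l * refl_mat (l, k))"
    by (subst reflect_sum) (simp_all add: refl_mat_def)
  finally show ?thesis .
qed

text \<open>Polarising the norm identity for two basis vectors shows that the rows are orthonormal;
  transposition passes to the columns.\<close>

lemma orthm_refl_mat: "orthm n refl_mat"
proof -
  have "ortho {..<n} (\<lambda>k l. refl_mat (l, k))"
    unfolding ortho_def
  proof (intro ballI)
    fix j l assume jl: "j \<in> {..<n}" "l \<in> {..<n}"
    define e where "e j = (\<lambda>i. if i = j then 1 else 0 :: real)" for j :: nat
    have ee: "(\<Sum>k<n. e j k * e l k) = (if j = l then 1 else 0)" if "j < n" for j l
    proof -
      have "(\<Sum>k<n. e j k * e l k) = (\<Sum>k<n. if k = j then (if j = l then 1 else 0) else 0)"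
        by (intro sum.cong) (auto simp: e_def)
      then show ?thesis using that by simp
    qed
    have sq2: "(\<Sum>k<n. (u k + v k)\<^sup>2) = (\<Sum>k<n. (u k)\<^sup>2) + 2 * (\<Sum>k<n. u k * v k) + (\<Sum>k<n. (v k)\<^sup>2)"
      for u v :: "nat \<Rightarrow> real"
      unfolding power2_sum sum.distrib sum_distrib_left by (simp add: mult.assoc)
    have R: "(\<lambda>k. refl_mat (j, k)) = reflect N m r (n - N) (e j)" for j
      by (simp add: refl_mat_def e_def)
    have add: "reflect N m r (n - N) (\<lambda>k. e j k + e l k) = (\<lambda>k. refl_mat (j, k) + refl_mat (l, k))"
      using reflect_linear[of "n - N" 1 "e j" 1 "e l"] by (simp add: refl_mat_def e_def)
    have "(\<Sum>k<n. (refl_mat (j, k) + refl_mat (l, k))\<^sup>2) = (\<Sum>k<n. (e j k + e l k)\<^sup>2)"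
      using reflect_norm[OF order_refl, of "\<lambda>k. e j k + e l k"] unfolding add .
    moreover have "(\<Sum>k<n. (refl_mat (j, k))\<^sup>2) = (\<Sum>k<n. (e j k)\<^sup>2)" for j
      using reflect_norm[OF order_refl, of "e j"] by (simp add: R[symmetric])
    ultimately have "(\<Sum>k<n. refl_mat (j, k) * refl_mat (l, k)) = (\<Sum>k<n. e j k * e l k)"
      unfolding sq2 by simp
    then show "(\<Sum>i<n. refl_mat (j, i) * refl_mat (l, i)) = (if j = l then 1 else 0)"
      using ee jl by simp
  qed
  from ortho_transpose[OF this] show ?thesis by (simp add: orthm_def)
qed

lemma tridiagonal_sum:
  fixes T :: "nat \<times> nat \<Rightarrow> real"
  assumes T: "\<And>k l. k < n \<Longrightarrow> l < n \<Longrightarrow> k \<noteq> l \<Longrightarrow> k \<noteq> Suc l \<Longrightarrow> l \<noteq> Suc k \<Longrightarrow> T (k, l) = 0"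
    and sym: "\<And>k. Suc k < n \<Longrightarrow> T (Suc k, k) = T (k, Suc k)"
  shows "(\<Sum>k<n. \<Sum>l<n. T (k, l) * f k l) =
    (\<Sum>k<n. T (k, k) * f k k + (if Suc k < n then T (k, Suc k) * (f k (Suc k) + f (Suc k) k) else 0))"
proof -
  have "(\<Sum>k<n. \<Sum>l<n. T (k, l) * f k l) = (\<Sum>k<n. \<Sum>l<n. (if l = k then T (k, k) * f k k else 0) +
      (if l = Suc k then T (k, Suc k) * f k (Suc k) else 0) + (if k = Suc l then T (Suc l, l) * f (Suc l) l else 0))"
    by (intro sum.cong refl) (auto simp: T)
  also have "\<dots> = (\<Sum>k<n. \<Sum>l<n. if l = k then T (k, k) * f k k else 0) +
     (\<Sum>k<n. \<Sum>l<n. if l = Suc k then T (k, Suc k) * f k (Suc k) else 0) +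
     (\<Sum>k<n. \<Sum>l<n. if k = Suc l then T (Suc l, l) * f (Suc l) l else 0)"
    by (simp add: sum.distrib)
  also have "(\<Sum>k<n. \<Sum>l<n. if k = Suc l then T (Suc l, l) * f (Suc l) l else 0) =
     (\<Sum>l<n. \<Sum>k<n. if k = Suc l then T (Suc l, l) * f (Suc l) l else 0)" by (rule sum.swap)
  also have "\<dots> = (\<Sum>l<n. if Suc l < n then T (l, Suc l) * f (Suc l) l else 0)"
    by (intro sum.cong refl) (auto simp: sym)
  also have "(\<Sum>k<n. \<Sum>l<n. if l = Suc k then T (k, Suc k) * f k (Suc k) else 0) =
    (\<Sum>k<n. if Suc k < n then T (k, Suc k) * f k (Suc k) else 0)"
    by (intro sum.cong refl) auto
  also have "(\<Sum>k<n. \<Sum>l<n. if l = k then T (k, k) * f k k else 0) = (\<Sum>k<n. T (k, k) * f k k)"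
    by (intro sum.cong refl) auto
  finally show ?thesis
    by (simp only: sum.distrib[symmetric]) (intro sum.cong refl, simp add: algebra_simps)
qed

lemma reduction_eq:
  assumes G: "\<And>k i. k < n \<Longrightarrow> i < n \<Longrightarrow> filled n N Y \<omega> k i = G (k, i)"
    and \<xi>: "\<And>k l. k \<le> l \<Longrightarrow> l < n \<Longrightarrow> \<xi> (k, l) = \<omega> (n * n + (k * n + l))"
  shows "reduction n N m r Y \<omega> = conj_by n (mm n (gs_mat n G) refl_mat) (part n n \<xi>)"
proof (rule ext)
  fix p :: "nat \<times> nat"
  obtain i j where p: "p = (i, j)" by (cases p)
  let ?B = "mm n (gs_mat n G) refl_mat" and ?T = "part n n \<xi>"
  let ?F = "frame n N m r (filled n N Y \<omega>)" and ?w = "\<lambda>l. \<omega> (n * n + l)"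
  show "reduction n N m r Y \<omega> p = conj_by n ?B ?T p"
  proof (cases "i < n \<and> j < n")
    case True
    have fG: "filled n N Y \<omega> = (\<lambda>k i. if k < n \<and> i < n then G (k, i) else 0)"
      using G by (auto simp: fun_eq_iff filled_def)
    have F: "?F k i = ?B (i, k)" if "k < n" "i < n" for k i
      using that by (simp add: frame_def fG reflect_expand mm_def gs_mat_def)
    have a: "?T (k, k) = wig_a n ?w k" if "k < n" for k
      using that \<xi>[of k k] by (simp add: part_def wig_a_def mult.commute)
    have b: "?T (k, Suc k) = wig_b n ?w k" if "Suc k < n" for k
    proof -
      have "(\<Sum>l\<in>{Suc k..<n}. (\<xi> (k, l))\<^sup>2) = (\<Sum>l\<in>{Suc k..<n}. (\<omega> (n * n + (k * n + l)))\<^sup>2)"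
        by (intro sum.cong refl) (simp add: \<xi>)
      then show ?thesis using that by (simp add: part_def wig_b_def min_def max_def)
    qed
    have b0: "wig_b n ?w k = 0" if "\<not> Suc k < n" for k
      using that by (simp add: wig_b_def)
    have "conj_by n ?B ?T (i, j) = (\<Sum>k<n. \<Sum>l<n. ?T (k, l) * (?B (i, k) * ?B (j, l)))"
      using True by (simp add: conj_by_def mult_ac)
    also have "\<dots> = (\<Sum>k<n. ?T (k, k) * (?B (i, k) * ?B (j, k)) +
      (if Suc k < n then ?T (k, Suc k) * (?B (i, k) * ?B (j, Suc k) + ?B (i, Suc k) * ?B (j, k)) else 0))"
    proof (rule tridiagonal_sum)
      fix k l :: nat assume "k < n" "l < n" "k \<noteq> l" "k \<noteq> Suc l" "l \<noteq> Suc k"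
      then show "?T (k, l) = 0" by (auto simp: part_def min_def max_def)
    next
      fix k assume "Suc k < n"
      then show "?T (Suc k, k) = ?T (k, Suc k)" by (intro part_symmetric) auto
    qed
    also have "\<dots> = (\<Sum>k<n. wig_term n ?w ?F k i j)"
    proof (intro sum.cong refl)
      fix k assume k: "k \<in> {..<n}"
      show "?T (k, k) * (?B (i, k) * ?B (j, k)) +
        (if Suc k < n then ?T (k, Suc k) * (?B (i, k) * ?B (j, Suc k) + ?B (i, Suc k) * ?B (j, k)) else 0) =
        wig_term n ?w ?F k i j"
      proof (cases "Suc k < n")
        case True
        then have "?F k i = ?B (i, k)" "?F k j = ?B (j, k)" "?F (Suc k) i = ?B (i, Suc k)" "?F (Suc k) j = ?B (j, Suc k)"
          using k \<open>i < n \<and> j < n\<close> by (simp_all only: F lessThan_iff)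
        then show ?thesis using k True by (simp add: wig_term_def a b mult.commute add.commute)
      next
        case False
        moreover have "?F k i = ?B (i, k)" "?F k j = ?B (j, k)"
          using k \<open>i < n \<and> j < n\<close> by (simp_all only: F lessThan_iff)
        ultimately show ?thesis using k by (simp add: wig_term_def a b0)
      qed
    qed
    also have "\<dots> = reduction n N m r Y \<omega> (i, j)" using True by (simp add: reduction_def)
    finally show ?thesis by (simp add: p)
  qed (auto simp: p reduction_def conj_by_def)
qed

end

section \<open>Splitting the random tape\<close>

lemma coins_eq_gauss: "coins = gauss UNIV"
  by (simp add: coins_def gauss_def)

lemma prob_space_coins: "prob_space coins"
  unfolding coins_eq_gauss by (rule prob_space_gauss)

lemma space_coins [simp]: "space coins = UNIV"
  by (simp add: coins_eq_gauss space_gauss PiE_UNIV_domain)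

lemma measurable_coinsI:
  assumes "\<And>i. (\<lambda>z. f z i) \<in> borel_measurable M"
  shows "f \<in> measurable M coins"
  unfolding coins_eq_gauss by (rule measurable_gaussI, rule assms) simp

lemma measurable_coins_component: "(\<lambda>\<omega>. \<omega> i) \<in> borel_measurable coins"
  unfolding coins_eq_gauss by (rule measurable_gauss_component) simp

lemma measurable_coins_pick:
  "(\<lambda>\<omega>. \<lambda>p\<in>I. \<omega> (f p)) \<in> measurable coins (gauss I)"
proof (rule measurable_gaussI)
  fix i assume "i \<in> I"
  then have "(\<lambda>\<omega>. (\<lambda>p\<in>I. \<omega> (f p)) i) = (\<lambda>\<omega>. \<omega> (f i) :: real)" by simp
  then show "(\<lambda>\<omega>. (\<lambda>p\<in>I. \<omega> (f p)) i) \<in> borel_measurable coins"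
    by (simp only: measurable_coins_component)
qed auto

lemma measurable_coins_shift: "(\<lambda>\<omega> i. \<omega> (i + a)) \<in> measurable coins coins"
  by (rule measurable_coinsI) (rule measurable_coins_component)

lemma nn_integral_coins_pick:
  assumes "inj_on f I" and g: "g \<in> borel_measurable (gauss I)"
  shows "(\<integral>\<^sup>+\<omega>. g (\<lambda>p\<in>I. \<omega> (f p)) \<partial>coins) = (\<integral>\<^sup>+x. g x \<partial>gauss I)"
proof -
  have "distr coins (gauss I) (\<lambda>\<omega>. \<lambda>p\<in>I. \<omega> (f p)) = gauss I"
    unfolding coins_def gauss_def
    by (rule distr_PiM_reindex) (use assms in \<open>auto simp: prob_space_normal_law\<close>)
  then have "(\<integral>\<^sup>+x. g x \<partial>gauss I) = (\<integral>\<^sup>+x. g x \<partial>distr coins (gauss I) (\<lambda>\<omega>. \<lambda>p\<in>I. \<omega> (f p)))"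
    by simp
  also have "\<dots> = (\<integral>\<^sup>+\<omega>. g (\<lambda>p\<in>I. \<omega> (f p)) \<partial>coins)"
    using g by (intro nn_integral_distr measurable_coins_pick) simp
  finally show ?thesis by simp
qed

text \<open>\<open>comb_seq a\<close> takes its first \<open>a\<close> cells from one tape and the
  others from a second one. An integral over one tape thus becomes one over two independent
  tapes.\<close>

lemma nn_integral_coins_split:
  assumes f: "f \<in> borel_measurable coins"
  shows "(\<integral>\<^sup>+\<omega>. f \<omega> \<partial>coins) = (\<integral>\<^sup>+\<omega>. \<integral>\<^sup>+\<omega>'. f (comb_seq a \<omega> \<omega>') \<partial>coins \<partial>coins)"
proof -
  interpret S: sequence_space "normal_law 1"
    unfolding sequence_space_def
    by (simp add: product_prob_space_def product_prob_space_axioms_def product_sigma_finite_def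
      prob_space_normal_law prob_space_imp_sigma_finite)
  interpret C: prob_space coins by (rule prob_space_coins)
  have m: "(\<lambda>(\<omega>, \<omega>'). comb_seq a \<omega> \<omega>') \<in> measurable (coins \<Otimes>\<^sub>M coins) coins"
    unfolding coins_def by (rule measurable_comb_seq)
  have "coins = distr (coins \<Otimes>\<^sub>M coins) coins (\<lambda>(\<omega>, \<omega>'). comb_seq a \<omega> \<omega>')"
    unfolding coins_def by (rule S.PiM_comb_seq[symmetric])
  then have "(\<integral>\<^sup>+\<omega>. f \<omega> \<partial>coins) = (\<integral>\<^sup>+\<omega>. f \<omega> \<partial>distr (coins \<Otimes>\<^sub>M coins) coins (\<lambda>(\<omega>, \<omega>'). comb_seq a \<omega> \<omega>'))"
    by simp
  also have "\<dots> = (\<integral>\<^sup>+z. f (case z of (\<omega>, \<omega>') \<Rightarrow> comb_seq a \<omega> \<omega>') \<partial>(coins \<Otimes>\<^sub>M coins))"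
    using f by (intro nn_integral_distr m) simp
  also have "\<dots> = (\<integral>\<^sup>+\<omega>. \<integral>\<^sup>+\<omega>'. f (comb_seq a \<omega> \<omega>') \<partial>coins \<partial>coins)"
    using measurable_compose[OF m f] by (subst C.nn_integral_fst[symmetric]) (auto simp: case_prod_beta)
  finally show ?thesis .
qed

lemma index_less: "k < n \<Longrightarrow> l < n \<Longrightarrow> k * n + l < n * n" for n :: nat
proof -
  assume "k < n" "l < n"
  then have "k * n + l < Suc k * n" "Suc k * n \<le> n * n" by (auto intro: mult_le_mono1 simp del: mult_Suc) simp_all
  then show ?thesis by linarith
qed

lemma inj_index: "inj_on (\<lambda>(k, l). k * n + l) (A \<times> {..<n})" for n :: nat
proof (rule inj_onI)
  fix p q assume "p \<in> A \<times> {..<n}" "q \<in> A \<times> {..<n}" and eq: "(case p of (k, l) \<Rightarrow> k * n + l) = (case q of (k, l) \<Rightarrow> k * n + l)"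
  then obtain k l k' l' where pq: "p = (k, l)" "q = (k', l')" "l < n" "l' < n" by auto
  with eq have "(k * n + l) div n = (k' * n + l') div n" "(k * n + l) mod n = (k' * n + l') mod n" by auto
  then show "p = q" using pq by simp
qed

definition fresh :: "nat \<Rightarrow> nat \<Rightarrow> (nat \<Rightarrow> real) \<Rightarrow> nat \<times> nat \<Rightarrow> real" where
  "fresh n N \<omega> = (\<lambda>p\<in>{N..<n} \<times> {..<n}. \<omega> (fst p * n + snd p))"

definition upper :: "nat \<Rightarrow> (nat \<Rightarrow> real) \<Rightarrow> nat \<times> nat \<Rightarrow> real" where
  "upper n \<omega> = (\<lambda>p\<in>ut n. \<omega> (n * n + (fst p * n + snd p)))"

definition rowsof :: "nat \<Rightarrow> nat \<Rightarrow> (nat \<times> nat \<Rightarrow> real) \<Rightarrow> (nat \<times> nat \<Rightarrow> real) \<Rightarrow> nat \<times> nat \<Rightarrow> real" where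
  "rowsof n N g h = merge ({..<N} \<times> {..<n}) ({N..<n} \<times> {..<n}) (g, h)"

text \<open>Three disjoint stretches of tape are used: \<open>n * n\<close> cells for the added
  rows, \<open>n * n\<close> for the tridiagonal matrix, and the remainder for the certificate.
  Cutting at \<open>2 * (n * n)\<close> and then at \<open>n * n\<close> makes them independent; the
  added rows finally join the samples to form one Gaussian array.\<close>

lemma nn_integral_tape:
  assumes N: "N \<le> n" and \<Phi>: "\<Phi> \<in> borel_measurable (gauss (sq n) \<Otimes>\<^sub>M (gauss (ut n) \<Otimes>\<^sub>M coins))"
  shows "(\<integral>\<^sup>+g. \<integral>\<^sup>+\<omega>. \<Phi> (rowsof n N g (fresh n N \<omega>), upper n \<omega>, \<lambda>i. \<omega> (i + 2 * (n * n))) \<partial>coins \<partial>gauss ({..<N} \<times> {..<n})) =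
    (\<integral>\<^sup>+G. \<integral>\<^sup>+\<xi>. \<integral>\<^sup>+\<omega>. \<Phi> (G, \<xi>, \<omega>) \<partial>coins \<partial>gauss (ut n) \<partial>gauss (sq n))"
proof -
  interpret C: prob_space coins by (rule prob_space_coins)
  interpret U: prob_space "gauss (ut n)" by (rule prob_space_gauss)
  define I J where "I = {..<N} \<times> {..<n}" and "J = {N..<n} \<times> {..<n}"
  have IJ: "I \<inter> J = {}" "finite I" "finite J" "sq n = I \<union> J" using N by (auto simp: I_def J_def)
  define \<Psi> where "\<Psi> G \<xi> = (\<integral>\<^sup>+\<omega>. \<Phi> (G, \<xi>, \<omega>) \<partial>coins)" for G \<xi>
  have \<Psi>m: "(\<lambda>(G, \<xi>). \<Psi> G \<xi>) \<in> borel_measurable (gauss (sq n) \<Otimes>\<^sub>M gauss (ut n))"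
  proof -
    have "(\<lambda>z. (fst (fst z), snd (fst z), snd z)) \<in>
        measurable ((gauss (sq n) \<Otimes>\<^sub>M gauss (ut n)) \<Otimes>\<^sub>M coins) (gauss (sq n) \<Otimes>\<^sub>M (gauss (ut n) \<Otimes>\<^sub>M coins))"
      by (rule measurable_Pair[OF measurable_compose[OF measurable_fst measurable_fst]
            measurable_Pair[OF measurable_compose[OF measurable_fst measurable_snd] measurable_snd]])
    from C.borel_measurable_nn_integral_fst[OF measurable_compose[OF this \<Phi>]]
    show ?thesis by (simp add: \<Psi>_def case_prod_beta')
  qed
  define \<Theta> where "\<Theta> G = (\<integral>\<^sup>+\<xi>. \<Psi> G \<xi> \<partial>gauss (ut n))" for G
  have \<Theta>m: "\<Theta> \<in> borel_measurable (gauss (sq n))"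
    unfolding \<Theta>_def using U.borel_measurable_nn_integral_fst[OF \<Psi>m] by simp
  have inner: "(\<integral>\<^sup>+\<omega>. \<Phi> (rowsof n N g (fresh n N \<omega>), upper n \<omega>, \<lambda>i. \<omega> (i + 2 * (n * n))) \<partial>coins) =
      (\<integral>\<^sup>+h. \<Theta> (merge I J (g, h)) \<partial>gauss J)" if g: "g \<in> space (gauss I)" for g
  proof -
    have mr: "(\<lambda>h. rowsof n N g h) \<in> measurable (gauss J) (gauss (sq n))"
      using measurable_compose[OF measurable_Pair1'[OF g] measurable_merge_gauss[OF IJ(1)]]
      unfolding IJ(4) by (simp add: rowsof_def I_def J_def)
    have mf: "fresh n N \<in> measurable coins (gauss J)"
      unfolding fresh_def[abs_def] J_def by (rule measurable_coins_pick)
    have mu: "upper n \<in> measurable coins (gauss (ut n))"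
      unfolding upper_def[abs_def] by (rule measurable_coins_pick)
    have mG: "(\<lambda>\<omega>. rowsof n N g (fresh n N \<omega>)) \<in> measurable coins (gauss (sq n))"
      by (rule measurable_compose[OF mf mr])
    have f1: "(\<lambda>\<omega>. \<Phi> (rowsof n N g (fresh n N \<omega>), upper n \<omega>, \<lambda>i. \<omega> (i + 2 * (n * n)))) \<in> borel_measurable coins"
      by (rule measurable_compose[OF _ \<Phi>], intro measurable_Pair mG mu measurable_coins_shift)
    have f2: "(\<lambda>\<omega>. \<Psi> (rowsof n N g (fresh n N \<omega>)) (upper n \<omega>)) \<in> borel_measurable coins"
      using measurable_compose[OF measurable_Pair[OF mG mu] \<Psi>m] by simp
    have c1: "fresh n N (comb_seq a \<omega> \<omega>') = fresh n N \<omega>" if "n * n \<le> a" for a \<omega> \<omega>'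
      using that index_less by (force simp: fresh_def comb_seq_less intro!: restrict_ext)
    have c2: "upper n (comb_seq (2 * (n * n)) \<omega> \<omega>') = upper n \<omega>" for \<omega> \<omega>'
    proof -
      have "n * n + (k * n + l) < 2 * (n * n)" if "(k, l) \<in> ut n" for k l
        using that index_less[of k n l] by (auto simp: ut_def)
      then show ?thesis by (auto simp: upper_def comb_seq_less intro!: restrict_ext)
    qed
    have c3: "upper n (comb_seq (n * n) \<omega> \<omega>') = (\<lambda>p\<in>ut n. \<omega>' (fst p * n + snd p))" for \<omega> \<omega>'
      by (auto simp: upper_def comb_seq_def intro!: restrict_ext)
    have "(\<integral>\<^sup>+\<omega>. \<Phi> (rowsof n N g (fresh n N \<omega>), upper n \<omega>, \<lambda>i. \<omega> (i + 2 * (n * n))) \<partial>coins) =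
      (\<integral>\<^sup>+\<omega>. \<Psi> (rowsof n N g (fresh n N \<omega>)) (upper n \<omega>) \<partial>coins)"
      unfolding nn_integral_coins_split[OF f1, of "2 * (n * n)"]
      by (simp add: c1 c2 comb_seq_add \<Psi>_def)
    also have "\<dots> = (\<integral>\<^sup>+\<omega>. \<integral>\<^sup>+\<omega>'. \<Psi> (rowsof n N g (fresh n N \<omega>)) (\<lambda>p\<in>ut n. \<omega>' (fst p * n + snd p)) \<partial>coins \<partial>coins)"
      unfolding nn_integral_coins_split[OF f2, of "n * n"] by (simp add: c1 c3)
    also have "\<dots> = (\<integral>\<^sup>+\<omega>. \<Theta> (rowsof n N g (fresh n N \<omega>)) \<partial>coins)"
    proof (rule nn_integral_cong)
      fix \<omega>
      have "(\<lambda>\<xi>. \<Psi> (rowsof n N g (fresh n N \<omega>)) \<xi>) \<in> borel_measurable (gauss (ut n))"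
        using measurable_compose[OF measurable_Pair1'[OF measurable_space[OF mG, of \<omega>]] \<Psi>m] by simp
      moreover have "inj_on (\<lambda>p. fst p * n + snd p) (ut n)"
        by (rule inj_on_subset[OF inj_index[of n UNIV, unfolded case_prod_unfold]]) (auto simp: ut_def)
      ultimately show "(\<integral>\<^sup>+\<omega>'. \<Psi> (rowsof n N g (fresh n N \<omega>)) (\<lambda>p\<in>ut n. \<omega>' (fst p * n + snd p)) \<partial>coins) =
        \<Theta> (rowsof n N g (fresh n N \<omega>))"
        unfolding \<Theta>_def by (rule nn_integral_coins_pick[rotated])
    qed
    also have "\<dots> = (\<integral>\<^sup>+h. \<Theta> (rowsof n N g h) \<partial>gauss J)"
    proof -
      have "inj_on (\<lambda>p. fst p * n + snd p) J"
        using inj_index[of n "{N..<n}"] by (simp add: J_def case_prod_unfold)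
      then show ?thesis
        unfolding fresh_def J_def by (rule nn_integral_coins_pick) (rule measurable_compose[OF mr \<Theta>m, unfolded J_def])
    qed
    finally show ?thesis by (simp add: rowsof_def I_def J_def)
  qed
  have "(\<integral>\<^sup>+g. \<integral>\<^sup>+\<omega>. \<Phi> (rowsof n N g (fresh n N \<omega>), upper n \<omega>, \<lambda>i. \<omega> (i + 2 * (n * n))) \<partial>coins \<partial>gauss I) =
    (\<integral>\<^sup>+g. \<integral>\<^sup>+h. \<Theta> (merge I J (g, h)) \<partial>gauss J \<partial>gauss I)"
    by (rule nn_integral_cong) (rule inner)
  also have "\<dots> = (\<integral>\<^sup>+G. \<Theta> G \<partial>gauss (sq n))"
    unfolding IJ(4) by (rule nn_integral_gauss_fold[symmetric, OF IJ(1-3)]) (use \<Theta>m IJ(4) in simp)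
  finally show ?thesis by (simp add: \<Theta>_def \<Psi>_def I_def)
qed

section \<open>Gaussian samples\<close>

text \<open>Independent Gaussian rows are one Gaussian family over pairs of indices, because both
  laws agree on boxes.\<close>

lemma distr_flatten:
  fixes A :: "'a set" and B :: "'b set"
  assumes A: "finite A" and B: "finite B"
  shows "distr (\<Pi>\<^sub>M k\<in>A. gauss B) (gauss (A \<times> B)) (\<lambda>Y. \<lambda>p\<in>A \<times> B. Y (fst p) (snd p)) = gauss (A \<times> B)"
    and "(\<lambda>Y. \<lambda>p\<in>A \<times> B. Y (fst p) (snd p)) \<in> measurable (\<Pi>\<^sub>M k\<in>A. gauss B) (gauss (A \<times> B))"
proof -
  let ?f = "\<lambda>Y. \<lambda>p\<in>A \<times> B. Y (fst p) (snd p)"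
  show m: "?f \<in> measurable (\<Pi>\<^sub>M k\<in>A. gauss B) (gauss (A \<times> B))"
  proof (rule measurable_gaussI)
    fix p assume p: "p \<in> A \<times> B"
    have "(\<lambda>Y. Y (fst p)) \<in> measurable (\<Pi>\<^sub>M k\<in>A. gauss B) (gauss B)"
      by (rule measurable_component_singleton) (use p in auto)
    moreover have "(\<lambda>y. y (snd p)) \<in> borel_measurable (gauss B)"
      by (rule measurable_gauss_component) (use p in auto)
    ultimately have "(\<lambda>Y. Y (fst p) (snd p)) \<in> borel_measurable (\<Pi>\<^sub>M k\<in>A. gauss B)"
      by (rule measurable_compose)
    moreover have "(\<lambda>Y. ?f Y p) = (\<lambda>Y. Y (fst p) (snd p) :: real)" using p by auto
    ultimately show "(\<lambda>Y. ?f Y p) \<in> borel_measurable (\<Pi>\<^sub>M k\<in>A. gauss B)" by (simp only:)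
  qed auto
  interpret P: product_prob_space "\<lambda>_::'a. gauss B" A
    by (rule product_prob_spaceI) (rule prob_space_gauss)
  show "distr (\<Pi>\<^sub>M k\<in>A. gauss B) (gauss (A \<times> B)) ?f = gauss (A \<times> B)"
    unfolding gauss_def[of "A \<times> B"]
  proof (rule gauss_pf.PiM_eqI)
    fix E :: "'a \<times> 'b \<Rightarrow> real set" assume E: "\<And>i. i \<in> A \<times> B \<Longrightarrow> E i \<in> sets (normal_law 1)"
    have "emeasure (distr (\<Pi>\<^sub>M k\<in>A. gauss B) (Pi\<^sub>M (A \<times> B) (\<lambda>_. normal_law 1)) ?f) (Pi\<^sub>E (A \<times> B) E) =
      emeasure (\<Pi>\<^sub>M k\<in>A. gauss B) (?f -` Pi\<^sub>E (A \<times> B) E \<inter> space (\<Pi>\<^sub>M k\<in>A. gauss B))"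
      using m E A B by (intro emeasure_distr sets_PiM_I_finite) (auto simp: gauss_def)
    also have "\<dots> = emeasure (\<Pi>\<^sub>M k\<in>A. gauss B) (Pi\<^sub>E A (\<lambda>k. Pi\<^sub>E B (\<lambda>i. E (k, i))))"
    proof (rule arg_cong[where f="emeasure (\<Pi>\<^sub>M k\<in>A. gauss B)"])
      show "?f -` Pi\<^sub>E (A \<times> B) E \<inter> space (\<Pi>\<^sub>M k\<in>A. gauss B) = Pi\<^sub>E A (\<lambda>k. Pi\<^sub>E B (\<lambda>i. E (k, i)))"
        by (auto simp: space_PiM space_gauss PiE_iff extensional_def)
    qed
    also have "\<dots> = (\<Prod>k\<in>A. emeasure (gauss B) (Pi\<^sub>E B (\<lambda>i. E (k, i))))"
    proof (rule P.emeasure_PiM[OF A])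
      fix k assume "k \<in> A"
      then show "Pi\<^sub>E B (\<lambda>i. E (k, i)) \<in> sets (gauss B)"
        unfolding gauss_def using E B by (intro sets_PiM_I_finite) auto
    qed
    also have "\<dots> = (\<Prod>k\<in>A. \<Prod>i\<in>B. emeasure (normal_law 1) (E (k, i)))"
    proof (rule prod.cong[OF refl])
      fix k assume "k \<in> A"
      then show "emeasure (gauss B) (Pi\<^sub>E B (\<lambda>i. E (k, i))) = (\<Prod>i\<in>B. emeasure (normal_law 1) (E (k, i)))"
        unfolding gauss_def using E B by (intro gauss_pf.emeasure_PiM) auto
    qed
    also have "\<dots> = (\<Prod>p\<in>A \<times> B. emeasure (normal_law 1) (E p))"
      by (simp add: prod.cartesian_product case_prod_beta)
    finally show "emeasure (distr (\<Pi>\<^sub>M k\<in>A. gauss B) (Pi\<^sub>M (A \<times> B) (\<lambda>_. normal_law 1)) ?f) (Pi\<^sub>E (A \<times> B) E) =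
      (\<Prod>p\<in>A \<times> B. emeasure (normal_law 1) (E p))" .
  qed (use A B in auto)
qed

lemma nn_integral_gauss_rows:
  assumes A: "finite A" and B: "finite B" and f: "f \<in> borel_measurable (\<Pi>\<^sub>M k\<in>A. gauss B)"
  shows "(\<integral>\<^sup>+Y. f Y \<partial>(\<Pi>\<^sub>M k\<in>A. gauss B)) = (\<integral>\<^sup>+g. f (\<lambda>k\<in>A. \<lambda>i\<in>B. g (k, i)) \<partial>gauss (A \<times> B))"
proof -
  let ?flat = "\<lambda>Y. \<lambda>p\<in>A \<times> B. Y (fst p) (snd p)" and ?curry = "\<lambda>g. \<lambda>k\<in>A. \<lambda>i\<in>B. g (k, i) :: real"
  have mc: "?curry \<in> measurable (gauss (A \<times> B)) (\<Pi>\<^sub>M k\<in>A. gauss B)"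
  proof (rule measurable_restrict)
    fix k assume k: "k \<in> A"
    show "(\<lambda>g. \<lambda>i\<in>B. g (k, i)) \<in> measurable (gauss (A \<times> B)) (gauss B)"
    proof (rule measurable_gaussI)
      fix i assume i: "i \<in> B"
      then have "(\<lambda>g. (\<lambda>i\<in>B. g (k, i)) i) = (\<lambda>g. g (k, i) :: real)" by simp
      moreover have "(\<lambda>g. g (k, i)) \<in> borel_measurable (gauss (A \<times> B))"
        by (rule measurable_gauss_component) (use i k in auto)
      ultimately show "(\<lambda>g. (\<lambda>i\<in>B. g (k, i)) i) \<in> borel_measurable (gauss (A \<times> B))" by (simp only:)
    qed auto
  qed
  have "(\<integral>\<^sup>+g. f (?curry g) \<partial>gauss (A \<times> B)) =
      (\<integral>\<^sup>+g. f (?curry g) \<partial>distr (\<Pi>\<^sub>M k\<in>A. gauss B) (gauss (A \<times> B)) ?flat)"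
    by (simp only: distr_flatten(1)[OF A B])
  also have "\<dots> = (\<integral>\<^sup>+Y. f (?curry (?flat Y)) \<partial>(\<Pi>\<^sub>M k\<in>A. gauss B))"
    using measurable_compose[OF mc f] by (intro nn_integral_distr distr_flatten(2)[OF A B]) simp
  also have "\<dots> = (\<integral>\<^sup>+Y. f Y \<partial>(\<Pi>\<^sub>M k\<in>A. gauss B))"
  proof (rule nn_integral_cong)
    fix Y assume "Y \<in> space (\<Pi>\<^sub>M k\<in>A. gauss B)"
    then have "?curry (?flat Y) = Y"
      by (auto simp: space_PiM space_gauss PiE_iff extensional_def fun_eq_iff)
    then show "f (?curry (?flat Y)) = f Y" by simp
  qed
  finally show ?thesis ..
qed

text \<open>A nonnegative form that vanishes at \<open>v\<close> is minimal there, so its derivative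
  in the direction \<open>w\<close>, the image of \<open>v\<close>, must vanish; this derivative is
  \<open>2 * b\<close>. The step \<open>t = - b / (c + 1)\<close> makes it quantitative, the 1
  keeping the denominator positive.\<close>

lemma psd_form_eq_0:
  fixes A :: "nat \<Rightarrow> nat \<Rightarrow> real"
  assumes sym: "\<forall>i<n. \<forall>j<n. A i j = A j i" and psd: "\<forall>v. (\<Sum>i<n. \<Sum>j<n. v i * A i j * v j) \<ge> 0"
    and v: "(\<Sum>i<n. \<Sum>j<n. v i * A i j * v j) = 0" and i: "i < n"
  shows "(\<Sum>j<n. A i j * v j) = 0"
proof -
  define w where "w i = (\<Sum>j<n. A i j * v j)" for i
  define b where "b = (\<Sum>i<n. (w i)\<^sup>2)"
  define c where "c = (\<Sum>i<n. \<Sum>j<n. w i * A i j * w j)"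
  have c: "0 \<le> c" using psd by (simp add: c_def)
  have wv: "(\<Sum>i<n. \<Sum>j<n. w i * A i j * v j) = b"
    by (simp add: b_def w_def power2_eq_square sum_distrib_left mult.assoc)
  have "(\<Sum>i<n. \<Sum>j<n. v i * A i j * w j) = (\<Sum>j<n. \<Sum>i<n. v i * A i j * w j)" by (rule sum.swap)
  also have "\<dots> = (\<Sum>j<n. \<Sum>i<n. w j * A j i * v i)"
    using sym by (intro sum.cong refl) auto
  finally have vw: "(\<Sum>i<n. \<Sum>j<n. v i * A i j * w j) = b" using wv by simp
  define t where "t = - b / (c + 1)"
  have "0 \<le> (\<Sum>i<n. \<Sum>j<n. (v i + t * w i) * A i j * (v j + t * w j))"
    using psd[rule_format, of "\<lambda>i. v i + t * w i"] by simp
  also have "\<dots> = (\<Sum>i<n. \<Sum>j<n. v i * A i j * v j + t * (v i * A i j * w j) + t * (w i * A i j * v j) + t\<^sup>2 * (w i * A i j * w j))"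
    by (intro sum.cong refl) (simp add: algebra_simps power2_eq_square)
  also have "\<dots> = 2 * t * b + t\<^sup>2 * c"
    by (simp add: sum.distrib sum_distrib_left[symmetric] v vw wv c_def)
  finally have ge: "0 \<le> 2 * t * b + t\<^sup>2 * c" .
  have tb: "b = - t * (c + 1)" using c by (simp add: t_def)
  have "2 * t * b + t\<^sup>2 * c = - (t\<^sup>2 * (c + 2))"
    unfolding tb by (simp add: power2_eq_square algebra_simps)
  with ge have "t\<^sup>2 * (c + 2) \<le> 0" by simp
  then have "t = 0" using c by (simp add: mult_le_0_iff)
  then have "b = 0" using tb by simp
  then have "\<forall>i\<in>{..<n}. (w i)\<^sup>2 = 0" unfolding b_def by (subst (asm) sum_nonneg_eq_0_iff) auto
  then show ?thesis using i by (simp add: w_def)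
qed

definition is_root :: "nat \<Rightarrow> (nat \<Rightarrow> nat \<Rightarrow> real) \<Rightarrow> (nat \<Rightarrow> nat \<Rightarrow> real) \<Rightarrow> bool" where
  "is_root n C A \<longleftrightarrow> (\<forall>i<n. \<forall>j<n. A i j = A j i) \<and> (\<forall>v. (\<Sum>i<n. \<Sum>j<n. v i * A i j * v j) \<ge> 0) \<and>
     (\<forall>i<n. \<forall>j<n. (\<Sum>k<n. A i k * A k j) = C i j)"

text \<open>If \<open>D = A - B\<close> then \<open>AD + DB = 0\<close>; multiplying by \<open>D\<close> and taking traces shows that the two
  nonnegative numbers \<open>tr (DAD)\<close> and \<open>tr (DBD)\<close> vanish.\<close>

lemma root_unique:
  assumes A: "is_root n C A" and B: "is_root n C B" and ij: "i < n" "j < n"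
  shows "A i j = B i j"
proof -
  define D where "D i j = A i j - B i j" for i j
  have symA: "A i j = A j i" and symB: "B i j = B j i" and symD: "D i j = D j i" if "i < n" "j < n" for i j
    using A B that by (auto simp: is_root_def D_def)
  have AD: "(\<Sum>k<n. A i k * D k j) + (\<Sum>k<n. D i k * B k j) = 0" if "i < n" "j < n" for i j
  proof -
    have "(\<Sum>k<n. A i k * A k j) = C i j" "(\<Sum>k<n. B i k * B k j) = C i j"
      using A B that unfolding is_root_def by blast+
    then have "(\<Sum>k<n. A i k * A k j) = (\<Sum>k<n. B i k * B k j)" by simp
    moreover have "(\<Sum>k<n. A i k * D k j) + (\<Sum>k<n. D i k * B k j) = (\<Sum>k<n. A i k * A k j) - (\<Sum>k<n. B i k * B k j)"
      unfolding sum.distrib[symmetric] sum_subtractf[symmetric] by (simp add: D_def algebra_simps)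
    ultimately show ?thesis by simp
  qed
  define qA where "qA j = (\<Sum>i<n. \<Sum>k<n. D i j * A i k * D k j)" for j
  define qB where "qB j = (\<Sum>i<n. \<Sum>k<n. D i j * B i k * D k j)" for j
  have q0: "0 \<le> qA j" "0 \<le> qB j" for j
    using A B by (auto simp: qA_def qB_def is_root_def)
  have "(\<Sum>j<n. qA j) = (\<Sum>j<n. \<Sum>i<n. D j i * (\<Sum>k<n. A i k * D k j))"
    unfolding qA_def sum_distrib_left using symD by (intro sum.cong refl) auto
  moreover have "(\<Sum>j<n. qB j) = (\<Sum>j<n. \<Sum>i<n. D j i * (\<Sum>k<n. D i k * B k j))"
  proof -
    have "(\<Sum>j<n. \<Sum>i<n. D j i * (\<Sum>k<n. D i k * B k j)) = (\<Sum>j<n. \<Sum>i<n. \<Sum>k<n. D j i * B j k * D k i)"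
      unfolding sum_distrib_left using symD symB by (intro sum.cong refl) auto
    also have "\<dots> = (\<Sum>i<n. \<Sum>j<n. \<Sum>k<n. D j i * B j k * D k i)" by (rule sum.swap)
    finally show ?thesis by (simp add: qB_def)
  qed
  ultimately have "(\<Sum>j<n. qA j) + (\<Sum>j<n. qB j) =
      (\<Sum>j<n. \<Sum>i<n. D j i * ((\<Sum>k<n. A i k * D k j) + (\<Sum>k<n. D i k * B k j)))"
    by (simp add: sum.distrib distrib_left)
  also have "\<dots> = 0" by (simp add: AD)
  finally have "(\<Sum>j<n. qA j + qB j) = 0" by (simp add: sum.distrib)
  then have "\<forall>j\<in>{..<n}. qA j + qB j = 0"
    by (subst (asm) sum_nonneg_eq_0_iff) (auto simp: q0)
  then have qz: "qA j = 0" "qB j = 0" if "j < n" for j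
    using that q0(1)[of j] q0(2)[of j] add_nonneg_eq_0_iff by blast+
  have "(\<Sum>k<n. A i k * D k j) = 0" if "i < n" "j < n" for i j
    using A that qz(1)[OF that(2)] unfolding is_root_def qA_def by (intro psd_form_eq_0) auto
  moreover have "(\<Sum>k<n. B i k * D k j) = 0" if "i < n" "j < n" for i j
    using B that qz(2)[OF that(2)] unfolding is_root_def qB_def by (intro psd_form_eq_0) auto
  ultimately have "(\<Sum>k<n. D i k * D k j) = 0" if "i < n" "j < n" for i j
    using that by (simp add: D_def[of i] left_diff_distrib sum_subtractf)
  from this[OF ij(2) ij(2)] have "(\<Sum>k<n. (D k j)\<^sup>2) = 0"
    using symD ij by (simp add: power2_eq_square)
  then have "\<forall>k\<in>{..<n}. (D k j)\<^sup>2 = 0" by (subst (asm) sum_nonneg_eq_0_iff) auto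
  then show ?thesis using ij by (simp add: D_def)
qed

text \<open>\<open>psd_sqrt\<close> is a Hilbert choice; uniqueness of the root allows any explicit
  root to take its place.\<close>

lemma psd_sqrt_eq:
  assumes "is_root n C A" "i < n" "j < n"
  shows "psd_sqrt n C i j = A i j"
proof -
  have "psd_sqrt n C = (SOME A. is_root n C A)" by (simp add: psd_sqrt_def is_root_def)
  then have "is_root n C (psd_sqrt n C)" using someI[of "is_root n C", OF assms(1)] by simp
  from root_unique[OF this assms] show ?thesis .
qed

text \<open>The coefficient \<open>c\<close> for which the identity plus \<open>c\<close> times the
  outer square of \<open>x\<close> is the root: \<open>1 + c * s\<close> must equal
  \<open>sqrt (1 + \<beta> * s)\<close>, with \<open>s\<close> the squared norm. For
  \<open>x = 0\<close> the quotient is 0 by convention.\<close>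

definition root_coef :: "nat \<Rightarrow> real \<Rightarrow> (nat \<Rightarrow> real) \<Rightarrow> real" where
  "root_coef n \<beta> x = (if \<beta> * (\<Sum>i<n. (x i)\<^sup>2) \<ge> -1 then (sqrt (1 + \<beta> * (\<Sum>i<n. (x i)\<^sup>2)) - 1) / (\<Sum>i<n. (x i)\<^sup>2) else 0)"

definition planted_root :: "nat \<Rightarrow> real \<Rightarrow> (nat \<Rightarrow> real) \<Rightarrow> nat \<Rightarrow> nat \<Rightarrow> real" where
  "planted_root n \<beta> x i j = id_mat i j + root_coef n \<beta> x * x i * x j"

lemma id_mat_sum:
  assumes "i < n"
  shows "(\<Sum>j<n. id_mat i j * f j) = f i" "(\<Sum>j<n. f j * id_mat j i) = f i"
proof -
  have "(\<Sum>j<n. id_mat i j * f j) = (\<Sum>j<n. if j = i then f j else 0)"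
    "(\<Sum>j<n. f j * id_mat j i) = (\<Sum>j<n. if j = i then f j else 0)"
    by (rule sum.cong; simp add: id_mat_def)+
  then show "(\<Sum>j<n. id_mat i j * f j) = f i" "(\<Sum>j<n. f j * id_mat j i) = f i" using assms by simp_all
qed

text \<open>The relation between \<open>b\<close> and \<open>c\<close> carries a factor
  \<open>s\<close> so as to include \<open>x = 0\<close>, where the rank-one term vanishes for every
  \<open>b\<close>. For negative \<open>c\<close>, positivity is the Cauchy-Schwarz inequality
  together with \<open>0 \<le> 1 + c * s\<close>.\<close>

lemma is_root_rank_one:
  assumes s: "s = (\<Sum>i<n. (x i)\<^sup>2)" and c: "0 \<le> 1 + c * s" and b: "b * s = (2 * c + c\<^sup>2 * s) * s"
  shows "is_root n (\<lambda>i j. id_mat i j + b * x i * x j) (\<lambda>i j. id_mat i j + c * x i * x j)"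
  unfolding is_root_def
proof (intro conjI allI impI)
  fix i j assume ij: "i < n" "j < n"
  show "id_mat i j + c * x i * x j = id_mat j i + c * x j * x i" by (simp add: id_mat_def)
  have "(\<Sum>k<n. (id_mat i k + c * x i * x k) * (id_mat k j + c * x k * x j)) =
    (\<Sum>k<n. id_mat i k * id_mat k j + id_mat i k * (c * x k * x j) + (c * x i * x k) * id_mat k j + c * c * x i * x j * (x k)\<^sup>2)"
    by (intro sum.cong refl) (simp add: algebra_simps power2_eq_square)
  also have "\<dots> = id_mat i j + c * x i * x j + c * x i * x j + c * c * x i * x j * s"
    unfolding sum.distrib id_mat_sum[OF ij(1)] id_mat_sum[OF ij(2)] by (simp add: s sum_distrib_left)
  also have "\<dots> = id_mat i j + (2 * c + c\<^sup>2 * s) * x i * x j" by (simp add: power2_eq_square algebra_simps)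
  also have "(2 * c + c\<^sup>2 * s) * x i * x j = b * x i * x j"
  proof (cases "s = 0")
    case True
    then have "\<forall>i\<in>{..<n}. (x i)\<^sup>2 = 0" unfolding s by (subst (asm) sum_nonneg_eq_0_iff) auto
    then show ?thesis using ij by simp
  qed (use b in simp)
  finally show "(\<Sum>k<n. (id_mat i k + c * x i * x k) * (id_mat k j + c * x k * x j)) = id_mat i j + b * x i * x j" .
next
  fix v :: "nat \<Rightarrow> real"
  have "(\<Sum>i<n. \<Sum>j<n. v i * (id_mat i j + c * x i * x j) * v j) =
    (\<Sum>i<n. v i * (\<Sum>j<n. id_mat i j * v j) + c * (v i * x i) * (\<Sum>j<n. x j * v j))"
    by (intro sum.cong refl) (simp add: sum_distrib_left sum.distrib[symmetric] algebra_simps)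
  also have "\<dots> = (\<Sum>i<n. v i * v i + c * (v i * x i) * (\<Sum>j<n. x j * v j))"
    by (intro sum.cong refl) (simp add: id_mat_sum)
  also have "\<dots> = dotp n v v + c * (dotp n x v)\<^sup>2"
    by (simp add: dotp_def sum.distrib sum_distrib_left sum_distrib_right power2_eq_square sum_product mult_ac)
  also have "0 \<le> dotp n v v + c * (dotp n x v)\<^sup>2"
  proof (cases "0 \<le> c")
    case True
    then show ?thesis by (simp add: dotp_self_nonneg)
  next
    case False
    have "(dotp n x v)\<^sup>2 \<le> s * dotp n v v"
      using dotp_Cauchy_Schwarz[of n x v] by (simp add: s dotp_self)
    then have "c * (s * dotp n v v) \<le> c * (dotp n x v)\<^sup>2"
      using False by (intro mult_left_mono_neg) auto
    moreover have "0 \<le> (1 + c * s) * dotp n v v" using c dotp_self_nonneg by (intro mult_nonneg_nonneg)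
    ultimately show ?thesis by (simp add: algebra_simps)
  qed
  finally show "0 \<le> (\<Sum>i<n. \<Sum>j<n. v i * (id_mat i j + c * x i * x j) * v j)" .
qed

lemma is_root_planted: "is_root n (planted_cov n \<beta> x) (planted_root n \<beta> x)"
proof -
  define s where "s = (\<Sum>i<n. (x i)\<^sup>2)"
  have s: "0 \<le> s" by (simp add: s_def sum_nonneg)
  have L2: "(L2_set x {..<n})\<^sup>2 = s" by (simp add: L2_set_def s_def sum_nonneg)
  show ?thesis
  proof (cases "\<beta> * s \<ge> -1")
    case True
    define c where "c = root_coef n \<beta> x"
    have c: "c = (sqrt (1 + \<beta> * s) - 1) / s" using True by (simp add: c_def root_coef_def s_def)
    have pos: "0 \<le> 1 + c * s" by (cases "s = 0") (use True in \<open>auto simp: c\<close>)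
    have b: "\<beta> * s = (2 * c + c\<^sup>2 * s) * s"
    proof (cases "s = 0")
      case False
      have "(2 * c + c\<^sup>2 * s) * s = (1 + c * s)\<^sup>2 - 1" by (simp add: power2_eq_square algebra_simps)
      also have "1 + c * s = sqrt (1 + \<beta> * s)" using False by (simp add: c)
      also have "(sqrt (1 + \<beta> * s))\<^sup>2 = 1 + \<beta> * s" using True by simp
      finally have "(2 * c + c\<^sup>2 * s) * s = \<beta> * s" by simp
      then show ?thesis by (rule sym)
    qed simp
    have "planted_cov n \<beta> x = (\<lambda>i j. id_mat i j + \<beta> * x i * x j)"
      using True by (simp add: planted_cov_def L2)
    moreover have "planted_root n \<beta> x = (\<lambda>i j. id_mat i j + c * x i * x j)"
      by (simp add: planted_root_def fun_eq_iff c_def)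
    ultimately show ?thesis using is_root_rank_one[OF s_def pos b] by simp
  next
    case False
    have "planted_cov n \<beta> x = (\<lambda>i j. id_mat i j + 0 * x i * x j)"
      using False by (auto simp: planted_cov_def L2 fun_eq_iff)
    moreover have "planted_root n \<beta> x = (\<lambda>i j. id_mat i j + 0 * x i * x j)"
      using False by (auto simp: planted_root_def root_coef_def s_def fun_eq_iff)
    ultimately show ?thesis using is_root_rank_one[OF s_def, of 0 0 ] by simp
  qed
qed

lemma is_root_id: "is_root n id_mat id_mat"
  using is_root_rank_one[OF refl, where n=n and x="\<lambda>_. 0" and c=0 and b=0] by simp

lemma sets_vec_space: "sets (vec_space n) = sets (gauss {..<n})"
  by (simp add: vec_space_def sets_gauss)

definition rows_map :: "nat \<Rightarrow> nat \<Rightarrow> (nat \<Rightarrow> nat \<Rightarrow> real) \<Rightarrow> (nat \<times> nat \<Rightarrow> real) \<Rightarrow> nat \<Rightarrow> nat \<Rightarrow> real" where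
  "rows_map n K A g = (\<lambda>k\<in>{..<K}. \<lambda>i\<in>{..<n}. \<Sum>j<n. A i j * g (k, j))"

definition samples :: "nat \<Rightarrow> nat \<Rightarrow> (nat \<Rightarrow> nat \<Rightarrow> real) measure" where
  "samples n K = (\<Pi>\<^sub>M k\<in>{..<K}. vec_space n)"

text \<open>All samples are written as a function of one standard Gaussian array and an explicit
  root, so that null and planted samples can be built from the same array.\<close>

lemma samples_law:
  assumes A: "is_root n C A"
  shows "(\<Pi>\<^sub>M k\<in>{..<K}. gaussian_vec n C) = distr (gauss ({..<K} \<times> {..<n})) (samples n K) (rows_map n K A)"
proof -
  define T where "T g = (\<lambda>i\<in>{..<n}. \<Sum>j<n. A i j * g j)" for g
  have mT: "T \<in> measurable (gauss {..<n}) (vec_space n)"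
    unfolding measurable_cong_sets[OF refl sets_vec_space] T_def
  proof (rule measurable_gaussI)
    fix i assume "i \<in> {..<n}"
    then have "(\<lambda>x. (\<lambda>i\<in>{..<n}. \<Sum>j<n. A i j * x j) i) = (\<lambda>x. \<Sum>j<n. A i j * x j)" by simp
    moreover have "(\<lambda>x. \<Sum>j<n. A i j * x j) \<in> borel_measurable (gauss {..<n})"
      by (intro borel_measurable_sum borel_measurable_times borel_measurable_const measurable_gauss_component)
    ultimately show "(\<lambda>x. (\<lambda>i\<in>{..<n}. \<Sum>j<n. A i j * x j) i) \<in> borel_measurable (gauss {..<n})" by (simp only:)
  qed simp
  have g: "gaussian_vec n C = distr (gauss {..<n}) (vec_space n) T"
    unfolding gaussian_vec_def gauss_def[symmetric] T_def
    by (intro distr_cong refl restrict_ext sum.cong) (simp add: psd_sqrt_eq[OF A])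
  have m1: "(\<lambda>Y. \<lambda>k\<in>{..<K}. T (Y k)) \<in> measurable (\<Pi>\<^sub>M k\<in>{..<K}. gauss {..<n}) (samples n K)"
    unfolding samples_def by (rule measurable_restrict, rule measurable_compose[OF _ mT], rule measurable_component_singleton)
  have "(\<Pi>\<^sub>M k\<in>{..<K}. gaussian_vec n C) = distr (\<Pi>\<^sub>M k\<in>{..<K}. gauss {..<n}) (samples n K) (\<lambda>Y. \<lambda>k\<in>{..<K}. T (Y k))"
    unfolding g samples_def
    by (rule distr_PiM_components[symmetric]) (simp_all add: prob_space_gauss mT)
  also have "\<dots> = distr (gauss ({..<K} \<times> {..<n})) (samples n K) (rows_map n K A)"
  proof (rule measure_eqI)
    fix E assume E: "E \<in> sets (distr (\<Pi>\<^sub>M k\<in>{..<K}. gauss {..<n}) (samples n K) (\<lambda>Y. \<lambda>k\<in>{..<K}. T (Y k)))"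
    then have iE: "indicator E \<in> borel_measurable (samples n K)" by simp
    have mr: "rows_map n K A \<in> measurable (gauss ({..<K} \<times> {..<n})) (samples n K)"
      unfolding samples_def rows_map_def
    proof (rule measurable_restrict)
      fix k assume k: "k \<in> {..<K}"
      show "(\<lambda>g. \<lambda>i\<in>{..<n}. \<Sum>j<n. A i j * g (k, j)) \<in> measurable (gauss ({..<K} \<times> {..<n})) (vec_space n)"
        unfolding measurable_cong_sets[OF refl sets_vec_space]
      proof (rule measurable_gaussI)
        fix i assume "i \<in> {..<n}"
        then have "(\<lambda>x. (\<lambda>i\<in>{..<n}. \<Sum>j<n. A i j * x (k, j)) i) = (\<lambda>x. \<Sum>j<n. A i j * x (k, j))" by simp
        moreover have "(\<lambda>x. \<Sum>j<n. A i j * x (k, j)) \<in> borel_measurable (gauss ({..<K} \<times> {..<n}))"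
          by (intro borel_measurable_sum borel_measurable_times borel_measurable_const measurable_gauss_component)
            (use k in simp)
        ultimately show "(\<lambda>x. (\<lambda>i\<in>{..<n}. \<Sum>j<n. A i j * x (k, j)) i) \<in> borel_measurable (gauss ({..<K} \<times> {..<n}))"
          by (simp only:)
      qed simp
    qed
    have "emeasure (distr (\<Pi>\<^sub>M k\<in>{..<K}. gauss {..<n}) (samples n K) (\<lambda>Y. \<lambda>k\<in>{..<K}. T (Y k))) E =
      (\<integral>\<^sup>+Y. indicator E Y \<partial>distr (\<Pi>\<^sub>M k\<in>{..<K}. gauss {..<n}) (samples n K) (\<lambda>Y. \<lambda>k\<in>{..<K}. T (Y k)))"
      using E by simp
    also have "\<dots> = (\<integral>\<^sup>+Y. indicator E (\<lambda>k\<in>{..<K}. T (Y k)) \<partial>(\<Pi>\<^sub>M k\<in>{..<K}. gauss {..<n}))"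
      using m1 iE by (intro nn_integral_distr) auto
    also have "\<dots> = (\<integral>\<^sup>+g. indicator E (\<lambda>k\<in>{..<K}. T ((\<lambda>k\<in>{..<K}. \<lambda>i\<in>{..<n}. g (k, i)) k)) \<partial>gauss ({..<K} \<times> {..<n}))"
      by (rule nn_integral_gauss_rows[OF finite_lessThan finite_lessThan measurable_compose[OF m1 iE]])
    also have "\<dots> = (\<integral>\<^sup>+g. indicator E (rows_map n K A g) \<partial>gauss ({..<K} \<times> {..<n}))"
    proof -
      have "(\<lambda>k\<in>{..<K}. T ((\<lambda>k\<in>{..<K}. \<lambda>i\<in>{..<n}. g (k, i)) k)) = rows_map n K A g" for g
        by (auto simp: fun_eq_iff rows_map_def T_def)
      then show ?thesis by (simp only:)
    qed
    also have "\<dots> = (\<integral>\<^sup>+Y. indicator E Y \<partial>distr (gauss ({..<K} \<times> {..<n})) (samples n K) (rows_map n K A))"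
      using mr iE by (intro nn_integral_distr[symmetric]) auto
    also have "\<dots> = emeasure (distr (gauss ({..<K} \<times> {..<n})) (samples n K) (rows_map n K A)) E"
      using E by simp
    finally show "emeasure (distr (\<Pi>\<^sub>M k\<in>{..<K}. gauss {..<n}) (samples n K) (\<lambda>Y. \<lambda>k\<in>{..<K}. T (Y k))) E =
      emeasure (distr (gauss ({..<K} \<times> {..<n})) (samples n K) (rows_map n K A)) E" .
  qed simp
  finally show ?thesis .
qed

lemma measurable_rows_map2:
  assumes A: "\<And>i j. i < n \<Longrightarrow> j < n \<Longrightarrow> (\<lambda>x. A x i j) \<in> borel_measurable M"
  shows "(\<lambda>(x, g). rows_map n K (A x) g) \<in> measurable (M \<Otimes>\<^sub>M gauss ({..<K} \<times> {..<n})) (samples n K)"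
  unfolding samples_def rows_map_def case_prod_beta
proof (rule measurable_restrict)
  let ?P = "M \<Otimes>\<^sub>M gauss ({..<K} \<times> {..<n})"
  fix k assume k: "k \<in> {..<K}"
  show "(\<lambda>p. \<lambda>i\<in>{..<n}. \<Sum>j<n. A (fst p) i j * snd p (k, j)) \<in> measurable ?P (vec_space n)"
    unfolding measurable_cong_sets[OF refl sets_vec_space]
  proof (rule measurable_gaussI)
    fix i assume i: "i \<in> {..<n}"
    then have "(\<lambda>p. (\<lambda>i\<in>{..<n}. \<Sum>j<n. A (fst p) i j * snd p (k, j)) i) = (\<lambda>p. \<Sum>j<n. A (fst p) i j * snd p (k, j))" by simp
    moreover have "(\<lambda>p. \<Sum>j<n. A (fst p) i j * snd p (k, j)) \<in> borel_measurable ?P"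
    proof (intro borel_measurable_sum borel_measurable_times)
      fix j assume j: "j \<in> {..<n}"
      show "(\<lambda>p. A (fst p) i j) \<in> borel_measurable ?P"
        by (rule measurable_compose[OF measurable_fst A]) (use i j in auto)
      have "(\<lambda>g. g (k, j)) \<in> borel_measurable (gauss ({..<K} \<times> {..<n}))"
        by (rule measurable_gauss_component) (use k j in auto)
      then show "(\<lambda>p. snd p (k, j)) \<in> borel_measurable ?P" by (rule measurable_compose[OF measurable_snd])
    qed
    ultimately show "(\<lambda>p. (\<lambda>i\<in>{..<n}. \<Sum>j<n. A (fst p) i j * snd p (k, j)) i) \<in> borel_measurable ?P" by (simp only:)
  qed simp
qed

lemma measurable_rows_map: "rows_map n K A \<in> measurable (gauss ({..<K} \<times> {..<n})) (samples n K)"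
  using measurable_compose[OF measurable_Pair1' measurable_rows_map2[of n "\<lambda>_. A" "count_space UNIV"], of "()" K]
  by simp

lemma measurable_sample_entry:
  assumes "k < K" "i < n"
  shows "(\<lambda>Y. Y k i) \<in> borel_measurable (samples n K)"
proof -
  have "(\<lambda>Y. Y k) \<in> measurable (samples n K) (vec_space n)"
    unfolding samples_def by (rule measurable_component_singleton) (use assms in auto)
  moreover have "(\<lambda>y. y i) \<in> borel_measurable (vec_space n)"
    unfolding vec_space_def by (rule measurable_component_singleton) (use assms in auto)
  ultimately show ?thesis by (rule measurable_compose)
qed

context windows
begin

lemma refl_mat_restrict: "mm n Q refl_mat = mm n Q (\<lambda>p\<in>sq n. refl_mat p)"
  by (auto simp: mm_def fun_eq_iff)

lemma measurable_mm_refl: "(\<lambda>Q. mm n Q refl_mat) \<in> measurable (mat_space n) (mat_space n)"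
  unfolding refl_mat_restrict
  by (intro measurable_mm measurable_ident_sets refl measurable_const) (simp add: space_mat_space)

lemma measurable_model:
  assumes G: "G \<in> measurable M (gauss (sq n))" and \<xi>: "\<xi> \<in> measurable M (gauss (ut n))"
  shows "(\<lambda>z. conj_by n (mm n (gs_mat n (G z)) refl_mat) (part n n (\<xi> z))) \<in> measurable M (mat_space n)"
  by (intro measurable_conj_by measurable_compose[OF measurable_compose[OF G measurable_gs_mat] measurable_mm_refl]
      measurable_compose[OF \<xi> measurable_part])

lemma measurable_reduction: "(\<lambda>(Y, \<omega>). reduction n N m r Y \<omega>) \<in> measurable (samples n N \<Otimes>\<^sub>M coins) (mat_space n)"
proof -
  define G where "G z = (\<lambda>p\<in>sq n. filled n N (fst z) (snd z) (fst p) (snd p))"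
    for z :: "(nat \<Rightarrow> nat \<Rightarrow> real) \<times> (nat \<Rightarrow> real)"
  have "G \<in> measurable (samples n N \<Otimes>\<^sub>M coins) (gauss (sq n))"
    unfolding G_def
  proof (rule measurable_gaussI)
    fix p assume "p \<in> sq n"
    then obtain k i where p: "p = (k, i)" "k < n" "i < n" by auto
    show "(\<lambda>z. (\<lambda>p\<in>sq n. filled n N (fst z) (snd z) (fst p) (snd p)) p) \<in> borel_measurable (samples n N \<Otimes>\<^sub>M coins)"
    proof (cases "N \<le> k")
      case True
      then have "(\<lambda>z. (\<lambda>p\<in>sq n. filled n N (fst z) (snd z) (fst p) (snd p)) p) = (\<lambda>z. snd z (k * n + i))"
        using p by (simp add: filled_def)
      then show ?thesis by (simp only: measurable_compose[OF measurable_snd measurable_coins_component])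
    next
      case False
      then have "(\<lambda>z. (\<lambda>p\<in>sq n. filled n N (fst z) (snd z) (fst p) (snd p)) p) = (\<lambda>z. fst z k i)"
        using p by (simp add: filled_def)
      moreover have "(\<lambda>z. fst z k i) \<in> borel_measurable (samples n N \<Otimes>\<^sub>M coins)"
        by (rule measurable_compose[OF measurable_fst measurable_sample_entry]) (use False p in auto)
      ultimately show ?thesis by (simp only:)
    qed
  qed simp
  moreover have "(\<lambda>z. upper n (snd z)) \<in> measurable (samples n N \<Otimes>\<^sub>M coins) (gauss (ut n))"
    unfolding upper_def[abs_def] by (rule measurable_compose[OF measurable_snd measurable_coins_pick])
  ultimately have "(\<lambda>z. conj_by n (mm n (gs_mat n (G z)) refl_mat) (part n n (upper n (snd z)))) \<in>
      measurable (samples n N \<Otimes>\<^sub>M coins) (mat_space n)"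
    by (rule measurable_model)
  moreover have "(\<lambda>(Y, \<omega>). reduction n N m r Y \<omega>) = (\<lambda>z. conj_by n (mm n (gs_mat n (G z)) refl_mat) (part n n (upper n (snd z))))"
    by (auto simp: fun_eq_iff G_def upper_def ut_def intro!: reduction_eq[THEN fun_cong])
  ultimately show ?thesis by (simp only:)
qed

text \<open>The completed array in the planted case: the samples are transformed by
  \<open>A\<close>, the added rows are not. It couples the planted frame with the null frame of the
  same \<open>G\<close>.\<close>

definition partial_rows :: "(nat \<Rightarrow> nat \<Rightarrow> real) \<Rightarrow> (nat \<times> nat \<Rightarrow> real) \<Rightarrow> nat \<times> nat \<Rightarrow> real" where
  "partial_rows A G = (\<lambda>(k, i)\<in>sq n. if k < N then \<Sum>j<n. A i j * G (k, j) else G (k, i))"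

lemma measurable_partial_rows: "partial_rows A \<in> measurable (gauss (sq n)) (gauss (sq n))"
proof (rule measurable_gaussI)
  fix p assume "p \<in> sq n"
  then obtain k i where p: "p = (k, i)" "k < n" "i < n" by auto
  show "(\<lambda>G. partial_rows A G p) \<in> borel_measurable (gauss (sq n))"
  proof (cases "k < N")
    case True
    then have "(\<lambda>G. partial_rows A G p) = (\<lambda>G. \<Sum>j<n. A i j * G (k, j))" using p by (simp add: partial_rows_def)
    moreover have "(\<lambda>G. \<Sum>j<n. A i j * G (k, j)) \<in> borel_measurable (gauss (sq n))"
      by (intro borel_measurable_sum borel_measurable_times borel_measurable_const measurable_gauss_component)
        (use p in simp)
    ultimately show ?thesis by (simp only:)
  next
    case False
    then have "(\<lambda>G. partial_rows A G p) = (\<lambda>G. G (k, i))" using p by (simp add: partial_rows_def)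
    moreover have "(\<lambda>G. G (k, i)) \<in> borel_measurable (gauss (sq n))"
      by (rule measurable_gauss_component) (use p in simp)
    ultimately show ?thesis by (simp only:)
  qed
qed (simp add: partial_rows_def)

lemma nn_integral_reduction:
  assumes A: "is_root n C A" and \<Phi>: "\<Phi> \<in> borel_measurable (mat_space n \<Otimes>\<^sub>M coins)"
  shows "(\<integral>\<^sup>+Y. \<integral>\<^sup>+\<omega>. \<Phi> (reduction n N m r Y \<omega>, \<lambda>i. \<omega> (i + 2 * (n * n))) \<partial>coins \<partial>(\<Pi>\<^sub>M k\<in>{..<N}. gaussian_vec n C)) =
    (\<integral>\<^sup>+G. \<integral>\<^sup>+\<xi>. \<integral>\<^sup>+\<omega>. \<Phi> (conj_by n (mm n (gs_mat n (partial_rows A G)) refl_mat) (part n n \<xi>), \<omega>)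
      \<partial>coins \<partial>gauss (ut n) \<partial>gauss (sq n))"
proof -
  interpret C: prob_space coins by (rule prob_space_coins)
  define \<Phi>' where "\<Phi>' z = \<Phi> (conj_by n (mm n (gs_mat n (partial_rows A (fst z))) refl_mat) (part n n (fst (snd z))), snd (snd z))"
    for z :: "(nat \<times> nat \<Rightarrow> real) \<times> (nat \<times> nat \<Rightarrow> real) \<times> (nat \<Rightarrow> real)"
  have \<Phi>'m: "\<Phi>' \<in> borel_measurable (gauss (sq n) \<Otimes>\<^sub>M (gauss (ut n) \<Otimes>\<^sub>M coins))"
    unfolding \<Phi>'_def
    by (rule measurable_compose[OF _ \<Phi>], intro measurable_Pair measurable_model
        measurable_compose[OF measurable_fst measurable_partial_rows] measurable_compose[OF measurable_snd measurable_fst]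
        measurable_compose[OF measurable_snd measurable_snd])
  have mY: "(\<lambda>Y. \<integral>\<^sup>+\<omega>. \<Phi> (reduction n N m r Y \<omega>, \<lambda>i. \<omega> (i + 2 * (n * n))) \<partial>coins) \<in> borel_measurable (samples n N)"
  proof -
    have "(\<lambda>z. \<Phi> (case z of (Y, \<omega>) \<Rightarrow> reduction n N m r Y \<omega>, \<lambda>i. snd z (i + 2 * (n * n)))) \<in> borel_measurable (samples n N \<Otimes>\<^sub>M coins)"
      by (rule measurable_compose[OF _ \<Phi>], intro measurable_Pair measurable_reduction
          measurable_compose[OF measurable_snd measurable_coins_shift])
    from C.borel_measurable_nn_integral_fst[OF this] show ?thesis by simp
  qed
  have "(\<integral>\<^sup>+Y. \<integral>\<^sup>+\<omega>. \<Phi> (reduction n N m r Y \<omega>, \<lambda>i. \<omega> (i + 2 * (n * n))) \<partial>coins \<partial>(\<Pi>\<^sub>M k\<in>{..<N}. gaussian_vec n C)) =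
    (\<integral>\<^sup>+g. \<integral>\<^sup>+\<omega>. \<Phi> (reduction n N m r (rows_map n N A g) \<omega>, \<lambda>i. \<omega> (i + 2 * (n * n))) \<partial>coins \<partial>gauss ({..<N} \<times> {..<n}))"
    unfolding samples_law[OF A] using mY by (intro nn_integral_distr measurable_rows_map) simp
  also have "\<dots> = (\<integral>\<^sup>+g. \<integral>\<^sup>+\<omega>. \<Phi>' (rowsof n N g (fresh n N \<omega>), upper n \<omega>, \<lambda>i. \<omega> (i + 2 * (n * n))) \<partial>coins \<partial>gauss ({..<N} \<times> {..<n}))"
  proof -
    have "reduction n N m r (rows_map n N A g) \<omega> =
      conj_by n (mm n (gs_mat n (partial_rows A (rowsof n N g (fresh n N \<omega>)))) refl_mat) (part n n (upper n \<omega>))" for g \<omega>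
    proof (rule reduction_eq)
      fix k i assume ki: "k < n" "i < n"
      show "filled n N (rows_map n N A g) \<omega> k i = partial_rows A (rowsof n N g (fresh n N \<omega>)) (k, i)"
        using ki by (auto simp: filled_def rows_map_def partial_rows_def rowsof_def merge_def fresh_def)
    qed (simp add: upper_def ut_def)
    then show ?thesis by (simp add: \<Phi>'_def)
  qed
  also have "\<dots> = (\<integral>\<^sup>+G. \<integral>\<^sup>+\<xi>. \<integral>\<^sup>+\<omega>. \<Phi>' (G, \<xi>, \<omega>) \<partial>coins \<partial>gauss (ut n) \<partial>gauss (sq n))"
    by (rule nn_integral_tape[OF N \<Phi>'m])
  finally show ?thesis by (simp add: \<Phi>'_def)
qed

text \<open>With the identity as root, the orthonormalised array is exactly Haar distributed, so the
  tridiagonal identity for the GOE applies at every positive \<open>n\<close> without error.\<close>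

theorem null_law:
  assumes n: "0 < n" and \<Phi>: "\<Phi> \<in> borel_measurable (mat_space n \<Otimes>\<^sub>M coins)"
  shows "(\<integral>\<^sup>+Y. \<integral>\<^sup>+\<omega>. \<Phi> (reduction n N m r Y \<omega>, \<lambda>i. \<omega> (i + 2 * (n * n))) \<partial>coins \<partial>(\<Pi>\<^sub>M k\<in>{..<N}. gaussian_vec n id_mat)) =
    (\<integral>\<^sup>+W. \<integral>\<^sup>+\<omega>. \<Phi> (W, \<omega>) \<partial>coins \<partial>GOE n)"
proof -
  interpret C: prob_space coins by (rule prob_space_coins)
  define F where "F W = (\<integral>\<^sup>+\<omega>. \<Phi> (W, \<omega>) \<partial>coins)" for W
  have F: "F \<in> borel_measurable (mat_space n)"
    unfolding F_def by (rule C.borel_measurable_nn_integral_fst[OF \<Phi>])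
  interpret U: prob_space "gauss (ut n)" by (rule prob_space_gauss)
  define H where "H Q = (\<integral>\<^sup>+\<xi>. F (conj_by n (mm n Q refl_mat) (part n n \<xi>)) \<partial>gauss (ut n))" for Q
  have H: "H \<in> borel_measurable (mat_space n)"
  proof -
    have "(\<lambda>z. F (conj_by n (mm n (fst z) refl_mat) (part n n (snd z)))) \<in> borel_measurable (mat_space n \<Otimes>\<^sub>M gauss (ut n))"
      by (rule measurable_compose[OF _ F], intro measurable_conj_by measurable_compose[OF measurable_fst measurable_mm_refl]
          measurable_compose[OF measurable_snd measurable_part])
    from U.borel_measurable_nn_integral_fst[OF this] show ?thesis by (simp add: H_def[abs_def])
  qed
  have id: "gs_mat n (partial_rows id_mat G) = gs_mat n G" for G
  proof -
    have "partial_rows id_mat G (k, i) = G (k, i)" if "k < n" "i < n" for k i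
      using that by (simp add: partial_rows_def id_mat_sum)
    then have "(\<lambda>k i. if k < n \<and> i < n then partial_rows id_mat G (k, i) else 0) = (\<lambda>k i. if k < n \<and> i < n then G (k, i) else 0)"
      by (auto simp: fun_eq_iff)
    then show ?thesis by (simp add: gs_mat_def)
  qed
  have "(\<integral>\<^sup>+Y. \<integral>\<^sup>+\<omega>. \<Phi> (reduction n N m r Y \<omega>, \<lambda>i. \<omega> (i + 2 * (n * n))) \<partial>coins \<partial>(\<Pi>\<^sub>M k\<in>{..<N}. gaussian_vec n id_mat)) =
    (\<integral>\<^sup>+G. H (gs_mat n G) \<partial>gauss (sq n))"
    unfolding nn_integral_reduction[OF is_root_id \<Phi>] id H_def F_def ..
  also have "\<dots> = (\<integral>\<^sup>+Q. H Q \<partial>haar n)"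
    unfolding haar_def by (rule nn_integral_distr[symmetric, OF measurable_gs_mat]) (simp only: measurable_distr_eq1 H)
  also have "\<dots> = (\<integral>\<^sup>+W. F W \<partial>GOE n)"
    unfolding H_def by (rule nn_integral_haar_tridiagonal[OF n F orthm_refl_mat])
  finally show ?thesis by (simp add: F_def)
qed

end

section \<open>Moments of Gaussian sums of squares\<close>

lemma normal_moments:
  "integrable (normal_law 1) (\<lambda>x. x\<^sup>2)" "(\<integral>x. x\<^sup>2 \<partial>normal_law 1) = 1"
  "integrable (normal_law 1) (\<lambda>x. x\<^sup>2 - 1)" "(\<integral>x. x\<^sup>2 - 1 \<partial>normal_law 1) = 0"
  "integrable (normal_law 1) (\<lambda>x. (x\<^sup>2 - 1)\<^sup>2)" "(\<integral>x. (x\<^sup>2 - 1)\<^sup>2 \<partial>normal_law 1) = 2"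
proof -
  note prob_space = gauss_pf.M.prob_space
  have i: "integrable (normal_law 1) (\<lambda>x. x ^ k)" for k
    unfolding normal_law_def using integrable_std_normal_moment[of k]
    by (subst integrable_density) auto
  have v: "(\<integral>x. x ^ (2 * k) \<partial>normal_law 1) = fact (2 * k) / (2 ^ k * fact k)" for k
    unfolding normal_law_def using integral_std_normal_moment_even[of k]
    by (subst integral_density) auto
  show i2: "integrable (normal_law 1) (\<lambda>x. x\<^sup>2)" by (rule i)
  show v2: "(\<integral>x. x\<^sup>2 \<partial>normal_law 1) = 1" using v[of 1] by simp
  have v4: "(\<integral>x. x ^ 4 \<partial>normal_law 1) = 3" using v[of 2] by (simp add: fact_numeral)
  show "integrable (normal_law 1) (\<lambda>x. x\<^sup>2 - 1)" "(\<integral>x. x\<^sup>2 - 1 \<partial>normal_law 1) = 0"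
    using i2 v2 prob_space by auto
  have eq: "(x\<^sup>2 - 1)\<^sup>2 = x ^ 4 - 2 * x\<^sup>2 + 1" for x :: real by algebra
  show "integrable (normal_law 1) (\<lambda>x. (x\<^sup>2 - 1)\<^sup>2)" "(\<integral>x. (x\<^sup>2 - 1)\<^sup>2 \<partial>normal_law 1) = 2"
    unfolding eq using i[of 4] i2 v2 v4 prob_space by auto
qed

lemma prob_normal_UNIV: "measure (normal_law 1) UNIV = 1"
  using prob_space.prob_space[OF prob_space_normal_law[OF zero_less_one]] by simp

lemma gauss_product_integral:
  fixes h :: "'i \<Rightarrow> real \<Rightarrow> real"
  assumes I: "finite I" and h: "\<And>i. i \<in> I \<Longrightarrow> integrable (normal_law 1) (h i)"
  shows "integrable (gauss I) (\<lambda>x. \<Prod>i\<in>I. h i (x i))"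
    "(\<integral>x. (\<Prod>i\<in>I. h i (x i)) \<partial>gauss I) = (\<Prod>i\<in>I. \<integral>x. h i x \<partial>normal_law 1)"
  unfolding gauss_def using I h
  by (auto intro: gauss_pf.product_integrable_prod gauss_pf.product_integral_prod)

lemma gauss_square_moment:
  assumes I: "finite I" "i \<in> I"
  shows "integrable (gauss I) (\<lambda>x. (x i)\<^sup>2)" "(\<integral>x. (x i)\<^sup>2 \<partial>gauss I) = 1"
proof -
  define h where "h j = (if j = i then (\<lambda>x. x\<^sup>2) else (\<lambda>x::real. 1::real))" for j
  have h: "integrable (normal_law 1) (h j)" for j
    using normal_moments(1) by (simp add: h_def)
  have e: "(\<Prod>j\<in>I. h j (x j)) = (x i)\<^sup>2" for x :: "'a \<Rightarrow> real"
    using I by (simp add: prod.remove[of I i] h_def)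
  have "(\<Prod>j\<in>I. \<integral>x. h j x \<partial>normal_law 1) = 1"
    by (rule prod.neutral) (auto simp: h_def normal_moments prob_normal_UNIV)
  then show "integrable (gauss I) (\<lambda>x. (x i)\<^sup>2)" "(\<integral>x. (x i)\<^sup>2 \<partial>gauss I) = 1"
    using gauss_product_integral[OF I(1), of h] h unfolding e by auto
qed

text \<open>Products of distinct centred squares integrate to 0 by independence, and each diagonal
  term contributes the variance 2 of a squared standard normal.\<close>

lemma gauss_chi_variance:
  assumes I: "finite I" and J: "J \<subseteq> I"
  shows "integrable (gauss I) (\<lambda>x. (\<Sum>j\<in>J. (x j)\<^sup>2 - 1)\<^sup>2)"
    "(\<integral>x. (\<Sum>j\<in>J. (x j)\<^sup>2 - 1)\<^sup>2 \<partial>gauss I) = 2 * real (card J)"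
proof -
  have fJ: "finite J" using I J finite_subset by blast
  have c: "integrable (gauss I) (\<lambda>x. ((x i)\<^sup>2 - 1) * ((x j)\<^sup>2 - 1)) \<and>
      (\<integral>x. ((x i)\<^sup>2 - 1) * ((x j)\<^sup>2 - 1) \<partial>gauss I) = (if i = j then 2 else 0)" if ij: "i \<in> I" "j \<in> I" for i j
  proof -
    define h where "h k = (if k = i \<and> k = j then (\<lambda>x. (x\<^sup>2 - 1)\<^sup>2) else if k = i \<or> k = j then (\<lambda>x. x\<^sup>2 - 1)
      else (\<lambda>x::real. 1::real))" for k
    have h: "integrable (normal_law 1) (h k)" for k
      using normal_moments(3,5) by (simp add: h_def)
    have e: "(\<Prod>k\<in>I. h k (x k)) = ((x i)\<^sup>2 - 1) * ((x j)\<^sup>2 - 1)" for x :: "'a \<Rightarrow> real"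
    proof (cases "i = j")
      case True
      then show ?thesis using I ij by (simp add: prod.remove[of I i] h_def power2_eq_square)
    next
      case False
      have "(\<Prod>k\<in>I. h k (x k)) = h i (x i) * (h j (x j) * (\<Prod>k\<in>I - {i} - {j}. h k (x k)))"
        using I ij False by (simp add: prod.remove[of I i] prod.remove[of "I - {i}" j])
      also have "(\<Prod>k\<in>I - {i} - {j}. h k (x k)) = 1" by (rule prod.neutral) (auto simp: h_def)
      finally show ?thesis using False by (simp add: h_def)
    qed
    have v: "(\<Prod>k\<in>I. \<integral>x. h k x \<partial>normal_law 1) = (if i = j then 2 else 0)"
    proof (cases "i = j")
      case True
      then have "(\<Prod>k\<in>I. \<integral>x. h k x \<partial>normal_law 1) = 2 * (\<Prod>k\<in>I - {i}. \<integral>x. h k x \<partial>normal_law 1)"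
        using I ij by (simp add: prod.remove[of I i] h_def normal_moments)
      also have "(\<Prod>k\<in>I - {i}. \<integral>x. h k x \<partial>normal_law 1) = 1"
        by (rule prod.neutral) (use True in \<open>auto simp: h_def prob_normal_UNIV\<close>)
      finally show ?thesis using True by simp
    next
      case False
      then have "(\<integral>x. h i x \<partial>normal_law 1) = 0" by (simp add: h_def normal_moments)
      then show ?thesis using False I ij by (simp add: prod.remove[of I i])
    qed
    show ?thesis using gauss_product_integral[OF I, of h] h unfolding e v by auto
  qed
  have e: "(\<Sum>j\<in>J. (x j)\<^sup>2 - 1)\<^sup>2 = (\<Sum>i\<in>J. \<Sum>j\<in>J. ((x i)\<^sup>2 - 1) * ((x j)\<^sup>2 - 1))" for x :: "'a \<Rightarrow> real"
    by (simp only: power2_eq_square sum_product)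
  have ci: "integrable (gauss I) (\<lambda>x. ((x i)\<^sup>2 - 1) * ((x j)\<^sup>2 - 1))" if "i \<in> J" "j \<in> J" for i j
    using c[of i j] that J by auto
  have cv: "(\<integral>x. ((x i)\<^sup>2 - 1) * ((x j)\<^sup>2 - 1) \<partial>gauss I) = (if j = i then 2 else 0)" if "i \<in> J" "j \<in> J" for i j
  proof -
    have "i \<in> I" "j \<in> I" using that J by auto
    from c[OF this] show ?thesis by (cases "i = j") auto
  qed
  show "integrable (gauss I) (\<lambda>x. (\<Sum>j\<in>J. (x j)\<^sup>2 - 1)\<^sup>2)"
    unfolding e by (intro Bochner_Integration.integrable_sum ci)
  have "(\<integral>x. (\<Sum>j\<in>J. (x j)\<^sup>2 - 1)\<^sup>2 \<partial>gauss I) =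
      (\<Sum>i\<in>J. \<Sum>j\<in>J. \<integral>x. ((x i)\<^sup>2 - 1) * ((x j)\<^sup>2 - 1) \<partial>gauss I)"
    unfolding e by (simp add: Bochner_Integration.integral_sum Bochner_Integration.integrable_sum ci)
  also have "\<dots> = (\<Sum>i\<in>J. \<Sum>j\<in>J. if j = i then 2 else 0)"
    by (intro sum.cong refl cv)
  also have "\<dots> = (\<Sum>i\<in>J. 2)" using fJ by (intro sum.cong refl) simp
  finally show "(\<integral>x. (\<Sum>j\<in>J. (x j)\<^sup>2 - 1)\<^sup>2 \<partial>gauss I) = 2 * real (card J)" by simp
qed

lemma gauss_chi_tail:
  assumes I: "finite I" and J: "J \<subseteq> I" and t: "0 < t"
  shows "measure (gauss I) {x \<in> space (gauss I). t \<le> \<bar>(\<Sum>j\<in>J. (x j)\<^sup>2) - real (card J)\<bar>} \<le> 2 * real (card J) / t\<^sup>2"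
proof -
  interpret prob_space "gauss I" by (rule prob_space_gauss)
  have e: "(\<Sum>j\<in>J. (x j)\<^sup>2 - 1) = (\<Sum>j\<in>J. (x j)\<^sup>2) - real (card J)" for x :: "'a \<Rightarrow> real"
    by (simp add: sum_subtractf)
  have "measure (gauss I) {x \<in> space (gauss I). t\<^sup>2 \<le> (\<Sum>j\<in>J. (x j)\<^sup>2 - 1)\<^sup>2} \<le> 2 * real (card J) / t\<^sup>2"
    using integral_Markov_inequality_measure[OF gauss_chi_variance(1)[OF I J], of "{}" "t\<^sup>2"] t
    by (simp add: gauss_chi_variance(2)[OF I J])
  moreover have "t\<^sup>2 \<le> y\<^sup>2 \<longleftrightarrow> t \<le> \<bar>y\<bar>" for y
    using t abs_le_square_iff[of t y] by simp
  ultimately show ?thesis by (simp add: e)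
qed

section \<open>The planted quadratic form\<close>

context windows
begin

abbreviation "d \<equiv> n - N"

text \<open>The deterministic value around which the off-diagonal entry \<open>k\<close>
  concentrates: a chi variable with \<open>n - 1 - k\<close> degrees of freedom is near the root of
  that number.\<close>

definition drift :: "nat \<Rightarrow> real" where
  "drift k = sqrt ((real n - 1 - real k) / real n)"

lemma drift_bounds: "Suc k < n \<Longrightarrow> 0 \<le> drift k" "Suc k < n \<Longrightarrow> drift k \<le> 1"
  "Suc k < n \<Longrightarrow> 1 - real (Suc k) / real n \<le> drift k"
proof -
  assume k: "Suc k < n"
  define v where "v = (real n - 1 - real k) / real n"
  have v: "0 \<le> v" "v \<le> 1" using k by (auto simp: v_def field_simps)
  show "0 \<le> drift k" "drift k \<le> 1" using v by (simp_all add: drift_def flip: v_def)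
  \<comment> \<open>On the unit interval a number is at most its square root, which gives a linear
    lower bound on the drift.\<close>
  have "v\<^sup>2 \<le> v" using v by (simp add: power2_eq_square mult_left_le)
  then have "v \<le> sqrt v" by (rule real_le_rsqrt)
  moreover have "v = 1 - real (Suc k) / real n" using k by (simp add: v_def field_simps)
  ultimately show "1 - real (Suc k) / real n \<le> drift k" by (simp add: drift_def v_def)
qed

text \<open>Within a window \<open>p\<close> is constant, so each of the \<open>m - 1\<close> inner
  pairs contributes twice the squared height times a drift of at least \<open>1 - d * m / n\<close>.
  The pair across a window boundary may be negative but costs at most the two squared heights, a
  relative loss of order \<open>1 / m\<close>.\<close>

lemma flat_form:
  fixes z :: "nat \<Rightarrow> real"
  defines "p \<equiv> \<lambda>k. if k < d * m then z (N + k div m) / r else 0"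
  shows "2 * (\<Sum>k<n. if Suc k < n then drift k * (p k * p (Suc k)) else 0) \<ge>
    2 * (\<Sum>j<d. (z (N + j))\<^sup>2) * (1 - real (d * m) / real n - 2 / real m)"
proof (cases "d = 0")
  case True
  then have "p k = 0" for k by (simp add: p_def)
  then show ?thesis using True by (simp cong: if_cong)
next
  case False
  then have dn: "d * m < n" using fit N by simp
  define b0 where "b0 = 1 - real (d * m) / real n"
  have b0: "0 \<le> b0" "b0 \<le> 1" using dn by (auto simp: b0_def divide_le_eq_1 simp del: of_nat_mult)
  \<comment> \<open>The squared height of window \<open>j\<close>, set to 0 from \<open>d\<close> on
    so that the boundary after the last window obeys the same estimate.\<close>
  define zz where "zz j = (if j < d then (z (N + j))\<^sup>2 / m else 0)" for j
  have zz: "0 \<le> zz j" for j by (simp add: zz_def)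
  have pp: "(p (j * m + i))\<^sup>2 = zz j" if "i < m" for i j
  proof -
    have "(j * m + i) div m = j" using that by simp
    moreover have "j * m + i < d * m \<longleftrightarrow> j < d"
    proof
      assume "j < d"
      then have "Suc j * m \<le> d * m" by (intro mult_le_mono1) simp
      then show "j * m + i < d * m" using that by simp
    next
      assume "j * m + i < d * m"
      then have "j * m < d * m" by (rule le_less_trans[OF le_add1])
      then show "j < d" by simp
    qed
    ultimately show ?thesis by (simp add: p_def zz_def power_divide m power2_eq_square)
  qed
  define g where "g k = 2 * (drift k * (p k * p (Suc k)))" for k
  have "2 * (\<Sum>k<n. if Suc k < n then drift k * (p k * p (Suc k)) else 0) = (\<Sum>k<n. if k < d * m then g k else 0)"
    unfolding sum_distrib_left g_def using dn by (intro sum.cong refl) (auto simp: p_def)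
  also have "\<dots> = (\<Sum>k<d * m. g k)"
  proof -
    have "{..<n} \<inter> {k. k < d * m} = {..<d * m}" using dn by auto
    then show ?thesis by (simp add: sum.If_cases)
  qed
  also have "\<dots> = (\<Sum>j<d. \<Sum>i<m. g (j * m + i))"
  proof -
    have "sum g {j * m..<j * m + m} = (\<Sum>i<m. g (j * m + i))" for j
      by (rule sum.reindex_bij_witness[of _ "\<lambda>i. j * m + i" "\<lambda>k. k - j * m"]) auto
    then show ?thesis using sum.nat_group[of g m d] by simp
  qed
  also have "\<dots> \<ge> (\<Sum>j<d. 2 * b0 * (real m - 1) * zz j - zz j - zz (Suc j))"
  proof (rule sum_mono)
    fix j assume j: "j \<in> {..<d}"
    have w: "j * m + m \<le> d * m"
      using j mult_le_mono1[of "Suc j" d m] by simp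
    have inner: "2 * b0 * zz j \<le> g (j * m + i)" if i: "Suc i < m" for i
    proof -
      have lt: "j * m + Suc i < d * m" using w i by simp
      have k: "Suc (j * m + i) < n" using lt dn by simp
      have "p (Suc (j * m + i)) = p (j * m + i)"
      proof -
        have "Suc (j * m + i) div m = j" "(j * m + i) div m = j"
          using i by (metis add_Suc_right div_mult_self3 div_less add.right_neutral add.commute m_pos less_numeral_extra(3)) (use i in simp)
        then show ?thesis using lt by (simp add: p_def)
      qed
      then have "g (j * m + i) = 2 * drift (j * m + i) * (p (j * m + i))\<^sup>2"
        by (simp add: g_def power2_eq_square)
      also have "(p (j * m + i))\<^sup>2 = zz j" using i by (intro pp) simp
      finally have gg: "g (j * m + i) = 2 * drift (j * m + i) * zz j" .
      have "real (Suc (j * m + i)) \<le> real (d * m)" by (rule of_nat_mono) (use lt in simp)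
      then have "b0 \<le> 1 - real (Suc (j * m + i)) / real n"
        unfolding b0_def by (intro diff_mono divide_right_mono) auto
      also have "\<dots> \<le> drift (j * m + i)" by (rule drift_bounds(3)[OF k])
      finally show ?thesis unfolding gg using zz[of j] by (simp add: mult_right_mono)
    qed
    have last: "- zz j - zz (Suc j) \<le> g (j * m + (m - 1))"
    proof -
      let ?k = "j * m + (m - 1)"
      have k: "Suc ?k = Suc j * m + 0" using m_pos by simp
      have kn: "Suc ?k < n"
        using w dn m_pos by simp
      have "(p ?k)\<^sup>2 = zz j" "(p (Suc ?k))\<^sup>2 = zz (Suc j)"
        using pp[of "m - 1" j] pp[of 0 "Suc j"] m_pos unfolding k by auto
      moreover have "- (x\<^sup>2 + y\<^sup>2) \<le> 2 * (\<delta> * (x * y))" if "0 \<le> \<delta>" "\<delta> \<le> 1" for x y \<delta> :: real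
      proof -
        have "2 * \<bar>x * y\<bar> \<le> x\<^sup>2 + y\<^sup>2"
          using sum_squares_bound[of "\<bar>x\<bar>" "\<bar>y\<bar>"] by (simp add: abs_mult)
        moreover have "\<delta> * \<bar>x * y\<bar> \<le> \<bar>x * y\<bar>" using that by (intro mult_left_le_one_le) auto
        moreover have "- (\<delta> * \<bar>x * y\<bar>) \<le> \<delta> * (x * y)"
          using mult_left_mono[of "- \<bar>x * y\<bar>" "x * y" \<delta>] that by simp
        ultimately show ?thesis by simp
      qed
      from this[OF drift_bounds(1,2)[OF kn]] have "- ((p ?k)\<^sup>2 + (p (Suc ?k))\<^sup>2) \<le> g ?k"
        unfolding g_def by blast
      ultimately show ?thesis by simp
    qed
    have "(\<Sum>i<m. g (j * m + i)) = (\<Sum>i<m - 1. g (j * m + i)) + g (j * m + (m - 1))"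
      using m_pos by (metis Suc_diff_1 sum.lessThan_Suc)
    also have "\<dots> \<ge> (\<Sum>i<m - 1. 2 * b0 * zz j) + (- zz j - zz (Suc j))"
      by (intro add_mono sum_mono inner last) auto
    also have "(\<Sum>i<m - 1. 2 * b0 * zz j) = 2 * b0 * (real m - 1) * zz j"
      using m_pos by (simp add: of_nat_diff Suc_leI)
    finally show "2 * b0 * (real m - 1) * zz j - zz j - zz (Suc j) \<le> (\<Sum>i<m. g (j * m + i))" by simp
  qed
  also have "(\<Sum>j<d. 2 * b0 * (real m - 1) * zz j - zz j - zz (Suc j)) =
      (2 * b0 * (real m - 1) - 1) * (\<Sum>j<d. zz j) - (\<Sum>j<d. zz (Suc j))"
    by (simp add: sum_subtractf sum_distrib_left left_diff_distrib)
  also have "\<dots> \<ge> (2 * b0 * (real m - 1) - 2) * (\<Sum>j<d. zz j)"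
  proof -
    have "(\<Sum>j<d. zz (Suc j)) = (\<Sum>j<Suc d. zz j) - zz 0"
      by (subst sum.lessThan_Suc_shift) simp
    also have "\<dots> \<le> (\<Sum>j<d. zz j)" using zz[of 0] by (simp add: zz_def)
    finally show ?thesis by (simp add: algebra_simps)
  qed
  also have "(\<Sum>j<d. zz j) = (\<Sum>j<d. (z (N + j))\<^sup>2) / m" by (simp add: zz_def sum_divide_distrib)
  finally have "(2 * b0 * (real m - 1) - 2) * ((\<Sum>j<d. (z (N + j))\<^sup>2) / m) \<le>
    2 * (\<Sum>k<n. if Suc k < n then drift k * (p k * p (Suc k)) else 0)" .
  \<comment> \<open>The right side exceeds the left by \<open>2 * Z * (1 - b0) / m\<close>, which is
    nonnegative because \<open>b0 \<le> 1\<close>.\<close>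
  moreover have "2 * (\<Sum>j<d. (z (N + j))\<^sup>2) * (b0 - 2 / real m) \<le> (2 * b0 * (real m - 1) - 2) * ((\<Sum>j<d. (z (N + j))\<^sup>2) / m)"
  proof -
    define Z where "Z = (\<Sum>j<d. (z (N + j))\<^sup>2)"
    have Z: "0 \<le> Z" by (simp add: Z_def sum_nonneg)
    have "(2 * b0 * (real m - 1) - 2) * (Z / m) - 2 * Z * (b0 - 2 / real m) = 2 * Z * (1 - b0) / m"
      using m_pos by (simp add: field_simps)
    also have "\<dots> \<ge> 0" using Z b0 by simp
    finally show ?thesis by (simp add: Z_def)
  qed
  ultimately show ?thesis unfolding b0_def by simp
qed

lemma adjacent_squares:
  fixes f :: "nat \<Rightarrow> real"
  shows "(\<Sum>k<n. if Suc k < n then (f k)\<^sup>2 + (f (Suc k))\<^sup>2 else 0) \<le> 2 * (\<Sum>k<n. (f k)\<^sup>2)"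
proof -
  have "(\<Sum>k<n. if Suc k < n then (f (Suc k))\<^sup>2 else 0) = (\<Sum>k\<in>{k. Suc k < n}. (f (Suc k))\<^sup>2)"
    by (rule sum.mono_neutral_cong_right) auto
  also have "\<dots> = (\<Sum>k\<in>Suc ` {k. Suc k < n}. (f k)\<^sup>2)" by (simp add: sum.reindex)
  also have "\<dots> \<le> (\<Sum>k<n. (f k)\<^sup>2)" by (rule sum_mono2) auto
  finally have "(\<Sum>k<n. if Suc k < n then (f (Suc k))\<^sup>2 else 0) \<le> (\<Sum>k<n. (f k)\<^sup>2)" .
  moreover have "(\<Sum>k<n. if Suc k < n then (f k)\<^sup>2 else 0) \<le> (\<Sum>k<n. (f k)\<^sup>2)"
    by (rule sum_mono) simp
  moreover have "(\<Sum>k<n. if Suc k < n then (f k)\<^sup>2 + (f (Suc k))\<^sup>2 else 0) =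
    (\<Sum>k<n. if Suc k < n then (f k)\<^sup>2 else 0) + (\<Sum>k<n. if Suc k < n then (f (Suc k))\<^sup>2 else 0)"
    unfolding sum.distrib[symmetric] by (intro sum.cong) auto
  ultimately show ?thesis by linarith
qed

text \<open>The tail of \<open>z\<close> is mapped to the flat vector of \<open>flat_form\<close>.
  The head has squared norm \<open>Z'\<close>, thought of as small, and the reflections preserve
  norms; its cross terms with the flat part are absorbed with weight \<open>t\<close>, at the price
  \<open>t\<close> on the large part and \<open>1 / t\<close> on the small one.\<close>

lemma drift_form_lower:
  fixes z :: "nat \<Rightarrow> real"
  assumes t: "0 < t"
  defines "w \<equiv> reflect N m r d z"
  defines "Z \<equiv> (\<Sum>k<n. (z k)\<^sup>2)" and "Z' \<equiv> (\<Sum>k<N. (z k)\<^sup>2)"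
  shows "2 * (\<Sum>k<n. if Suc k < n then drift k * (w k * w (Suc k)) else 0) \<ge>
    2 * (Z - Z') * (1 - real (d * m) / real n - 2 / real m) - 2 * t * Z - (2 / t + 2) * Z'"
proof -
  define z1 z2 where "z1 = (\<lambda>k. if k < N then z k else 0)" and "z2 = (\<lambda>k. if k < N then 0 else z k)"
  define q p where "q = reflect N m r d z1" and "p = reflect N m r d z2"
  have w: "w k = p k + q k" for k
    using reflect_linear[of d 1 z2 1 z1] by (simp add: w_def p_def q_def z1_def z2_def fun_eq_iff if_distrib cong: if_cong)
  have Ns: "{..<n} \<inter> {k. k < N} = {..<N}" "{..<n} \<inter> - {k. k < N} = {N..<n}" using N by auto
  have q2: "(\<Sum>k<n. (q k)\<^sup>2) = Z'"
  proof -
    have "(\<Sum>k<n. (q k)\<^sup>2) = (\<Sum>k<n. if k < N then (z k)\<^sup>2 else 0)"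
      unfolding q_def reflect_norm[OF order_refl] by (intro sum.cong) (auto simp: z1_def)
    then show ?thesis by (simp add: sum.If_cases Ns Z'_def)
  qed
  have ZZ: "Z = Z' + (\<Sum>k\<in>{N..<n}. (z k)\<^sup>2)"
    unfolding Z_def Z'_def using sum.atLeastLessThan_concat[of 0 N n "\<lambda>k. (z k)\<^sup>2"] N by (simp add: atLeast0LessThan)
  have p2: "(\<Sum>k<n. (p k)\<^sup>2) = Z - Z'"
  proof -
    have "(\<Sum>k<n. (p k)\<^sup>2) = (\<Sum>k<n. if k < N then 0 else (z k)\<^sup>2)"
      unfolding p_def reflect_norm[OF order_refl] by (intro sum.cong) (auto simp: z2_def)
    then show ?thesis by (simp add: sum.If_cases Ns ZZ)
  qed
  have Zd: "(\<Sum>j<d. (z (N + j))\<^sup>2) = Z - Z'"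
  proof -
    have "(\<Sum>k\<in>{N..<n}. (z k)\<^sup>2) = (\<Sum>j<d. (z (N + j))\<^sup>2)"
      by (rule sum.reindex_bij_witness[of _ "\<lambda>j. N + j" "\<lambda>k. k - N"]) auto
    then show ?thesis using ZZ by simp
  qed
  have pe: "p k = (if k < d * m then z (N + k div m) / r else 0)" if "k < n" for k
  proof -
    have "z2 (N + k div m) = z (N + k div m)" by (simp add: z2_def)
    then show ?thesis using that fit N unfolding p_def
      by (subst reflect_tail) (auto simp: z2_def)
  qed
  \<comment> \<open>Weighted AM-GM for the two cross terms and plain AM-GM for the product of the
    two small parts.\<close>
  have pq: "2 * (\<delta> * ((a + a') * (b + b'))) \<ge> 2 * (\<delta> * (a * b)) - t * (a\<^sup>2 + b\<^sup>2) - (1 / t + 1) * (a'\<^sup>2 + b'\<^sup>2)"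
    if "0 \<le> \<delta>" "\<delta> \<le> 1" for a a' b b' \<delta> :: real
  proof -
    have am: "2 * \<bar>x * y\<bar> \<le> t * x\<^sup>2 + y\<^sup>2 / t" for x y
    proof -
      have "0 \<le> (sqrt t * \<bar>x\<bar> - \<bar>y\<bar> / sqrt t)\<^sup>2" by simp
      also have "\<dots> = t * x\<^sup>2 + y\<^sup>2 / t - 2 * \<bar>x * y\<bar>"
        using t by (simp add: power2_diff power_mult_distrib power_divide abs_mult)
      finally show ?thesis by simp
    qed
    have am1: "2 * \<bar>a' * b'\<bar> \<le> a'\<^sup>2 + b'\<^sup>2"
      using sum_squares_bound[of "\<bar>a'\<bar>" "\<bar>b'\<bar>"] by (simp add: abs_mult)
    define e where "e = a * b' + a' * b + a' * b'"
    have "\<bar>e\<bar> \<le> \<bar>a * b'\<bar> + \<bar>b * a'\<bar> + \<bar>a' * b'\<bar>"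
      unfolding e_def by (simp add: mult.commute[of a' b])
    then have "2 * \<bar>e\<bar> \<le> t * (a\<^sup>2 + b\<^sup>2) + (1 / t + 1) * (a'\<^sup>2 + b'\<^sup>2)"
      using am[of a b'] am[of b a'] am1 by (simp add: algebra_simps add_divide_distrib)
    moreover have "\<delta> * \<bar>e\<bar> \<le> \<bar>e\<bar>" using that by (intro mult_left_le_one_le) auto
    moreover have "- (\<delta> * \<bar>e\<bar>) \<le> \<delta> * e" using mult_left_mono[of "- \<bar>e\<bar>" e \<delta>] that by simp
    moreover have "2 * (\<delta> * ((a + a') * (b + b'))) = 2 * (\<delta> * (a * b)) + 2 * (\<delta> * e)"
      by (simp add: e_def algebra_simps)
    ultimately show ?thesis by linarith
  qed
  have "2 * (\<Sum>k<n. if Suc k < n then drift k * (w k * w (Suc k)) else 0) =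
      (\<Sum>k<n. if Suc k < n then 2 * (drift k * ((p k + q k) * (p (Suc k) + q (Suc k)))) else 0)"
    unfolding sum_distrib_left w by (intro sum.cong) auto
  also have "\<dots> \<ge> (\<Sum>k<n. if Suc k < n then 2 * (drift k * (p k * p (Suc k))) - t * ((p k)\<^sup>2 + (p (Suc k))\<^sup>2)
      - (1 / t + 1) * ((q k)\<^sup>2 + (q (Suc k))\<^sup>2) else 0)"
    by (rule sum_mono) (auto intro!: pq drift_bounds)
  also have "(\<Sum>k<n. if Suc k < n then 2 * (drift k * (p k * p (Suc k))) - t * ((p k)\<^sup>2 + (p (Suc k))\<^sup>2)
      - (1 / t + 1) * ((q k)\<^sup>2 + (q (Suc k))\<^sup>2) else 0) =
    2 * (\<Sum>k<n. if Suc k < n then drift k * (p k * p (Suc k)) else 0)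
    - t * (\<Sum>k<n. if Suc k < n then (p k)\<^sup>2 + (p (Suc k))\<^sup>2 else 0)
    - (1 / t + 1) * (\<Sum>k<n. if Suc k < n then (q k)\<^sup>2 + (q (Suc k))\<^sup>2 else 0)"
    unfolding sum_distrib_left sum_subtractf[symmetric] by (intro sum.cong) auto
  also have "\<dots> \<ge> 2 * (Z - Z') * (1 - real (d * m) / real n - 2 / real m) - t * (2 * (Z - Z')) - (1 / t + 1) * (2 * Z')"
  proof (intro diff_mono mult_left_mono)
    have "(\<Sum>k<n. if Suc k < n then drift k * (p k * p (Suc k)) else 0) =
      (\<Sum>k<n. if Suc k < n then drift k * ((if k < d * m then z (N + k div m) / r else 0) *
         (if Suc k < d * m then z (N + Suc k div m) / r else 0)) else 0)"
      by (intro sum.cong) (auto simp: pe)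
    then show "2 * (Z - Z') * (1 - real (d * m) / real n - 2 / real m) \<le>
        2 * (\<Sum>k<n. if Suc k < n then drift k * (p k * p (Suc k)) else 0)"
      using flat_form[of z] by (simp add: Zd)
  qed (use adjacent_squares[of p] adjacent_squares[of q] p2 q2 t in auto)
  also have "2 * (Z - Z') * (1 - real (d * m) / real n - 2 / real m) - t * (2 * (Z - Z')) - (1 / t + 1) * (2 * Z') \<ge>
     2 * (Z - Z') * (1 - real (d * m) / real n - 2 / real m) - 2 * t * Z - (2 / t + 2) * Z'"
  proof -
    have "0 \<le> t * Z'" using t by (simp add: Z'_def sum_nonneg)
    then show ?thesis by (simp add: algebra_simps)
  qed
  finally show ?thesis by simp
qed

end

lemma orthm_rows_norm:
  assumes Q: "orthm n Q"
  shows "(\<Sum>k<n. (\<Sum>i<n. x i * Q (i, k))\<^sup>2) = (\<Sum>i<n. (x i)\<^sup>2)"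
proof -
  have "ortho {..<n} (\<lambda>i j. Q (j, i))" using ortho_transpose[of n "\<lambda>i j. Q (i, j)"] Q by (simp add: orthm_def)
  from ortho_norm[OF this, of x] show ?thesis by (simp add: mult.commute)
qed

context windows
begin

lemma qform_conj:
  fixes x Q
  defines "w \<equiv> reflect N m r d (\<lambda>l. \<Sum>i<n. x i * Q (i, l))"
  shows "qform n (conj_by n (mm n Q refl_mat) T) x = (\<Sum>k<n. \<Sum>l<n. T (k, l) * (w k * w l))"
proof -
  let ?B = "mm n Q refl_mat"
  have w: "w k = (\<Sum>i<n. x i * ?B (i, k))" if k: "k < n" for k
  proof -
    have "w k = (\<Sum>l<n. \<Sum>i<n. x i * (Q (i, l) * refl_mat (l, k)))"
      unfolding w_def reflect_expand[OF k] by (simp add: sum_distrib_right mult.assoc)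
    also have "\<dots> = (\<Sum>i<n. \<Sum>l<n. x i * (Q (i, l) * refl_mat (l, k)))" by (rule sum.swap)
    also have "\<dots> = (\<Sum>i<n. x i * ?B (i, k))"
      using k by (intro sum.cong refl) (simp add: mm_def sum_distrib_left)
    finally show ?thesis .
  qed
  define f where "f i j k l = x i * (?B (i, k) * T (k, l) * ?B (j, l)) * x j" for i j k l
  have "qform n (conj_by n ?B T) x = (\<Sum>i<n. \<Sum>j<n. \<Sum>k<n. \<Sum>l<n. f i j k l)"
    unfolding qform_def by (intro sum.cong refl) (simp add: conj_by_def f_def sum_distrib_left sum_distrib_right)
  also have "\<dots> = (\<Sum>i<n. \<Sum>k<n. \<Sum>j<n. \<Sum>l<n. f i j k l)"
    by (rule sum.cong[OF refl]) (rule sum.swap)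
  also have "\<dots> = (\<Sum>k<n. \<Sum>i<n. \<Sum>j<n. \<Sum>l<n. f i j k l)" by (rule sum.swap)
  also have "\<dots> = (\<Sum>k<n. \<Sum>i<n. \<Sum>l<n. \<Sum>j<n. f i j k l)"
    by (rule sum.cong[OF refl], rule sum.cong[OF refl]) (rule sum.swap)
  also have "\<dots> = (\<Sum>k<n. \<Sum>l<n. \<Sum>i<n. \<Sum>j<n. f i j k l)"
    by (rule sum.cong[OF refl]) (rule sum.swap)
  also have "\<dots> = (\<Sum>k<n. \<Sum>l<n. T (k, l) * (w k * w l))"
  proof (intro sum.cong refl)
    fix k l assume "k \<in> {..<n}" "l \<in> {..<n}"
    then have "T (k, l) * (w k * w l) = T (k, l) * (\<Sum>i<n. \<Sum>j<n. (x i * ?B (i, k)) * (x j * ?B (j, l)))"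
      by (simp only: w lessThan_iff sum_product)
    also have "\<dots> = (\<Sum>i<n. \<Sum>j<n. f i j k l)"
      unfolding sum_distrib_left by (intro sum.cong refl) (simp add: f_def)
    finally show "(\<Sum>i<n. \<Sum>j<n. f i j k l) = T (k, l) * (w k * w l)" ..
  qed
  finally show ?thesis .
qed

lemma qform_tridiagonal:
  fixes w :: "nat \<Rightarrow> real"
  shows "(\<Sum>k<n. \<Sum>l<n. part n n \<xi> (k, l) * (w k * w l)) =
    (\<Sum>k<n. sqrt 2 * \<xi> (k, k) / sqrt n * (w k)\<^sup>2 +
      (if Suc k < n then 2 * (sqrt (\<Sum>l\<in>{Suc k..<n}. (\<xi> (k, l))\<^sup>2) / sqrt n) * (w k * w (Suc k)) else 0))"
proof -
  have "(\<Sum>k<n. \<Sum>l<n. part n n \<xi> (k, l) * (w k * w l)) =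
    (\<Sum>k<n. part n n \<xi> (k, k) * (w k * w k) + (if Suc k < n then part n n \<xi> (k, Suc k) * (w k * w (Suc k) + w (Suc k) * w k) else 0))"
    by (rule tridiagonal_sum[of "part n n \<xi>" "\<lambda>k l. w k * w l"])
      (auto simp: part_def min_def max_def)
  also have "\<dots> = (\<Sum>k<n. sqrt 2 * \<xi> (k, k) / sqrt n * (w k)\<^sup>2 +
      (if Suc k < n then 2 * (sqrt (\<Sum>l\<in>{Suc k..<n}. (\<xi> (k, l))\<^sup>2) / sqrt n) * (w k * w (Suc k)) else 0))"
    by (intro sum.cong refl) (auto simp: part_def min_def max_def power2_eq_square)
  finally show ?thesis .
qed

text \<open>The difference of roots is at most \<open>\<bar>S - \<nu>\<bar> / sqrt \<nu>\<close>.
  Replacing a number by half of one plus its square leaves only the second moment of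
  \<open>S - \<nu>\<close> to be known.\<close>

lemma sqrt_deviation:
  assumes S: "0 \<le> S" and \<nu>: "0 < \<nu>"
  shows "\<bar>sqrt S - sqrt \<nu>\<bar> \<le> ((S - \<nu>)\<^sup>2 / \<nu> + 1) / 2"
proof -
  define D where "D = \<bar>sqrt S - sqrt \<nu>\<bar>"
  have "0 \<le> (D - 1)\<^sup>2" by simp
  then have "2 * D \<le> D\<^sup>2 + 1" by (simp add: power2_diff)
  moreover have "D\<^sup>2 \<le> (S - \<nu>)\<^sup>2 / \<nu>"
  proof -
    have "(S - \<nu>)\<^sup>2 = D\<^sup>2 * (sqrt S + sqrt \<nu>)\<^sup>2"
    proof -
      have "S - \<nu> = (sqrt S - sqrt \<nu>) * (sqrt S + sqrt \<nu>)"
        using S \<nu> by (simp add: algebra_simps)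
      then show ?thesis by (simp add: D_def power_mult_distrib)
    qed
    moreover have "\<nu> \<le> (sqrt S + sqrt \<nu>)\<^sup>2"
      using S \<nu> by (simp add: power2_sum)
    ultimately have "D\<^sup>2 * \<nu> \<le> (S - \<nu>)\<^sup>2" by (simp add: mult_left_mono)
    then show ?thesis using \<nu> by (simp add: le_divide_eq)
  qed
  ultimately show ?thesis by (simp add: D_def)
qed

text \<open>By AM-GM every deviation is at most half of one plus its square, up to scaling; the squares have bounded
  mean, so Markov's inequality applies to the sum.\<close>

lemma noise_bound:
  fixes w :: "nat \<Rightarrow> real"
  assumes n: "0 < n" and \<eta>: "0 < \<eta>"
  defines "s \<equiv> (\<Sum>k<n. (w k)\<^sup>2)"
  shows "\<exists>E\<in>sets (gauss (ut n)). measure (gauss (ut n)) E \<le> 9 * s / (2 * sqrt n * \<eta>) \<and>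
    (\<forall>\<xi>\<in>space (gauss (ut n)) - E. (\<Sum>k<n. \<Sum>l<n. part n n \<xi> (k, l) * (w k * w l)) \<ge>
       2 * (\<Sum>k<n. if Suc k < n then drift k * (w k * w (Suc k)) else 0) - \<eta>)"
proof -
  define J where "J k = Pair k ` {Suc k..<n}" for k :: nat
  have J: "J k \<subseteq> ut n" for k by (auto simp: J_def ut_def)
  have cJ: "card (J k) = n - Suc k" for k
  proof -
    have inj: "inj_on (Pair k) {Suc k..<n}" by (rule inj_onI) simp
    show ?thesis unfolding J_def card_image[OF inj] by simp
  qed
  have sJ: "(\<Sum>j\<in>J k. (\<xi> j)\<^sup>2 - 1) = (\<Sum>l\<in>{Suc k..<n}. (\<xi> (k, l))\<^sup>2) - real (n - Suc k)" for \<xi> :: "nat \<times> nat \<Rightarrow> real" and k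
  proof -
    have "(\<Sum>j\<in>J k. (\<xi> j)\<^sup>2 - 1) = (\<Sum>j\<in>J k. (\<xi> j)\<^sup>2) - real (n - Suc k)"
      by (simp add: sum_subtractf cJ)
    then show ?thesis by (simp add: J_def sum.reindex inj_on_def)
  qed
  \<comment> \<open>\<open>e1\<close> and \<open>e2\<close> dominate the deviations of the diagonal
    and off-diagonal entries. Both have mean \<open>3 / (2 * sqrt n)\<close>, and each square of
    \<open>w\<close> is counted at most once with \<open>e1\<close> and twice with
    \<open>e2\<close>: hence the 9 in the bound.\<close>
  define e1 where "e1 k \<xi> = (2 * (\<xi> (k, k))\<^sup>2 + 1) / (2 * sqrt n)" for k and \<xi> :: "nat \<times> nat \<Rightarrow> real"
  define e2 where "e2 k \<xi> = ((\<Sum>j\<in>J k. (\<xi> j)\<^sup>2 - 1)\<^sup>2 / real (n - Suc k) + 1) / (2 * sqrt n)" for k and \<xi> :: "nat \<times> nat \<Rightarrow> real"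
  define err where "err \<xi> = (\<Sum>k<n. e1 k \<xi> * (w k)\<^sup>2 + (if Suc k < n then e2 k \<xi> * ((w k)\<^sup>2 + (w (Suc k))\<^sup>2) else 0))" for \<xi>
  interpret U: prob_space "gauss (ut n)" by (rule prob_space_gauss)
  have e1i: "integrable (gauss (ut n)) (e1 k)" "(\<integral>\<xi>. e1 k \<xi> \<partial>gauss (ut n)) = 3 / (2 * sqrt n)" if "k < n" for k
  proof -
    have kk: "(k, k) \<in> ut n" using that by (simp add: ut_def)
    show "integrable (gauss (ut n)) (e1 k)"
      unfolding e1_def[abs_def] using gauss_square_moment(1)[OF finite_ut kk] by auto
    show "(\<integral>\<xi>. e1 k \<xi> \<partial>gauss (ut n)) = 3 / (2 * sqrt n)"
      unfolding e1_def[abs_def] using gauss_square_moment[OF finite_ut kk] U.prob_space by simp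
  qed
  have e2i: "integrable (gauss (ut n)) (e2 k)" "(\<integral>\<xi>. e2 k \<xi> \<partial>gauss (ut n)) = 3 / (2 * sqrt n)" if "Suc k < n" for k
  proof -
    have [simp]: "real (n - Suc k) \<noteq> 0" using that by simp
    show "integrable (gauss (ut n)) (e2 k)"
      unfolding e2_def[abs_def] using gauss_chi_variance(1)[OF finite_ut J[of k]] by auto
    show "(\<integral>\<xi>. e2 k \<xi> \<partial>gauss (ut n)) = 3 / (2 * sqrt n)"
      unfolding e2_def[abs_def] using gauss_chi_variance[OF finite_ut J[of k]] U.prob_space that
      by (simp add: cJ del: of_nat_diff)
  qed
  have ti: "integrable (gauss (ut n)) (\<lambda>\<xi>. e1 k \<xi> * (w k)\<^sup>2 + (if Suc k < n then e2 k \<xi> * ((w k)\<^sup>2 + (w (Suc k))\<^sup>2) else 0))"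
    if "k < n" for k
    using e1i[OF that] e2i[of k] by (cases "Suc k < n") auto
  have tv: "(\<integral>\<xi>. e1 k \<xi> * (w k)\<^sup>2 + (if Suc k < n then e2 k \<xi> * ((w k)\<^sup>2 + (w (Suc k))\<^sup>2) else 0) \<partial>gauss (ut n)) =
      3 / (2 * sqrt n) * (w k)\<^sup>2 + (if Suc k < n then 3 / (2 * sqrt n) * ((w k)\<^sup>2 + (w (Suc k))\<^sup>2) else 0)"
    if "k < n" for k
    using e1i[OF that] e2i[of k] by (cases "Suc k < n") auto
  have ei: "integrable (gauss (ut n)) err"
    unfolding err_def[abs_def] by (rule Bochner_Integration.integrable_sum) (use ti in auto)
  have "(\<integral>\<xi>. err \<xi> \<partial>gauss (ut n)) = (\<Sum>k<n. 3 / (2 * sqrt n) * (w k)\<^sup>2 + (if Suc k < n then 3 / (2 * sqrt n) * ((w k)\<^sup>2 + (w (Suc k))\<^sup>2) else 0))"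
    unfolding err_def[abs_def]
    by (rule trans[OF Bochner_Integration.integral_sum sum.cong[OF refl tv]]) (simp_all only: ti lessThan_iff)
  also have "\<dots> = 3 / (2 * sqrt n) * s + 3 / (2 * sqrt n) * (\<Sum>k<n. if Suc k < n then (w k)\<^sup>2 + (w (Suc k))\<^sup>2 else 0)"
    unfolding s_def sum_distrib_left sum.distrib[symmetric] by (intro sum.cong) auto
  also have "\<dots> \<le> 3 / (2 * sqrt n) * s + 3 / (2 * sqrt n) * (2 * s)"
    unfolding s_def by (intro add_left_mono mult_left_mono adjacent_squares) auto
  also have "\<dots> = 9 * s / (2 * sqrt n)" using n by (simp add: field_simps)
  finally have ev: "(\<integral>\<xi>. err \<xi> \<partial>gauss (ut n)) \<le> 9 * s / (2 * sqrt n)" .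
  have e0: "0 \<le> err \<xi>" for \<xi>
    unfolding err_def by (intro sum_nonneg add_nonneg_nonneg) (auto simp: e1_def e2_def)
  define E where "E = {\<xi> \<in> space (gauss (ut n)). \<eta> \<le> err \<xi>}"
  have E: "E \<in> sets (gauss (ut n))"
    unfolding E_def using borel_measurable_integrable[OF ei] by measurable
  have "measure (gauss (ut n)) E \<le> (\<integral>\<xi>. err \<xi> \<partial>gauss (ut n)) / \<eta>"
    unfolding E_def using e0 \<eta> by (intro integral_Markov_inequality_measure[OF ei, of "{}"]) auto
  also have "\<dots> \<le> 9 * s / (2 * sqrt n) / \<eta>" using ev \<eta> by (intro divide_right_mono) auto
  also have "\<dots> = 9 * s / (2 * sqrt n * \<eta>)" by simp
  finally have mE: "measure (gauss (ut n)) E \<le> 9 * s / (2 * sqrt n * \<eta>)" .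
  have "(\<Sum>k<n. \<Sum>l<n. part n n \<xi> (k, l) * (w k * w l)) \<ge>
       2 * (\<Sum>k<n. if Suc k < n then drift k * (w k * w (Suc k)) else 0) - \<eta>"
    if \<xi>: "\<xi> \<in> space (gauss (ut n)) - E" for \<xi>
  proof -
    have a: "- (e1 k \<xi> * (w k)\<^sup>2) \<le> sqrt 2 * \<xi> (k, k) / sqrt n * (w k)\<^sup>2" for k
    proof -
      have "0 \<le> (sqrt 2 * \<xi> (k, k) + 1)\<^sup>2" by simp
      then have "- (2 * (\<xi> (k, k))\<^sup>2 + 1) \<le> 2 * (sqrt 2 * \<xi> (k, k))" by (simp add: power2_sum power_mult_distrib)
      then have "- (2 * (\<xi> (k, k))\<^sup>2 + 1) / (2 * sqrt n) \<le> 2 * (sqrt 2 * \<xi> (k, k)) / (2 * sqrt n)"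
        by (intro divide_right_mono) auto
      then have "- e1 k \<xi> \<le> sqrt 2 * \<xi> (k, k) / sqrt n"
        by (simp add: e1_def diff_divide_distrib add_divide_distrib)
      from mult_right_mono[OF this, of "(w k)\<^sup>2"] show ?thesis by simp
    qed
    have b: "2 * (drift k * (w k * w (Suc k))) - e2 k \<xi> * ((w k)\<^sup>2 + (w (Suc k))\<^sup>2) \<le>
        2 * (sqrt (\<Sum>l\<in>{Suc k..<n}. (\<xi> (k, l))\<^sup>2) / sqrt n) * (w k * w (Suc k))" if k: "Suc k < n" for k
    proof -
      define S where "S = (\<Sum>l\<in>{Suc k..<n}. (\<xi> (k, l))\<^sup>2)"
      define D where "D = sqrt S / sqrt n - drift k"
      have S: "0 \<le> S" by (simp add: S_def sum_nonneg)
      have "\<bar>sqrt S - sqrt (real (n - Suc k))\<bar> \<le> ((S - real (n - Suc k))\<^sup>2 / real (n - Suc k) + 1) / 2"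
        using k by (intro sqrt_deviation S) simp
      then have "\<bar>sqrt S - sqrt (real (n - Suc k))\<bar> / sqrt n \<le> ((S - real (n - Suc k))\<^sup>2 / real (n - Suc k) + 1) / 2 / sqrt n"
        by (intro divide_right_mono) auto
      moreover have "D = (sqrt S - sqrt (real (n - Suc k))) / sqrt n"
      proof -
        have "real n - 1 - real k = real (n - Suc k)" using k by (simp add: of_nat_diff)
        show ?thesis unfolding D_def drift_def \<open>real n - 1 - real k = real (n - Suc k)\<close> real_sqrt_divide
          by (simp only: diff_divide_distrib)
      qed
      ultimately have D: "\<bar>D\<bar> \<le> e2 k \<xi>" unfolding e2_def sJ S_def by (simp add: abs_divide)
      have "2 * \<bar>w k * w (Suc k)\<bar> \<le> (w k)\<^sup>2 + (w (Suc k))\<^sup>2"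
        using sum_squares_bound[of "\<bar>w k\<bar>" "\<bar>w (Suc k)\<bar>"] by (simp add: abs_mult)
      then have "\<bar>D\<bar> * (2 * \<bar>w k * w (Suc k)\<bar>) \<le> e2 k \<xi> * ((w k)\<^sup>2 + (w (Suc k))\<^sup>2)"
        using D by (intro mult_mono) auto
      moreover have "- (\<bar>D\<bar> * (2 * \<bar>w k * w (Suc k)\<bar>)) \<le> 2 * (D * (w k * w (Suc k)))"
        using abs_ge_minus_self[of "2 * (D * (w k * w (Suc k)))"] by (simp add: abs_mult)
      moreover have "2 * (sqrt S / sqrt n) * (w k * w (Suc k)) = 2 * (drift k * (w k * w (Suc k))) + 2 * (D * (w k * w (Suc k)))"
        by (simp add: D_def algebra_simps)
      ultimately show ?thesis unfolding S_def by linarith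
    qed
    have "2 * (\<Sum>k<n. if Suc k < n then drift k * (w k * w (Suc k)) else 0) - err \<xi> =
       (\<Sum>k<n. - (e1 k \<xi> * (w k)\<^sup>2) + (if Suc k < n then 2 * (drift k * (w k * w (Suc k))) - e2 k \<xi> * ((w k)\<^sup>2 + (w (Suc k))\<^sup>2) else 0))"
      unfolding err_def sum_distrib_left sum_subtractf[symmetric] by (intro sum.cong) auto
    also have "\<dots> \<le> (\<Sum>k<n. sqrt 2 * \<xi> (k, k) / sqrt n * (w k)\<^sup>2 +
      (if Suc k < n then 2 * (sqrt (\<Sum>l\<in>{Suc k..<n}. (\<xi> (k, l))\<^sup>2) / sqrt n) * (w k * w (Suc k)) else 0))"
      using a b by (intro sum_mono add_mono) auto
    finally have "2 * (\<Sum>k<n. if Suc k < n then drift k * (w k * w (Suc k)) else 0) - err \<xi> \<le>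
       (\<Sum>k<n. \<Sum>l<n. part n n \<xi> (k, l) * (w k * w l))" unfolding qform_tridiagonal .
    moreover have "err \<xi> < \<eta>" using \<xi> by (auto simp: E_def)
    ultimately show ?thesis by linarith
  qed
  then show ?thesis using E mE by blast
qed

text \<open>The projection \<open>v\<close> of \<open>x\<close> onto the span of the planted samples is the image under \<open>A\<close> of a vector \<open>v0\<close> in
  the span of the null samples, and \<open>x\<close> has no more than a \<open>1 - \<rho>\<close> fraction of its squared norm there.\<close>

lemma projection_bound:
  fixes x :: "nat \<Rightarrow> real"
  assumes Q: "orthm n (gs_mat n (partial_rows A G))" and Q0: "orthm n (gs_mat n G)"
    and A: "\<And>i j. i < n \<Longrightarrow> j < n \<Longrightarrow> A i j = id_mat i j + c * x i * x j"
    and s: "s = (\<Sum>i<n. (x i)\<^sup>2)"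
    and \<rho>: "0 \<le> \<rho>" and p0: "(\<Sum>k<N. (\<Sum>i<n. x i * gs_mat n G (i, k))\<^sup>2) \<le> (1 - \<rho>) * s"
  shows "\<rho> * (\<Sum>k<N. (\<Sum>i<n. x i * gs_mat n (partial_rows A G) (i, k))\<^sup>2) \<le> (1 + c * s)\<^sup>2 * s"
proof -
  define y g where "y k i = (if k < n \<and> i < n then partial_rows A G (k, i) else 0)"
    and "g k i = (if k < n \<and> i < n then G (k, i) else 0)" for k i
  have Qc: "gs_mat n (partial_rows A G) (l, k) = gs n y N k l" "gs_mat n G (l, k) = gs n g N k l" if "k < N" "l < n" for k l
    using that N gs_stable[of k N n n] by (simp_all add: gs_mat_def y_def[abs_def] g_def[abs_def])
  have on: "dotp n (gs n y N k) (gs n y N l) = (if k = l then 1 else 0)"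
    "dotp n (gs n g N k) (gs n g N l) = (if k = l then 1 else 0)" if kl: "k < N" "l < N" for k l
  proof -
    have "(\<Sum>i<n. gs_mat n (partial_rows A G) (i, k) * gs_mat n (partial_rows A G) (i, l)) = (if k = l then 1 else 0)"
      "(\<Sum>i<n. gs_mat n G (i, k) * gs_mat n G (i, l)) = (if k = l then 1 else 0)"
      using Q Q0 kl N by (auto simp: orthm_def ortho_def)
    then show "dotp n (gs n y N k) (gs n y N l) = (if k = l then 1 else 0)"
      "dotp n (gs n g N k) (gs n g N l) = (if k = l then 1 else 0)"
      using kl by (simp_all add: dotp_def Qc)
  qed
  have comb: "dotp n (\<lambda>l. \<Sum>k<N. a k * V k l) (\<lambda>l. \<Sum>k<N. a k * V k l) = (\<Sum>k<N. (a k)\<^sup>2)"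
    if V: "\<And>k l. k < N \<Longrightarrow> l < N \<Longrightarrow> dotp n (V k) (V l) = (if k = l then 1 else 0)" for a :: "nat \<Rightarrow> real" and V
  proof -
    have "dotp n (\<lambda>l. \<Sum>k<N. a k * V k l) (\<lambda>l. \<Sum>k<N. a k * V k l) = (\<Sum>k<N. \<Sum>l<N. a k * (a l * dotp n (V k) (V l)))"
      by (simp add: dotp_sum dotp_simps sum_distrib_left mult_ac)
    also have "\<dots> = (\<Sum>k<N. \<Sum>l<N. if l = k then (a k)\<^sup>2 else 0)"
      by (intro sum.cong refl) (simp add: V power2_eq_square)
    finally show ?thesis by simp
  qed
  define z where "z k = dotp n x (gs n y N k)" for k
  define z0 where "z0 k = dotp n x (gs n g N k)" for k
  have zz: "(\<Sum>i<n. x i * gs_mat n (partial_rows A G) (i, k)) = z k" "(\<Sum>i<n. x i * gs_mat n G (i, k)) = z0 k" if "k < N" for k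
    using that by (simp_all add: z_def z0_def dotp_def Qc)
  define Z where "Z = (\<Sum>k<N. (z k)\<^sup>2)"
  define v where "v l = (\<Sum>k<N. z k * gs n y N k l)" for l
  have vv: "dotp n v v = Z" unfolding v_def[abs_def] Z_def by (rule comb[OF on(1)])
  have vx: "dotp n v x = Z"
    unfolding v_def[abs_def] Z_def by (simp add: dotp_sum dotp_simps z_def dotp_commute[of n x] power2_eq_square)
  have "in_span n N y v"
  proof (rule in_span_trans)
    show "in_span n N (gs n y N) v" unfolding in_span_def v_def by blast
  qed (rule gs_span(2))
  then obtain b where b: "\<And>l. l < n \<Longrightarrow> v l = (\<Sum>k<N. b k * y k l)" unfolding in_span_def by blast
  define v0 where "v0 l = (\<Sum>k<N. b k * g k l)" for l
  define a where "a = dotp n x v0"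
  define h where "h = dotp n v0 v0"
  have yg: "y k l = g k l + c * dotp n x (g k) * x l" if kl: "k < N" "l < n" for k l
  proof -
    have "y k l = (\<Sum>j<n. (id_mat l j + c * x l * x j) * g k j)"
      using kl N by (simp add: y_def partial_rows_def g_def A)
    also have "\<dots> = (\<Sum>j<n. id_mat l j * g k j) + c * x l * (\<Sum>j<n. x j * g k j)"
      by (simp add: distrib_right sum.distrib sum_distrib_left mult.assoc)
    finally show ?thesis using kl by (simp add: id_mat_sum dotp_def)
  qed
  have v_v0: "v l = v0 l + c * a * x l" if l: "l < n" for l
  proof -
    have "v l = (\<Sum>k<N. b k * g k l + c * x l * (b k * dotp n x (g k)))"
      unfolding b[OF l] by (intro sum.cong refl) (simp add: yg l algebra_simps)
    also have "\<dots> = v0 l + c * x l * (\<Sum>k<N. b k * dotp n x (g k))"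
      by (simp add: v0_def sum.distrib sum_distrib_left)
    also have "(\<Sum>k<N. b k * dotp n x (g k)) = a"
      by (simp add: a_def v0_def[abs_def] dotp_sum dotp_simps)
    finally show ?thesis by simp
  qed
  have xx: "dotp n x x = s" by (simp add: s dotp_self)
  have "dotp n v x = dotp n (\<lambda>l. v0 l + c * a * x l) x" by (rule dotp_cong) (simp_all add: v_v0)
  also have "\<dots> = (1 + c * s) * a"
    by (simp only: dotp_simps xx) (simp add: a_def dotp_commute[of n v0 x] algebra_simps)
  finally have Za: "Z = (1 + c * s) * a" by (simp add: vx)
  have "dotp n v v = dotp n (\<lambda>l. v0 l + c * a * x l) (\<lambda>l. v0 l + c * a * x l)" by (rule dotp_cong) (simp_all add: v_v0)
  also have "\<dots> = h + 2 * c * a\<^sup>2 + c\<^sup>2 * a\<^sup>2 * s"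
    by (simp only: dotp_simps xx) (simp add: h_def a_def dotp_commute[of n v0 x] power2_eq_square algebra_simps)
  finally have Zh: "Z = h + 2 * c * a\<^sup>2 + c\<^sup>2 * a\<^sup>2 * s" by (simp add: vv)
  \<comment> \<open>In the orthonormal null frame \<open>a\<close> is the inner product of the
    coefficients of \<open>v0\<close> and of \<open>x\<close>, so Cauchy-Schwarz brings in the
    assumption \<open>p0\<close>.\<close>
  have ah: "a\<^sup>2 \<le> h * ((1 - \<rho>) * s)"
  proof -
    have "in_span n N (gs n g N) v0"
    proof (rule in_span_trans)
      show "in_span n N g v0" unfolding in_span_def v0_def by blast
    qed (rule gs_span(1))
    then obtain e where e: "\<And>l. l < n \<Longrightarrow> v0 l = (\<Sum>k<N. e k * gs n g N k l)" unfolding in_span_def by blast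
    have "h = dotp n (\<lambda>l. \<Sum>k<N. e k * gs n g N k l) (\<lambda>l. \<Sum>k<N. e k * gs n g N k l)"
      unfolding h_def by (rule dotp_cong) (simp_all add: e)
    also have "\<dots> = (\<Sum>k<N. (e k)\<^sup>2)" by (rule comb[OF on(2)])
    finally have h: "h = dotp N e e" by (simp add: dotp_self)
    have "a = dotp n x (\<lambda>l. \<Sum>k<N. e k * gs n g N k l)"
      unfolding a_def by (rule dotp_cong) (simp_all add: e)
    also have "\<dots> = (\<Sum>k<N. e k * z0 k)" by (simp add: dotp_sum dotp_simps z0_def)
    finally have "a\<^sup>2 \<le> h * (\<Sum>k<N. (z0 k)\<^sup>2)"
      using dotp_Cauchy_Schwarz[of N e z0] by (simp add: dotp_def h power2_eq_square)
    also have "\<dots> \<le> h * ((1 - \<rho>) * s)"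
      using p0 by (intro mult_left_mono) (simp_all add: zz h_def dotp_self_nonneg)
    finally show ?thesis .
  qed
  have h0: "0 \<le> h" "0 \<le> s" "0 \<le> Z" by (simp_all add: h_def dotp_self_nonneg s Z_def sum_nonneg)
  \<comment> \<open>From \<open>Zh\<close>, \<open>s * Z\<close> is \<open>s * h - a\<^sup>2\<close>
    plus \<open>(1 + c * s)\<^sup>2 * a\<^sup>2\<close>, and the first part is at least
    \<open>\<rho> * a\<^sup>2\<close>. Since \<open>(1 + c * s)\<^sup>2 * a\<^sup>2\<close> is the
    square of \<open>Z\<close>, multiplying through leaves a factor \<open>Z\<close> to divide
    by.\<close>
  have "(1 + c * s)\<^sup>2 * (s * Z) = (1 + c * s)\<^sup>2 * (s * h - a\<^sup>2) + (1 + c * s)\<^sup>2 * ((1 + c * s)\<^sup>2 * a\<^sup>2)"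
    unfolding Zh by (simp add: algebra_simps power2_eq_square)
  also have "\<dots> \<ge> (1 + c * s)\<^sup>2 * (\<rho> * a\<^sup>2)"
  proof -
    have "a\<^sup>2 \<le> s * h - \<rho> * (s * h)" using ah by (simp add: algebra_simps)
    moreover have "\<rho> * a\<^sup>2 \<le> \<rho> * (s * h)"
    proof -
      have "0 \<le> \<rho> * (s * h)" using \<rho> h0 by simp
      then have "a\<^sup>2 \<le> s * h" using \<open>a\<^sup>2 \<le> s * h - \<rho> * (s * h)\<close> by simp
      then show ?thesis using \<rho> by (intro mult_left_mono)
    qed
    ultimately have "(1 + c * s)\<^sup>2 * (\<rho> * a\<^sup>2) \<le> (1 + c * s)\<^sup>2 * (s * h - a\<^sup>2)"
      by (intro mult_left_mono) auto
    moreover have "0 \<le> (1 + c * s)\<^sup>2 * ((1 + c * s)\<^sup>2 * a\<^sup>2)" by simp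
    ultimately show ?thesis by linarith
  qed
  finally have "\<rho> * Z * Z \<le> ((1 + c * s)\<^sup>2 * s) * Z"
    by (simp add: Za power2_eq_square mult_ac)
  then have "\<rho> * Z \<le> (1 + c * s)\<^sup>2 * s"
  proof (cases "Z = 0")
    case False
    then have "0 < Z" using h0 by simp
    then show ?thesis using \<open>\<rho> * Z * Z \<le> ((1 + c * s)\<^sup>2 * s) * Z\<close> by (simp add: mult_le_cancel_right)
  qed (use h0 in simp)
  then show ?thesis by (simp add: Z_def zz)
qed

lemma AE_orthm_gs_mat: "AE G in gauss (sq n). orthm n (gs_mat n G)"
  by (rule AE_distrD[OF measurable_gs_mat AE_haar_orthm[unfolded haar_def]])

text \<open>The root is injective: if \<open>u\<close> plus \<open>c\<close> times its inner product
  with \<open>x\<close> times \<open>x\<close> vanishes, pairing with \<open>x\<close> and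
  \<open>nz\<close> force that inner product, hence \<open>u\<close>, to be 0. So the transformed
  rows are again almost surely independent.\<close>

lemma AE_orthm_partial_rows:
  assumes A: "\<And>i j. i < n \<Longrightarrow> j < n \<Longrightarrow> A i j = id_mat i j + c * x i * x j"
    and nz: "1 + c * (\<Sum>i<n. (x i)\<^sup>2) \<noteq> 0"
  shows "AE G in gauss (sq n). orthm n (gs_mat n (partial_rows A G))"
proof -
  define B where "B k l i = (if k < N then A l i else id_mat l i)" for k l i :: nat
  have B: "\<exists>i<n. (\<Sum>l<n. u l * B k l i) \<noteq> 0" if u: "dotp n u u \<noteq> 0" for k and u :: "nat \<Rightarrow> real"
  proof (rule ccontr)
    assume "\<not> ?thesis"
    then have z: "(\<Sum>l<n. u l * B k l i) = 0" if "i < n" for i using that by blast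
    have "u i = 0" if i: "i < n" for i
    proof (cases "k < N")
      case False
      then show ?thesis using z[OF i] id_mat_sum(2)[OF i, of u] by (simp add: B_def)
    next
      case True
      have e: "u i + c * dotp n u x * x i = 0" if i: "i < n" for i
      proof -
        have "(\<Sum>l<n. u l * B k l i) = (\<Sum>l<n. u l * id_mat l i + c * (u l * x l) * x i)"
          using True i by (intro sum.cong refl) (simp add: B_def A algebra_simps)
        also have "\<dots> = u i + c * dotp n u x * x i"
          unfolding sum.distrib id_mat_sum(2)[OF i] by (simp add: dotp_def sum_distrib_left sum_distrib_right)
        finally show ?thesis using z[OF i] by simp
      qed
      have "dotp n (\<lambda>i. u i + c * dotp n u x * x i) x = dotp n (\<lambda>_. 0) x" by (rule dotp_cong) (simp_all add: e)
      then have "dotp n u x * (1 + c * dotp n x x) = 0"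
        by (simp only: dotp_simps) (simp add: dotp_def algebra_simps)
      then have "dotp n u x = 0" using nz by (simp add: dotp_self)
      then show ?thesis using e[OF i] by simp
    qed
    then show False using u by (simp add: dotp_self_eq_0)
  qed
  have rm: "row_map n B G = (\<lambda>k i. if k < n \<and> i < n then partial_rows A G (k, i) else 0)" for G
    by (auto simp: fun_eq_iff row_map_def B_def partial_rows_def id_mat_sum)
  from AE_gs_nonzero[of n B] B have "AE G in gauss (sq n). \<forall>k<n. dotp n (gs n (row_map n B G) n k) (gs n (row_map n B G) n k) \<noteq> 0"
    by blast
  then show ?thesis
  proof (rule AE_mp, intro AE_I2 impI)
    fix G assume "\<forall>k<n. dotp n (gs n (row_map n B G) n k) (gs n (row_map n B G) n k) \<noteq> 0"
    then have "ortho {..<n} (\<lambda>i k. gs n (row_map n B G) n k i)" by (intro gs_orthonormal) simp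
    then show "orthm n (gs_mat n (partial_rows A G))"
      unfolding rm by (simp add: orthm_def ortho_def gs_mat_def)
  qed
qed

text \<open>By the invariance of the Haar measure \<open>x\<close> may be replaced by a multiple of a basis vector and the first
  \<open>N\<close> columns by entries of the first column, which is a normalised Gaussian vector.\<close>

lemma spike_projection:
  fixes x :: "nat \<Rightarrow> real"
  assumes n: "0 < n" and d: "0 < d" and s: "0 < s" "s = (\<Sum>i<n. (x i)\<^sup>2)"
  defines "E \<equiv> {G \<in> space (gauss (sq n)). (1 - real d / (2 * real n)) * s < (\<Sum>k<N. (\<Sum>i<n. x i * gs_mat n G (i, k))\<^sup>2)}"
  shows "E \<in> sets (gauss (sq n))" "emeasure (gauss (sq n)) E \<le> ennreal (32 / real d + 8 / real n)"
proof -
  define \<rho> where "\<rho> = real d / (2 * real n)"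
  have \<rho>: "\<rho> < 1" using n by (simp add: \<rho>_def field_simps)
  define H where "H Q = (\<Sum>k<N. (\<Sum>i<n. x i * Q (i, k))\<^sup>2)" for Q :: "nat \<times> nat \<Rightarrow> real"
  have H: "H \<in> borel_measurable (mat_space n)"
    unfolding H_def
    by (intro borel_measurable_sum borel_measurable_power borel_measurable_times borel_measurable_const measurable_mat_component)
      (use N in auto)
  define F where "F Q = (indicator {(1 - \<rho>) * s<..} (H Q) :: ennreal)" for Q
  have F: "F \<in> borel_measurable (mat_space n)"
    unfolding F_def by (rule measurable_compose[OF H]) simp
  have HG: "(\<lambda>G. H (gs_mat n G)) \<in> borel_measurable (gauss (sq n))"
    by (rule measurable_compose[OF measurable_gs_mat H])
  have Eeq: "E = {G \<in> space (gauss (sq n)). (1 - \<rho>) * s < H (gs_mat n G)}"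
    by (simp add: E_def H_def \<rho>_def)
  show E: "E \<in> sets (gauss (sq n))"
    unfolding Eeq using HG by measurable
  \<comment> \<open>The Householder reflection from coordinate 0 takes \<open>x\<close> to
    \<open>sqrt s\<close> times the first basis vector.\<close>
  from householder[OF n, of x] obtain C where C: "orthm n C"
    and Cx: "\<And>i. i < n \<Longrightarrow> (\<Sum>l<n. x l * C (i, l)) = (if i = 0 then sqrt s else 0)"
    by (auto simp: atLeast0LessThan s)
  have HC: "H (transp n (mm n Q C)) = s * (\<Sum>k<N. (Q (k, 0))\<^sup>2)" for Q
  proof -
    have "(\<Sum>i<n. x i * transp n (mm n Q C) (i, k)) = sqrt s * Q (k, 0)" if k: "k < N" for k
    proof -
      have "(\<Sum>i<n. x i * transp n (mm n Q C) (i, k)) = (\<Sum>i<n. \<Sum>j<n. Q (k, j) * (x i * C (j, i)))"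
        using k N by (intro sum.cong refl) (simp add: transp_def mm_def sum_distrib_left algebra_simps)
      also have "\<dots> = (\<Sum>j<n. \<Sum>i<n. Q (k, j) * (x i * C (j, i)))" by (rule sum.swap)
      also have "\<dots> = (\<Sum>j<n. if j = 0 then Q (k, j) * sqrt s else 0)"
        unfolding sum_distrib_left[symmetric] by (intro sum.cong refl) (simp add: Cx)
      finally show ?thesis using n by simp
    qed
    then show ?thesis using s by (simp add: H_def power_mult_distrib sum_distrib_left)
  qed
  have FQ: "F (transp n (mm n Q C)) = indicator {1 - \<rho><..} (\<Sum>k<N. (Q (k, 0))\<^sup>2)" for Q
    unfolding F_def HC using s by (simp add: indicator_def mult.commute)
  \<comment> \<open>The first Gram-Schmidt vector is the first Gaussian row divided by its norm,
    with no elimination before it.\<close>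
  have col: "gs_mat n G (k, 0) = G (0, k) / sqrt (\<Sum>i<n. (G (0, i))\<^sup>2)" if k: "k < n" for G k
  proof -
    let ?M = "\<lambda>k i. if k < n \<and> i < n then G (k, i) else 0"
    have "gs_mat n G (k, 0) = gs n ?M (Suc 0) 0 k"
      using k n gs_stable[of 0 "Suc 0" n n ?M] by (simp add: gs_mat_def)
    also have "\<dots> = G (0, k) / sqrt (dotp n (?M 0) (?M 0))"
      using k n by (simp add: gs_norm_def)
    also have "dotp n (?M 0) (?M 0) = (\<Sum>i<n. (G (0, i))\<^sup>2)"
      unfolding dotp_self using n by (intro sum.cong) auto
    finally show ?thesis .
  qed
  define J1 J2 where "J1 = Pair (0::nat) ` {N..<n}" and "J2 = Pair (0::nat) ` {..<n}"
  have J: "J1 \<subseteq> sq n" "J2 \<subseteq> sq n" using n by (auto simp: J1_def J2_def)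
  have cJ: "card J1 = d" "card J2 = n"
  proof -
    have inj: "inj_on (Pair (0::nat)) A" for A :: "nat set" by (rule inj_onI) simp
    show "card J1 = d" "card J2 = n" using card_image[OF inj, of "{N..<n}"] card_image[OF inj, of "{..<n}"]
      by (simp_all add: J1_def J2_def)
  qed
  have sJ: "(\<Sum>j\<in>J1. (G j)\<^sup>2) = (\<Sum>i\<in>{N..<n}. (G (0, i))\<^sup>2)" "(\<Sum>j\<in>J2. (G j)\<^sup>2) = (\<Sum>i<n. (G (0, i))\<^sup>2)" for G :: "nat \<times> nat \<Rightarrow> real"
    by (simp_all add: J1_def J2_def sum.reindex inj_on_def)
  \<comment> \<open>Outside \<open>E1\<close> and \<open>E2\<close> the last \<open>d\<close>
    squares sum to more than \<open>3 * d / 4\<close> and all of them to less than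
    \<open>3 * n / 2\<close>, so the tail has a share above \<open>d / (2 * n)\<close>, which is
    \<open>\<rho>\<close>. Chebyshev gives the bounds \<open>32 / d\<close> and
    \<open>8 / n\<close>.\<close>
  define E1 where "E1 = {G \<in> space (gauss (sq n)). real d / 4 \<le> \<bar>(\<Sum>j\<in>J1. (G j)\<^sup>2) - real (card J1)\<bar>}"
  define E2 where "E2 = {G \<in> space (gauss (sq n)). real n / 2 \<le> \<bar>(\<Sum>j\<in>J2. (G j)\<^sup>2) - real (card J2)\<bar>}"
  have sm: "(\<lambda>G. \<bar>(\<Sum>j\<in>J. (G j)\<^sup>2) - c\<bar>) \<in> borel_measurable (gauss (sq n))" if "J \<subseteq> sq n" for J and c :: real
    by (intro borel_measurable_abs borel_measurable_diff borel_measurable_sum borel_measurable_power borel_measurable_const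
        measurable_gauss_component) (use that in auto)
  have E12: "E1 \<in> sets (gauss (sq n))" "E2 \<in> sets (gauss (sq n))"
    unfolding E1_def E2_def
    by (rule borel_measurable_le[OF borel_measurable_const sm[OF J(1)]], rule borel_measurable_le[OF borel_measurable_const sm[OF J(2)]])
  have fin: "finite (sq n)" by simp
  have ar: "2 * a / (a / 4)\<^sup>2 = 32 / a" "2 * a / (a / 2)\<^sup>2 = 8 / a" if "0 < a" for a :: real
    using that by (simp_all add: power2_eq_square field_simps)
  have dn: "0 < real d" "0 < real n" "0 < real d / 4" "0 < real n / 2" using d n by simp_all
  have m1: "measure (gauss (sq n)) E1 \<le> 32 / real d"
    unfolding E1_def ar(1)[OF dn(1), symmetric] using gauss_chi_tail[OF fin J(1) dn(3)] unfolding cJ .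
  have m2: "measure (gauss (sq n)) E2 \<le> 8 / real n"
    unfolding E2_def ar(2)[OF dn(2), symmetric] using gauss_chi_tail[OF fin J(2) dn(4)] unfolding cJ .
  have sub: "(indicator {1 - \<rho><..} (\<Sum>k<N. (gs_mat n G (k, 0))\<^sup>2) :: ennreal) \<le> indicator (E1 \<union> E2) G"
    if G: "G \<in> space (gauss (sq n))" for G
  proof (rule ccontr)
    assume not: "\<not> ?thesis"
    define S where "S = (\<Sum>i<n. (G (0, i))\<^sup>2)"
    define S1 where "S1 = (\<Sum>i\<in>{N..<n}. (G (0, i))\<^sup>2)"
    define S0 where "S0 = (\<Sum>i<N. (G (0, i))\<^sup>2)"
    have nE: "G \<notin> E1" "G \<notin> E2" and gt: "1 - \<rho> < (\<Sum>k<N. (gs_mat n G (k, 0))\<^sup>2)"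
      using not by (auto simp: indicator_def split: if_splits)
    have S: "S = S0 + S1"
      unfolding S_def S1_def S0_def using sum.atLeastLessThan_concat[of 0 N n "\<lambda>i. (G (0, i))\<^sup>2"] N
      by (simp add: atLeast0LessThan)
    have "\<bar>S1 - d\<bar> < d / 4" using nE(1) G by (auto simp: E1_def cJ sJ S1_def)
    then have S1: "3 * d / 4 < S1" by linarith
    have "\<bar>S - n\<bar> < n / 2" using nE(2) G by (auto simp: E2_def cJ sJ S_def)
    then have S2: "S < 3 * n / 2" by linarith
    have S0: "0 \<le> S0" by (simp add: S0_def sum_nonneg)
    have Spos: "0 < S" using S S0 S1 d by linarith
    have "(\<Sum>k<N. (gs_mat n G (k, 0))\<^sup>2) = (\<Sum>k<N. (G (0, k))\<^sup>2 / S)"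
      using N Spos by (intro sum.cong refl) (simp add: col power_divide flip: S_def)
    then have "(1 - \<rho>) * S < S0" using gt Spos by (simp add: S0_def sum_divide_distrib[symmetric] less_divide_eq)
    moreover have "\<rho> * S \<le> \<rho> * (3 * n / 2)" using S2 by (intro mult_left_mono) (simp_all add: \<rho>_def)
    moreover have "\<rho> * (3 * n / 2) = 3 * d / 4" using n by (simp add: \<rho>_def)
    ultimately show False using S S1 by (simp add: algebra_simps)
  qed
  have "emeasure (gauss (sq n)) E = (\<integral>\<^sup>+G. indicator E G \<partial>gauss (sq n))" using E by simp
  also have "\<dots> = (\<integral>\<^sup>+G. F (gs_mat n G) \<partial>gauss (sq n))"
    by (rule nn_integral_cong) (simp add: Eeq F_def indicator_def)
  also have "\<dots> = (\<integral>\<^sup>+Q. F Q \<partial>haar n)"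
    unfolding haar_def by (rule nn_integral_distr[symmetric, OF measurable_gs_mat]) (simp only: measurable_distr_eq1 F)
  also have "\<dots> = (\<integral>\<^sup>+Q. F (transp n Q) \<partial>haar n)" by (rule nn_integral_haar_transp[OF F, symmetric])
  also have "\<dots> = (\<integral>\<^sup>+Q. F (transp n (mm n Q C)) \<partial>haar n)"
    by (rule nn_integral_haar_right[OF _ C, symmetric]) (intro measurable_compose[OF _ F] measurable_transp measurable_ident_sets refl)
  also have "\<dots> = (\<integral>\<^sup>+G. F (transp n (mm n (gs_mat n G) C)) \<partial>gauss (sq n))"
  proof -
    have "(\<lambda>Q. F (transp n (mm n Q C))) \<in> borel_measurable (mat_space n)"
    proof -
      have "(\<lambda>Q. mm n Q C) = (\<lambda>Q. mm n Q (\<lambda>p\<in>sq n. C p))" by (auto simp: mm_def fun_eq_iff)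
      moreover have "(\<lambda>Q. F (transp n (mm n Q (\<lambda>p\<in>sq n. C p)))) \<in> borel_measurable (mat_space n)"
        by (intro measurable_compose[OF _ F] measurable_transp measurable_mm measurable_ident_sets refl measurable_const)
          (simp add: space_mat_space)
      ultimately show ?thesis by metis
    qed
    then show ?thesis
      unfolding haar_def by (intro nn_integral_distr[OF measurable_gs_mat]) (simp only: measurable_distr_eq1)
  qed
  also have "\<dots> \<le> (\<integral>\<^sup>+G. indicator (E1 \<union> E2) G \<partial>gauss (sq n))"
    unfolding FQ by (rule nn_integral_mono) (rule sub)
  also have "\<dots> = emeasure (gauss (sq n)) (E1 \<union> E2)" using E12 by (intro nn_integral_indicator) auto
  also have "\<dots> \<le> emeasure (gauss (sq n)) E1 + emeasure (gauss (sq n)) E2" using E12 by (rule emeasure_subadditive)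
  also have "\<dots> \<le> ennreal (32 / real d) + ennreal (8 / real n)"
  proof -
    interpret G: prob_space "gauss (sq n)" by (rule prob_space_gauss)
    show ?thesis unfolding G.emeasure_eq_measure using m1 m2 by (intro add_mono ennreal_leI)
  qed
  finally show "emeasure (gauss (sq n)) E \<le> ennreal (32 / real d + 8 / real n)"
    by (simp add: ennreal_plus)
qed

end

lemma sym_mat_conj_by: "sym_mat n (conj_by n B (part n K \<xi>))"
  unfolding sym_mat_def by (intro allI impI conj_by_symmetric part_symmetric)

context windows
begin

text \<open>Error budget: \<open>\<kappa> / 4\<close> for the noise, \<open>\<kappa> / 4\<close> for
  the mass of the spike in the span of the samples, and the rest for the deviation of
  \<open>s\<close> from 1, the window losses and the weight \<open>t = \<kappa> / 32\<close>. The
  factor \<open>64 / \<kappa> + 4\<close> is \<open>2 / t + 2\<close> from the cross terms plus 2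
  for the mass missing in the main term.\<close>

lemma planted_form:
  fixes x :: "nat \<Rightarrow> real"
  assumes n: "0 < n" and d: "0 < d" and \<kappa>: "0 < \<kappa>" "\<kappa> \<le> 1"
    and dm: "real (d * m) / real n \<le> \<kappa> / 32" and mm: "2 / real m \<le> \<kappa> / 32"
    and s: "s = (\<Sum>i<n. (x i)\<^sup>2)" "\<bar>s - 1\<bar> \<le> \<kappa> / 32"
    and Q: "orthm n Q" and Z: "(64 / \<kappa> + 4) * (\<Sum>k<N. (\<Sum>i<n. x i * Q (i, k))\<^sup>2) \<le> \<kappa> / 4"
  shows "\<exists>E\<in>sets (gauss (ut n)). measure (gauss (ut n)) E \<le> 36 / (\<kappa> * sqrt n) \<and>
    (\<forall>\<xi>\<in>space (gauss (ut n)) - E. 2 - \<kappa> \<le> qform n (conj_by n (mm n Q refl_mat) (part n n \<xi>)) x)"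
proof -
  define z where "z l = (\<Sum>i<n. x i * Q (i, l))" for l
  define w where "w = reflect N m r d z"
  define Z' where "Z' = (\<Sum>k<N. (z k)\<^sup>2)"
  have zs: "(\<Sum>k<n. (z k)\<^sup>2) = s" unfolding z_def s(1) by (rule orthm_rows_norm[OF Q])
  have ws: "(\<Sum>k<n. (w k)\<^sup>2) = s" unfolding w_def reflect_norm[OF order_refl] by (rule zs)
  have Z0: "0 \<le> Z'" by (simp add: Z'_def sum_nonneg)
  have Z1: "(64 / \<kappa> + 4) * Z' \<le> \<kappa> / 4" using Z by (simp add: Z'_def z_def)
  have sb: "1 - \<kappa> / 32 \<le> s" "s \<le> 33 / 32" using s(2) \<kappa> by linarith+
  have \<eta>: "0 < \<kappa> / 4" using \<kappa> by simp
  from noise_bound[OF n \<eta>, of w] obtain E where E: "E \<in> sets (gauss (ut n))"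
    "measure (gauss (ut n)) E \<le> 9 * s / (2 * sqrt n * (\<kappa> / 4))"
    and E2: "\<And>\<xi>. \<xi> \<in> space (gauss (ut n)) - E \<Longrightarrow>
      2 * (\<Sum>k<n. if Suc k < n then drift k * (w k * w (Suc k)) else 0) - \<kappa> / 4 \<le> (\<Sum>k<n. \<Sum>l<n. part n n \<xi> (k, l) * (w k * w l))"
    unfolding ws by blast
  have "9 * s / (2 * sqrt n * (\<kappa> / 4)) = 18 * s / (\<kappa> * sqrt n)" using \<kappa> by (simp add: field_simps)
  also have "\<dots> \<le> 36 / (\<kappa> * sqrt n)" using sb \<kappa> by (intro divide_right_mono) auto
  finally have mE: "measure (gauss (ut n)) E \<le> 36 / (\<kappa> * sqrt n)" using E(2) by simp
  define e where "e = real (d * m) / real n + 2 / real m"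
  have e: "0 \<le> e" "e \<le> \<kappa> / 16"
    unfolding e_def using dm mm by (simp, linarith)
  have low: "2 - \<kappa> \<le> 2 * (\<Sum>k<n. if Suc k < n then drift k * (w k * w (Suc k)) else 0) - \<kappa> / 4"
  proof -
    have t: "0 < \<kappa> / 32" using \<kappa> by simp
    define D where "D = (\<Sum>k<n. if Suc k < n then drift k * (w k * w (Suc k)) else 0)"
    define U where "U = (s - Z') * (1 - e)"
    define V where "V = (2 / (\<kappa> / 32) + 2) * Z'"
    define P where "P = \<kappa> * s"
    have "2 * (s - Z') * (1 - e) - 2 * (\<kappa> / 32) * s - (2 / (\<kappa> / 32) + 2) * Z' \<le> 2 * D"
      using drift_form_lower[OF t, of z] unfolding zs Z'_def[symmetric] w_def[symmetric] e_def D_def by (simp only: diff_diff_eq)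
    moreover have "2 * U - P / 16 - V = 2 * (s - Z') * (1 - e) - 2 * (\<kappa> / 32) * s - (2 / (\<kappa> / 32) + 2) * Z'"
      by (simp add: U_def V_def P_def algebra_simps)
    ultimately have 1: "2 * U - P / 16 - V \<le> 2 * D" by (simp only:)
    have 2: "s - P / 16 - Z' \<le> U"
    proof -
      have "s * e \<le> s * (\<kappa> / 16)" using e sb \<kappa> by (intro mult_left_mono) auto
      moreover have "0 \<le> e * Z'" using e Z0 by simp
      ultimately show ?thesis by (simp add: U_def P_def algebra_simps)
    qed
    have "(64 / \<kappa> + 4) * Z' = V + 2 * Z'" by (simp add: V_def algebra_simps)
    then have 3: "V + 2 * Z' \<le> \<kappa> / 4" using Z1 by simp
    have "\<kappa> * s \<le> \<kappa> * (33 / 32)" using sb \<kappa> by (intro mult_left_mono) auto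
    then have 4: "P \<le> 33 / 32 * \<kappa>" by (simp add: P_def)
    show ?thesis unfolding D_def[symmetric] using 1 2 3 4 sb(1) \<kappa> by linarith
  qed
  have "2 - \<kappa> \<le> qform n (conj_by n (mm n Q refl_mat) (part n n \<xi>)) x" if "\<xi> \<in> space (gauss (ut n)) - E" for \<xi>
    unfolding qform_conj z_def[symmetric] w_def[symmetric] using E2[OF that] low by linarith
  then show ?thesis using E(1) mE by blast
qed

text \<open>For a fixed spike two things can go wrong: the null frame captures too much of
  \<open>x\<close>, or the tridiagonal matrix deviates. Otherwise the form at \<open>x\<close> is at
  least \<open>2 - \<kappa>\<close>, and \<open>bad\<close> applies to that fixed matrix, because
  the tape of the certificate is integrated separately from the variables that produce the
  matrix.\<close>

theorem planted_bad:
  fixes x :: "nat \<Rightarrow> real"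
  assumes n: "0 < n" and d: "0 < d" and \<kappa>: "0 < \<kappa>" "\<kappa> \<le> 1"
    and dm: "real (d * m) / real n \<le> \<kappa> / 32" and mm: "2 / real m \<le> \<kappa> / 32"
    and s: "s = (\<Sum>i<n. (x i)\<^sup>2)" "\<bar>s - 1\<bar> \<le> \<kappa> / 32" and \<tau>: "0 < 1 + \<beta> * s"
    and small: "(64 / \<kappa> + 4) * (2 * real n / real d) * ((1 + \<beta> * s) * s) \<le> \<kappa> / 4"
    and Bad: "Bad \<in> sets (mat_space n \<Otimes>\<^sub>M coins)"
    and bad: "\<And>W. W \<in> space (mat_space n) \<Longrightarrow> sym_mat n W \<Longrightarrow> 2 - \<kappa> \<le> qform n W x \<Longrightarrow> AE \<omega> in coins. (W, \<omega>) \<notin> Bad"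
  shows "(\<integral>\<^sup>+Y. \<integral>\<^sup>+\<omega>. indicator Bad (reduction n N m r Y \<omega>, \<lambda>i. \<omega> (i + 2 * (n * n))) \<partial>coins
      \<partial>(\<Pi>\<^sub>M k\<in>{..<N}. gaussian_vec n (planted_cov n \<beta> x))) \<le> ennreal (32 / real d + 8 / real n + 36 / (\<kappa> * sqrt n))"
proof -
  interpret C: prob_space coins by (rule prob_space_coins)
  interpret U: prob_space "gauss (ut n)" by (rule prob_space_gauss)
  interpret G: prob_space "gauss (sq n)" by (rule prob_space_gauss)
  define c where "c = root_coef n \<beta> x"
  define A where "A = planted_root n \<beta> x"
  have s0: "0 < s" using s(2) \<kappa> by linarith
  have c: "c = (sqrt (1 + \<beta> * s) - 1) / s" using \<tau> by (simp add: c_def root_coef_def s(1))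
  have cs: "1 + c * s = sqrt (1 + \<beta> * s)" using s0 by (simp add: c)
  have A: "A i j = id_mat i j + c * x i * x j" for i j by (simp add: A_def planted_root_def c_def)
  define \<rho> where "\<rho> = real d / (2 * real n)"
  have \<rho>: "0 < \<rho>" using n d by (simp add: \<rho>_def)
  define E1 where "E1 = {G \<in> space (gauss (sq n)). (1 - \<rho>) * s < (\<Sum>k<N. (\<Sum>i<n. x i * gs_mat n G (i, k))\<^sup>2)}"
  have E1: "E1 \<in> sets (gauss (sq n))" "emeasure (gauss (sq n)) E1 \<le> ennreal (32 / real d + 8 / real n)"
    unfolding E1_def \<rho>_def by (rule spike_projection[OF n d s0 s(1)])+
  define W where "W G \<xi> = conj_by n (mm n (gs_mat n (partial_rows A G)) refl_mat) (part n n \<xi>)" for G \<xi>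
  define R where "R = ennreal (36 / (\<kappa> * sqrt n))"
  have le1: "(\<integral>\<^sup>+\<omega>. indicator Bad (V, \<omega>) \<partial>coins) \<le> 1" for V
  proof -
    have "(\<integral>\<^sup>+\<omega>. indicator Bad (V, \<omega>) \<partial>coins) \<le> (\<integral>\<^sup>+\<omega>. 1 \<partial>coins)"
      by (rule nn_integral_mono) (simp add: indicator_def)
    then show ?thesis by (simp add: C.emeasure_space_1[unfolded space_coins])
  qed
  have inner: "(\<integral>\<^sup>+\<xi>. \<integral>\<^sup>+\<omega>. indicator Bad (W G \<xi>, \<omega>) \<partial>coins \<partial>gauss (ut n)) \<le> indicator E1 G + R"
    if G: "G \<in> space (gauss (sq n))" and Q: "orthm n (gs_mat n (partial_rows A G))" and Q0: "orthm n (gs_mat n G)" for G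
  proof (cases "G \<in> E1")
    case True
    have "(\<integral>\<^sup>+\<xi>. \<integral>\<^sup>+\<omega>. indicator Bad (W G \<xi>, \<omega>) \<partial>coins \<partial>gauss (ut n)) \<le> (\<integral>\<^sup>+\<xi>. 1 \<partial>gauss (ut n))"
      by (rule nn_integral_mono) (rule le1)
    also have "\<dots> = 1" by (simp add: U.emeasure_space_1)
    also have "\<dots> \<le> indicator E1 G + R" using True by simp
    finally show ?thesis .
  next
    case False
    define Z where "Z = (\<Sum>k<N. (\<Sum>i<n. x i * gs_mat n (partial_rows A G) (i, k))\<^sup>2)"
    have "\<rho> * Z \<le> (1 + c * s)\<^sup>2 * s"
      unfolding Z_def using False G \<rho>
      by (intro projection_bound[OF Q Q0 A s(1)]) (auto simp: E1_def)
    then have "\<rho> * Z \<le> (1 + \<beta> * s) * s" using \<tau> by (simp add: cs)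
    then have "Z \<le> ((1 + \<beta> * s) * s) / \<rho>" using \<rho> by (simp add: le_divide_eq mult.commute)
    \<comment> \<open>Dividing by \<open>\<rho>\<close> costs the factor \<open>2 * n / d\<close>;
      smallness of \<open>1 + \<beta> * s\<close> has to compensate for it.\<close>
    also have "\<dots> = (2 * real n / real d) * ((1 + \<beta> * s) * s)" using n d by (simp add: \<rho>_def)
    finally have "(64 / \<kappa> + 4) * Z \<le> (64 / \<kappa> + 4) * ((2 * real n / real d) * ((1 + \<beta> * s) * s))"
      using \<kappa> by (intro mult_left_mono) auto
    also have "\<dots> \<le> \<kappa> / 4" using small by (simp only: mult.assoc)
    finally obtain E where E: "E \<in> sets (gauss (ut n))" "measure (gauss (ut n)) E \<le> 36 / (\<kappa> * sqrt n)"
      and low: "\<And>\<xi>. \<xi> \<in> space (gauss (ut n)) - E \<Longrightarrow> 2 - \<kappa> \<le> qform n (W G \<xi>) x"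
      unfolding W_def using planted_form[OF n d \<kappa> dm mm s Q] unfolding Z_def by blast
    have "(\<integral>\<^sup>+\<omega>. indicator Bad (W G \<xi>, \<omega>) \<partial>coins) \<le> indicator E \<xi>" if \<xi>: "\<xi> \<in> space (gauss (ut n))" for \<xi>
    proof (cases "\<xi> \<in> E")
      case True
      then show ?thesis using le1 by simp
    next
      case False
      have "W G \<xi> \<in> space (mat_space n)" by (simp add: W_def space_mat_space conj_by_def)
      moreover have "sym_mat n (W G \<xi>)" unfolding W_def by (rule sym_mat_conj_by)
      ultimately have "AE \<omega> in coins. (W G \<xi>, \<omega>) \<notin> Bad"
        by (rule bad) (rule low, use False \<xi> in blast)
      then have "(\<integral>\<^sup>+\<omega>. indicator Bad (W G \<xi>, \<omega>) \<partial>coins) = (\<integral>\<^sup>+\<omega>. 0 \<partial>coins)"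
        by (intro nn_integral_cong_AE) (auto elim!: eventually_mono)
      then show ?thesis by simp
    qed
    then have "(\<integral>\<^sup>+\<xi>. \<integral>\<^sup>+\<omega>. indicator Bad (W G \<xi>, \<omega>) \<partial>coins \<partial>gauss (ut n)) \<le> (\<integral>\<^sup>+\<xi>. indicator E \<xi> \<partial>gauss (ut n))"
      by (intro nn_integral_mono)
    also have "\<dots> = ennreal (measure (gauss (ut n)) E)" using E(1) by (simp add: U.emeasure_eq_measure)
    also have "\<dots> \<le> R" unfolding R_def by (rule ennreal_leI[OF E(2)])
    finally show ?thesis by (rule order_trans) simp
  qed
  have iB: "indicator Bad \<in> borel_measurable (mat_space n \<Otimes>\<^sub>M coins)" using Bad by (rule borel_measurable_indicator)
  have "(\<integral>\<^sup>+Y. \<integral>\<^sup>+\<omega>. indicator Bad (reduction n N m r Y \<omega>, \<lambda>i. \<omega> (i + 2 * (n * n))) \<partial>coins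
      \<partial>(\<Pi>\<^sub>M k\<in>{..<N}. gaussian_vec n (planted_cov n \<beta> x))) =
    (\<integral>\<^sup>+G. \<integral>\<^sup>+\<xi>. \<integral>\<^sup>+\<omega>. indicator Bad (W G \<xi>, \<omega>) \<partial>coins \<partial>gauss (ut n) \<partial>gauss (sq n))"
    unfolding nn_integral_reduction[OF is_root_planted iB] W_def A_def ..
  also have "\<dots> \<le> (\<integral>\<^sup>+G. indicator E1 G + R \<partial>gauss (sq n))"
  proof (rule nn_integral_mono_AE)
    have "1 + c * (\<Sum>i<n. (x i)\<^sup>2) \<noteq> 0" using cs \<tau> by (simp add: s(1)[symmetric])
    from AE_orthm_partial_rows[of A, OF A this] AE_orthm_gs_mat AE_space[of "gauss (sq n)"]
    show "AE G in gauss (sq n). (\<integral>\<^sup>+\<xi>. \<integral>\<^sup>+\<omega>. indicator Bad (W G \<xi>, \<omega>) \<partial>coins \<partial>gauss (ut n)) \<le> indicator E1 G + R"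
      by eventually_elim (rule inner)
  qed
  also have "\<dots> = emeasure (gauss (sq n)) E1 + R"
  proof -
    have "(\<integral>\<^sup>+G. indicator E1 G + R \<partial>gauss (sq n)) = (\<integral>\<^sup>+G. indicator E1 G \<partial>gauss (sq n)) + (\<integral>\<^sup>+G. R \<partial>gauss (sq n))"
      by (rule nn_integral_add[OF borel_measurable_indicator[OF E1(1)] borel_measurable_const])
    also have "(\<integral>\<^sup>+G. indicator E1 G \<partial>gauss (sq n)) = emeasure (gauss (sq n)) E1"
      by (rule nn_integral_indicator[OF E1(1)])
    also have "(\<integral>\<^sup>+G. R \<partial>gauss (sq n)) = R * 1"
      unfolding G.emeasure_space_1[symmetric] by (rule nn_integral_const)
    finally show ?thesis by (simp only: mult_1_right)
  qed
  also have "\<dots> \<le> ennreal (32 / real d + 8 / real n) + R" using E1(2) by (rule add_right_mono)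
  also have "\<dots> = ennreal (32 / real d + 8 / real n + 36 / (\<kappa> * sqrt n))"
    unfolding R_def using \<kappa> by (subst ennreal_plus[symmetric]) auto
  finally show ?thesis .
qed

end

section \<open>The planted law as a kernel\<close>

lemma sets_PiM_gaussian_vec:
  fixes K :: nat
  shows "sets (\<Pi>\<^sub>M k\<in>{..<K}. gaussian_vec n C) = sets (samples n K)"
  unfolding samples_def by (intro sets_PiM_cong refl) (simp add: gaussian_vec_def)

lemma measurable_vec_entry:
  assumes "sets M = sets (vec_space n)" "i < n"
  shows "(\<lambda>x. x i) \<in> borel_measurable M"
  unfolding measurable_cong_sets[OF assms(1) refl] vec_space_def
  by (rule measurable_component_singleton) (use assms(2) in simp)

lemma measurable_sum_squares:
  assumes M: "sets M = sets (vec_space n)"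
  shows "(\<lambda>x. \<Sum>i<n. (x i)\<^sup>2) \<in> borel_measurable M"
  by (intro borel_measurable_sum borel_measurable_power measurable_vec_entry[OF M]) (simp only: lessThan_iff)

lemma measurable_planted_root:
  assumes M: "sets M = sets (vec_space n)" and ij: "i < n" "j < n"
  shows "(\<lambda>x. planted_root n \<beta> x i j) \<in> borel_measurable M"
proof -
  have "(\<lambda>s::real. if \<beta> * s \<ge> -1 then (sqrt (1 + \<beta> * s) - 1) / s else 0) \<in> borel_measurable borel"
    by measurable
  from measurable_compose[OF measurable_sum_squares[OF M] this] have "root_coef n \<beta> \<in> borel_measurable M"
    unfolding root_coef_def[abs_def] .
  then show ?thesis
    unfolding planted_root_def
    by (intro borel_measurable_add borel_measurable_times borel_measurable_const measurable_vec_entry[OF M] ij)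
qed

text \<open>The Hilbert choice in the covariance law gives no control over its dependence on the
  spike; the explicit root is measurable in \<open>x\<close> and makes the mixture over the prior a
  proper composition of kernels.\<close>

lemma measurable_planted_kernel:
  assumes M: "sets M = sets (vec_space n)"
  shows "(\<lambda>x. \<Pi>\<^sub>M k\<in>{..<K}. gaussian_vec n (planted_cov n \<beta> x)) \<in> measurable M (subprob_algebra (samples n K))"
proof -
  let ?I = "{..<K} \<times> {..<n}"
  have g: "(\<lambda>x. gauss ?I) \<in> measurable M (subprob_algebra (gauss ?I))"
    by (rule measurable_const)
      (simp add: space_subprob_algebra prob_space_imp_subprob_space prob_space_gauss)
  have "(\<lambda>(x, g). rows_map n K (planted_root n \<beta> x) g) \<in> measurable (M \<Otimes>\<^sub>M gauss ?I) (samples n K)"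
    by (rule measurable_rows_map2[OF measurable_planted_root[OF M]])
  from measurable_distr2[OF this g] show ?thesis
    unfolding samples_law[OF is_root_planted] .
qed

lemma prob_space_planted_kernel:
  fixes K :: nat
  shows "prob_space (\<Pi>\<^sub>M k\<in>{..<K}. gaussian_vec n (planted_cov n \<beta> x))"
  unfolding samples_law[OF is_root_planted]
  by (intro prob_space.prob_space_distr prob_space_gauss measurable_rows_map)

text \<open>Here \<open>n\<close> divided by the aspect ratio is \<open>n - n / M\<close>, so
  rounding up leaves exactly \<open>n div M\<close> dimensions without a sample.\<close>

lemma num_samples_eq:
  assumes M: "2 \<le> M"
  shows "num_samples (real M / (real M - 1)) n = n - n div M"
proof -
  have "real n / (real M / (real M - 1)) = real n - real n / real M"
    using M by (simp add: field_simps)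
  moreover have "\<lceil>real n - real n / real M\<rceil> = int n - \<lfloor>real n / real M\<rfloor>"
    using ceiling_diff_of_int ceiling_def[of "real n - real n / real M"] floor_diff_of_int[of "real n / real M" "int n"] by simp
  moreover have "\<lfloor>real n / real M\<rfloor> = int (n div M)" by (rule floor_divide_of_nat_eq)
  ultimately show ?thesis by (simp add: num_samples_def nat_diff_distrib)
qed

lemma (in windows) emeasure_reduction:
  assumes P: "sets P = sets (samples n N)" and B: "B \<in> sets (mat_space n \<Otimes>\<^sub>M coins)"
  defines "red \<equiv> \<lambda>z. (reduction n N m r (fst z) (snd z), \<lambda>i. snd z (i + 2 * (n * n)))"
  shows "red \<in> measurable (P \<Otimes>\<^sub>M coins) (mat_space n \<Otimes>\<^sub>M coins)"
    "red -` B \<inter> space (P \<Otimes>\<^sub>M coins) \<in> sets (P \<Otimes>\<^sub>M coins)"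
    "emeasure (P \<Otimes>\<^sub>M coins) (red -` B \<inter> space (P \<Otimes>\<^sub>M coins)) =
      (\<integral>\<^sup>+Y. \<integral>\<^sup>+\<omega>. indicator B (reduction n N m r Y \<omega>, \<lambda>i. \<omega> (i + 2 * (n * n))) \<partial>coins \<partial>P)"
proof -
  interpret C: prob_space coins by (rule prob_space_coins)
  have "(\<lambda>z. (case z of (Y, \<omega>) \<Rightarrow> reduction n N m r Y \<omega>, \<lambda>i. snd z (i + 2 * (n * n)))) \<in>
      measurable (samples n N \<Otimes>\<^sub>M coins) (mat_space n \<Otimes>\<^sub>M coins)"
    by (intro measurable_Pair measurable_reduction measurable_compose[OF measurable_snd measurable_coins_shift])
  then show red: "red \<in> measurable (P \<Otimes>\<^sub>M coins) (mat_space n \<Otimes>\<^sub>M coins)"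
    unfolding red_def measurable_cong_sets[OF sets_pair_measure_cong[OF P refl] refl] case_prod_beta .
  show R: "red -` B \<inter> space (P \<Otimes>\<^sub>M coins) \<in> sets (P \<Otimes>\<^sub>M coins)"
    by (rule measurable_sets[OF red B])
  show "emeasure (P \<Otimes>\<^sub>M coins) (red -` B \<inter> space (P \<Otimes>\<^sub>M coins)) =
      (\<integral>\<^sup>+Y. \<integral>\<^sup>+\<omega>. indicator B (reduction n N m r Y \<omega>, \<lambda>i. \<omega> (i + 2 * (n * n))) \<partial>coins \<partial>P)"
    unfolding C.emeasure_pair_measure[OF R]
    by (intro nn_integral_cong) (auto simp: indicator_def red_def space_pair_measure)
qed

theorem theorem3p8:
  fixes S :: "nat \<Rightarrow> (nat \<Rightarrow> real) set"
    and X :: "nat \<Rightarrow> (nat \<Rightarrow> real) measure"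
  assumes "constraint_set S"
    and "normalized_spike_prior X"
    and "whp X (\<lambda>n x. x \<in> S n)"
    and "\<exists>\<epsilon>>0. \<exists>f. polytime_matrix_alg f \<and> certifies S f (2 - \<epsilon>)"
  shows "\<exists>\<gamma>>1. \<exists>\<beta>. -1 < \<beta> \<and> \<beta> < 0 \<and>
    (\<exists>f. polytime_sample_alg \<gamma> f \<and> strong_detection \<gamma> \<beta> X f)"
proof -

  \<comment> \<open>Choice of the constants\<close>
  interpret C: prob_space coins by (rule prob_space_coins)
  from assms(4) obtain \<epsilon> f where \<epsilon>: "0 < \<epsilon>" and alg: "polytime_matrix_alg f" and cert: "certifies S f (2 - \<epsilon>)"
    by blast
  \<comment> \<open>The threshold is rational because it becomes a constant of the program; keeping
    it above 1 ensures \<open>\<kappa> \<le> 1\<close>.\<close>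
  have "max 1 (2 - \<epsilon>) < 2" using \<epsilon> by simp
  from of_rat_dense[OF this] obtain q0 where q0: "max 1 (2 - \<epsilon>) < of_rat q0" "of_rat q0 < (2::real)" by blast
  define q where "q = (of_rat q0 :: real)"
  define \<kappa> where "\<kappa> = 2 - q"
  have \<kappa>: "0 < \<kappa>" "\<kappa> \<le> 1" and q: "2 - \<epsilon> < q" "2 - \<kappa> = q" using q0 by (auto simp: \<kappa>_def q_def)
  \<comment> \<open>Since \<open>m = r * r\<close> is at least \<open>r\<close>, this makes
    \<open>2 / m\<close> at most \<open>\<kappa> / 32\<close>, the loss allowed at window
    boundaries.\<close>
  obtain r :: nat where r: "64 / \<kappa> \<le> real r" using real_arch_simple by blast
  have "0 < 64 / \<kappa>" using \<kappa> by simp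
  then have r0: "0 < r" using r by (metis less_le_trans of_nat_0_less_iff)
  define m where "m = r * r"
  have m0: "0 < m" using r0 by (simp add: m_def)
  have mm: "2 / real m \<le> \<kappa> / 32"
  proof -
    have "64 \<le> real r * \<kappa>" using r \<kappa> by (simp add: divide_le_eq)
    also have "\<dots> \<le> real m * \<kappa>"
      using \<kappa> r0 by (intro mult_right_mono) (simp_all add: m_def flip: of_nat_mult)
    finally show ?thesis using m0 by (simp add: field_simps)
  qed
  obtain M0 :: nat where M0: "32 * real m / \<kappa> \<le> real M0" using real_arch_simple by blast
  \<comment> \<open>\<open>M0\<close> bounds the part \<open>d * m / n\<close> of the coordinates
    covered by windows by \<open>\<kappa> / 32\<close>. The term \<open>m + 2\<close> gives
    \<open>M \<ge> m + 1\<close>, so that the windows fit among the samples, and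
    \<open>M \<ge> 2\<close>.\<close>
  define M where "M = max M0 (m + 2)"
  have M2: "2 \<le> M" "m + 1 \<le> M" by (auto simp: M_def)
  have "32 * real m / \<kappa> \<le> real M" using M0 by (simp add: M_def)
  then have mM: "real m / real M \<le> \<kappa> / 32" using \<kappa> M2 by (simp add: field_simps)
  define \<gamma> where "\<gamma> = real M / (real M - 1)"
  have \<gamma>: "1 < \<gamma>" using M2 by (simp add: \<gamma>_def)
  have N: "num_samples \<gamma> n = n - n div M" for n unfolding \<gamma>_def by (rule num_samples_eq[OF M2(1)])
  have d: "n - num_samples \<gamma> n = n div M" for n by (simp add: N)
  have fit: "(n - num_samples \<gamma> n) * m \<le> num_samples \<gamma> n" for n
  proof -
    have "n div M * (m + 1) \<le> n div M * M" using M2 by (intro mult_left_mono) auto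
    also have "\<dots> \<le> n" by simp
    finally show ?thesis unfolding d by (simp add: N)
  qed
  have Nn: "num_samples \<gamma> n \<le> n" for n by (simp add: N)
  have win: "windows n (num_samples \<gamma> n) m r" for n
    by unfold_locales (simp_all add: m_def r0 Nn fit[unfolded m_def])
  define L where "L = 64 / \<kappa> + 4"
  have L: "4 \<le> L" using \<kappa> by (simp add: L_def)
  \<comment> \<open>Solves \<open>L * (4 * M) * (2 * \<tau>) = \<kappa> / 4\<close>, where
    \<open>4 * M\<close> bounds \<open>2 * n / d\<close>, \<open>2\<close> bounds the squared norm
    of the spike, and \<open>\<tau>\<close> will bound \<open>1 + \<beta> * s\<close>.\<close>
  define \<tau> where "\<tau> = \<kappa> / (4 * L * (8 * real M))"
  have LM: "1 \<le> 4 * L * (8 * real M)"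
  proof -
    have "1 * 1 \<le> (4 * L) * (8 * real M)" using L M2 by (intro mult_mono) auto
    then show ?thesis by simp
  qed
  have \<tau>: "0 < \<tau>" "\<tau> \<le> 1"
    using LM \<kappa> by (simp_all add: \<tau>_def divide_le_eq)
  \<comment> \<open>If \<open>s\<close> is within \<open>\<tau> / 4\<close> of 1, then
    \<open>1 + \<beta> * s\<close> lies above 0 and is at most \<open>\<tau>\<close>. The gap
    between \<open>\<beta>\<close> and -1 leaves room for a spike slightly longer than 1.\<close>
  define \<beta> where "\<beta> = - (1 - \<tau> / 4)"
  have \<beta>: "-1 < \<beta>" "\<beta> < 0" using \<tau> by (simp_all add: \<beta>_def)
  \<comment> \<open>A norm within \<open>\<delta>\<close> of 1 has its square within
    \<open>3 * \<delta>\<close> of 1, as \<open>\<delta> \<le> 1\<close>.\<close>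
  define \<delta> where "\<delta> = min (\<tau> / 4) (\<kappa> / 32) / 3"
  have \<delta>: "0 < \<delta>" "\<delta> \<le> 1" "3 * \<delta> \<le> \<tau> / 4" "3 * \<delta> \<le> \<kappa> / 32"
    using \<tau> \<kappa> by (auto simp: \<delta>_def)
  define red where "red n z = (reduction n (num_samples \<gamma> n) m r (fst z) (snd z), \<lambda>i. snd z (i + 2 * (n * n)))"
    for n and z :: "(nat \<Rightarrow> nat \<Rightarrow> real) \<times> (nat \<Rightarrow> real)"
  define g where "g n Y \<omega> = (if f n (reduction n (num_samples \<gamma> n) m r Y \<omega>) (\<lambda>i. \<omega> (i + 2 * (n * n))) < q then 0 else 1 :: nat)"
    for n Y \<omega>
  have red: "red n = (\<lambda>z. (reduction n (num_samples \<gamma> n) m r (fst z) (snd z), \<lambda>i. snd z (i + 2 * (n * n))))" for n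
    by (simp add: red_def fun_eq_iff)
  note er = windows.emeasure_reduction[OF win, folded red]
  have g: "polytime_sample_alg \<gamma> g"
    unfolding g_def[abs_def] q_def by (rule polytime_reduction[OF alg Nn fit])

  \<comment> \<open>Error under the null law\<close>
  have null: "whp (\<lambda>n. wishart_null \<gamma> n \<Otimes>\<^sub>M coins) (\<lambda>n (Y, \<omega>). g n Y \<omega> = 0)"
  proof -
    from cert obtain e A where e: "e \<longlonglongrightarrow> 0" and A: "\<And>n. A n \<in> sets (GOE n \<Otimes>\<^sub>M coins)"
      "\<And>n W \<omega>. (W, \<omega>) \<in> A n \<Longrightarrow> f n W \<omega> \<le> 2 - \<epsilon> + e n"
      and lim: "(\<lambda>n. measure (GOE n \<Otimes>\<^sub>M coins) (A n)) \<longlonglongrightarrow> 1"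
      unfolding certifies_def whp_def by blast
    have A': "A n \<in> sets (mat_space n \<Otimes>\<^sub>M coins)" for n
      using A(1)[of n] unfolding sets_pair_measure_cong[OF sets_GOE refl] .
    have P: "sets (wishart_null \<gamma> n) = sets (samples n (num_samples \<gamma> n))" for n
      unfolding wishart_null_def by (rule sets_PiM_gaussian_vec)
    \<comment> \<open>Empty for \<open>n = 0\<close> and while \<open>e n\<close> is still too large
      for the threshold; this concerns finitely many \<open>n\<close> and does not affect the limit.
      Afterwards its probability equals that of \<open>A n\<close> under the GOE.\<close>
    define B where "B n = (if 0 < n \<and> 2 - \<epsilon> + e n < q then red n -` A n \<inter> space (wishart_null \<gamma> n \<Otimes>\<^sub>M coins) else {})" for n
    have "B n \<in> sets (wishart_null \<gamma> n \<Otimes>\<^sub>M coins)" for n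
      using er(2)[OF P A'] by (simp add: B_def)
    moreover have "case z of (Y, \<omega>) \<Rightarrow> g n Y \<omega> = 0" if z: "z \<in> B n" for n z
    proof -
      have "red n z \<in> A n" "2 - \<epsilon> + e n < q" using z by (auto simp: B_def split: if_splits)
      then have "f n (fst (red n z)) (snd (red n z)) < q" using A(2)[of "fst (red n z)" "snd (red n z)" n] by simp
      then show ?thesis by (cases z) (simp add: g_def red_def)
    qed
    moreover have "(\<lambda>n. measure (wishart_null \<gamma> n \<Otimes>\<^sub>M coins) (B n)) \<longlonglongrightarrow> 1"
    proof (rule Lim_transform_eventually[OF lim])
      have "eventually (\<lambda>n. e n < q - (2 - \<epsilon>)) sequentially"
        using q(1) by (intro order_tendstoD(2)[OF e]) simp
      then show "eventually (\<lambda>n. measure (GOE n \<Otimes>\<^sub>M coins) (A n) = measure (wishart_null \<gamma> n \<Otimes>\<^sub>M coins) (B n)) sequentially"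
        using eventually_gt_at_top[of 0]
      proof eventually_elim
        case (elim n)
        have "emeasure (wishart_null \<gamma> n \<Otimes>\<^sub>M coins) (B n) =
          (\<integral>\<^sup>+Y. \<integral>\<^sup>+\<omega>. indicator (A n) (reduction n (num_samples \<gamma> n) m r Y \<omega>, \<lambda>i. \<omega> (i + 2 * (n * n))) \<partial>coins \<partial>wishart_null \<gamma> n)"
          using elim er(3)[OF P A'] by (simp add: B_def)
        also have "\<dots> = (\<integral>\<^sup>+W. \<integral>\<^sup>+\<omega>. indicator (A n) (W, \<omega>) \<partial>coins \<partial>GOE n)"
          unfolding wishart_null_def
          by (rule windows.null_law[OF win elim(2) borel_measurable_indicator[OF A']])
        also have "\<dots> = emeasure (GOE n \<Otimes>\<^sub>M coins) (A n)" by (rule C.emeasure_pair_measure[OF A(1), symmetric])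
        finally show ?case by (simp add: measure_def)
      qed
    qed
    ultimately show ?thesis unfolding whp_def by (intro exI[of _ B] conjI allI ballI)
  qed

  \<comment> \<open>Error under the planted law\<close>
  have planted: "whp (\<lambda>n. wishart_planted \<gamma> \<beta> X n \<Otimes>\<^sub>M coins) (\<lambda>n (Y, \<omega>). g n Y \<omega> = 1)"
  proof -
    have X: "prob_space (X n)" "sets (X n) = sets (vec_space n)" for n
      using assms(2) by (auto simp: normalized_spike_prior_def)
    define D where "D n = {x \<in> space (X n). \<bar>L2_set x {..<n} - 1\<bar> > \<delta>}" for n
    have Dlim: "(\<lambda>n. measure (X n) (D n)) \<longlonglongrightarrow> 0"
      using assms(2) \<delta>(1) by (simp add: normalized_spike_prior_def D_def)
    from assms(3) obtain A where A: "\<And>n. A n \<in> sets (X n)" "\<And>n x. x \<in> A n \<Longrightarrow> x \<in> S n"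
      and Alim: "(\<lambda>n. measure (X n) (A n)) \<longlonglongrightarrow> 1"
      unfolding whp_def by blast
    let ?K = "\<lambda>n x. \<Pi>\<^sub>M k\<in>{..<num_samples \<gamma> n}. gaussian_vec n (planted_cov n \<beta> x)"
    let ?P = "wishart_planted \<gamma> \<beta> X"
    have K: "?K n \<in> measurable (X n) (subprob_algebra (samples n (num_samples \<gamma> n)))" for n
      by (rule measurable_planted_kernel[OF X(2)])
    have P: "sets (?P n) = sets (samples n (num_samples \<gamma> n))" for n
      unfolding wishart_planted_def
      using prob_space.not_empty[OF X(1)[of n]] by (intro sets_bind[OF sets_kernel[OF K]]) auto
    have Pp: "prob_space (?P n)" for n
      unfolding wishart_planted_def
      by (rule prob_space.prob_space_bind[OF X(1) AE_I2[OF prob_space_planted_kernel] K])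
    have D: "D n \<in> sets (X n)" for n
    proof -
      have "(\<lambda>x. L2_set x {..<n}) \<in> borel_measurable (X n)"
        unfolding L2_set_def by (rule measurable_compose[OF measurable_sum_squares[OF X(2)] borel_measurable_sqrt])
      then have "(\<lambda>x. \<bar>L2_set x {..<n} - 1\<bar>) \<in> borel_measurable (X n)"
        by (intro borel_measurable_abs borel_measurable_diff borel_measurable_const)
      from borel_measurable_less[OF borel_measurable_const this] show ?thesis unfolding D_def .
    qed
    define Bad where "Bad n = {z \<in> space (mat_space n \<Otimes>\<^sub>M coins). (case z of (W, \<omega>) \<Rightarrow> f n W \<omega>) < q}" for n
    have Bad: "Bad n \<in> sets (mat_space n \<Otimes>\<^sub>M coins)" for n
      unfolding Bad_def by (rule borel_measurable_less[OF measurable_polytime_matrix_alg[OF alg] borel_measurable_const])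
    define B where "B n = space (?P n \<Otimes>\<^sub>M coins) - (red n -` Bad n \<inter> space (?P n \<Otimes>\<^sub>M coins))" for n
    define h where "h n x = (\<integral>\<^sup>+Y. \<integral>\<^sup>+\<omega>. indicator (Bad n) (reduction n (num_samples \<gamma> n) m r Y \<omega>, \<lambda>i. \<omega> (i + 2 * (n * n))) \<partial>coins \<partial>?K n x)"
      for n x
    define R where "R n = 64 * real M / real n + 8 / real n + 36 / \<kappa> / sqrt (real n)" for n
    have Rlim: "R \<longlonglongrightarrow> 0"
    proof -
      have "filterlim (\<lambda>n. sqrt (real n)) at_infinity sequentially"
        by (rule filterlim_at_top_imp_at_infinity[OF filterlim_compose[OF sqrt_at_top filterlim_real_sequentially]])
      from tendsto_divide_0[OF tendsto_const this]
      have "(\<lambda>n. 36 / \<kappa> / sqrt (real n)) \<longlonglongrightarrow> 0" .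
      from tendsto_add[OF tendsto_add[OF lim_const_over_n[of "64 * real M"] lim_const_over_n[of 8]] this]
      show ?thesis by (simp add: R_def[abs_def])
    qed
    have h1: "h n x \<le> 1" for n x
    proof -
      interpret K: prob_space "?K n x" by (rule prob_space_planted_kernel)
      have "h n x \<le> (\<integral>\<^sup>+Y. \<integral>\<^sup>+\<omega>. 1 \<partial>coins \<partial>?K n x)"
        unfolding h_def by (intro nn_integral_mono) (simp add: indicator_def)
      also have "\<dots> = 1" by (simp add: C.emeasure_space_1[unfolded space_coins] K.emeasure_space_1)
      finally show ?thesis .
    qed
    \<comment> \<open>For a spike that lies in the constraint set and has nearly unit norm; all
      other spikes are handled by \<open>h1\<close> and their vanishing probability.\<close>
    have hR: "h n x \<le> ennreal (R n)" if n: "M \<le> n" and x: "x \<in> A n" "x \<notin> D n" for n x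
    proof -
      define s where "s = (\<Sum>i<n. (x i)\<^sup>2)"
      have n0: "0 < n" using n M2 by simp
      have d0: "0 < n div M" using n M2 by (simp add: div_greater_zero_iff)
      \<comment> \<open>As \<open>n\<close> is at least \<open>M\<close>, rounding down loses at
        most a factor 2.\<close>
      have dM: "real n \<le> 2 * real M * real (n div M)"
      proof -
        have a: "n < M * (n div M) + M" using M2 mod_less_divisor[of M n] mult_div_mod_eq[of M n] by linarith
        have b: "M \<le> M * (n div M)" using d0 by simp
        have "n \<le> 2 * M * (n div M)" using a b by linarith
        then show ?thesis by (metis of_nat_le_iff of_nat_mult of_nat_numeral)
      qed
      have L2: "\<bar>L2_set x {..<n} - 1\<bar> \<le> \<delta>"
        using x sets.sets_into_space[OF A(1)[of n]] by (auto simp: D_def)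
      define l where "l = L2_set x {..<n}"
      have sl: "s = l\<^sup>2" by (simp add: s_def l_def L2_set_def sum_nonneg)
      have l: "\<bar>l - 1\<bar> \<le> \<delta>" using L2 by (simp add: l_def)
      have s1: "\<bar>s - 1\<bar> \<le> 3 * \<delta>"
      proof -
        have "s - 1 = (l - 1) * (l + 1)" by (simp add: sl power2_eq_square algebra_simps)
        then have "\<bar>s - 1\<bar> = \<bar>l - 1\<bar> * \<bar>l + 1\<bar>" by (simp add: abs_mult)
        also have "\<dots> \<le> \<delta> * 3" using l \<delta> by (intro mult_mono) auto
        finally show ?thesis by simp
      qed
      have s2: "\<bar>s - 1\<bar> \<le> \<kappa> / 32" "\<bar>s - 1\<bar> \<le> \<tau> / 4" using s1 \<delta> by linarith+
      have sb: "1 - \<tau> / 4 \<le> s" "s \<le> 1 + \<tau> / 4" using s2(2) by linarith+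
      have bs: "\<beta> * s = - ((1 - \<tau> / 4) * s)" by (simp add: \<beta>_def algebra_simps)
      have b1: "0 < 1 + \<beta> * s"
      proof -
        have "(1 - \<tau> / 4) * s \<le> (1 - \<tau> / 4) * (1 + \<tau> / 4)" using sb \<tau> by (intro mult_left_mono) auto
        also have "\<dots> = 1 - (\<tau> / 4)\<^sup>2" by (simp add: power2_eq_square algebra_simps)
        also have "\<dots> < 1" using \<tau> by simp
        finally show ?thesis by (simp add: bs)
      qed
      have b2: "1 + \<beta> * s \<le> \<tau>"
      proof -
        have "(1 - \<tau> / 4) * (1 - \<tau> / 4) \<le> (1 - \<tau> / 4) * s" using sb \<tau> by (intro mult_left_mono) auto
        moreover have "1 - \<tau> / 2 \<le> (1 - \<tau> / 4) * (1 - \<tau> / 4)" by (simp add: algebra_simps)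
        ultimately show ?thesis unfolding bs using \<tau> by linarith
      qed
      have small: "L * (2 * real n / real (n div M)) * ((1 + \<beta> * s) * s) \<le> \<kappa> / 4"
      proof -
        have "2 * real n / real (n div M) \<le> 4 * real M" using dM d0 by (simp add: divide_le_eq)
        then have "L * (2 * real n / real (n div M)) \<le> L * (4 * real M)" using L by (intro mult_left_mono) auto
        moreover have "(1 + \<beta> * s) * s \<le> \<tau> * 2" using b1 b2 sb \<tau> by (intro mult_mono) auto
        ultimately have "L * (2 * real n / real (n div M)) * ((1 + \<beta> * s) * s) \<le> (L * (4 * real M)) * (\<tau> * 2)"
          by (rule mult_mono) (use b1 sb \<tau> L in simp_all)
        also have "\<dots> = \<kappa> / 4" using L M2 by (simp add: \<tau>_def field_simps)
        finally show ?thesis .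
      qed
      have dm: "real ((n div M) * m) / real n \<le> \<kappa> / 32"
      proof -
        have "real (n div M) \<le> real n / real M" by (rule of_nat_div_le_of_nat)
        then have "real (n div M) * real m / real n \<le> real n / real M * real m / real n"
          by (intro divide_right_mono mult_right_mono) auto
        also have "\<dots> = real m / real M" using n0 by simp
        finally show ?thesis using mM unfolding of_nat_mult by linarith
      qed
      \<comment> \<open>Soundness of the certificate holds for each fixed symmetric matrix and all
        points of \<open>S n\<close> at once. At \<open>x\<close> it forces an output of at least
        \<open>2 - \<kappa>\<close>, which is the threshold.\<close>
      have bad: "AE \<omega> in coins. (W, \<omega>) \<notin> Bad n" if W: "W \<in> space (mat_space n)" "sym_mat n W" "2 - \<kappa> \<le> qform n W x" for W
      proof -
        from cert W have "AE \<omega> in coins. \<forall>x\<in>S n. qform n W x \<le> f n W \<omega>"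
          unfolding certifies_def by blast
        then show ?thesis
        proof eventually_elim
          case (elim \<omega>)
          then have "qform n W x \<le> f n W \<omega>" using A(2)[OF x(1)] by blast
          then show ?case using W(3) q(2) by (simp add: Bad_def)
        qed
      qed
      have "h n x \<le> ennreal (32 / real (n div M) + 8 / real n + 36 / (\<kappa> * sqrt n))"
        unfolding h_def
        by (rule windows.planted_bad[OF win, unfolded d, OF n0 d0 \<kappa> dm mm s_def s2(1) b1 small[unfolded L_def] Bad bad])
      also have "\<dots> \<le> ennreal (R n)"
      proof (rule ennreal_leI)
        have "32 / real (n div M) \<le> 64 * real M / real n"
          using dM d0 n0 by (simp add: divide_le_eq le_divide_eq)
        then show "32 / real (n div M) + 8 / real n + 36 / (\<kappa> * sqrt n) \<le> R n"
          by (simp add: R_def)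
      qed
      finally show ?thesis .
    qed
    \<comment> \<open>Union bound over three failures: an error for a good spike, a spike outside
      \<open>A n\<close>, and a spike whose norm is off.\<close>
    have low: "1 - (R n + (1 - measure (X n) (A n)) + measure (X n) (D n)) \<le> measure (?P n \<Otimes>\<^sub>M coins) (B n)" if n: "M \<le> n" for n
    proof -
      interpret X: prob_space "X n" by (rule X)
      interpret P: prob_space "?P n" by (rule Pp)
      interpret PC: pair_prob_space "?P n" coins by unfold_locales
      let ?E = "red n -` Bad n \<inter> space (?P n \<Otimes>\<^sub>M coins)"
      have E: "?E \<in> sets (?P n \<Otimes>\<^sub>M coins)" by (rule er(2)[OF P Bad])
      have hm: "(\<lambda>Y. \<integral>\<^sup>+\<omega>. indicator (Bad n) (reduction n (num_samples \<gamma> n) m r Y \<omega>, \<lambda>i. \<omega> (i + 2 * (n * n))) \<partial>coins)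
          \<in> borel_measurable (samples n (num_samples \<gamma> n))"
      proof -
        have "(\<lambda>z. indicator (Bad n) (red n z) :: ennreal) \<in> borel_measurable (samples n (num_samples \<gamma> n) \<Otimes>\<^sub>M coins)"
          by (rule measurable_compose[OF er(1)[OF refl Bad] borel_measurable_indicator[OF Bad]])
        from C.borel_measurable_nn_integral_fst[OF this] show ?thesis by (simp add: red_def)
      qed
      have R0: "0 \<le> R n" using \<kappa> by (simp add: R_def)
      have "emeasure (?P n \<Otimes>\<^sub>M coins) ?E = (\<integral>\<^sup>+x. h n x \<partial>X n)"
        unfolding er(3)[OF P Bad] h_def unfolding wishart_planted_def by (rule nn_integral_bind[OF hm K])
      also have "\<dots> \<le> (\<integral>\<^sup>+x. (ennreal (R n) + indicator (space (X n) - A n) x) + indicator (D n) x \<partial>X n)"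
      proof (rule nn_integral_mono)
        fix x assume x: "x \<in> space (X n)"
        show "h n x \<le> (ennreal (R n) + indicator (space (X n) - A n) x) + indicator (D n) x"
        proof (cases "x \<in> A n \<and> x \<notin> D n")
          case True
          then show ?thesis using hR[OF n, of x] by simp
        next
          case False
          have "(1::ennreal) \<le> indicator (space (X n) - A n) x + indicator (D n) x"
            using False x by (auto simp: indicator_def)
          then have "h n x \<le> indicator (space (X n) - A n) x + indicator (D n) x" using h1[of n x] by (rule order_trans[rotated])
          also have "\<dots> \<le> (ennreal (R n) + indicator (space (X n) - A n) x) + indicator (D n) x"
            by (intro add_right_mono) simp
          finally show ?thesis .
        qed
      qed
      also have "\<dots> = (\<integral>\<^sup>+x. ennreal (R n) + indicator (space (X n) - A n) x \<partial>X n) + (\<integral>\<^sup>+x. indicator (D n) x \<partial>X n)"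
        by (rule nn_integral_add[OF borel_measurable_add[OF borel_measurable_const borel_measurable_indicator[OF sets.compl_sets[OF A(1)]]]
            borel_measurable_indicator[OF D]])
      also have "(\<integral>\<^sup>+x. indicator (D n) x \<partial>X n) = emeasure (X n) (D n)"
        by (rule nn_integral_indicator[OF D])
      also have "(\<integral>\<^sup>+x. ennreal (R n) + indicator (space (X n) - A n) x \<partial>X n) =
          (\<integral>\<^sup>+x. ennreal (R n) \<partial>X n) + (\<integral>\<^sup>+x. indicator (space (X n) - A n) x \<partial>X n)"
        by (rule nn_integral_add[OF borel_measurable_const borel_measurable_indicator[OF sets.compl_sets[OF A(1)]]])
      also have "(\<integral>\<^sup>+x. indicator (space (X n) - A n) x \<partial>X n) = emeasure (X n) (space (X n) - A n)"
        by (rule nn_integral_indicator[OF sets.compl_sets[OF A(1)]])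
      also have "(\<integral>\<^sup>+x. ennreal (R n) \<partial>X n) = ennreal (R n) * emeasure (X n) (space (X n))"
        by (rule nn_integral_const)
      also have "ennreal (R n) * emeasure (X n) (space (X n)) + emeasure (X n) (space (X n) - A n) + emeasure (X n) (D n) =
          ennreal (R n + (1 - measure (X n) (A n)) + measure (X n) (D n))"
        unfolding X.emeasure_space_1 X.emeasure_eq_measure X.prob_compl[OF A(1)] using R0 X.prob_le_1[of "A n"]
        by (simp add: ennreal_plus X.prob_space)
      finally have "measure (?P n \<Otimes>\<^sub>M coins) ?E \<le> R n + (1 - measure (X n) (A n)) + measure (X n) (D n)"
        unfolding PC.emeasure_eq_measure using R0 X.prob_le_1[of "A n"] by (subst (asm) ennreal_le_iff) auto
      moreover have "measure (?P n \<Otimes>\<^sub>M coins) (B n) = 1 - measure (?P n \<Otimes>\<^sub>M coins) ?E"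
        unfolding B_def by (rule PC.prob_compl[OF E])
      ultimately show ?thesis by linarith
    qed
    have "B n \<in> sets (?P n \<Otimes>\<^sub>M coins)" for n
      unfolding B_def by (rule sets.compl_sets[OF er(2)[OF P Bad]])
    moreover have "case z of (Y, \<omega>) \<Rightarrow> g n Y \<omega> = 1" if z: "z \<in> B n" for n z
    proof -
      have "red n z \<in> space (mat_space n \<Otimes>\<^sub>M coins)"
        by (rule measurable_space[OF er(1)[OF P Bad]]) (use z in \<open>simp add: B_def\<close>)
      moreover have "red n z \<notin> Bad n" using z unfolding B_def by blast
      ultimately have "\<not> f n (fst (red n z)) (snd (red n z)) < q" by (simp add: Bad_def case_prod_beta)
      then show ?thesis by (cases z) (simp add: g_def red_def)
    qed
    moreover have "(\<lambda>n. measure (?P n \<Otimes>\<^sub>M coins) (B n)) \<longlonglongrightarrow> 1"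
    proof (rule tendsto_sandwich)
      show "eventually (\<lambda>n. 1 - (R n + (1 - measure (X n) (A n)) + measure (X n) (D n)) \<le> measure (?P n \<Otimes>\<^sub>M coins) (B n)) sequentially"
        using eventually_ge_at_top[of M] by eventually_elim (rule low)
      show "eventually (\<lambda>n. measure (?P n \<Otimes>\<^sub>M coins) (B n) \<le> 1) sequentially"
      proof (rule always_eventually, rule allI)
        fix n
        interpret P: prob_space "?P n" by (rule Pp)
        interpret PC: pair_prob_space "?P n" coins by unfold_locales
        show "measure (?P n \<Otimes>\<^sub>M coins) (B n) \<le> 1" by (rule PC.prob_le_1)
      qed
      show "(\<lambda>n. 1 - (R n + (1 - measure (X n) (A n)) + measure (X n) (D n))) \<longlonglongrightarrow> 1"
        using tendsto_diff[OF tendsto_const tendsto_add[OF tendsto_add[OF Rlim tendsto_diff[OF tendsto_const Alim]] Dlim], of 1 1]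
        by simp
    qed simp
    ultimately show ?thesis unfolding whp_def by (intro exI[of _ B] conjI allI ballI)
  qed
  show ?thesis using \<gamma> \<beta> g null planted unfolding strong_detection_def by blast
qed

end
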